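(* Let $\kappa<0$, $\tau\ne0$, and let $\Sigma$ be a complete, connected, rotationally invariant surface with constant mean curvature $H\ge0$ and energy $E$ in $\mathrm{Sl}(2,\mathbb{R})$ (with the metric $g$ of parameters $\kappa,\tau$). Then $\Sigma$ must be of one of the following types: 1. If $4H^2+\kappa>0$, then: (a) if $E=0$, then $\Sigma$ is a $2$-sphere; it is not always embedded; (b) if $E>0$, then $\Sigma$ is an unduloid-type surface; (c) if $E<0$, then $\Sigma$ is a nodoid-type surface, which is always immersed. Moreover, surfaces of types 1.(b) and 1.(c) are compact if and only if $$T(H,E)=2\int_{x_1}^{x_2}\frac{(E+H\sinh^2x)\sqrt{1-\frac{4\tau^2}{\kappa}\tanh^2x}}{\tau\sqrt{\sinh^2x\cosh^2x+\frac4\kappa(E+H\sinh^2x)^2}}\,dx$$ is a rational multiple of $\pi$, where $x_j=\operatorname{arcsinh}\sqrt{t_j}$, $j=1,2$, and $$t_1=\frac{-8HE-\kappa-\sqrt{16\kappa E(H-E)+\kappa^2}}{2(4H^2+\kappa)},\qquad t_2=\frac{-8HE-\kappa+\sqrt{16\kappa E(H-E)+\kappa^2}}{2(4H^2+\kappa)}.$$ Moreover, surfaces of type 1.(b) are compact and embedded if and only if $T=2\pi/k$ with $k\in\mathbb{Z}$, $k\neq0$. 2. If $4H^2+\kappa\le0$, then $\Sigma$ is immersed and non-compact. Moreover, the curve $\gamma$ which generates $\Sigma$ is of open sphere type when $E=0$, of open unduloid type when $E>0$, and of open nodoid type when $E<0$.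
   Context: $\mathrm{Sl}(2,\mathbb{R})$ is identified with $\{(z,w)\in\mathbb{C}^2:|z|^2-|w|^2=1\}$. With the global frame $E^1_{(z,w)}=(\bar w,\bar z)$, $E^2_{(z,w)}=(i\bar w,i\bar z)$, $V_{(z,w)}=(iz,iw)$, the metric is $g(E^i,E^j)=\delta_{ij}\frac{4}{-\kappa}$, $g(V,V)=\frac{16\tau^2}{\kappa^2}$, $g(V,E^j)=0$. Rotationally invariant means invariant under $\mathrm{Rot}=\{(z,w)\mapsto(z,e^{it}w):t\in\mathbb{R}\}$, a group of isometries fixing pointwise the axis $\ell=\{(z,0)\}$ (a circle). Mean curvature is half the trace of the second fundamental form. Generating curve: the orbit space is identified with $\{(z,a)\in\mathbb{C}\times\mathbb{R}:|z|^2-a^2=1\}$, and a $\mathrm{Rot}$-invariant surface is the preimage of a curve $\gamma(s)=(\cosh x(s)e^{iy(s)},\sinh x(s))$ with $x'^2+y'^2\cosh^2x=1$; $\alpha$ is the function with $x'=\cos\alpha$, $y'=\sin\alpha/\cosh x$. The immersion is $\Phi(s,t)=(\cosh x(s)e^{iy(s)},\sinh x(s)e^{it})$. Normal: $\Sigma$ is oriented by $$N=C\left\{-\tau\,\mathrm{Re}\left[\left(\tfrac{\tan\alpha}{\cosh x}-i\tanh x\right)e^{i(t+y)}\right]E^1_\Phi-\tau\,\mathrm{Im}\left[\left(\tfrac{\tan\alpha}{\cosh x}-i\tanh x\right)e^{i(t+y)}\right]E^2_\Phi-\tfrac{\kappa}{4\tau}V_\Phi\right\},$$ $$C=\frac{\cos\alpha\cosh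 x}{\sqrt{\cos^2\alpha\left[\cosh^2x-\frac{4\tau^2}{\kappa}\sinh^2x\right]-\frac{4\tau^2}{\kappa}\sin^2\alpha}},$$ with $C\tan\alpha$ understood by continuous extension where $\cos\alpha=0$. The direction of parametrization of $\gamma$ is chosen so that the mean curvature $H$ with respect to $N$ satisfies $H\ge0$. Energy: $E=\tau C\sinh x\tan\alpha-H\sinh^2x$, which is constant along $\gamma$ when $H$ is constant. The types of curves are as follows, with $y$ lifted to $\mathbb{R}$ and described for $x\ge0$ (replacing $(x(s),y(s))$ by $(-x(-s),y(-s))$ gives the equivalent picture with $x\le0$). Unduloid-type: $\gamma$ is the graph of a periodic function $x=x(y)$ oscillating between $x_1$ and $x_2$, strictly monotone between consecutive critical points and symmetric under reflection across each line $y=\text{const}$ through a critical point (like a Euclidean unduloid). Nodoid-type: along $\gamma$, $x$ oscillates between $x_1$ and $x_2$, $\gamma$ is symmetric under reflection across each line $y=\text{const}$ through a point where $x'=0$, and between two consecutive such points $\sin\alpha$ changes sign once, so that this piece is a union of two graphs $x(y)$ (like a Euclidean nodoid). Open sphere type: $\gamma$ starts at a point of the axis and is the graph of a strictly monotone, strictly convex function $y=y(x)$, $x\in[0,+\infty)$. Open unduloid type: $\gamma$ is the graph of a function $x=x(y)$ with a unique critical point, a positive minimum of $x$; $\gamma$ is symmetric under reflection across the line $y=\text{const}$ through that point, and $x$ is strictly monotone on each side and unbounded. Open nodoid type: along $\gamma$, $x'$ vanishes exactly once, at a positive minimum of $x$; $\gamma$ is symmetric under reflection across the line $y=\text{const}$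 through that point, $x$ is unbounded, and on each of the two halves $\sin\alpha$ changes sign once, so that each half is a union of two graphs $x(y)$.
   Formalization: If x1=x2, Σ is the torus x=const (constant unduloid), excluded from the T=2π/k criterion. In case 2 with H=0: E=0 gives y=const, and any E≠0 gives open unduloid type. Open sphere type is meant up to y→−y. *)

theory Defs
  imports "HOL-Analysis.Analysis"
begin

section \<open>The ambient space\<close>

type_synonym point = "complex \<times> complex"

definition SL2 :: "point set" where
  "SL2 = {(z, w). (cmod z)\<^sup>2 - (cmod w)\<^sup>2 = 1}"

text \<open>The global frame \<open>E\<^sup>1, E\<^sup>2, V\<close>, as linear vector fields on all of \<open>\<complex>\<^sup>2\<close>; on \<open>SL2\<close> they
  are tangent to it. The index \<open>3\<close> stands for \<open>V\<close>.\<close>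

definition frame :: "3 \<Rightarrow> point \<Rightarrow> point" where
  "frame j = (\<lambda>(z, w).
     if j = 1 then (cnj w, cnj z)
     else if j = 2 then (\<i> * cnj w, \<i> * cnj z)
     else (\<i> * z, \<i> * w))"

text \<open>Components of a tangent vector with respect to the frame, see \<open>frame_decomposition\<close> below.\<close>

definition frame_coord :: "point \<Rightarrow> point \<Rightarrow> real^3" where
  "frame_coord p u = (case (p, u) of ((z, w), (a, b)) \<Rightarrow>
     vector [Re (b * z - a * w), Im (b * z - a * w), Im (a * cnj z - b * cnj w)])"

definition frame_weight :: "real \<Rightarrow> real \<Rightarrow> 3 \<Rightarrow> real" where
  "frame_weight \<kappa> \<tau> j = (if j = 3 then 16 * \<tau>\<^sup>2 / \<kappa>\<^sup>2 else 4 / (- \<kappa>))"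

definition metric :: "real \<Rightarrow> real \<Rightarrow> point \<Rightarrow> point \<Rightarrow> point \<Rightarrow> real" where
  "metric \<kappa> \<tau> p u v = (\<Sum>j\<in>UNIV. frame_weight \<kappa> \<tau> j * frame_coord p u $ j * frame_coord p v $ j)"

lemma frame_decomposition:
  assumes p: "(z, w) \<in> SL2" and tangent: "Re (cnj z * a) - Re (cnj w * b) = 0"
  shows "(a, b) = (\<Sum>j\<in>UNIV. frame_coord (z, w) (a, b) $ j *\<^sub>R frame j (z, w))"
proof -
  have n: "(Re z)\<^sup>2 + (Im z)\<^sup>2 - (Re w)\<^sup>2 - (Im w)\<^sup>2 = 1"
    using p by (simp add: SL2_def cmod_power2)
  have t: "Re z * Re a + Im z * Im a - Re w * Re b - Im w * Im b = 0"
    using tangent by simp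
  have 1: "Re a = (Re b * Re z - Im b * Im z - (Re a * Re w - Im a * Im w)) * Re w
      + (Re b * Im z + Im b * Re z - (Re a * Im w + Im a * Re w)) * Im w
      - (Im a * Re z - Re a * Im z - (Im b * Re w - Re b * Im w)) * Im z"
    using n t by algebra
  have 2: "Im a = - (Re b * Re z - Im b * Im z - (Re a * Re w - Im a * Im w)) * Im w
      + (Re b * Im z + Im b * Re z - (Re a * Im w + Im a * Re w)) * Re w
      + (Im a * Re z - Re a * Im z - (Im b * Re w - Re b * Im w)) * Re z"
    using n t by algebra
  have 3: "Re b = (Re b * Re z - Im b * Im z - (Re a * Re w - Im a * Im w)) * Re z
      + (Re b * Im z + Im b * Re z - (Re a * Im w + Im a * Re w)) * Im z
      - (Im a * Re z - Re a * Im z - (Im b * Re w - Re b * Im w)) * Im w"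
    using n t by algebra
  have 4: "Im b = - (Re b * Re z - Im b * Im z - (Re a * Re w - Im a * Im w)) * Im z
      + (Re b * Im z + Im b * Re z - (Re a * Im w + Im a * Re w)) * Re z
      + (Im a * Re z - Re a * Im z - (Im b * Re w - Re b * Im w)) * Re w"
    using n t by algebra
  show ?thesis
    unfolding sum_3 frame_coord_def frame_def prod.case vector_3
    using 1 2 3 4 by (simp add: complex_eq_iff algebra_simps)
qed

lemma frame_coord_frame:
  assumes "p \<in> SL2"
  shows "frame_coord p (frame i p) = axis i 1"
proof -
  obtain z w where p: "p = (z, w)" by (cases p)
  have n: "Re z * Re z + Im z * Im z = 1 + (Re w * Re w + Im w * Im w)"
    using assms unfolding p SL2_def by (simp add: cmod_power2) (simp add: power2_eq_square)
  have i: "i = 1 \<or> i = 2 \<or> i = 3" by (rule exhaust_3)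
  show ?thesis
    using i n
    by (auto simp: p frame_coord_def frame_def vec_eq_iff forall_3 axis_def algebra_simps)
qed

lemma metric_frame:
  assumes "p \<in> SL2"
  shows "metric \<kappa> \<tau> p (frame i p) (frame j p) = (if i = j then frame_weight \<kappa> \<tau> i else 0)"
proof -
  have "i = 1 \<or> i = 2 \<or> i = 3" "j = 1 \<or> j = 2 \<or> j = 3" by (rule exhaust_3)+
  then show ?thesis
    unfolding metric_def frame_coord_frame[OF assms] sum_3 by (auto simp: axis_def)
qed


section \<open>Levi-Civita connection and mean curvature\<close>

definition lie_bracket :: "(point \<Rightarrow> point) \<Rightarrow> (point \<Rightarrow> point) \<Rightarrow> point \<Rightarrow> point" where
  "lie_bracket X Y p =
     frechet_derivative Y (at p) (X p) - frechet_derivative X (at p) (Y p)"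

text \<open>The component along \<open>frame k\<close> of the covariant derivative of \<open>frame j\<close> in direction
  \<open>frame i\<close>, by the Koszul formula; its derivative terms vanish because the inner products
  of the frame fields are constant.\<close>

definition connection :: "real \<Rightarrow> real \<Rightarrow> point \<Rightarrow> 3 \<Rightarrow> 3 \<Rightarrow> 3 \<Rightarrow> real" where
  "connection \<kappa> \<tau> p i j k =
     (metric \<kappa> \<tau> p (lie_bracket (frame i) (frame j) p) (frame k p)
      - metric \<kappa> \<tau> p (lie_bracket (frame j) (frame k) p) (frame i p)
      + metric \<kappa> \<tau> p (lie_bracket (frame k) (frame i) p) (frame j p))
     / (2 * frame_weight \<kappa> \<tau> k)"

text \<open>Covariant derivative at time \<open>u\<close> of a vector field \<open>W\<close> along a curve \<open>\<beta>\<close>.\<close>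

definition cov_deriv ::
  "real \<Rightarrow> real \<Rightarrow> (real \<Rightarrow> point) \<Rightarrow> (real \<Rightarrow> point) \<Rightarrow> real \<Rightarrow> point" where
  "cov_deriv \<kappa> \<tau> \<beta> W u =
     (let v = frame_coord (\<beta> u) (vector_derivative \<beta> (at u));
          c = (\<lambda>r. frame_coord (\<beta> r) (W r))
      in \<Sum>k\<in>UNIV. (vector_derivative (\<lambda>r. c r $ k) (at u)
            + (\<Sum>i\<in>UNIV. \<Sum>j\<in>UNIV. v $ i * c u $ j * connection \<kappa> \<tau> (\<beta> u) i j k))
          *\<^sub>R frame k (\<beta> u))"

definition partial1 :: "(real \<Rightarrow> real \<Rightarrow> point) \<Rightarrow> real \<Rightarrow> real \<Rightarrow> point" where
  "partial1 F s t = vector_derivative (\<lambda>r. F r t) (at s)"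

definition partial2 :: "(real \<Rightarrow> real \<Rightarrow> point) \<Rightarrow> real \<Rightarrow> real \<Rightarrow> point" where
  "partial2 F s t = vector_derivative (\<lambda>r. F s r) (at t)"

text \<open>Half the trace, with respect to the first fundamental form of the parametrized surface
  \<open>F\<close>, of the second fundamental form \<open>g (\<nabla>\<^sub>X Y, N)\<close>.\<close>

definition mean_curvature ::
  "real \<Rightarrow> real \<Rightarrow> (real \<Rightarrow> real \<Rightarrow> point) \<Rightarrow> (real \<Rightarrow> real \<Rightarrow> point) \<Rightarrow> real \<Rightarrow> real \<Rightarrow> real" where
  "mean_curvature \<kappa> \<tau> F N s t =
     (let g = metric \<kappa> \<tau> (F s t);
          g11 = g (partial1 F s t) (partial1 F s t);
          g12 = g (partial1 F s t) (partial2 F s t);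
          g22 = g (partial2 F s t) (partial2 F s t);
          h11 = g (cov_deriv \<kappa> \<tau> (\<lambda>r. F r t) (\<lambda>r. partial1 F r t) s) (N s t);
          h12 = g (cov_deriv \<kappa> \<tau> (\<lambda>r. F r t) (\<lambda>r. partial2 F r t) s) (N s t);
          h22 = g (cov_deriv \<kappa> \<tau> (\<lambda>r. F s r) (\<lambda>r. partial2 F s r) t) (N s t)
      in (g22 * h11 - 2 * g12 * h12 + g11 * h22) / (g11 * g22 - g12\<^sup>2) / 2)"


section \<open>Rotationally invariant surfaces\<close>

text \<open>The generating curve \<open>\<gamma>\<close> is parametrized on an interval \<open>I\<close>. A point of the surface that
  lies on the axis \<open>\<ell>\<close> is fixed by the rotations, so it corresponds to an end of \<open>\<gamma>\<close>: the orbit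
  of \<open>(z, w)\<close> is determined by \<open>z\<close> and \<open>|w|\<close>, and \<open>x\<close> has a constant sign in the interior of \<open>I\<close>.
  Conversely, an end of \<open>I\<close> belongs to \<open>I\<close> only if it lies on the axis, where the
  rotationally invariant tangent plane is orthogonal to \<open>\<ell>\<close>; there are no boundary points.\<close>

definition generating_curve ::
  "real set \<Rightarrow> (real \<Rightarrow> real) \<Rightarrow> (real \<Rightarrow> real) \<Rightarrow> (real \<Rightarrow> real) \<Rightarrow> bool" where
  "generating_curve I x y \<alpha> \<longleftrightarrow>
     is_interval I \<and> interior I \<noteq> {} \<and>
     (\<forall>s\<in>I. (x has_real_derivative cos (\<alpha> s)) (at s within I)) \<and>
     (\<forall>s\<in>I. (y has_real_derivative sin (\<alpha> s) / cosh (x s)) (at s within I)) \<and>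
     (\<exists>\<alpha>'. continuous_on I \<alpha>' \<and> (\<forall>s\<in>I. (\<alpha> has_real_derivative \<alpha>' s) (at s within I))) \<and>
     (\<forall>s\<in>interior I. x s \<noteq> 0) \<and>
     (\<forall>s\<in>I - interior I. x s = 0 \<and> sin (\<alpha> s) = 0)"

definition rot_immersion :: "(real \<Rightarrow> real) \<Rightarrow> (real \<Rightarrow> real) \<Rightarrow> real \<Rightarrow> real \<Rightarrow> point" where
  "rot_immersion x y s t =
     (complex_of_real (cosh (x s)) * cis (y s), complex_of_real (sinh (x s)) * cis t)"

definition rot_surface :: "real set \<Rightarrow> (real \<Rightarrow> real) \<Rightarrow> (real \<Rightarrow> real) \<Rightarrow> point set" where
  "rot_surface I x y = (\<lambda>(s, t). rot_immersion x y s t) ` (I \<times> UNIV)"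

definition normal_denom :: "real \<Rightarrow> real \<Rightarrow> real \<Rightarrow> real \<Rightarrow> real" where
  "normal_denom \<kappa> \<tau> X a =
     sqrt ((cos a)\<^sup>2 * ((cosh X)\<^sup>2 - 4 * \<tau>\<^sup>2 / \<kappa> * (sinh X)\<^sup>2) - 4 * \<tau>\<^sup>2 / \<kappa> * (sin a)\<^sup>2)"

definition normal_C :: "real \<Rightarrow> real \<Rightarrow> real \<Rightarrow> real \<Rightarrow> real" where
  "normal_C \<kappa> \<tau> X a = cos a * cosh X / normal_denom \<kappa> \<tau> X a"

text \<open>\<open>C tan \<alpha>\<close>, extended continuously to \<open>cos \<alpha> = 0\<close>.\<close>

definition normal_C_tan :: "real \<Rightarrow> real \<Rightarrow> real \<Rightarrow> real \<Rightarrow> real" where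
  "normal_C_tan \<kappa> \<tau> X a = sin a * cosh X / normal_denom \<kappa> \<tau> X a"

lemma normal_C_tan_eq: "cos a \<noteq> 0 \<Longrightarrow> normal_C_tan \<kappa> \<tau> X a = normal_C \<kappa> \<tau> X a * tan a"
  by (simp add: normal_C_tan_def normal_C_def tan_def)

definition rot_normal ::
  "real \<Rightarrow> real \<Rightarrow> (real \<Rightarrow> real) \<Rightarrow> (real \<Rightarrow> real) \<Rightarrow> (real \<Rightarrow> real) \<Rightarrow> real \<Rightarrow> real \<Rightarrow> point" where
  "rot_normal \<kappa> \<tau> x y \<alpha> s t =
     (let p = rot_immersion x y s t;
          \<nu> = (complex_of_real (normal_C_tan \<kappa> \<tau> (x s) (\<alpha> s) / cosh (x s))
               - \<i> * complex_of_real (normal_C \<kappa> \<tau> (x s) (\<alpha> s) * tanh (x s))) * cis (t + y s)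
      in (- \<tau> * Re \<nu>) *\<^sub>R frame 1 p + (- \<tau> * Im \<nu>) *\<^sub>R frame 2 p
         - (\<kappa> / (4 * \<tau>) * normal_C \<kappa> \<tau> (x s) (\<alpha> s)) *\<^sub>R frame 3 p)"

definition energy ::
  "real \<Rightarrow> real \<Rightarrow> real \<Rightarrow> (real \<Rightarrow> real) \<Rightarrow> (real \<Rightarrow> real) \<Rightarrow> real \<Rightarrow> real" where
  "energy \<kappa> \<tau> H x \<alpha> s =
     \<tau> * normal_C_tan \<kappa> \<tau> (x s) (\<alpha> s) * sinh (x s) - H * (sinh (x s))\<^sup>2"

subsection \<open>The abstract surface: identifications, completeness, immersion, embeddedness\<close>

text \<open>The identifications made on \<open>I \<times> \<real>\<close> to obtain the surface generated by \<open>\<gamma>\<close>.\<close>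

definition same_point :: "(real \<Rightarrow> real) \<Rightarrow> real \<times> real \<Rightarrow> real \<times> real \<Rightarrow> bool" where
  "same_point x p q \<longleftrightarrow>
     fst p = fst q \<and> (x (fst p) = 0 \<or> (\<exists>k::int. snd q = snd p + 2 * pi * of_int k))"

definition speed ::
  "real \<Rightarrow> real \<Rightarrow> (real \<Rightarrow> point) \<Rightarrow> real \<Rightarrow> real" where
  "speed \<kappa> \<tau> \<beta> u =
     sqrt (metric \<kappa> \<tau> (\<beta> u) (vector_derivative \<beta> (at u)) (vector_derivative \<beta> (at u)))"

text \<open>Intrinsic Riemannian distance. \<open>valid_path\<close> (piecewise \<open>C\<^sup>1\<close>) does not bound the
  derivative near the exceptional points, hence the explicit integrability condition.\<close>

definition intrinsic_dist ::
  "real \<Rightarrow> real \<Rightarrow> real set \<Rightarrow> (real \<Rightarrow> real) \<Rightarrow> (real \<Rightarrow> real)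
     \<Rightarrow> real \<times> real \<Rightarrow> real \<times> real \<Rightarrow> real" where
  "intrinsic_dist \<kappa> \<tau> I x y p q =
     Inf {integral {0..1} (speed \<kappa> \<tau> ((\<lambda>(s, t). rot_immersion x y s t) \<circ> c)) | c.
       valid_path c \<and> path_image c \<subseteq> I \<times> UNIV \<and>
       pathstart c = p \<and> same_point x (pathfinish c) q \<and>
       speed \<kappa> \<tau> ((\<lambda>(s, t). rot_immersion x y s t) \<circ> c) integrable_on {0..1}}"

definition complete_surface ::
  "real \<Rightarrow> real \<Rightarrow> real set \<Rightarrow> (real \<Rightarrow> real) \<Rightarrow> (real \<Rightarrow> real) \<Rightarrow> bool" where
  "complete_surface \<kappa> \<tau> I x y \<longleftrightarrow>
     (\<forall>p :: nat \<Rightarrow> real \<times> real.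
        (\<forall>n. p n \<in> I \<times> UNIV) \<and>
        (\<forall>e>0. \<exists>M. \<forall>m\<ge>M. \<forall>n\<ge>M. intrinsic_dist \<kappa> \<tau> I x y (p m) (p n) < e)
        \<longrightarrow> (\<exists>q\<in>I \<times> UNIV. (\<lambda>n. intrinsic_dist \<kappa> \<tau> I x y (p n) q) \<longlonglongrightarrow> 0))"

definition rot_cmc_surface ::
  "real \<Rightarrow> real \<Rightarrow> real \<Rightarrow> real \<Rightarrow> real set
     \<Rightarrow> (real \<Rightarrow> real) \<Rightarrow> (real \<Rightarrow> real) \<Rightarrow> (real \<Rightarrow> real) \<Rightarrow> bool" where
  "rot_cmc_surface \<kappa> \<tau> H E I x y \<alpha> \<longleftrightarrow>
     generating_curve I x y \<alpha> \<and>
     complete_surface \<kappa> \<tau> I x y \<and>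
     (\<forall>s\<in>interior I. \<forall>t.
        mean_curvature \<kappa> \<tau> (rot_immersion x y) (rot_normal \<kappa> \<tau> x y \<alpha>) s t = H) \<and>
     (\<forall>s\<in>I. energy \<kappa> \<tau> H x \<alpha> s = E)"

definition C1_immersion_on :: "(real \<times> real) set \<Rightarrow> (real \<times> real \<Rightarrow> point) \<Rightarrow> bool" where
  "C1_immersion_on U F \<longleftrightarrow>
     (\<exists>F'. (\<forall>v\<in>U. (F has_derivative F' v) (at v) \<and> inj (F' v)) \<and>
           (\<forall>h. continuous_on U (\<lambda>v. F' v h)))"

text \<open>The map \<open>\<Phi>\<close> descends to an immersion of the quotient of \<open>I \<times> \<real>\<close> by \<open>same_point\<close>;
  the maps \<open>q\<close> are charts of this quotient, also around the points on the axis.\<close>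

definition immersed_surface :: "real set \<Rightarrow> (real \<Rightarrow> real) \<Rightarrow> (real \<Rightarrow> real) \<Rightarrow> bool" where
  "immersed_surface I x y \<longleftrightarrow>
     (\<forall>s\<in>I. \<exists>J U q F.
        openin (top_of_set I) J \<and> s \<in> J \<and> open U \<and>
        quotient_map (top_of_set (J \<times> UNIV)) (top_of_set U) q \<and>
        (\<forall>p\<in>J \<times> UNIV. \<forall>p'\<in>J \<times> UNIV. q p = q p' \<longleftrightarrow> same_point x p p') \<and>
        (\<forall>p\<in>J \<times> UNIV. rot_immersion x y (fst p) (snd p) = F (q p)) \<and>
        C1_immersion_on U F)"

definition embedded_surface :: "point set \<Rightarrow> bool" where
  "embedded_surface S \<longleftrightarrow>
     (\<forall>p\<in>S. \<exists>V U F G.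
        open V \<and> p \<in> V \<and> open U \<and> homeomorphism U (S \<inter> V) F G \<and> C1_immersion_on U F)"

text \<open>The abstract surface is a topological sphere; \<open>\<Phi>\<close> itself need not be injective on it.\<close>

definition two_sphere_surface :: "real set \<Rightarrow> (real \<Rightarrow> real) \<Rightarrow> bool" where
  "two_sphere_surface I x \<longleftrightarrow>
     (\<exists>q. quotient_map (top_of_set (I \<times> UNIV)) (top_of_set (sphere (0::real^3) 1)) q \<and>
          (\<forall>p\<in>I \<times> UNIV. \<forall>p'\<in>I \<times> UNIV. q p = q p' \<longleftrightarrow> same_point x p p'))"


section \<open>Types of generating curves\<close>

type_synonym curve_type =
  "real set \<Rightarrow> (real \<Rightarrow> real) \<Rightarrow> (real \<Rightarrow> real) \<Rightarrow> (real \<Rightarrow> real) \<Rightarrow> bool"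

text \<open>The types are described for curves in \<open>x \<ge> 0\<close>; a curve in \<open>x \<le> 0\<close> is first replaced by
  \<open>(-x(-s), y(-s))\<close>, whose angle function is \<open>-\<alpha>(-s)\<close>.\<close>

definition of_type :: "curve_type \<Rightarrow> curve_type" where
  "of_type P I x y \<alpha> \<longleftrightarrow>
     (\<forall>s\<in>I. 0 \<le> x s) \<and> P I x y \<alpha> \<or>
     (\<forall>s\<in>I. x s \<le> 0) \<and> P (uminus ` I) (\<lambda>s. - x (- s)) (\<lambda>s. y (- s)) (\<lambda>s. - \<alpha> (- s))"

text \<open>A constant \<open>f\<close>, with \<open>x1 = x2\<close>, is admitted as the degenerate case.\<close>

definition unduloid_type :: "real \<Rightarrow> real \<Rightarrow> curve_type" where
  "unduloid_type x1 x2 I x y \<alpha> \<longleftrightarrow>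
     (\<exists>f f'. bij_betw y I UNIV \<and> (\<forall>s\<in>I. x s = f (y s)) \<and>
        (\<forall>v. (f has_real_derivative f' v) (at v)) \<and>
        (\<exists>P>0. \<forall>v. f (v + P) = f v) \<and>
        range f = {x1..x2} \<and>
        (\<forall>a b. a < b \<and> f' a = 0 \<and> f' b = 0 \<and> (\<forall>v. a < v \<and> v < b \<longrightarrow> f' v \<noteq> 0)
           \<longrightarrow> strict_mono_on {a..b} f \<or> strict_antimono_on {a..b} f) \<and>
        (\<forall>c. f' c = 0 \<longrightarrow> (\<forall>u. f (c + u) = f (c - u))))"

text \<open>Since \<open>x' = cos \<alpha>\<close>, the points with \<open>x' = 0\<close> are those with \<open>cos \<alpha> = 0\<close>.\<close>

definition symmetric_at :: "real \<Rightarrow> real set \<Rightarrow> (real \<Rightarrow> real) \<Rightarrow> (real \<Rightarrow> real) \<Rightarrow> bool" where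
  "symmetric_at c I x y \<longleftrightarrow>
     (\<forall>u. c + u \<in> I \<longrightarrow> c - u \<in> I \<and> x (c - u) = x (c + u) \<and> y (c - u) = 2 * y c - y (c + u))"

definition consecutive_critical :: "real set \<Rightarrow> (real \<Rightarrow> real) \<Rightarrow> real \<Rightarrow> real \<Rightarrow> bool" where
  "consecutive_critical I \<alpha> a b \<longleftrightarrow>
     a \<in> I \<and> b \<in> I \<and> a < b \<and> cos (\<alpha> a) = 0 \<and> cos (\<alpha> b) = 0 \<and>
     (\<forall>s. a < s \<and> s < b \<longrightarrow> cos (\<alpha> s) \<noteq> 0)"

definition changes_sign_once :: "(real \<Rightarrow> real) \<Rightarrow> real set \<Rightarrow> real \<Rightarrow> bool" where
  "changes_sign_once h S c \<longleftrightarrow>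
     c \<in> S \<and> (\<exists>s\<in>S. s < c) \<and> (\<exists>s\<in>S. c < s) \<and> h c = 0 \<and>
     ((\<forall>s\<in>S. (s < c \<longrightarrow> h s < 0) \<and> (c < s \<longrightarrow> 0 < h s)) \<or>
      (\<forall>s\<in>S. (s < c \<longrightarrow> 0 < h s) \<and> (c < s \<longrightarrow> h s < 0)))"

text \<open>A piece of \<open>\<gamma>\<close> is a graph \<open>x(y)\<close> iff \<open>y\<close> is injective on it.\<close>

definition two_graphs :: "real set \<Rightarrow> (real \<Rightarrow> real) \<Rightarrow> (real \<Rightarrow> real) \<Rightarrow> bool" where
  "two_graphs S y \<alpha> \<longleftrightarrow>
     (\<exists>c. changes_sign_once (\<lambda>s. sin (\<alpha> s)) S c \<and>
          inj_on y (S \<inter> {..c}) \<and> inj_on y (S \<inter> {c..}))"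

definition nodoid_type :: "real \<Rightarrow> real \<Rightarrow> curve_type" where
  "nodoid_type x1 x2 I x y \<alpha> \<longleftrightarrow>
     x1 < x2 \<and> x ` I = {x1..x2} \<and>
     (\<forall>s\<in>I. \<exists>a b. a \<le> s \<and> s < b \<and> consecutive_critical I \<alpha> a b) \<and>
     (\<forall>c\<in>I. cos (\<alpha> c) = 0 \<longrightarrow> symmetric_at c I x y) \<and>
     (\<forall>a b. consecutive_critical I \<alpha> a b \<longrightarrow>
        (x a = x1 \<and> x b = x2 \<or> x a = x2 \<and> x b = x1) \<and> two_graphs {a..b} y \<alpha>)"

text \<open>The sign \<open>\<epsilon>\<close> accounts for the isometry \<open>(z, w) \<mapsto> (cnj z, cnj w)\<close>, which maps \<open>y\<close> to \<open>-y\<close>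
  and carries such surfaces to such surfaces.\<close>

definition open_sphere_type :: curve_type where
  "open_sphere_type I x y \<alpha> \<longleftrightarrow>
     (\<exists>f \<epsilon>. \<epsilon> \<in> {1, -1} \<and> bij_betw x I {0..} \<and> (\<forall>s\<in>I. y s = \<epsilon> * f (x s)) \<and>
        strict_mono_on {0..} f \<and>
        (\<forall>a\<ge>0. \<forall>b\<ge>0. \<forall>u. a \<noteq> b \<and> 0 < u \<and> u < 1
           \<longrightarrow> f ((1 - u) * a + u * b) < (1 - u) * f a + u * f b))"

text \<open>The limit of the previous type for \<open>H = 0\<close>: the geodesic \<open>y = const\<close>.\<close>

definition half_geodesic :: curve_type where
  "half_geodesic I x y \<alpha> \<longleftrightarrow> bij_betw x I {0..} \<and> (\<exists>c. \<forall>s\<in>I. y s = c)"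

definition open_unduloid_type :: curve_type where
  "open_unduloid_type I x y \<alpha> \<longleftrightarrow>
     (\<exists>f f' J v0. open J \<and> is_interval J \<and> bij_betw y I J \<and> (\<forall>s\<in>I. x s = f (y s)) \<and>
        (\<forall>v\<in>J. (f has_real_derivative f' v) (at v)) \<and>
        v0 \<in> J \<and> (\<forall>v\<in>J. f' v = 0 \<longleftrightarrow> v = v0) \<and>
        0 < f v0 \<and> (\<forall>v\<in>J. f v0 \<le> f v) \<and>
        (\<forall>u. v0 + u \<in> J \<longrightarrow> v0 - u \<in> J \<and> f (v0 - u) = f (v0 + u)) \<and>
        strict_antimono_on (J \<inter> {..v0}) f \<and> strict_mono_on (J \<inter> {v0..}) f \<and>
        \<not> bdd_above (f ` J))"

definition open_nodoid_type :: curve_type where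
  "open_nodoid_type I x y \<alpha> \<longleftrightarrow>
     (\<exists>c\<in>I. (\<forall>s\<in>I. cos (\<alpha> s) = 0 \<longleftrightarrow> s = c) \<and>
        0 < x c \<and> (\<forall>s\<in>I. x c \<le> x s) \<and>
        symmetric_at c I x y \<and> \<not> bdd_above (x ` I) \<and>
        two_graphs (I \<inter> {..c}) y \<alpha> \<and> two_graphs (I \<inter> {c..}) y \<alpha>)"


section \<open>Extremal values and period\<close>

definition root_disc :: "real \<Rightarrow> real \<Rightarrow> real \<Rightarrow> real" where
  "root_disc \<kappa> H E = 16 * \<kappa> * E * (H - E) + \<kappa>\<^sup>2"

definition t_min :: "real \<Rightarrow> real \<Rightarrow> real \<Rightarrow> real" where
  "t_min \<kappa> H E = (- 8 * H * E - \<kappa> - sqrt (root_disc \<kappa> H E)) / (2 * (4 * H\<^sup>2 + \<kappa>))"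

definition t_max :: "real \<Rightarrow> real \<Rightarrow> real \<Rightarrow> real" where
  "t_max \<kappa> H E = (- 8 * H * E - \<kappa> + sqrt (root_disc \<kappa> H E)) / (2 * (4 * H\<^sup>2 + \<kappa>))"

definition x_min :: "real \<Rightarrow> real \<Rightarrow> real \<Rightarrow> real" where
  "x_min \<kappa> H E = arsinh (sqrt (t_min \<kappa> H E))"

definition x_max :: "real \<Rightarrow> real \<Rightarrow> real \<Rightarrow> real" where
  "x_max \<kappa> H E = arsinh (sqrt (t_max \<kappa> H E))"

definition period :: "real \<Rightarrow> real \<Rightarrow> real \<Rightarrow> real \<Rightarrow> real" where
  "period \<kappa> \<tau> H E =
     2 * integral {x_min \<kappa> H E..x_max \<kappa> H E} (\<lambda>x.
       (E + H * (sinh x)\<^sup>2) * sqrt (1 - 4 * \<tau>\<^sup>2 / \<kappa> * (tanh x)\<^sup>2) /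
       (\<tau> * sqrt ((sinh x)\<^sup>2 * (cosh x)\<^sup>2 + 4 / \<kappa> * (E + H * (sinh x)\<^sup>2)\<^sup>2)))"

end

(* The quantity P = 2 sinh x cosh x cos alpha / lam, differentiated with respect to the arclength of
   gamma in the orbit space (up to a factor), turns the condition on the mean curvature into a linear
   equation for S = sinh^2 x with constant coefficients: S'' is affine in S, with leading coefficient of
   the sign of -(4 H^2 + kappa). So S oscillates harmonically if 4 H^2 + kappa > 0 and grows without bound
   otherwise. By the conservation of energy, the derivative of y is an explicit function of S with the sign
   of tau (E + H S), which determines the type of gamma. *)
theory Submission imports Defs "HOL-Analysis.Analysis"
begin

text \<open>The conserved energy yields only the first-order relation P^2 = 4 \<open>Qf\<close>(S),
  which would also allow S to rest at a zero of \<open>Qf\<close>. Hence the second-order equation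
  is derived from the mean curvature itself, and uniqueness for linear equations then gives every
  reflection symmetry. The factor \<open>lam\<close> is the length density of the curve in the
  quotient metric; arclength covers the whole line because a bounded x keeps \<open>lam\<close> away
  from 0. If E = 0 the curve meets the axis, where S and P both vanish, and sinh x takes the role of
  S. Two facts need more than the oscillation: a nodoid crosses itself because y advances over a
  period in the direction given by \<tau>, which follows by comparison with an elementary integral;
  and the sphere that crosses itself is found with 4 H^2 + \<kappa> close to 0, where its extent in
  y grows without bound. If H = 0, reversing the curve changes the sign of E, so a negative E gives
  the graph type too. If S is constant, the period integral runs over a single point, so this case
  is treated apart.\<close>

section \<open>Ambient metric and Levi-Civita connection in the global frame\<close>

locale sl2_params =
  fixes \<kappa> \<tau> :: real
  assumes \<kappa>_neg: "\<kappa> < 0" and \<tau>_nz: "\<tau> \<noteq> 0"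
begin

text \<open>The ratio of the weight of V to that of the two other frame fields: up to the factor
  \<open>A\<close>, the metric has the weights 1, 1, \<rho>.\<close>

definition \<rho> :: real where "\<rho> = - 4 * \<tau>\<^sup>2 / \<kappa>"

definition A :: real where "A = 4 / (- \<kappa>)"

lemma \<rho>_pos: "\<rho> > 0"
  using \<kappa>_neg \<tau>_nz by (simp add: \<rho>_def divide_simps mult_neg_pos)

lemma A_pos: "A > 0"
  using \<kappa>_neg by (simp add: A_def divide_simps)

lemma frame_weight_simps [simp]:
  "frame_weight \<kappa> \<tau> 1 = A" "frame_weight \<kappa> \<tau> 2 = A" "frame_weight \<kappa> \<tau> 3 = A * \<rho>"
  using \<kappa>_neg by (simp_all add: frame_weight_def A_def \<rho>_def power2_eq_square)

end

text \<open>Each frame field is real linear on all of C^2 and hence its own derivative, so that the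
  brackets become finite computations.\<close>

lemma linear_frame: "linear (frame j)"
  by (rule linearI) (auto simp: frame_def scaleR_conv_of_real algebra_simps split: prod.splits)

lemma frechet_derivative_frame: "frechet_derivative (frame j) (at p) = frame j"
  using linear_frame by (simp add: linear_imp_has_derivative frechet_derivative_at[symmetric])

lemma lie_bracket_frame:
  "lie_bracket (frame i) (frame i) p = 0"
  "lie_bracket (frame 1) (frame 2) p = 2 *\<^sub>R frame 3 p"
  "lie_bracket (frame 2) (frame 1) p = (-2) *\<^sub>R frame 3 p"
  "lie_bracket (frame 2) (frame 3) p = (-2) *\<^sub>R frame 1 p"
  "lie_bracket (frame 3) (frame 2) p = 2 *\<^sub>R frame 1 p"
  "lie_bracket (frame 3) (frame 1) p = (-2) *\<^sub>R frame 2 p"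
  "lie_bracket (frame 1) (frame 3) p = 2 *\<^sub>R frame 2 p"
  unfolding lie_bracket_def frechet_derivative_frame
  by (auto simp: frame_def complex_eq_iff split: prod.splits)

lemma linear_frame_coord: "linear (frame_coord p)"
  by (rule linearI)
     (auto simp: frame_coord_def vec_eq_iff forall_3 algebra_simps split: prod.splits)

lemma metric_scaleR_left: "metric \<kappa> \<tau> p (c *\<^sub>R u) v = c * metric \<kappa> \<tau> p u v"
  by (simp add: metric_def linear_cmul[OF linear_frame_coord] sum_distrib_left algebra_simps)

lemma metric_minus_left: "metric \<kappa> \<tau> p (- u) v = - metric \<kappa> \<tau> p u v"
  using metric_scaleR_left[of \<kappa> \<tau> p "-1" u v] by simp

lemma metric_0_left: "metric \<kappa> \<tau> p 0 v = 0"
  by (simp add: metric_def linear_0[OF linear_frame_coord])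

lemma frame_coord_combination:
  assumes "p \<in> SL2"
  shows "frame_coord p (\<Sum>k\<in>UNIV. f k *\<^sub>R frame k p) $ j = f j"
proof -
  have "frame_coord p (\<Sum>k\<in>UNIV. f k *\<^sub>R frame k p) = (\<Sum>k\<in>UNIV. f k *\<^sub>R axis k 1)"
    by (simp add: linear_sum[OF linear_frame_coord] linear_cmul[OF linear_frame_coord]
        frame_coord_frame[OF assms])
  then show ?thesis
    by (simp add: sum_3 axis_def) (use exhaust_3[of j] in auto)
qed

context sl2_params
begin

text \<open>Only triples of distinct indices contribute, since the bracket of two different frame
  fields is a multiple of the third.\<close>

lemma connection_simps:
  assumes "p \<in> SL2"
  shows
    "connection \<kappa> \<tau> p 1 2 3 = 1" "connection \<kappa> \<tau> p 2 1 3 = -1"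
    "connection \<kappa> \<tau> p 1 3 2 = - \<rho>" "connection \<kappa> \<tau> p 3 1 2 = - 2 - \<rho>"
    "connection \<kappa> \<tau> p 2 3 1 = \<rho>" "connection \<kappa> \<tau> p 3 2 1 = 2 + \<rho>"
    "connection \<kappa> \<tau> p i i j = 0" "connection \<kappa> \<tau> p i j i = 0" "connection \<kappa> \<tau> p j i i = 0"
  using A_pos \<rho>_pos exhaust_3[of i] exhaust_3[of j]
  by (auto simp: connection_def lie_bracket_frame metric_scaleR_left metric_minus_left metric_0_left metric_frame[OF assms]
      field_simps)

text \<open>The covariant derivative in terms of the frame components of the curve's velocity and of
  the field.\<close>

lemma cov_deriv_coord:
  assumes p: "\<beta> u \<in> SL2"
    and v: "frame_coord (\<beta> u) (vector_derivative \<beta> (at u)) = vector [v1, v2, v3]"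
    and S: "open S" "u \<in> S"
    and W: "\<And>r. r \<in> S \<Longrightarrow> frame_coord (\<beta> r) (W r) = vector [w1 r, w2 r, w3 r]"
    and d: "(w1 has_real_derivative d1) (at u)" "(w2 has_real_derivative d2) (at u)"
      "(w3 has_real_derivative d3) (at u)"
  shows "frame_coord (\<beta> u) (cov_deriv \<kappa> \<tau> \<beta> W u) =
    vector [d1 + \<rho> * v2 * w3 u + (2 + \<rho>) * v3 * w2 u,
            d2 - \<rho> * v1 * w3 u - (2 + \<rho>) * v3 * w1 u,
            d3 + v1 * w2 u - v2 * w1 u]"
proof -
  define w where "w k r = (if k = 1 then w1 r else if k = 2 then w2 r else w3 r)" for k :: 3 and r
  define d where "d k = (if k = 1 then d1 else if k = 2 then d2 else d3)" for k :: 3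
  have dk: "vector_derivative (\<lambda>r. frame_coord (\<beta> r) (W r) $ k) (at u) = d k" for k
  proof (rule vector_derivative_at)
    have "(w k has_vector_derivative d k) (at u)"
      using assms(6-8) unfolding w_def d_def has_real_derivative_iff_has_vector_derivative by auto
    then show "((\<lambda>r. frame_coord (\<beta> r) (W r) $ k) has_vector_derivative d k) (at u)"
      by (rule has_vector_derivative_transform_within_open[OF _ S])
         (use exhaust_3[of k] W in \<open>auto simp: w_def\<close>)
  qed
  show ?thesis
    unfolding cov_deriv_def Let_def dk v W[OF S(2)]
    by (simp add: vec_eq_iff forall_3 frame_coord_combination[OF p])
       (simp add: sum_3 connection_simps[OF p] d_def algebra_simps)
qed

end

section \<open>Tangent vectors, normal and mean curvature of the immersion\<close>

lemma rot_immersion_SL2: "rot_immersion x y s t \<in> SL2"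
proof -
  have "(cosh (x s))\<^sup>2 - (sinh (x s))\<^sup>2 = 1"
    by (simp add: cosh_square_eq)
  then show ?thesis
    by (simp add: rot_immersion_def SL2_def norm_mult power_mult_distrib)
qed

lemma has_vector_derivative_complex_of_real_mult_cis:
  assumes "(f has_real_derivative f') (at s within S)" "(g has_real_derivative g') (at s within S)"
  shows "((\<lambda>r. complex_of_real (f r) * cis (g r)) has_vector_derivative
      (complex_of_real f' + \<i> * complex_of_real (f s * g')) * cis (g s)) (at s within S)"
proof -
  have 1: "((\<lambda>r. complex_of_real (f r)) has_vector_derivative complex_of_real f') (at s within S)"
    using assms(1) by (simp add: has_real_derivative_iff_has_vector_derivative has_vector_derivative_of_real)
  have 2: "((\<lambda>r. cis (g r)) has_vector_derivative (g' *\<^sub>R (\<i> * cis (g s)))) (at s within S)"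
  proof -
    have "((\<lambda>r. exp (\<i> * complex_of_real (g r))) has_vector_derivative
        (\<i> * complex_of_real g') * exp (\<i> * complex_of_real (g s))) (at s within S)"
      using assms(2)
      by (auto intro!: derivative_eq_intros has_vector_derivative_of_real
          has_vector_derivative_mult_right field_vector_diff_chain_within[where g=exp, unfolded o_def]
          simp: has_real_derivative_iff_has_vector_derivative)
    then show ?thesis by (simp add: cis_conv_exp scaleR_conv_of_real mult_ac)
  qed
  show ?thesis
    using has_vector_derivative_mult[OF 1 2] by (simp add: scaleR_conv_of_real algebra_simps)
qed

text \<open>The angle may depend on the parameter, so that one formula serves both partial
  derivatives and the velocity along an arbitrary path in the parameter domain.\<close>

lemma has_vector_derivative_rot_immersion:
  assumes "(x has_real_derivative x') (at s within S)" "(y has_real_derivative y') (at s within S)"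
    "(th has_real_derivative th') (at s within S)"
  shows "((\<lambda>r. rot_immersion x y r (th r)) has_vector_derivative
    ((complex_of_real (x' * sinh (x s)) + \<i> * complex_of_real (y' * cosh (x s))) * cis (y s),
     (complex_of_real (x' * cosh (x s)) + \<i> * complex_of_real (th' * sinh (x s))) * cis (th s)))
    (at s within S)"
  unfolding rot_immersion_def
proof (rule has_vector_derivative_Pair)
  have c: "((\<lambda>r. cosh (x r)) has_real_derivative x' * sinh (x s)) (at s within S)"
    "((\<lambda>r. sinh (x r)) has_real_derivative x' * cosh (x s)) (at s within S)"
    using assms(1) by (auto intro!: derivative_eq_intros)
  show "((\<lambda>r. complex_of_real (cosh (x r)) * cis (y r)) has_vector_derivative
      (complex_of_real (x' * sinh (x s)) + \<i> * complex_of_real (y' * cosh (x s))) * cis (y s)) (at s within S)"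
    using has_vector_derivative_complex_of_real_mult_cis[OF c(1) assms(2)] by (simp add: mult_ac)
  show "((\<lambda>r. complex_of_real (sinh (x r)) * cis (th r)) has_vector_derivative
      (complex_of_real (x' * cosh (x s)) + \<i> * complex_of_real (th' * sinh (x s))) * cis (th s)) (at s within S)"
    using has_vector_derivative_complex_of_real_mult_cis[OF c(2) assms(3)] by (simp add: mult_ac)
qed

text \<open>The first two components are a vector turned by the angle t + y. Those of the normal are
  turned by the same angle, so it drops out of all inner products.\<close>

lemma frame_coord_rot_tangent:
  "frame_coord (rot_immersion x y s t)
    ((complex_of_real (x' * sinh (x s)) + \<i> * complex_of_real (y' * cosh (x s))) * cis (y s),
     (complex_of_real (x' * cosh (x s)) + \<i> * complex_of_real (t' * sinh (x s))) * cis t) =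
   vector [x' * cos (t + y s) - (t' - y') * cosh (x s) * sinh (x s) * sin (t + y s),
           x' * sin (t + y s) + (t' - y') * cosh (x s) * sinh (x s) * cos (t + y s),
           y' * (cosh (x s))\<^sup>2 - t' * (sinh (x s))\<^sup>2]"
proof -
  have 1: "cosh (x s) * cosh (x s) = 1 + sinh (x s) * sinh (x s)"
    using cosh_square_eq[of "x s"] by (simp add: power2_eq_square)
  have 2: "sin t * sin t = 1 - cos t * cos t" "sin (y s) * sin (y s) = 1 - cos (y s) * cos (y s)"
    using sin_squared_eq[of t] sin_squared_eq[of "y s"] by (simp_all add: power2_eq_square)
  show ?thesis
    unfolding frame_coord_def rot_immersion_def prod.case
    apply (simp add: vec_eq_iff forall_3 cos_add sin_add)
    using 1 2
    by (intro conjI; algebra)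
qed

context sl2_params
begin

text \<open>\<open>A * (sinh X)\<^sup>2 * K2 X\<close> is the squared length of the vector field
  generating the rotations.\<close>

definition K2 :: "real \<Rightarrow> real" where "K2 X = (cosh X)\<^sup>2 + \<rho> * (sinh X)\<^sup>2"

lemma K2_pos: "K2 X > 0"
  unfolding K2_def using \<rho>_pos by (intro add_pos_nonneg) auto

lemma normal_denom_eq: "normal_denom \<kappa> \<tau> X a = sqrt ((cos a)\<^sup>2 * K2 X + \<rho> * (sin a)\<^sup>2)"
  by (simp add: normal_denom_def K2_def \<rho>_def)

lemma normal_denom_arg_pos: "(cos a)\<^sup>2 * K2 X + \<rho> * (sin a)\<^sup>2 > 0"
proof (cases "sin a = 0")
  case True
  then have "(cos a)\<^sup>2 = 1" using sin_cos_squared_add[of a] by simp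
  then show ?thesis using True K2_pos[of X] by simp
next
  case False
  then show ?thesis using \<rho>_pos K2_pos[of X] by (intro add_nonneg_pos) auto
qed

lemma normal_denom_pos: "normal_denom \<kappa> \<tau> X a > 0"
  using normal_denom_arg_pos by (simp add: normal_denom_eq)

lemma normal_denom_sq: "(normal_denom \<kappa> \<tau> X a)\<^sup>2 = (cos a)\<^sup>2 * K2 X + \<rho> * (sin a)\<^sup>2"
  using normal_denom_arg_pos[of a X] by (simp add: normal_denom_eq)

lemma metric_coord:
  assumes "frame_coord p u = vector [u1, u2, u3]" "frame_coord p v = vector [v1, v2, v3]"
  shows "metric \<kappa> \<tau> p u v = A * (u1 * v1 + u2 * v2 + \<rho> * u3 * v3)"
  by (simp add: metric_def assms sum_3 algebra_simps)

text \<open>The mean curvature of the rotational surface, with \<open>a'\<close> standing for the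
  derivative of \<alpha>. Neither y nor t occurs, as they enter the frame components only as the
  angle t + y.\<close>

definition curvature_expr :: "real \<Rightarrow> real \<Rightarrow> real \<Rightarrow> real" where
  "curvature_expr X a a' =
     (let D = normal_denom \<kappa> \<tau> X a in
      \<tau> * (K2 X * a' + sin a * (((cosh X)\<^sup>2 + (sinh X)\<^sup>2) * D\<^sup>2
        - (cosh X)\<^sup>2 * (sinh X)\<^sup>2 * (1 + \<rho>) * (cos a)\<^sup>2) / (sinh X * cosh X)) / (2 * D ^ 3))"

lemma frame_coord_normal:
  "frame_coord (rot_immersion x y s t) (rot_normal \<kappa> \<tau> x y \<alpha> s t) =
   (let D = normal_denom \<kappa> \<tau> (x s) (\<alpha> s) in
    vector [- \<tau> * (sin (\<alpha> s) * cos (t + y s) + cos (\<alpha> s) * sinh (x s) * sin (t + y s)) / D,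
            - \<tau> * (sin (\<alpha> s) * sin (t + y s) - cos (\<alpha> s) * sinh (x s) * cos (t + y s)) / D,
            \<tau> * cos (\<alpha> s) * cosh (x s) / (\<rho> * D)])"
proof -
  define D where "D = normal_denom \<kappa> \<tau> (x s) (\<alpha> s)"
  have D: "D \<noteq> 0" using normal_denom_pos[of "x s" "\<alpha> s"] by (simp add: D_def)
  have k: "\<kappa> / (4 * \<tau>) = - \<tau> / \<rho>"
    using \<kappa>_neg \<tau>_nz by (simp add: \<rho>_def field_simps power2_eq_square)
  note ax = linear_add[OF linear_frame_coord] linear_diff[OF linear_frame_coord]
    linear_cmul[OF linear_frame_coord] frame_coord_frame[OF rot_immersion_SL2]
  show ?thesis
    unfolding rot_normal_def Let_def ax k D_def[symmetric] normal_C_tan_def normal_C_def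
    using D \<rho>_pos
    by (simp add: vec_eq_iff forall_3 axis_def tanh_def field_simps)
qed

text \<open>Trigonometric and hyperbolic values become variables subject to the polynomial relations
  \<open>e1\<close> to \<open>e5\<close>, so that every identity below is one of polynomials modulo
  these relations.\<close>

lemma mean_curvature_eq:
  assumes O: "open S" "s \<in> S"
    and x: "\<And>r. r \<in> S \<Longrightarrow> (x has_real_derivative cos (\<alpha> r)) (at r)"
    and y: "\<And>r. r \<in> S \<Longrightarrow> (y has_real_derivative sin (\<alpha> r) / cosh (x r)) (at r)"
    and a: "(\<alpha> has_real_derivative a') (at s)"
    and xs: "x s \<noteq> 0"
  shows "mean_curvature \<kappa> \<tau> (rot_immersion x y) (rot_normal \<kappa> \<tau> x y \<alpha>) s t
    = curvature_expr (x s) (\<alpha> s) a'"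
proof -
  let ?F = "rot_immersion x y" and ?p = "rot_immersion x y s t"
  define D where "D = normal_denom \<kappa> \<tau> (x s) (\<alpha> s)"
  define c sh u w co si where "c = cosh (x s)" and "sh = sinh (x s)" and "u = sin (\<alpha> s)"
    and "w = cos (\<alpha> s)" and "co = cos (t + y s)" and "si = sin (t + y s)"
  note defs = c_def sh_def u_def w_def co_def si_def
  \<comment> \<open>The derivative of y at s; \<open>e5\<close> replaces the division by cosh
    x.\<close>
  define th where "th = u / c"
  have c0: "c > 0" by (simp add: c_def)
  have sh0: "sh \<noteq> 0" using xs by (simp add: sh_def)
  have D0: "D > 0" using normal_denom_pos by (simp add: D_def)
  have e1: "co\<^sup>2 + si\<^sup>2 = 1" by (simp add: defs)
  have e2: "u\<^sup>2 + w\<^sup>2 = 1" by (simp add: defs)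
  have e3: "c\<^sup>2 = 1 + sh\<^sup>2" by (simp add: defs cosh_square_eq)
  have e4: "D\<^sup>2 = w\<^sup>2 * (c\<^sup>2 + \<rho> * sh\<^sup>2) + \<rho> * u\<^sup>2"
    by (simp add: D_def normal_denom_sq K2_def defs)
  have e5: "th * c = u" using c0 by (simp add: th_def)
  have p1: "((\<lambda>r. ?F r q) has_vector_derivative
      ((complex_of_real (cos (\<alpha> r) * sinh (x r)) + \<i> * complex_of_real (sin (\<alpha> r) / cosh (x r) * cosh (x r))) * cis (y r),
       (complex_of_real (cos (\<alpha> r) * cosh (x r)) + \<i> * complex_of_real (0 * sinh (x r))) * cis q)) (at r)"
    if "r \<in> S" for r q
    by (rule has_vector_derivative_rot_immersion[OF x[OF that] y[OF that]]) simp
  have p2: "((\<lambda>q. ?F r q) has_vector_derivative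
      ((complex_of_real (0 * sinh (x r)) + \<i> * complex_of_real (0 * cosh (x r))) * cis (y r),
       (complex_of_real (0 * cosh (x r)) + \<i> * complex_of_real (1 * sinh (x r))) * cis q)) (at q)" for r q
  proof -
    have 1: "((\<lambda>r. x s) has_real_derivative 0) (at q)" "((\<lambda>r. y s) has_real_derivative 0) (at q)"
      "((\<lambda>r. r) has_real_derivative 1) (at q)" for s
      by (auto intro!: derivative_eq_intros)
    show ?thesis
      using has_vector_derivative_rot_immersion[OF 1(1)[of r] 1(2)[of r] 1(3)]
      by (simp add: rot_immersion_def)
  qed
  have f1: "frame_coord (?F r q) (partial1 ?F r q) =
     vector [cos (\<alpha> r) * cos (q + y r) + sin (\<alpha> r) * sinh (x r) * sin (q + y r),
             cos (\<alpha> r) * sin (q + y r) - sin (\<alpha> r) * sinh (x r) * cos (q + y r),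
             sin (\<alpha> r) * cosh (x r)]" if "r \<in> S" for r q
    unfolding partial1_def vector_derivative_at[OF p1[OF that]] frame_coord_rot_tangent
    by (simp add: power2_eq_square)
  have f2: "frame_coord (?F r q) (partial2 ?F r q) =
     vector [- sinh (x r) * cosh (x r) * sin (q + y r), sinh (x r) * cosh (x r) * cos (q + y r),
             - (sinh (x r))\<^sup>2]" for r q
    unfolding partial2_def vector_derivative_at[OF p2] frame_coord_rot_tangent
    by (simp add: mult_ac)
  have F1: "frame_coord ?p (partial1 ?F s t) = vector [w * co + u * sh * si, w * si - u * sh * co, u * c]"
    using f1[OF O(2)] by (simp add: defs)
  have F2: "frame_coord ?p (partial2 ?F s t) = vector [- (sh * c * si), sh * c * co, - sh\<^sup>2]"
    using f2 by (simp add: defs)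
  have FN: "frame_coord ?p (rot_normal \<kappa> \<tau> x y \<alpha> s t) =
     vector [- \<tau> * (u * co + w * sh * si) / D, - \<tau> * (u * si - w * sh * co) / D, \<tau> * w * c / (\<rho> * D)]"
    by (simp add: frame_coord_normal Let_def D_def defs)
  note der = x[OF O(2)] y[OF O(2)] a
  have h11: "frame_coord ?p (cov_deriv \<kappa> \<tau> (\<lambda>r. ?F r t) (\<lambda>r. partial1 ?F r t) s) =
     vector [ (- u * a' * co - w * th * si + (w * a' * sh + u * w * c) * si + u * sh * th * co)
               + \<rho> * (w * si - u * sh * co) * (u * c) + (2 + \<rho>) * (u * c) * (w * si - u * sh * co),
              (- u * a' * si + w * th * co - (w * a' * sh + u * w * c) * co + u * sh * th * si)
               - \<rho> * (w * co + u * sh * si) * (u * c) - (2 + \<rho>) * (u * c) * (w * co + u * sh * si),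
              (w * a' * c + u * w * sh) + (w * co + u * sh * si) * (w * si - u * sh * co)
               - (w * si - u * sh * co) * (w * co + u * sh * si)]"
  proof -
    have d: "((\<lambda>r. cos (\<alpha> r) * cos (t + y r) + sin (\<alpha> r) * sinh (x r) * sin (t + y r))
       has_real_derivative (- u * a' * co - w * th * si + (w * a' * sh + u * w * c) * si + u * sh * th * co)) (at s)"
      "((\<lambda>r. cos (\<alpha> r) * sin (t + y r) - sin (\<alpha> r) * sinh (x r) * cos (t + y r))
       has_real_derivative (- u * a' * si + w * th * co - (w * a' * sh + u * w * c) * co + u * sh * th * si)) (at s)"
      "((\<lambda>r. sin (\<alpha> r) * cosh (x r)) has_real_derivative (w * a' * c + u * w * sh)) (at s)"
      unfolding defs th_def
      by (rule derivative_eq_intros der refl | (simp add: algebra_simps; fail))+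
    have v: "frame_coord (?F s t) (vector_derivative (\<lambda>r. ?F r t) (at s)) =
        vector [w * co + u * sh * si, w * si - u * sh * co, u * c]"
      using F1 by (simp add: partial1_def)
    show ?thesis
      using cov_deriv_coord[where \<beta> = "\<lambda>r. rot_immersion x y r t", OF rot_immersion_SL2 v O f1 d]
      by (simp add: defs)
  qed
  have h12: "frame_coord ?p (cov_deriv \<kappa> \<tau> (\<lambda>r. ?F r t) (\<lambda>r. partial2 ?F r t) s) =
     vector [ - (w * (c\<^sup>2 + sh\<^sup>2) * si + sh * c * co * th)
               + \<rho> * (w * si - u * sh * co) * (- sh\<^sup>2) + (2 + \<rho>) * (u * c) * (sh * c * co),
              (w * (c\<^sup>2 + sh\<^sup>2) * co - sh * c * si * th)
               - \<rho> * (w * co + u * sh * si) * (- sh\<^sup>2) - (2 + \<rho>) * (u * c) * (- (sh * c * si)),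
              (- 2 * sh * c * w) + (w * co + u * sh * si) * (sh * c * co)
               - (w * si - u * sh * co) * (- (sh * c * si))]"
  proof -
    have d: "((\<lambda>r. - sinh (x r) * cosh (x r) * sin (t + y r))
       has_real_derivative (- (w * (c\<^sup>2 + sh\<^sup>2) * si + sh * c * co * th))) (at s)"
      "((\<lambda>r. sinh (x r) * cosh (x r) * cos (t + y r))
       has_real_derivative (w * (c\<^sup>2 + sh\<^sup>2) * co - sh * c * si * th)) (at s)"
      "((\<lambda>r. - (sinh (x r))\<^sup>2) has_real_derivative (- 2 * sh * c * w)) (at s)"
      unfolding defs th_def
      by (rule derivative_eq_intros der refl | (simp add: algebra_simps power2_eq_square; fail))+
    have v: "frame_coord (?F s t) (vector_derivative (\<lambda>r. ?F r t) (at s)) =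
        vector [w * co + u * sh * si, w * si - u * sh * co, u * c]"
      using F1 by (simp add: partial1_def)
    show ?thesis
      using cov_deriv_coord[where \<beta> = "\<lambda>r. rot_immersion x y r t", OF rot_immersion_SL2 v O f2 d]
      by (simp add: defs)
  qed
  have h22: "frame_coord ?p (cov_deriv \<kappa> \<tau> (\<lambda>r. ?F s r) (\<lambda>r. partial2 ?F s r) t) =
     vector [ - (sh * c * co) + \<rho> * (sh * c * co) * (- sh\<^sup>2) + (2 + \<rho>) * (- sh\<^sup>2) * (sh * c * co),
              - (sh * c * si) - \<rho> * (- (sh * c * si)) * (- sh\<^sup>2) - (2 + \<rho>) * (- sh\<^sup>2) * (- (sh * c * si)),
              0 + (- (sh * c * si)) * (sh * c * co) - (sh * c * co) * (- (sh * c * si))]"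
  proof -
    have d: "((\<lambda>r. - sinh (x s) * cosh (x s) * sin (r + y s))
       has_real_derivative (- (sh * c * co))) (at t)"
      "((\<lambda>r. sinh (x s) * cosh (x s) * cos (r + y s))
       has_real_derivative (- (sh * c * si))) (at t)"
      "((\<lambda>r. - (sinh (x s))\<^sup>2) has_real_derivative 0) (at t)"
      unfolding defs
      by (rule derivative_eq_intros refl | (simp add: algebra_simps; fail))+
    have v: "frame_coord (?F s t) (vector_derivative (\<lambda>r. ?F s r) (at t)) =
        vector [- (sh * c * si), sh * c * co, - sh\<^sup>2]"
      using F2 by (simp add: partial2_def)
    show ?thesis
      using cov_deriv_coord[where \<beta> = "\<lambda>r. rot_immersion x y s r" and S = UNIV, OF rot_immersion_SL2 v open_UNIV UNIV_I f2 d]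
      by (simp add: defs)
  qed
  have g11: "metric \<kappa> \<tau> ?p (partial1 ?F s t) (partial1 ?F s t) = A * (w\<^sup>2 + u\<^sup>2 * sh\<^sup>2 + \<rho> * u\<^sup>2 * c\<^sup>2)"
    unfolding metric_coord[OF F1 F1] using e1 by (simp; algebra)
  have g12: "metric \<kappa> \<tau> ?p (partial1 ?F s t) (partial2 ?F s t) = - A * (1 + \<rho>) * u * sh\<^sup>2 * c"
    unfolding metric_coord[OF F1 F2] using e1 by (simp; algebra)
  have g22: "metric \<kappa> \<tau> ?p (partial2 ?F s t) (partial2 ?F s t) = A * sh\<^sup>2 * (c\<^sup>2 + \<rho> * sh\<^sup>2)"
    unfolding metric_coord[OF F2 F2] using e1 by (simp; algebra)
  \<comment> \<open>All entries of the second fundamental form share the factor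
    \<open>A * \<tau> / D\<close>; in the V component of the normal, \<rho> cancels against the
    weight of V.\<close>
  have hN: "A * (X1 * (- \<tau> * N1 / D) + X2 * (- \<tau> * N2 / D) + \<rho> * X3 * (\<tau> * w * c / (\<rho> * D)))
      = A * \<tau> / D * (X3 * w * c - X1 * N1 - X2 * N2)" for X1 X2 X3 N1 N2
    using D0 \<rho>_pos by (simp add: field_simps)
  have H11: "metric \<kappa> \<tau> ?p (cov_deriv \<kappa> \<tau> (\<lambda>r. ?F r t) (\<lambda>r. partial1 ?F r t) s) (rot_normal \<kappa> \<tau> x y \<alpha> s t)
     = A * \<tau> / D * (- u * (- u * a' + th * u * sh - (2 + 2 * \<rho>) * u\<^sup>2 * sh * c)
         + w * sh * (- w * a' * sh - u * w * c + th * w - (2 + 2 * \<rho>) * u * c * w)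
         + w * c * (w * a' * c + u * w * sh))" (is "_ = _ * ?E11")
    unfolding metric_coord[OF h11 FN] hN
    by (rule arg_cong[where f = "(*) (A * \<tau> / D)"]) (use e1 in algebra)
  have H12: "metric \<kappa> \<tau> ?p (cov_deriv \<kappa> \<tau> (\<lambda>r. ?F r t) (\<lambda>r. partial2 ?F r t) s) (rot_normal \<kappa> \<tau> x y \<alpha> s t)
     = A * \<tau> / D * (- u * (\<rho> * sh\<^sup>2 * u * sh - th * sh * c + (2 + \<rho>) * u * c * sh * c)
         + w * sh * ((c\<^sup>2 + sh\<^sup>2) * w + \<rho> * sh\<^sup>2 * w) - w * c * w * sh * c)" (is "_ = _ * ?E12")
    unfolding metric_coord[OF h12 FN] hN
    by (rule arg_cong[where f = "(*) (A * \<tau> / D)"]) (use e1 in algebra)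
  have H22: "metric \<kappa> \<tau> ?p (cov_deriv \<kappa> \<tau> (\<lambda>r. ?F s r) (\<lambda>r. partial2 ?F s r) t) (rot_normal \<kappa> \<tau> x y \<alpha> s t)
     = A * \<tau> / D * (u * sh * c * (1 + (2 + 2 * \<rho>) * sh\<^sup>2))" (is "_ = _ * ?E22")
    unfolding metric_coord[OF h22 FN] hN
    by (rule arg_cong[where f = "(*) (A * \<tau> / D)"]) (use e1 in algebra)
  define M where "M = w\<^sup>2 + u\<^sup>2 * sh\<^sup>2 + \<rho> * u\<^sup>2 * c\<^sup>2"
  define K where "K = c\<^sup>2 + \<rho> * sh\<^sup>2"
  \<comment> \<open>The determinant of the first fundamental form is
    \<open>(A * sh * D)\<^sup>2\<close>, so the denominator of the normal measures the area.\<close>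
  have det: "M * (sh\<^sup>2 * K) - ((1 + \<rho>) * u * sh\<^sup>2 * c)\<^sup>2 = sh\<^sup>2 * D\<^sup>2"
    unfolding M_def K_def using e2 e3 e4 by algebra
  \<comment> \<open>The factor c clears the quotient hidden in \<open>th\<close>, which makes both
    sides polynomial.\<close>
  have id: "(sh\<^sup>2 * K * ?E11 + 2 * (1 + \<rho>) * u * sh\<^sup>2 * c * ?E12 + M * ?E22) * c
      = sh\<^sup>2 * K * a' * c + u * sh * ((c\<^sup>2 + sh\<^sup>2) * D\<^sup>2 - c\<^sup>2 * sh\<^sup>2 * (1 + \<rho>) * w\<^sup>2)"
    unfolding M_def K_def using e2 e3 e4 e5 by algebra
  have "mean_curvature \<kappa> \<tau> ?F (rot_normal \<kappa> \<tau> x y \<alpha>) s t =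
    (A * sh\<^sup>2 * K * (A * \<tau> / D * ?E11) - 2 * (- A * (1 + \<rho>) * u * sh\<^sup>2 * c) * (A * \<tau> / D * ?E12)
       + A * M * (A * \<tau> / D * ?E22)) / (A * M * (A * sh\<^sup>2 * K) - (- A * (1 + \<rho>) * u * sh\<^sup>2 * c)\<^sup>2) / 2"
    unfolding mean_curvature_def Let_def g11 g12 g22 H11 H12 H22 M_def K_def ..
  also have "\<dots> = A\<^sup>2 * \<tau> / D * (sh\<^sup>2 * K * ?E11 + 2 * (1 + \<rho>) * u * sh\<^sup>2 * c * ?E12 + M * ?E22)
      / (A\<^sup>2 * (M * (sh\<^sup>2 * K) - ((1 + \<rho>) * u * sh\<^sup>2 * c)\<^sup>2)) / 2" (is "?l / ?m / 2 = ?l' / ?m' / 2")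
  proof -
    have "?l = ?l'" using D0 by (simp add: field_simps power2_eq_square)
    moreover have "?m = ?m'" by (simp add: field_simps power2_eq_square)
    ultimately show ?thesis by (simp only:)
  qed
  also have "\<dots> = \<tau> * (K * a' + u * ((c\<^sup>2 + sh\<^sup>2) * D\<^sup>2 - c\<^sup>2 * sh\<^sup>2 * (1 + \<rho>) * w\<^sup>2) / (sh * c)) / (2 * D ^ 3)"
  proof -
    define E where "E = sh\<^sup>2 * K * ?E11 + 2 * (1 + \<rho>) * u * sh\<^sup>2 * c * ?E12 + M * ?E22"
    define Z where "Z = (c\<^sup>2 + sh\<^sup>2) * D\<^sup>2 - c\<^sup>2 * sh\<^sup>2 * (1 + \<rho>) * w\<^sup>2"
    have "E * c = sh\<^sup>2 * K * a' * c + u * sh * Z" unfolding E_def Z_def by (rule id)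
    then have E: "E = sh\<^sup>2 * (K * a' + u * Z / (sh * c))"
    proof -
      have "sh\<^sup>2 * (K * a' + u * Z / (sh * c)) * c = sh\<^sup>2 * K * a' * c + u * sh * Z"
        using c0 sh0 by (simp add: field_simps power2_eq_square)
      then show ?thesis
        using \<open>E * c = _\<close> c0 by (metis less_irrefl mult_right_cancel)
    qed
    show ?thesis
      unfolding det E_def[symmetric] Z_def[symmetric] unfolding E
      using A_pos c0 sh0 D0 by (simp add: divide_simps power2_eq_square power3_eq_cube)
  qed
  also have "\<dots> = curvature_expr (x s) (\<alpha> s) a'"
    by (simp add: curvature_expr_def Let_def K2_def K_def D_def defs)
  finally show ?thesis .
qed

end

section \<open>Lengths, intrinsic distance and completeness\<close>

lemma abs_sinh_le_cosh: "\<bar>sinh (X::real)\<bar> \<le> cosh X"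
  by (simp add: abs_if sinh_field_def cosh_field_def field_simps)

context sl2_params
begin

lemma metric_nonneg: "metric \<kappa> \<tau> p u u \<ge> 0"
proof -
  have "metric \<kappa> \<tau> p u u = A * (frame_coord p u $ 1)\<^sup>2 + A * (frame_coord p u $ 2)\<^sup>2
      + A * \<rho> * (frame_coord p u $ 3)\<^sup>2"
    by (simp add: metric_def sum_3 power2_eq_square)
  then show ?thesis using A_pos \<rho>_pos by simp
qed

lemma speed_nonneg: "speed \<kappa> \<tau> \<beta> u \<ge> 0"
  by (simp add: speed_def metric_nonneg)

lemma generating_curve_derivs:
  assumes "generating_curve I x y \<alpha>" "s \<in> I"
  shows "(x has_real_derivative cos (\<alpha> s)) (at s within I)"
    "(y has_real_derivative sin (\<alpha> s) / cosh (x s)) (at s within I)"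
    "\<exists>d. (\<alpha> has_real_derivative d) (at s within I)"
  using assms unfolding generating_curve_def by blast+

lemma generating_curve_continuous:
  assumes "generating_curve I x y \<alpha>"
  shows "continuous_on I x" "continuous_on I y" "continuous_on I \<alpha>"
proof -
  show "continuous_on I x" "continuous_on I y"
    by (rule DERIV_continuous_on, erule generating_curve_derivs[OF assms])+
  show "continuous_on I \<alpha>"
    unfolding continuous_on_eq_continuous_within
    using generating_curve_derivs(3)[OF assms] DERIV_continuous by blast
qed

lemma generating_curve_lipschitz:
  assumes g: "generating_curve I x y \<alpha>" and "s \<in> I" "r \<in> I"
  shows "\<bar>x s - x r\<bar> \<le> \<bar>s - r\<bar>"
proof -
  have "convex I" using g by (simp add: generating_curve_def is_interval_convex_1)
  then have "norm (x s - x r) \<le> 1 * norm (s - r)"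
    by (rule field_differentiable_bound)
       (use generating_curve_derivs(1)[OF g] assms in auto)
  then show ?thesis by simp
qed

text \<open>The metric pulled back by the immersion and divided by \<open>A\<close>, evaluated at
  the parameter velocity (s', t').\<close>

definition first_form :: "real \<Rightarrow> real \<Rightarrow> real \<Rightarrow> real \<Rightarrow> real" where
  "first_form X a s' t' =
     (cos a * s')\<^sup>2 + ((t' - sin a / cosh X * s') * cosh X * sinh X)\<^sup>2
     + \<rho> * (sin a / cosh X * s' * (cosh X)\<^sup>2 - t' * (sinh X)\<^sup>2)\<^sup>2"

text \<open>The path may touch an end of I, where x and y have only one-sided derivatives. Since
  \<open>c\<close> maps the neighbourhood \<open>T\<close> of u into the parameter domain,
  differentiation within the image of \<open>T\<close> is enough.\<close>

lemma has_vector_derivative_rot_immersion_path: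
  assumes g: "generating_curve I x y \<alpha>"
    and T: "open T" "u \<in> T" "c ` T \<subseteq> I \<times> UNIV"
    and c: "(c has_vector_derivative (s', t')) (at u)"
  shows "(((\<lambda>(s, t). rot_immersion x y s t) \<circ> c) has_vector_derivative
    (let s = fst (c u) in
     ((complex_of_real (cos (\<alpha> s) * s' * sinh (x s)) + \<i> * complex_of_real (sin (\<alpha> s) / cosh (x s) * s' * cosh (x s))) * cis (y s),
     (complex_of_real (cos (\<alpha> s) * s' * cosh (x s)) + \<i> * complex_of_real (t' * sinh (x s))) * cis (snd (c u))))) (at u)"
    "speed \<kappa> \<tau> ((\<lambda>(s, t). rot_immersion x y s t) \<circ> c) u =
       sqrt (A * first_form (x (fst (c u))) (\<alpha> (fst (c u))) s' t')"
proof -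
  let ?s = "fst (c u)"
  have sI: "?s \<in> I" using T by (auto simp: image_subset_iff mem_Times_iff)
  have im: "(fst \<circ> c) ` T \<subseteq> I" using T(3) by auto
  have dT: "at u within T = at u" by (rule at_within_open[OF T(2,1)])
  have d1: "((fst \<circ> c) has_real_derivative s') (at u)" "((snd \<circ> c) has_real_derivative t') (at u)"
    using bounded_linear.has_vector_derivative[OF bounded_linear_fst c]
      bounded_linear.has_vector_derivative[OF bounded_linear_snd c]
    by (simp_all add: has_real_derivative_iff_has_vector_derivative o_def)
  have ch: "((f \<circ> (fst \<circ> c)) has_real_derivative f' * s') (at u)"
    if "(f has_real_derivative f') (at ?s within I)" for f f'
  proof -
    have "(f has_real_derivative f') (at ((fst \<circ> c) u) within (fst \<circ> c) ` T)"
      by (rule DERIV_subset[OF _ im]) (use that in simp)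
    from DERIV_image_chain[OF this, of s', unfolded dT, OF d1(1)] show ?thesis .
  qed
  have X: "(x \<circ> (fst \<circ> c) has_real_derivative cos (\<alpha> ?s) * s') (at u)"
    and Y: "(y \<circ> (fst \<circ> c) has_real_derivative sin (\<alpha> ?s) / cosh (x ?s) * s') (at u)"
    by (rule ch[OF generating_curve_derivs(1)[OF g sI]], rule ch[OF generating_curve_derivs(2)[OF g sI]])
  have eq: "(\<lambda>(s, t). rot_immersion x y s t) \<circ> c = (\<lambda>r. rot_immersion (x \<circ> (fst \<circ> c)) (y \<circ> (fst \<circ> c)) r ((snd \<circ> c) r))"
    by (auto simp: fun_eq_iff rot_immersion_def split: prod.splits)
  have D: "(((\<lambda>(s, t). rot_immersion x y s t) \<circ> c) has_vector_derivative
     ((complex_of_real (cos (\<alpha> ?s) * s' * sinh (x ?s)) + \<i> * complex_of_real (sin (\<alpha> ?s) / cosh (x ?s) * s' * cosh (x ?s))) * cis (y ?s),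
     (complex_of_real (cos (\<alpha> ?s) * s' * cosh (x ?s)) + \<i> * complex_of_real (t' * sinh (x ?s))) * cis (snd (c u)))) (at u)"
    using has_vector_derivative_rot_immersion[OF X Y d1(2)] unfolding eq o_apply .
  then show "(((\<lambda>(s, t). rot_immersion x y s t) \<circ> c) has_vector_derivative
    (let s = ?s in
     ((complex_of_real (cos (\<alpha> s) * s' * sinh (x s)) + \<i> * complex_of_real (sin (\<alpha> s) / cosh (x s) * s' * cosh (x s))) * cis (y s),
     (complex_of_real (cos (\<alpha> s) * s' * cosh (x s)) + \<i> * complex_of_real (t' * sinh (x s))) * cis (snd (c u))))) (at u)"
    by (simp add: Let_def)
  have v: "vector_derivative ((\<lambda>(s, t). rot_immersion x y s t) \<circ> c) (at u) =
     ((complex_of_real (cos (\<alpha> ?s) * s' * sinh (x ?s)) + \<i> * complex_of_real (sin (\<alpha> ?s) / cosh (x ?s) * s' * cosh (x ?s))) * cis (y ?s),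
     (complex_of_real (cos (\<alpha> ?s) * s' * cosh (x ?s)) + \<i> * complex_of_real (t' * sinh (x ?s))) * cis (snd (c u)))"
    by (rule vector_derivative_at[OF D])
  have p: "((\<lambda>(s, t). rot_immersion x y s t) \<circ> c) u = rot_immersion x y ?s (snd (c u))"
    by (simp add: case_prod_unfold)
  note ft = frame_coord_rot_tangent[of x y ?s "snd (c u)" "cos (\<alpha> ?s) * s'" "sin (\<alpha> ?s) / cosh (x ?s) * s'" t']
  have rot: "(p * cos b - q * sin b) * (p * cos b - q * sin b) + (p * sin b + q * cos b) * (p * sin b + q * cos b) + \<rho> * m * m
      = p\<^sup>2 + q\<^sup>2 + \<rho> * m\<^sup>2" for p q m b
    using sin_cos_squared_add[of b] by algebra
  have m: "metric \<kappa> \<tau> (rot_immersion x y ?s (snd (c u)))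
     ((complex_of_real (cos (\<alpha> ?s) * s' * sinh (x ?s)) + \<i> * complex_of_real (sin (\<alpha> ?s) / cosh (x ?s) * s' * cosh (x ?s))) * cis (y ?s),
     (complex_of_real (cos (\<alpha> ?s) * s' * cosh (x ?s)) + \<i> * complex_of_real (t' * sinh (x ?s))) * cis (snd (c u)))
     ((complex_of_real (cos (\<alpha> ?s) * s' * sinh (x ?s)) + \<i> * complex_of_real (sin (\<alpha> ?s) / cosh (x ?s) * s' * cosh (x ?s))) * cis (y ?s),
     (complex_of_real (cos (\<alpha> ?s) * s' * cosh (x ?s)) + \<i> * complex_of_real (t' * sinh (x ?s))) * cis (snd (c u)))
     = A * first_form (x ?s) (\<alpha> ?s) s' t'"
    by (rule trans[OF metric_coord[OF ft ft]], subst rot, subst first_form_def, rule refl)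
  show "speed \<kappa> \<tau> ((\<lambda>(s, t). rot_immersion x y s t) \<circ> c) u =
       sqrt (A * first_form (x ?s) (\<alpha> ?s) s' t')"
    by (simp only: speed_def v p m)
qed

text \<open>Up to a square, \<open>first_form\<close> is the metric of the orbit space; this bounds the change of
  the parameter \<open>s\<close> by the length.\<close>

lemma first_form_ge:
  "(normal_denom \<kappa> \<tau> X a)\<^sup>2 * s'\<^sup>2 \<le> first_form X a s' t' * K2 X"
proof -
  define c sh u w Y where "c = cosh X" and "sh = sinh X" and "u = sin a" and "w = cos a"
    and "Y = sin a / cosh X * s'"
  have Y: "Y * c = u * s'" by (simp add: Y_def c_def u_def)
  have e: "c\<^sup>2 = 1 + sh\<^sup>2" by (simp add: c_def sh_def cosh_square_eq)
  \<comment> \<open>Completing the square in \<open>t'\<close>, whose square has the coefficient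
    \<open>(sinh X)\<^sup>2 * K2 X\<close> in \<open>first_form\<close>.\<close>
  have "first_form X a s' t' * K2 X - (normal_denom \<kappa> \<tau> X a)\<^sup>2 * s'\<^sup>2
     = (t' * sh * (c\<^sup>2 + \<rho> * sh\<^sup>2) - Y * c\<^sup>2 * sh * (1 + \<rho>))\<^sup>2"
    unfolding first_form_def K2_def normal_denom_sq Y_def[symmetric]
    unfolding c_def[symmetric] sh_def[symmetric] u_def[symmetric] w_def[symmetric]
    using Y e by algebra
  then show ?thesis
    by (metis diff_ge_0_iff_ge zero_le_power2)
qed

lemma first_form_nonneg: "first_form X a s' t' \<ge> 0"
  using \<rho>_pos unfolding first_form_def by (intro add_nonneg_nonneg mult_nonneg_nonneg) auto

text \<open>Wherever x is bounded, \<open>K2\<close> is bounded above, while the squared denominator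
  of the normal never falls below \<open>min 1 \<rho>\<close>; so \<open>first_form_ge\<close>
  controls s' by the speed.\<close>

lemma first_form_s_bound:
  assumes "cosh X \<le> M"
  shows "\<bar>s'\<bar> \<le> sqrt ((1 + \<rho>) * M\<^sup>2 / (A * min 1 \<rho>)) * sqrt (A * first_form X a s' t')"
proof -
  have K: "K2 X \<le> (1 + \<rho>) * M\<^sup>2"
  proof -
    have "(sinh X)\<^sup>2 \<le> (cosh X)\<^sup>2" by (simp add: cosh_square_eq)
    moreover have "(cosh X)\<^sup>2 \<le> M\<^sup>2" using assms by (intro power_mono) auto
    ultimately have "K2 X \<le> M\<^sup>2 + \<rho> * M\<^sup>2"
      unfolding K2_def using \<rho>_pos by (intro add_mono mult_left_mono) auto
    then show ?thesis by (simp add: algebra_simps)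
  qed
  have m: "min 1 \<rho> > 0" using \<rho>_pos by simp
  have "1 \<le> K2 X" unfolding K2_def using \<rho>_pos by (simp add: cosh_square_eq)
  then have "(cos a)\<^sup>2 * min 1 \<rho> + (sin a)\<^sup>2 * min 1 \<rho> \<le> (cos a)\<^sup>2 * K2 X + (sin a)\<^sup>2 * \<rho>"
    by (intro add_mono mult_left_mono) auto
  moreover have "(cos a)\<^sup>2 * min 1 \<rho> + (sin a)\<^sup>2 * min 1 \<rho> = min 1 \<rho>"
    by (metis distrib_right mult_1 sin_cos_squared_add2)
  ultimately have "min 1 \<rho> \<le> (normal_denom \<kappa> \<tau> X a)\<^sup>2"
    unfolding normal_denom_sq by (simp add: mult.commute)
  then have "min 1 \<rho> * s'\<^sup>2 \<le> (normal_denom \<kappa> \<tau> X a)\<^sup>2 * s'\<^sup>2"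
    by (rule mult_right_mono) simp
  also have "\<dots> \<le> first_form X a s' t' * K2 X" by (rule first_form_ge)
  also have "\<dots> \<le> first_form X a s' t' * ((1 + \<rho>) * M\<^sup>2)"
    using K first_form_nonneg by (rule mult_left_mono)
  finally have "s'\<^sup>2 \<le> (1 + \<rho>) * M\<^sup>2 / (A * min 1 \<rho>) * (A * first_form X a s' t')"
    using m A_pos by (simp add: divide_simps mult_ac)
  then have "sqrt (s'\<^sup>2) \<le> sqrt ((1 + \<rho>) * M\<^sup>2 / (A * min 1 \<rho>) * (A * first_form X a s' t'))"
    by (rule real_sqrt_le_mono)
  then show ?thesis by (simp only: real_sqrt_mult real_sqrt_abs)
qed

text \<open>Near the axis the speed does not control the angle t, but it controls the velocity of
  the second coordinate \<open>sinh x * cis t\<close>.\<close>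

lemma first_form_t_bound:
  assumes "cosh X \<le> M"
  shows "norm ((complex_of_real (cos a * s' * cosh X) + \<i> * complex_of_real (t' * sinh X)) * cis t)
    \<le> M * (2 / sqrt A + 1 / sqrt (A * \<rho>)) * sqrt (A * first_form X a s' t')"
proof -
  define R where "R = sqrt (first_form X a s' t')"
  have R: "sqrt (A * first_form X a s' t') = sqrt A * R" "R \<ge> 0"
    by (simp_all add: R_def real_sqrt_mult first_form_nonneg)
  have M: "M \<ge> 1" using assms cosh_real_ge_1[of X] by linarith
  have sM: "\<bar>sinh X\<bar> \<le> M"
  proof -
    show ?thesis using abs_sinh_le_cosh[of X] assms by simp
  qed
  define f2 f3 where "f2 = (t' - sin a / cosh X * s') * cosh X * sinh X"
    and "f3 = sin a / cosh X * s' * (cosh X)\<^sup>2 - t' * (sinh X)\<^sup>2"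
  have F: "first_form X a s' t' = (cos a * s')\<^sup>2 + f2\<^sup>2 + \<rho> * f3\<^sup>2"
    by (simp add: first_form_def f2_def f3_def)
  have b1: "\<bar>cos a * s'\<bar> \<le> R" unfolding R_def F
    using \<rho>_pos by (intro real_le_rsqrt) (simp add: add_increasing2)
  have b2: "\<bar>f2\<bar> \<le> R" unfolding R_def F
    using \<rho>_pos by (intro real_le_rsqrt) (simp add: add_increasing2)
  have b3: "sqrt \<rho> * \<bar>f3\<bar> \<le> R" unfolding R_def F
    using \<rho>_pos by (intro real_le_rsqrt) (simp add: power_mult_distrib)
  \<comment> \<open>By cosh^2 - sinh^2 = 1 this combination of the two components isolates
    \<open>t' * sinh X\<close> without a division by sinh X.\<close>
  have "f2 * cosh X + f3 * sinh X = t' * sinh X * ((cosh X)\<^sup>2 - (sinh X)\<^sup>2)"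
    unfolding f2_def f3_def by (simp add: algebra_simps power2_eq_square)
  then have T: "t' * sinh X = f2 * cosh X + f3 * sinh X"
    by (simp add: cosh_square_eq)
  have "norm ((complex_of_real (cos a * s' * cosh X) + \<i> * complex_of_real (t' * sinh X)) * cis t)
     \<le> \<bar>cos a * s' * cosh X\<bar> + \<bar>t' * sinh X\<bar>"
  proof -
    have "norm (complex_of_real (cos a * s' * cosh X) + \<i> * complex_of_real (t' * sinh X))
      \<le> norm (complex_of_real (cos a * s' * cosh X)) + norm (\<i> * complex_of_real (t' * sinh X))"
      by (rule norm_triangle_ineq)
    then show ?thesis by (simp only: norm_mult norm_cis norm_ii norm_of_real mult_1_left mult_1_right)
  qed
  also have "\<dots> \<le> \<bar>cos a * s'\<bar> * M + (\<bar>f2\<bar> * M + \<bar>f3\<bar> * M)"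
    unfolding T using assms sM
    by (intro add_mono order_trans[OF abs_triangle_ineq]) (auto simp: abs_mult intro!: mult_left_mono)
  also have "\<dots> \<le> R * M + (R * M + (R / sqrt \<rho>) * M)"
    using b1 b2 b3 M \<rho>_pos by (intro add_mono mult_right_mono) (auto simp: field_simps)
  also have "\<dots> = M * (2 / sqrt A + 1 / sqrt (A * \<rho>)) * (sqrt A * R)"
    using A_pos \<rho>_pos by (simp add: real_sqrt_mult field_simps)
  finally show ?thesis by (simp add: R)
qed

text \<open>The converse estimate; along a segment it bounds the distance from above.\<close>

lemma first_form_le:
  assumes "cosh X \<le> M"
  shows "sqrt (A * first_form X a s' t') \<le> sqrt (A * (2 + \<rho>)) * M\<^sup>2 * (\<bar>s'\<bar> + \<bar>t'\<bar>)"
proof -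
  have M: "M \<ge> 1" using assms cosh_real_ge_1[of X] by linarith
  have sM: "\<bar>sinh X\<bar> \<le> M"
  proof -
    show ?thesis using abs_sinh_le_cosh[of X] assms by simp
  qed
  define N where "N = M\<^sup>2 * (\<bar>s'\<bar> + \<bar>t'\<bar>)"
  have M2: "1 \<le> M\<^sup>2" using M by (simp add: one_le_power)
  have N0: "\<bar>s'\<bar> + \<bar>t'\<bar> \<le> N"
    unfolding N_def using mult_right_mono[OF M2, of "\<bar>s'\<bar> + \<bar>t'\<bar>"] by simp
  have Y: "\<bar>sin a / cosh X * s'\<bar> \<le> \<bar>s'\<bar>"
  proof -
    have "\<bar>sin a\<bar> \<le> cosh X"
      by (rule order_trans[OF abs_sin_le_one cosh_real_ge_1])
    then have "\<bar>sin a / cosh X\<bar> \<le> 1"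
      by (simp add: divide_le_eq_1)

    from mult_right_mono[OF this, of "\<bar>s'\<bar>"] show ?thesis by (simp only: abs_mult) simp
  qed
  have b1: "\<bar>cos a * s'\<bar> \<le> N"
  proof -
    have "\<bar>cos a\<bar> * \<bar>s'\<bar> \<le> 1 * \<bar>s'\<bar>" by (intro mult_right_mono) auto
    then show ?thesis using N0 by (simp add: abs_mult)
  qed
  have b2: "\<bar>(t' - sin a / cosh X * s') * cosh X * sinh X\<bar> \<le> N"
  proof -
    have "\<bar>t' - sin a / cosh X * s'\<bar> * \<bar>cosh X\<bar> * \<bar>sinh X\<bar> \<le> (\<bar>s'\<bar> + \<bar>t'\<bar>) * M * M"
      using abs_triangle_ineq4[of t' "sin a / cosh X * s'"] Y assms sM M
      by (intro mult_mono) auto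
    moreover have "(\<bar>s'\<bar> + \<bar>t'\<bar>) * M * M = N"
      by (simp add: N_def power2_eq_square)
    ultimately show ?thesis by (simp only: abs_mult)
  qed
  have b3: "\<bar>sin a / cosh X * s' * (cosh X)\<^sup>2 - t' * (sinh X)\<^sup>2\<bar> \<le> N"
  proof -
    have "(cosh X)\<^sup>2 \<le> M\<^sup>2" using power_mono[OF assms, of 2] by simp
    moreover have "(sinh X)\<^sup>2 \<le> M\<^sup>2" using power_mono[OF sM, of 2] by simp
    ultimately have "\<bar>sin a / cosh X * s'\<bar> * (cosh X)\<^sup>2 + \<bar>t'\<bar> * (sinh X)\<^sup>2 \<le> \<bar>s'\<bar> * M\<^sup>2 + \<bar>t'\<bar> * M\<^sup>2"
      by (intro add_mono mult_mono Y order_refl abs_ge_zero zero_le_power2)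
    moreover have "\<bar>sin a / cosh X * s' * (cosh X)\<^sup>2 - t' * (sinh X)\<^sup>2\<bar>
      \<le> \<bar>sin a / cosh X * s'\<bar> * (cosh X)\<^sup>2 + \<bar>t'\<bar> * (sinh X)\<^sup>2"
      using abs_triangle_ineq4[of "sin a / cosh X * s' * (cosh X)\<^sup>2" "t' * (sinh X)\<^sup>2"]
      by (simp only: abs_mult abs_power2)
    moreover have "\<bar>s'\<bar> * M\<^sup>2 + \<bar>t'\<bar> * M\<^sup>2 = N"
      by (simp add: N_def distrib_left mult.commute[of _ "M\<^sup>2"])
    ultimately show ?thesis by linarith
  qed
  have sq: "z\<^sup>2 \<le> N\<^sup>2" if "\<bar>z\<bar> \<le> N" for z
    using power_mono[OF that, of 2] by simp
  have "first_form X a s' t' \<le> N\<^sup>2 + N\<^sup>2 + \<rho> * N\<^sup>2"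
    unfolding first_form_def using \<rho>_pos by (intro add_mono mult_left_mono sq b1 b2 b3) simp
  also have "\<dots> = (2 + \<rho>) * N\<^sup>2"
    by (simp add: distrib_right)
  finally have "A * first_form X a s' t' \<le> A * (2 + \<rho>) * N\<^sup>2"
    using mult_left_mono[of "first_form X a s' t'" "(2 + \<rho>) * N\<^sup>2" A] A_pos by (simp add: mult.assoc)
  then have 1: "sqrt (A * first_form X a s' t') \<le> sqrt (A * (2 + \<rho>) * N\<^sup>2)"
    by (rule real_sqrt_le_mono)
  have 2: "sqrt (N\<^sup>2) = N"
    by (rule real_sqrt_unique[OF refl]) (rule order_trans[OF add_nonneg_nonneg[OF abs_ge_zero abs_ge_zero] N0])
  have "sqrt (A * first_form X a s' t') \<le> sqrt (A * (2 + \<rho>)) * N"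
    by (rule ord_le_eq_trans[OF 1 trans[OF real_sqrt_mult arg_cong[OF 2, of "(*) (sqrt (A * (2 + \<rho>)))"]]])
  then show ?thesis by (simp only: N_def mult.assoc)
qed

end

context sl2_params
begin

abbreviation image_path :: "(real \<Rightarrow> real) \<Rightarrow> (real \<Rightarrow> real) \<Rightarrow> (real \<Rightarrow> real \<times> real) \<Rightarrow> real \<Rightarrow> point" where
  "image_path x y c \<equiv> (\<lambda>(s, t). rot_immersion x y s t) \<circ> c"

text \<open>A map whose derivative along curves is bounded by the speed expands lengths at most by the
  same factor.\<close>

lemma dist_le_length:
  fixes h :: "real \<times> real \<Rightarrow> 'b::euclidean_space"
  assumes c: "valid_path c" "path_image c \<subseteq> I \<times> UNIV"
    and int: "speed \<kappa> \<tau> (image_path x y c) integrable_on {0..1}"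
    and h: "continuous_on (I \<times> UNIV) h"
    and B: "\<And>u s' t' T. \<lbrakk>open T; u \<in> T; c ` T \<subseteq> I \<times> UNIV; (c has_vector_derivative (s', t')) (at u)\<rbrakk>
      \<Longrightarrow> \<exists>d. (h \<circ> c has_vector_derivative d) (at u) \<and> norm d \<le> B * speed \<kappa> \<tau> (image_path x y c) u"
    and B0: "B \<ge> 0"
  shows "norm (h (pathfinish c) - h (pathstart c)) \<le> B * integral {0..1} (speed \<kappa> \<tau> (image_path x y c))"
proof -
  obtain S where S: "finite S" "continuous_on {0..1} c" "c C1_differentiable_on ({0..1} - S)"
    using c(1) unfolding valid_path_def piecewise_C1_differentiable_on_def by blast
  have im: "c ` {0..1} \<subseteq> I \<times> UNIV" using c(2) by (simp add: path_image_def)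
  have ex: "\<exists>d. (h \<circ> c has_vector_derivative d) (at u) \<and> norm d \<le> B * speed \<kappa> \<tau> (image_path x y c) u"
    if u: "u \<in> {0<..<1} - S" for u
  proof -
    obtain D where "\<forall>r\<in>{0..1} - S. (c has_vector_derivative D r) (at r)"
      using S(3) unfolding C1_differentiable_on_def by blast
    then have "(c has_vector_derivative D u) (at u)" using u by auto
    then have "(c has_vector_derivative (fst (D u), snd (D u))) (at u)" by simp
    moreover have "c ` {0<..<1} \<subseteq> I \<times> UNIV"
      using im by (auto simp: image_subset_iff)
    ultimately show ?thesis
      using B[of "{0<..<1}" u "fst (D u)" "snd (D u)"] u by auto
  qed
  \<comment> \<open>The default 0 at the exceptional points lets the norm bound hold on all of
    [0, 1].\<close>
  define d where "d u = (if u \<in> {0<..<1} - S then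
      (SOME d. (h \<circ> c has_vector_derivative d) (at u) \<and> norm d \<le> B * speed \<kappa> \<tau> (image_path x y c) u) else 0)" for u
  have d: "(h \<circ> c has_vector_derivative d u) (at u) \<and> norm (d u) \<le> B * speed \<kappa> \<tau> (image_path x y c) u"
    if "u \<in> {0<..<1} - S" for u
    using someI_ex[OF ex[OF that]] that by (simp add: d_def)
  have "(d has_integral (h \<circ> c) 1 - (h \<circ> c) 0) {0..1}"
  proof (rule fundamental_theorem_of_calculus_interior_strong[OF S(1)])
    show "continuous_on {0..1} (h \<circ> c)"
      using S(2) im by (intro continuous_on_compose continuous_on_subset[OF h])
    show "(h \<circ> c has_vector_derivative d u) (at u)" if "u \<in> {0<..<1} - S" for u
      using d[OF that] by blast
  qed simp
  note di = has_integral_integrable[OF this] and dv = integral_unique[OF this, unfolded o_apply]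
  have "norm (integral {0..1} d) \<le> integral {0..1} (\<lambda>u. B * speed \<kappa> \<tau> (image_path x y c) u)"
  proof (rule integral_norm_bound_integral[OF di])
    show "(\<lambda>u. B * speed \<kappa> \<tau> (image_path x y c) u) integrable_on {0..1}"
      using integrable_on_cmult_left[OF int, of B] by simp
    show "norm (d u) \<le> B * speed \<kappa> \<tau> (image_path x y c) u" if "u \<in> {0..1}" for u
    proof (cases "u \<in> {0<..<1} - S")
      case True
      then show ?thesis using d by blast
    next
      case False
      then have "d u = 0" by (simp only: d_def if_False)
      then show ?thesis using B0 speed_nonneg[of "image_path x y c" u] by simp
    qed
  qed
  then show ?thesis
    by (simp add: dv pathfinish_def pathstart_def integral_mult_right)
qed

text \<open>Segments in the parameter domain, which is convex, are the test paths for upper bounds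
  of the distance.\<close>

lemma straight_path:
  assumes g: "generating_curve I x y \<alpha>" and p: "p \<in> I \<times> UNIV" and q: "q \<in> I \<times> UNIV"
    and M: "\<And>s. s \<in> closed_segment (fst p) (fst q) \<Longrightarrow> cosh (x s) \<le> M"
  shows "path_image (linepath p q) \<subseteq> I \<times> UNIV"
    "speed \<kappa> \<tau> (image_path x y (linepath p q)) integrable_on {0..1}"
    "integral {0..1} (speed \<kappa> \<tau> (image_path x y (linepath p q)))
       \<le> sqrt (A * (2 + \<rho>)) * M\<^sup>2 * (\<bar>fst q - fst p\<bar> + \<bar>snd q - snd p\<bar>)"
proof -
  let ?c = "linepath p q"
  have cI: "convex I" using g by (simp add: generating_curve_def is_interval_convex_1)
  then have "convex (I \<times> (UNIV :: real set))" by (simp add: convex_Times)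
  then have sub: "closed_segment p q \<subseteq> I \<times> UNIV" using p q by (simp add: closed_segment_subset)
  then show im: "path_image ?c \<subseteq> I \<times> UNIV" by simp
  define S where "S u = fst p + u * (fst q - fst p)" for u
  have fc: "fst (?c u) = S u" for u by (simp add: linepath_def S_def algebra_simps)
  have Sseg: "S u \<in> closed_segment (fst p) (fst q)" if "u \<in> {0..1}" for u
    using that by (auto simp: closed_segment_def S_def algebra_simps intro!: exI[of _ u])
  have SI: "S ` {0..1} \<subseteq> I"
    using Sseg closed_segment_subset[OF _ _ cI, of "fst p" "fst q"] p q by (auto simp: mem_Times_iff)
  define f where "f u = sqrt (A * first_form (x (S u)) (\<alpha> (S u)) (fst q - fst p) (snd q - snd p))" for u
  have Sc: "continuous_on {0..1} S" unfolding S_def by (intro continuous_intros)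
  have fcont: "continuous_on {0..1} f"
    unfolding f_def first_form_def
    by (intro continuous_intros continuous_on_compose2[OF generating_curve_continuous(1)[OF g] Sc SI]
        continuous_on_compose2[OF generating_curve_continuous(3)[OF g] Sc SI]) auto
  \<comment> \<open>Beyond its ends the line may leave I, so nothing is known about the derivative
    at 0 and 1; two points do not affect the integral.\<close>
  have eq: "speed \<kappa> \<tau> (image_path x y ?c) u = f u" if u: "u \<in> {0..1} - {0, 1}" for u
  proof -
    have "(?c has_vector_derivative (fst q - fst p, snd q - snd p)) (at u)"
      using has_vector_derivative_linepath_within[of p q u UNIV] by (simp add: minus_prod_def)
    moreover have "open {0<..<1::real}" "u \<in> {0<..<1}" using u by auto
    moreover have "?c ` {0<..<1} \<subseteq> I \<times> UNIV"
      using im by (auto simp: path_image_def image_subset_iff)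
    ultimately have "speed \<kappa> \<tau> (image_path x y ?c) u =
       sqrt (A * first_form (x (fst (?c u))) (\<alpha> (fst (?c u))) (fst q - fst p) (snd q - snd p))"
      by (intro has_vector_derivative_rot_immersion_path(2)[OF g])
    then show ?thesis by (simp only: f_def fc)
  qed
  have fi: "f integrable_on {0..1}" using fcont by (rule integrable_continuous_real)
  show "speed \<kappa> \<tau> (image_path x y ?c) integrable_on {0..1}"
    by (rule integrable_spike[OF fi, of "{0, 1}"]) (use eq in auto)
  have "integral {0..1} (speed \<kappa> \<tau> (image_path x y ?c)) = integral {0..1} f"
    by (rule integral_spike[of "{0, 1}"]) (use eq in auto)
  also have "\<dots> \<le> integral {0..1} (\<lambda>u::real. sqrt (A * (2 + \<rho>)) * M\<^sup>2 * (\<bar>fst q - fst p\<bar> + \<bar>snd q - snd p\<bar>))"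
    by (rule Henstock_Kurzweil_Integration.integral_le[OF fi integrable_const_ivl])
      (simp only: f_def, intro first_form_le M Sseg)
  finally show "integral {0..1} (speed \<kappa> \<tau> (image_path x y ?c))
       \<le> sqrt (A * (2 + \<rho>)) * M\<^sup>2 * (\<bar>fst q - fst p\<bar> + \<bar>snd q - snd p\<bar>)"
    unfolding integral_const_real by simp
qed

lemma cosh_bounded_on_segment:
  assumes g: "generating_curve I x y \<alpha>" and "a \<in> I" "b \<in> I"
  obtains M where "\<And>s. s \<in> closed_segment a b \<Longrightarrow> cosh (x s) \<le> M"
proof -
  have "convex I" using g by (simp add: generating_curve_def is_interval_convex_1)
  then have "closed_segment a b \<subseteq> I" using assms by (simp add: closed_segment_subset)
  then have "continuous_on (closed_segment a b) (\<lambda>s. cosh (x s))"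
    by (intro continuous_intros continuous_on_subset[OF generating_curve_continuous(1)[OF g]])
  then have "compact ((\<lambda>s. cosh (x s)) ` closed_segment a b)"
    by (intro compact_continuous_image) auto
  then have "bdd_above ((\<lambda>s. cosh (x s)) ` closed_segment a b)"
    by (intro bounded_imp_bdd_above compact_imp_bounded)
  then show ?thesis using that unfolding bdd_above_def by auto
qed

lemma length_nonneg:
  "speed \<kappa> \<tau> \<beta> integrable_on {0..1} \<Longrightarrow> 0 \<le> integral {0..1} (speed \<kappa> \<tau> \<beta>)"
  by (rule integral_nonneg) (auto simp: speed_nonneg)

lemma intrinsic_dist_le:
  assumes g: "generating_curve I x y \<alpha>" and p: "p \<in> I \<times> UNIV" and q: "q' \<in> I \<times> UNIV"
    and M: "\<And>s. s \<in> closed_segment (fst p) (fst q') \<Longrightarrow> cosh (x s) \<le> M"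
    and s: "same_point x q' q"
  shows "intrinsic_dist \<kappa> \<tau> I x y p q
    \<le> sqrt (A * (2 + \<rho>)) * M\<^sup>2 * (\<bar>fst q' - fst p\<bar> + \<bar>snd q' - snd p\<bar>)"
proof -
  note L = straight_path[OF g p q M]
  have "intrinsic_dist \<kappa> \<tau> I x y p q \<le> integral {0..1} (speed \<kappa> \<tau> (image_path x y (linepath p q')))"
    unfolding intrinsic_dist_def
  proof (rule cInf_lower)
    show "bdd_below {integral {0..1} (speed \<kappa> \<tau> (image_path x y c)) | c.
       valid_path c \<and> path_image c \<subseteq> I \<times> UNIV \<and>
       pathstart c = p \<and> same_point x (pathfinish c) q \<and>
       speed \<kappa> \<tau> (image_path x y c) integrable_on {0..1}}"
      by (rule bdd_belowI[of _ 0]) (auto intro: length_nonneg)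
  qed (use L(1,2) s in \<open>force\<close>)
  then show ?thesis using L(3) by simp
qed

text \<open>An infimum of an empty set would be unspecified; the segment from p to q provides a
  length.\<close>

lemma intrinsic_dist_ge:
  assumes g: "generating_curve I x y \<alpha>" and p: "p \<in> I \<times> UNIV" and q: "q \<in> I \<times> UNIV"
    and b: "\<And>c. \<lbrakk>valid_path c; path_image c \<subseteq> I \<times> UNIV; pathstart c = p; same_point x (pathfinish c) q;
       speed \<kappa> \<tau> (image_path x y c) integrable_on {0..1}\<rbrakk>
       \<Longrightarrow> b \<le> integral {0..1} (speed \<kappa> \<tau> (image_path x y c))"
  shows "b \<le> intrinsic_dist \<kappa> \<tau> I x y p q"
  unfolding intrinsic_dist_def
proof (rule cInf_greatest)
  obtain M where M: "\<And>s. s \<in> closed_segment (fst p) (fst q) \<Longrightarrow> cosh (x s) \<le> M"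
    using cosh_bounded_on_segment[OF g, of "fst p" "fst q"] p q by (auto simp: mem_Times_iff)
  note L = straight_path[OF g p q M]
  have "same_point x q q" unfolding same_point_def by (auto intro!: exI[of _ "0::int"])
  then show "{integral {0..1} (speed \<kappa> \<tau> (image_path x y c)) | c.
       valid_path c \<and> path_image c \<subseteq> I \<times> UNIV \<and>
       pathstart c = p \<and> same_point x (pathfinish c) q \<and>
       speed \<kappa> \<tau> (image_path x y c) integrable_on {0..1}} \<noteq> {}"
    using L(1,2) by (auto intro!: exI[of _ "linepath p q"])
qed (use b in blast)

lemma intrinsic_dist_nonneg:
  assumes g: "generating_curve I x y \<alpha>" and p: "p \<in> I \<times> UNIV" and q: "q \<in> I \<times> UNIV"
  shows "0 \<le> intrinsic_dist \<kappa> \<tau> I x y p q"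
  by (rule intrinsic_dist_ge[OF g p q]) (rule length_nonneg)

text \<open>The derivative of \<open>\<phi>\<close> only needs to be controlled where \<open>x\<close> is bounded.\<close>

lemma intrinsic_dist_ge_function_of_s:
  assumes g: "generating_curve I x y \<alpha>" and p: "p \<in> I \<times> UNIV" and q: "q \<in> I \<times> UNIV"
    and \<phi>: "\<And>s. (\<phi> has_real_derivative \<phi>' s) (at s)"
    and b: "\<And>s. s \<in> I \<Longrightarrow> \<phi>' s = 0 \<or> cosh (x s) \<le> M \<and> \<bar>\<phi>' s\<bar> \<le> b"
    and b0: "b \<ge> 0"
  shows "\<bar>\<phi> (fst q) - \<phi> (fst p)\<bar>
    \<le> b * sqrt ((1 + \<rho>) * M\<^sup>2 / (A * min 1 \<rho>)) * intrinsic_dist \<kappa> \<tau> I x y p q"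
proof -
  define B where "B = b * sqrt ((1 + \<rho>) * M\<^sup>2 / (A * min 1 \<rho>))"
  have r0: "0 \<le> (1 + \<rho>) * M\<^sup>2 / (A * min 1 \<rho>)" using A_pos \<rho>_pos by simp
  have B0: "0 \<le> B" unfolding B_def using b0 r0 by simp
  have main: "\<bar>\<phi> (fst q) - \<phi> (fst p)\<bar> \<le> B * integral {0..1} (speed \<kappa> \<tau> (image_path x y c))"
    if c: "valid_path c" "path_image c \<subseteq> I \<times> UNIV" "pathstart c = p" "same_point x (pathfinish c) q"
       "speed \<kappa> \<tau> (image_path x y c) integrable_on {0..1}" for c
  proof -
    have "norm ((\<phi> \<circ> fst) (pathfinish c) - (\<phi> \<circ> fst) (pathstart c))
      \<le> B * integral {0..1} (speed \<kappa> \<tau> (image_path x y c))"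
    proof (rule dist_le_length[OF c(1,2,5) _ _ B0])
      have "continuous_on UNIV \<phi>" using \<phi> by (meson DERIV_continuous_on has_field_derivative_at_within)
      then show "continuous_on (I \<times> UNIV) (\<phi> \<circ> fst)"
        by (intro continuous_on_compose continuous_intros) (auto intro: continuous_on_subset)
      fix u s' t' T
      assume T: "open T" "u \<in> T" "c ` T \<subseteq> I \<times> UNIV" and dc: "(c has_vector_derivative (s', t')) (at u)"
      let ?s = "fst (c u)"
      have sI: "?s \<in> I" using T(2,3) by (auto simp: image_subset_iff mem_Times_iff)
      have "((\<lambda>r. fst (c r)) has_real_derivative s') (at u)"
        using bounded_linear.has_vector_derivative[OF bounded_linear_fst dc]
        by (simp add: has_real_derivative_iff_has_vector_derivative)
      then have "((\<lambda>r. \<phi> (fst (c r))) has_real_derivative (\<phi>' ?s * s')) (at u)"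
        by (rule DERIV_chain2[OF \<phi>])
      then have 1: "(\<phi> \<circ> fst \<circ> c has_vector_derivative (\<phi>' ?s * s')) (at u)"
        by (simp add: has_real_derivative_iff_has_vector_derivative o_def)
      have sp: "speed \<kappa> \<tau> (image_path x y c) u = sqrt (A * first_form (x ?s) (\<alpha> ?s) s' t')"
        by (rule has_vector_derivative_rot_immersion_path(2)[OF g T dc])
      have "norm (\<phi>' ?s * s') \<le> B * speed \<kappa> \<tau> (image_path x y c) u"
      proof (cases "\<phi>' ?s = 0")
        case True
        then show ?thesis using B0 speed_nonneg[of "image_path x y c" u] by simp
      next
        case False
        then have bb: "cosh (x ?s) \<le> M" "\<bar>\<phi>' ?s\<bar> \<le> b" using b[OF sI] by auto
        have "norm (\<phi>' ?s * s') = \<bar>\<phi>' ?s\<bar> * \<bar>s'\<bar>" by (simp add: abs_mult)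
        also have "\<dots> \<le> b * (sqrt ((1 + \<rho>) * M\<^sup>2 / (A * min 1 \<rho>)) * speed \<kappa> \<tau> (image_path x y c) u)"
          unfolding sp by (rule mult_mono[OF bb(2) first_form_s_bound[OF bb(1)] b0 abs_ge_zero])
        finally show ?thesis by (simp only: B_def mult.assoc)
      qed
      with 1 show "\<exists>d. (\<phi> \<circ> fst \<circ> c has_vector_derivative d) (at u) \<and> norm d \<le> B * speed \<kappa> \<tau> (image_path x y c) u"
        by blast
    qed
    moreover have "fst (pathfinish c) = fst q" using c(4) by (simp add: same_point_def)
    ultimately show ?thesis using c(3) by simp
  qed
  show ?thesis
  proof (cases "B = 0")
    \<comment> \<open>The factor cannot be divided out here; applied to the segment, the bound makes
      the two values of \<phi> equal.\<close>
    case True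
    obtain M' where M': "\<And>s. s \<in> closed_segment (fst p) (fst q) \<Longrightarrow> cosh (x s) \<le> M'"
      using cosh_bounded_on_segment[OF g, of "fst p" "fst q"] p q by (auto simp: mem_Times_iff)
    note L = straight_path[OF g p q M']
    have "same_point x q q" unfolding same_point_def by (auto intro!: exI[of _ "0::int"])
    then have "\<bar>\<phi> (fst q) - \<phi> (fst p)\<bar> \<le> B * integral {0..1} (speed \<kappa> \<tau> (image_path x y (linepath p q)))"
      using L(1,2) by (intro main) auto
    then show ?thesis unfolding B_def[symmetric] True by simp
  next
    case False
    then have Bp: "B > 0" using B0 by simp
    have "\<bar>\<phi> (fst q) - \<phi> (fst p)\<bar> / B \<le> intrinsic_dist \<kappa> \<tau> I x y p q"
      by (rule intrinsic_dist_ge[OF g p q]) (use main Bp in \<open>simp add: pos_divide_le_eq mult.commute\<close>)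
    then have "\<bar>\<phi> (fst q) - \<phi> (fst p)\<bar> \<le> intrinsic_dist \<kappa> \<tau> I x y p q * B"
      using Bp by (simp add: pos_divide_le_eq)
    then show ?thesis by (simp add: B_def mult.commute)
  qed
qed

text \<open>A sequence in I that approaches a missing end b is Cauchy in the surface, since x is
  Lipschitz and hence bounded near b. It cannot converge at a parameter r in I, because moving from
  r towards b costs a definite length.\<close>

lemma complete_surface_imp_closed:
  assumes g: "generating_curve I x y \<alpha>" and c: "complete_surface \<kappa> \<tau> I x y"
  shows "closed I"
proof (rule ccontr)
  assume "\<not> closed I"
  then obtain b where b: "b \<in> closure I" "b \<notin> I"
    using closure_subset_eq by blast
  obtain X where X: "\<And>n. X n \<in> I" "X \<longlonglongrightarrow> b"
    using b(1) unfolding closure_sequential by blast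
  have cI: "convex I" using g by (simp add: generating_curve_def is_interval_convex_1)
  obtain R where R: "\<And>n. \<bar>X n - b\<bar> \<le> R"
  proof -
    have "bounded (range (\<lambda>n. X n - b))"
      by (rule convergent_imp_bounded, rule tendsto_diff[OF X(2) tendsto_const])
    then show ?thesis using that unfolding bounded_iff by auto
  qed
  define r0 where "r0 = X 0"
  have r0: "r0 \<in> I" using X by (simp add: r0_def)
  have bnd: "cosh (x s) \<le> cosh (\<bar>x r0\<bar> + K + \<bar>r0 - b\<bar>)" if "s \<in> I" "\<bar>s - b\<bar> \<le> K" for s K
  proof -
    have "\<bar>x s - x r0\<bar> \<le> \<bar>s - r0\<bar>"
      by (rule generating_curve_lipschitz[OF g that(1) r0])
    then have "\<bar>x s\<bar> \<le> \<bar>x r0\<bar> + K + \<bar>r0 - b\<bar>" using that(2) by linarith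
    then have "cosh \<bar>x s\<bar> \<le> cosh (\<bar>x r0\<bar> + K + \<bar>r0 - b\<bar>)"
      by (subst cosh_real_nonneg_le_iff) auto
    then show ?thesis by simp
  qed
  define L where "L = sqrt (A * (2 + \<rho>)) * (cosh (\<bar>x r0\<bar> + R + \<bar>r0 - b\<bar>))\<^sup>2"
  have L0: "L \<ge> 0" using A_pos \<rho>_pos by (simp add: L_def)
  have le: "intrinsic_dist \<kappa> \<tau> I x y (X m, 0) (X n, 0) \<le> L * \<bar>X n - X m\<bar>" for m n
  proof -
    have "intrinsic_dist \<kappa> \<tau> I x y (X m, 0) (X n, 0)
      \<le> sqrt (A * (2 + \<rho>)) * (cosh (\<bar>x r0\<bar> + R + \<bar>r0 - b\<bar>))\<^sup>2
         * (\<bar>fst (X n, 0::real) - fst (X m, 0::real)\<bar> + \<bar>snd (X n, 0::real) - snd (X m, 0::real)\<bar>)"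
    proof (rule intrinsic_dist_le[OF g])
      show "(X m, 0) \<in> I \<times> UNIV" "(X n, 0) \<in> I \<times> UNIV" using X by auto
      show "same_point x (X n, 0) (X n, 0)" unfolding same_point_def by (auto intro!: exI[of _ "0::int"])
      fix s assume "s \<in> closed_segment (fst (X m, 0::real)) (fst (X n, 0::real))"
      then have s: "s \<in> closed_segment (X m) (X n)" by simp
      then have "s \<in> I" using closed_segment_subset[OF X(1) X(1) cI] by blast
      moreover have "\<bar>s - b\<bar> \<le> R"
        using s R[of m] R[of n] by (auto simp: closed_segment_eq_real_ivl split: if_splits)
      ultimately show "cosh (x s) \<le> cosh (\<bar>x r0\<bar> + R + \<bar>r0 - b\<bar>)" by (rule bnd)
    qed
    then show ?thesis by (simp add: L_def)
  qed
  have "\<exists>q\<in>I \<times> UNIV. (\<lambda>n. intrinsic_dist \<kappa> \<tau> I x y (X n, 0) q) \<longlonglongrightarrow> 0"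
  proof -
    have "\<exists>M. \<forall>m\<ge>M. \<forall>n\<ge>M. intrinsic_dist \<kappa> \<tau> I x y (X m, 0) (X n, 0) < e" if "e > 0" for e
    proof -
      have "Cauchy X" using X(2) by (rule LIMSEQ_imp_Cauchy)
      then obtain M where M: "\<And>m n. m \<ge> M \<Longrightarrow> n \<ge> M \<Longrightarrow> dist (X m) (X n) < e / (L + 1)"
        unfolding Cauchy_def using \<open>e > 0\<close> L0 by (metis divide_pos_pos add_nonneg_pos zero_less_one)
      have "intrinsic_dist \<kappa> \<tau> I x y (X m, 0) (X n, 0) < e" if "m \<ge> M" "n \<ge> M" for m n
      proof -
        have "L * \<bar>X n - X m\<bar> \<le> (L + 1) * \<bar>X n - X m\<bar>" by (rule mult_right_mono) auto
        also have "\<dots> < e" using M[OF that] L0 by (simp add: dist_real_def pos_less_divide_eq mult.commute abs_minus_commute)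
        finally show ?thesis using le[of m n] by linarith
      qed
      then show ?thesis by blast
    qed
    moreover have "(X n, 0) \<in> I \<times> (UNIV :: real set)" for n using X by auto
    ultimately show ?thesis
      using c unfolding complete_surface_def by (elim allE[of _ "\<lambda>n. (X n, 0)"] impE) auto
  qed
  then obtain q where q: "q \<in> I \<times> UNIV" "(\<lambda>n. intrinsic_dist \<kappa> \<tau> I x y (X n, 0) q) \<longlonglongrightarrow> 0" by blast
  define r where "r = fst q"
  have r: "r \<in> I" using q(1) by (auto simp: r_def)
  define \<epsilon> where "\<epsilon> = sgn (b - r)"
  have br: "b \<noteq> r" using r b(2) by auto
  have e1: "\<bar>\<epsilon>\<bar> = 1" "\<epsilon> * (b - r) = \<bar>b - r\<bar>" using br by (auto simp: \<epsilon>_def sgn_real_def)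
  \<comment> \<open>Only the displacement from r towards b is measured: on the other side of r,
    where x may be unbounded, \<phi> is constant. The square makes it differentiable at r.\<close>
  define \<phi> where "\<phi> s = (max 0 (\<epsilon> * (s - r)))\<^sup>2" for s
  define \<phi>' where "\<phi>' s = 2 * \<epsilon> * max 0 (\<epsilon> * (s - r))" for s
  have d: "(\<phi> has_real_derivative \<phi>' s) (at s)" for s
  proof -
    have sq: "((\<lambda>z::real. (max 0 z)\<^sup>2) has_real_derivative 2 * max 0 z) (at z)" for z
    proof (cases "z = 0")
      case False
      then consider "z > 0" | "z < 0" by linarith
      then show ?thesis
      proof cases
        case 1
        have "((\<lambda>z::real. z\<^sup>2) has_real_derivative 2 * max 0 z) (at z)"
          using 1 by (auto intro!: derivative_eq_intros)
        then show ?thesis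
          by (rule has_field_derivative_transform_within_open[where S = "{0<..}"]) (use 1 in auto)
      next
        case 2
        have "((\<lambda>z::real. 0) has_real_derivative 2 * max 0 z) (at z)"
          using 2 by (auto intro!: derivative_eq_intros)
        then show ?thesis
          by (rule has_field_derivative_transform_within_open[where S = "{..<0}"]) (use 2 in auto)
      qed
    next
      case True
      have "((\<lambda>h::real. ((max 0 (0 + h))\<^sup>2 - (max 0 0)\<^sup>2) / h) \<longlongrightarrow> 0) (at 0)"
      proof (rule Lim_null_comparison)
        show "\<forall>\<^sub>F h in at (0::real). norm (((max 0 (0 + h))\<^sup>2 - (max 0 0)\<^sup>2) / h) \<le> \<bar>h\<bar>"
          by (rule always_eventually) (auto simp: max_def power2_eq_square)
      qed (auto intro!: tendsto_eq_intros)
      then show ?thesis using True by (simp add: DERIV_def)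
    qed
    have "((\<lambda>s. \<epsilon> * (s - r)) has_real_derivative \<epsilon>) (at s)"
      by (auto intro!: derivative_eq_intros)
    from DERIV_chain2[OF sq this] show ?thesis by (simp add: \<phi>_def[abs_def] \<phi>'_def mult_ac)
  qed
  define M where "M = cosh (\<bar>x r0\<bar> + \<bar>r - b\<bar> + \<bar>r0 - b\<bar>)"
  define B where "B = 2 * \<bar>b - r\<bar> * sqrt ((1 + \<rho>) * M\<^sup>2 / (A * min 1 \<rho>))"
  have lower: "\<bar>\<phi> (fst q) - \<phi> (fst (X n, 0::real))\<bar> \<le> B * intrinsic_dist \<kappa> \<tau> I x y (X n, 0) q" for n
    unfolding B_def
  proof (rule intrinsic_dist_ge_function_of_s[OF g _ q(1) d])
    show "(X n, 0) \<in> I \<times> UNIV" using X by auto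
    fix s assume s: "s \<in> I"
    show "\<phi>' s = 0 \<or> cosh (x s) \<le> M \<and> \<bar>\<phi>' s\<bar> \<le> 2 * \<bar>b - r\<bar>"
    proof (cases "\<epsilon> * (s - r) \<le> 0")
      case True
      then show ?thesis by (simp add: \<phi>'_def)
    next
      case False
      \<comment> \<open>I is convex and misses b, so none of its points lies beyond b as seen from
        r.\<close>
      have "\<epsilon> * (s - r) \<le> \<epsilon> * (b - r)"
      proof (rule ccontr)
        assume "\<not> ?thesis"
        then have "b \<in> closed_segment r s" using False br
          by (auto simp: \<epsilon>_def sgn_real_def closed_segment_eq_real_ivl split: if_splits)
        then show False using closed_segment_subset[OF r s cI] b(2) by blast
      qed
      then have 1: "\<bar>s - r\<bar> \<le> \<bar>b - r\<bar>" and 2: "\<bar>s - b\<bar> \<le> \<bar>r - b\<bar>"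
        using False br by (auto simp: \<epsilon>_def sgn_real_def split: if_splits)
      have "cosh (x s) \<le> M" unfolding M_def by (rule bnd[OF s 2])
      moreover have "\<bar>\<phi>' s\<bar> \<le> 2 * \<bar>b - r\<bar>"
        using 1 False br by (auto simp: \<phi>'_def \<epsilon>_def sgn_real_def split: if_splits)
      ultimately show ?thesis by blast
    qed
  qed simp
  have "(\<lambda>n. B * intrinsic_dist \<kappa> \<tau> I x y (X n, 0) q) \<longlonglongrightarrow> B * 0"
    by (intro tendsto_mult_left q(2))
  moreover have "\<phi> (fst q) = 0" by (simp add: \<phi>_def r_def)
  ultimately have "(\<phi> \<circ> X) \<longlonglongrightarrow> 0"
    using lower by (intro Lim_null_comparison[of "\<phi> \<circ> X" "\<lambda>n. B * intrinsic_dist \<kappa> \<tau> I x y (X n, 0) q"]) auto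
  moreover have "(\<phi> \<circ> X) \<longlonglongrightarrow> \<phi> b"
    unfolding o_def by (rule isCont_tendsto_compose[OF DERIV_isCont[OF d] X(2)])
  ultimately have "\<phi> b = 0" using LIMSEQ_unique by blast
  then show False using e1 br by (simp add: \<phi>_def)
qed

end

context sl2_params
begin

text \<open>The angle is determined only modulo 2 pi, and not at all on the axis. The second complex
  coordinate is well defined on the quotient and determines the angle modulo 2 pi wherever x is
  nonzero.\<close>

lemma intrinsic_dist_ge_second_coordinate:
  assumes g: "generating_curve I x y \<alpha>" and p: "p \<in> I \<times> UNIV" and q: "q \<in> I \<times> UNIV"
    and M: "\<And>s. s \<in> I \<Longrightarrow> cosh (x s) \<le> M"
  shows "norm (snd (rot_immersion x y (fst q) (snd q)) - snd (rot_immersion x y (fst p) (snd p)))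
    \<le> M * (2 / sqrt A + 1 / sqrt (A * \<rho>)) * intrinsic_dist \<kappa> \<tau> I x y p q"
proof -
  define B where "B = M * (2 / sqrt A + 1 / sqrt (A * \<rho>))"
  have "fst p \<in> I" using p by (simp add: mem_Times_iff)
  from less_le_trans[OF cosh_real_pos M[OF this]] have "M > 0" .
  then have B0: "0 < B" unfolding B_def using A_pos \<rho>_pos by (intro mult_pos_pos add_pos_pos) auto
  define h where "h = (\<lambda>(s, t). snd (rot_immersion x y s t))"
  have main: "norm (h q - h p) \<le> B * integral {0..1} (speed \<kappa> \<tau> (image_path x y c))"
    if c: "valid_path c" "path_image c \<subseteq> I \<times> UNIV" "pathstart c = p" "same_point x (pathfinish c) q"
       "speed \<kappa> \<tau> (image_path x y c) integrable_on {0..1}" for c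
  proof -
    have "norm (h (pathfinish c) - h (pathstart c))
      \<le> B * integral {0..1} (speed \<kappa> \<tau> (image_path x y c))"
    proof (rule dist_le_length[OF c(1,2,5)])
      show "0 \<le> B" using B0 by simp
      show "continuous_on (I \<times> UNIV) h"
        unfolding h_def rot_immersion_def case_prod_unfold snd_conv
        by (intro continuous_intros continuous_on_compose2[OF generating_curve_continuous(1)[OF g]]) auto
      fix u s' t' T
      assume T: "open T" "u \<in> T" "c ` T \<subseteq> I \<times> UNIV" and dc: "(c has_vector_derivative (s', t')) (at u)"
      let ?s = "fst (c u)" and ?t = "snd (c u)"
      have sI: "?s \<in> I" using T(2,3) by (auto simp: image_subset_iff mem_Times_iff)
      note D = has_vector_derivative_rot_immersion_path[OF g T dc]
      have "snd \<circ> image_path x y c = h \<circ> c" by (auto simp: h_def fun_eq_iff case_prod_unfold)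
      then have 1: "(h \<circ> c has_vector_derivative
         (complex_of_real (cos (\<alpha> ?s) * s' * cosh (x ?s)) + \<i> * complex_of_real (t' * sinh (x ?s))) * cis ?t) (at u)"
        using bounded_linear.has_vector_derivative[OF bounded_linear_snd D(1)]
        by (simp only: Let_def snd_conv o_def)
      have "norm ((complex_of_real (cos (\<alpha> ?s) * s' * cosh (x ?s)) + \<i> * complex_of_real (t' * sinh (x ?s))) * cis ?t)
         \<le> B * speed \<kappa> \<tau> (image_path x y c) u"
        unfolding D(2) B_def by (rule first_form_t_bound[OF M[OF sI]])
      with 1 show "\<exists>d. (h \<circ> c has_vector_derivative d) (at u) \<and> norm d \<le> B * speed \<kappa> \<tau> (image_path x y c) u"
        by blast
    qed
    moreover have "h (pathfinish c) = h q"
    proof -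
      consider "x (fst q) = 0" | k :: int where "snd q = snd (pathfinish c) + 2 * pi * of_int k"
        using c(4) by (auto simp: same_point_def)
      then show ?thesis
      proof cases
        case 1
        then show ?thesis using c(4) by (simp add: h_def rot_immersion_def case_prod_unfold same_point_def)
      next
        case 2
        then show ?thesis using c(4)
          by (simp add: h_def rot_immersion_def case_prod_unfold same_point_def cis_mult[symmetric])
      qed
    qed
    ultimately show ?thesis using c(3) by simp
  qed
  have "norm (h q - h p) / B \<le> intrinsic_dist \<kappa> \<tau> I x y p q"
    by (rule intrinsic_dist_ge[OF g p q]) (use main B0 in \<open>simp add: pos_divide_le_eq mult.commute\<close>)
  then have "norm (h q - h p) \<le> intrinsic_dist \<kappa> \<tau> I x y p q * B"
    using B0 by (simp add: pos_divide_le_eq)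
  then show ?thesis by (simp add: B_def h_def mult.commute case_prod_unfold)
qed

lemma Cauchy_of_intrinsic_Cauchy:
  fixes f :: "nat \<Rightarrow> 'b::real_normed_vector"
  assumes "\<And>m n. norm (f n - f m) \<le> B * d m n" and "B \<ge> 0"
    and C: "\<forall>e>0. \<exists>M. \<forall>m\<ge>M. \<forall>n\<ge>M. d m n < (e::real)"
  shows "Cauchy f"
  unfolding Cauchy_def
proof (intro allI impI)
  fix e :: real assume "e > 0"
  then have "e / (B + 1) > 0" using assms(2) by simp
  then obtain M where M: "\<And>m n. m \<ge> M \<Longrightarrow> n \<ge> M \<Longrightarrow> d m n < e / (B + 1)" using C by blast
  have "dist (f m) (f n) < e" if "m \<ge> M" "n \<ge> M" for m n
  proof -
    have nn: "0 \<le> B * d n m" using order_trans[OF norm_ge_zero assms(1)] .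
    have lt: "(B + 1) * d n m < e" using M[OF that(2,1)] assms(2) by (simp add: pos_less_divide_eq mult.commute)
    have "B * d n m < e"
    proof (cases "d n m \<ge> 0")
      case True
      then show ?thesis using lt by (simp add: distrib_right)
    next
      case False
      then have "B * d n m \<le> 0" using assms(2) by (simp add: mult_nonneg_nonpos)
      then show ?thesis using \<open>e > 0\<close> by linarith
    qed
    then show ?thesis using assms(1)[of m n] unfolding dist_norm by linarith
  qed
  then show "\<exists>M. \<forall>m\<ge>M. \<forall>n\<ge>M. dist (f m) (f n) < e" by blast
qed

text \<open>Serves the explicit sphere at the end. The parameters s converge by the estimate for
  functions of s, and the angles need a limit only if the limit of s is off the axis.\<close>

lemma complete_surface_compact:
  assumes g: "generating_curve {a..b} x y \<alpha>"
  shows "complete_surface \<kappa> \<tau> {a..b} x y"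
  unfolding complete_surface_def
proof (intro allI impI)
  let ?I = "{a..b}" and ?d = "intrinsic_dist \<kappa> \<tau> {a..b} x y"
  fix p :: "nat \<Rightarrow> real \<times> real"
  assume "(\<forall>n. p n \<in> ?I \<times> UNIV) \<and> (\<forall>e>0. \<exists>M. \<forall>m\<ge>M. \<forall>n\<ge>M. ?d (p m) (p n) < e)"
  then have p: "\<And>n. p n \<in> ?I \<times> UNIV"
    and C: "\<forall>e>0. \<exists>M. \<forall>m\<ge>M. \<forall>n\<ge>M. ?d (p m) (p n) < e" by auto
  define s t where "s n = fst (p n)" and "t n = snd (p n)" for n
  have pn: "p n = (s n, t n)" for n by (simp add: s_def t_def)
  have sI: "s n \<in> ?I" for n using p[of n] by (auto simp: pn)
  have "compact ((\<lambda>s. cosh (x s)) ` ?I)"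
    by (intro compact_continuous_image continuous_intros generating_curve_continuous(1)[OF g]) auto
  then have "bdd_above ((\<lambda>s. cosh (x s)) ` ?I)"
    by (intro bounded_imp_bdd_above compact_imp_bounded)
  then obtain M where "\<forall>z\<in>(\<lambda>s. cosh (x s)) ` ?I. z \<le> M" unfolding bdd_above_def by blast
  then have M: "\<And>s. s \<in> ?I \<Longrightarrow> cosh (x s) \<le> M" by blast
  define L where "L = sqrt (A * (2 + \<rho>)) * M\<^sup>2"
  have "\<bar>s n - s m\<bar> \<le> 1 * sqrt ((1 + \<rho>) * M\<^sup>2 / (A * min 1 \<rho>)) * ?d (p m) (p n)" for m n
    using intrinsic_dist_ge_function_of_s[OF g p[of m] p[of n], of "\<lambda>s. s" "\<lambda>s. 1" M 1] M
    by (simp add: s_def)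
  then have "Cauchy s"
    using A_pos \<rho>_pos by (intro Cauchy_of_intrinsic_Cauchy[OF _ _ C]) auto
  then obtain s0 where s0: "s \<longlonglongrightarrow> s0" by (auto simp: Cauchy_convergent_iff convergent_def)
  have s0I: "s0 \<in> ?I" using closed_sequentially[OF closed_atLeastAtMost _ s0] sI by blast
  have seg: "cosh (x r) \<le> M" if "r \<in> closed_segment (s n) s0" for n r
    using that sI[of n] s0I by (intro M) (auto simp: closed_segment_eq_real_ivl split: if_splits)
  \<comment> \<open>\<open>e\<close> corrects the angles so that they agree with that of q modulo 2
    pi; it must tend to 0, as it contributes to the length of the segment.\<close>
  have fin: "(\<lambda>n. ?d (p n) q) \<longlonglongrightarrow> 0"
    if q: "q \<in> ?I \<times> UNIV" and e: "e \<longlonglongrightarrow> 0" and sp: "\<forall>\<^sub>F n in sequentially. same_point x (s0, t n + e n) q" for q e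
  proof (rule Lim_null_comparison)
    show "\<forall>\<^sub>F n in sequentially. norm (?d (p n) q) \<le> L * (\<bar>s0 - s n\<bar> + \<bar>e n\<bar>)"
      using sp
    proof eventually_elim
      case (elim n)
      have "?d (p n) q \<le> sqrt (A * (2 + \<rho>)) * M\<^sup>2 * (\<bar>fst (s0, t n + e n) - fst (p n)\<bar> + \<bar>snd (s0, t n + e n) - snd (p n)\<bar>)"
        by (rule intrinsic_dist_le[OF g p _ _ elim]) (use s0I seg in \<open>auto simp: pn\<close>)
      then show ?case using intrinsic_dist_nonneg[OF g p q] by (simp add: L_def pn)
    qed
    have "(\<lambda>n. L * (\<bar>s0 - s n\<bar> + \<bar>e n\<bar>)) \<longlonglongrightarrow> L * (\<bar>s0 - s0\<bar> + \<bar>0\<bar>)"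
      by (intro tendsto_intros s0 e)
    then show "(\<lambda>n. L * (\<bar>s0 - s n\<bar> + \<bar>e n\<bar>)) \<longlonglongrightarrow> 0" by simp
  qed
  show "\<exists>q\<in>?I \<times> UNIV. (\<lambda>n. ?d (p n) q) \<longlonglongrightarrow> 0"
  proof (cases "x s0 = 0")
    case True
    have "(\<lambda>n. ?d (p n) (s0, 0)) \<longlonglongrightarrow> 0"
      by (rule fin[of _ "\<lambda>n. 0"]) (use s0I True in \<open>auto simp: same_point_def\<close>)
    then show ?thesis using s0I by blast
  next
    case False
    define w where "w n = snd (rot_immersion x y (s n) (t n))" for n
    have w: "w n = complex_of_real (sinh (x (s n))) * cis (t n)" for n
      by (simp add: w_def rot_immersion_def)
    have "norm (w n - w m) \<le> M * (2 / sqrt A + 1 / sqrt (A * \<rho>)) * ?d (p m) (p n)" for m n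
      using intrinsic_dist_ge_second_coordinate[OF g p p M, of n m] by (simp add: w_def s_def t_def)
    moreover have "M \<ge> 0" using M[OF s0I] cosh_real_pos[of "x s0"] by linarith
    moreover from this have "0 \<le> M * (2 / sqrt A + 1 / sqrt (A * \<rho>))"
      using A_pos \<rho>_pos by (intro mult_nonneg_nonneg add_nonneg_nonneg) auto
    ultimately have "Cauchy w"
      by (intro Cauchy_of_intrinsic_Cauchy[where d = "\<lambda>m n. ?d (p m) (p n)", OF _ _ C])
    then obtain w0 where w0: "w \<longlonglongrightarrow> w0" by (auto simp: Cauchy_convergent_iff convergent_def)
    have xs: "(\<lambda>n. x (s n)) \<longlonglongrightarrow> x s0"
      by (rule continuous_on_tendsto_compose[OF generating_curve_continuous(1)[OF g] s0 s0I])
         (use sI in auto)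
    \<comment> \<open>Division by sinh x, which has a nonzero limit, turns convergence of the second
      coordinate into convergence of \<open>cis (t n)\<close>.\<close>
    have ne: "complex_of_real (sinh (x s0)) \<noteq> 0" using False by simp
    have "(\<lambda>n. w n / complex_of_real (sinh (x (s n)))) \<longlonglongrightarrow> w0 / complex_of_real (sinh (x s0))"
      by (intro tendsto_divide w0 tendsto_of_real tendsto_sinh xs ne)
    moreover have "\<forall>\<^sub>F n in sequentially. x (s n) \<noteq> 0"
      using tendsto_imp_eventually_ne[OF xs False] .
    then have "\<forall>\<^sub>F n in sequentially. w n / complex_of_real (sinh (x (s n))) = cis (t n)"
      by eventually_elim (simp add: w)
    ultimately have lim: "(\<lambda>n. cis (t n)) \<longlonglongrightarrow> w0 / complex_of_real (sinh (x s0))" (is "_ \<longlonglongrightarrow> ?z")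
      using tendsto_cong by fastforce
    have "(\<lambda>n. norm (cis (t n))) \<longlonglongrightarrow> norm ?z" by (rule tendsto_norm[OF lim])
    then have "norm ?z = 1" using LIMSEQ_unique[OF tendsto_const] by fastforce
    then obtain t0 where t0: "?z = cis t0"
      using cis_Arg[of ?z] that[of "Arg ?z"] by (metis norm_zero zero_neq_one sgn_div_norm inverse_1 scaleR_one)
    \<comment> \<open>The principal argument is continuous near 1, so it selects the representative
      of the angular difference that tends to 0.\<close>
    define e where "e n = - Arg (cis (t n) / cis t0)" for n
    have "(\<lambda>n. cis (t n) / cis t0) \<longlonglongrightarrow> cis t0 / cis t0"
      using lim unfolding t0 by (intro tendsto_divide tendsto_const) auto
    then have "(\<lambda>n. cis (t n) / cis t0) \<longlonglongrightarrow> 1" by simp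
    then have "(\<lambda>n. Arg (cis (t n) / cis t0)) \<longlonglongrightarrow> Arg 1"
      by (rule isCont_tendsto_compose[rotated]) (rule continuous_at_Arg, simp add: complex_nonpos_Reals_iff)
    then have e: "e \<longlonglongrightarrow> 0" unfolding e_def using tendsto_minus by fastforce
    have "same_point x (s0, t n + e n) (s0, t0)" for n
    proof -
      have "cis (- e n) = sgn (cis (t n) / cis t0)"
        unfolding e_def minus_minus by (rule cis_Arg) simp
      then have "cis (- e n) * cis t0 = cis (t n)"
        by (simp add: sgn_div_norm norm_divide)
      then have "cis (t n) * cis (e n) = cis (- e n) * cis t0 * cis (e n)" by (simp only:)
      then have "cis (t n + e n) = cis t0" by (simp only: cis_mult) simp
      then have "exp (\<i> * complex_of_real t0) = exp (\<i> * complex_of_real (t n + e n))"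
        by (simp only: cis_conv_exp)
      then obtain k :: int where "\<i> * complex_of_real t0 = \<i> * complex_of_real (t n + e n) + complex_of_real (real_of_int (2 * k) * pi) * \<i>"
        unfolding exp_eq by blast
      then have "Im (\<i> * complex_of_real t0) = Im (\<i> * complex_of_real (t n + e n) + complex_of_real (real_of_int (2 * k) * pi) * \<i>)"
        by (rule arg_cong)
      then have "t0 = t n + e n + 2 * pi * of_int k" by simp
      then show ?thesis by (auto simp: same_point_def)
    qed
    then have "(\<lambda>n. ?d (p n) (s0, t0)) \<longlonglongrightarrow> 0"
      using s0I by (intro fin[OF _ e]) auto
    then show ?thesis using s0I by blast
  qed
qed

end

section \<open>The equations of the profile curve\<close>

lemma has_real_derivative_sqrt:
  assumes "(f has_real_derivative f') (at s)" "f s > 0"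
  shows "((\<lambda>s. sqrt (f s)) has_real_derivative f' / (2 * sqrt (f s))) (at s)"
  using DERIV_chain2[OF DERIV_real_sqrt[OF assms(2)] assms(1)] by (simp add: field_simps)

text \<open>What the classification uses: completeness only as closedness of I, and the mean
  curvature as a pointwise relation between x, \<alpha> and the derivative of \<alpha>. In this form
  the conditions survive reversal, see \<open>profile_uminus\<close>, which later reduces everything
  to x > 0.\<close>

locale profile = sl2_params +
  fixes H E :: real and I :: "real set" and x y \<alpha> :: "real \<Rightarrow> real"
  assumes H_nonneg: "0 \<le> H"
    and gen: "generating_curve I x y \<alpha>"
    and closed_I: "closed I"
    and curv: "\<And>s a'. \<lbrakk>s \<in> interior I; (\<alpha> has_real_derivative a') (at s)\<rbrakk> \<Longrightarrow> curvature_expr (x s) (\<alpha> s) a' = H"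
    and en: "\<And>s. s \<in> I \<Longrightarrow> energy \<kappa> \<tau> H x \<alpha> s = E"

context sl2_params
begin

lemma generating_curve_interior_derivs:
  assumes "generating_curve I x y \<alpha>" "s \<in> interior I"
  shows "(x has_real_derivative cos (\<alpha> s)) (at s)"
    "(y has_real_derivative sin (\<alpha> s) / cosh (x s)) (at s)"
    "\<exists>d. (\<alpha> has_real_derivative d) (at s)"
    "x s \<noteq> 0"
proof -
  have "at s within I = at s" using assms(2) by (rule at_within_interior)
  moreover have "s \<in> I" using assms(2) interior_subset by blast
  ultimately show "(x has_real_derivative cos (\<alpha> s)) (at s)"
    "(y has_real_derivative sin (\<alpha> s) / cosh (x s)) (at s)"
    "\<exists>d. (\<alpha> has_real_derivative d) (at s)"
    using generating_curve_derivs[OF assms(1)] by metis+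
  show "x s \<noteq> 0" using assms unfolding generating_curve_def by blast
qed

lemma rot_cmc_surface_imp_profile:
  assumes "rot_cmc_surface \<kappa> \<tau> H E I x y \<alpha>" "0 \<le> H"
  shows "profile \<kappa> \<tau> H E I x y \<alpha>"
proof
  show g: "generating_curve I x y \<alpha>" using assms(1) by (simp add: rot_cmc_surface_def)
  show "closed I" using assms(1) complete_surface_imp_closed[OF g] by (simp add: rot_cmc_surface_def)
  show "energy \<kappa> \<tau> H x \<alpha> s = E" if "s \<in> I" for s using assms(1) that by (simp add: rot_cmc_surface_def)
  show "0 \<le> H" by fact
  show "curvature_expr (x s) (\<alpha> s) a' = H" if "s \<in> interior I" "(\<alpha> has_real_derivative a') (at s)" for s a'
  proof -
    have "mean_curvature \<kappa> \<tau> (rot_immersion x y) (rot_normal \<kappa> \<tau> x y \<alpha>) s 0 = curvature_expr (x s) (\<alpha> s) a'"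
      by (rule mean_curvature_eq[OF open_interior that(1) generating_curve_interior_derivs(1)[OF g]
            generating_curve_interior_derivs(2)[OF g] that(2) generating_curve_interior_derivs(4)[OF g that(1)]])
    then show ?thesis using assms(1) that(1) by (simp add: rot_cmc_surface_def)
  qed
qed

lemma generating_curve_uminus:
  assumes g: "generating_curve I x y \<alpha>"
  shows "generating_curve (uminus ` I) (\<lambda>s. - x (- s)) (\<lambda>s. y (- s)) (\<lambda>s. - \<alpha> (- s))"
proof -
  have d: "((\<lambda>s. f (- s)) has_real_derivative - f') (at s within uminus ` I)"
    if "(f has_real_derivative f') (at (- s) within I)" for f f' and s :: real
  proof -
    have "((\<lambda>s. - s) has_real_derivative -1) (at s within uminus ` I)"
      by (auto intro!: derivative_eq_intros)
    moreover have "(f has_real_derivative f') (at (- s) within uminus ` (uminus ` I))"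
      using that by (simp add: image_image)
    ultimately show ?thesis using DERIV_image_chain[of f f' uminus s "uminus ` I" "-1"] by (simp add: o_def)
  qed
  obtain \<alpha>' where a: "continuous_on I \<alpha>'" "\<And>s. s \<in> I \<Longrightarrow> (\<alpha> has_real_derivative \<alpha>' s) (at s within I)"
    using g unfolding generating_curve_def by blast
  have int: "interior (uminus ` I) = uminus ` interior I" by (rule interior_negations)
  have "is_interval (uminus ` I)" using g by (simp add: generating_curve_def is_interval_neg_translationI is_interval_uminus)
  moreover have "interior (uminus ` I) \<noteq> {}" using g int by (auto simp: generating_curve_def)
  moreover have "((\<lambda>s. - x (- s)) has_real_derivative cos (- \<alpha> (- s))) (at s within uminus ` I)" if "s \<in> uminus ` I" for s
    using DERIV_minus[OF d[OF generating_curve_derivs(1)[OF g, of "- s"]]] that by auto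
  moreover have "((\<lambda>s. y (- s)) has_real_derivative sin (- \<alpha> (- s)) / cosh (- x (- s))) (at s within uminus ` I)" if "s \<in> uminus ` I" for s
    using d[OF generating_curve_derivs(2)[OF g, of "- s"]] that by auto
  moreover have "continuous_on (uminus ` I) (\<lambda>s. \<alpha>' (- s)) \<and> (\<forall>s\<in>uminus ` I. ((\<lambda>s. - \<alpha> (- s)) has_real_derivative \<alpha>' (- s)) (at s within uminus ` I))"
  proof
    show "continuous_on (uminus ` I) (\<lambda>s. \<alpha>' (- s))"
      by (intro continuous_on_compose2[OF a(1)] continuous_intros) auto
    show "\<forall>s\<in>uminus ` I. ((\<lambda>s. - \<alpha> (- s)) has_real_derivative \<alpha>' (- s)) (at s within uminus ` I)"
    proof
      fix s assume "s \<in> uminus ` I"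
      then have "- s \<in> I" by auto
      from DERIV_minus[OF d[OF a(2)[OF this]]] show "((\<lambda>s. - \<alpha> (- s)) has_real_derivative \<alpha>' (- s)) (at s within uminus ` I)"
        by simp
    qed
  qed
  moreover have "\<forall>s\<in>uminus ` interior I. - x (- s) \<noteq> 0" using g by (auto simp: generating_curve_def)
  moreover have "\<forall>s\<in>uminus ` I - uminus ` interior I. - x (- s) = 0 \<and> sin (- \<alpha> (- s)) = 0"
    using g by (auto simp: generating_curve_def)
  ultimately show ?thesis unfolding generating_curve_def int by blast
qed

lemma normal_denom_uminus: "normal_denom \<kappa> \<tau> (- X) (- a) = normal_denom \<kappa> \<tau> X a"
  by (simp add: normal_denom_def)

text \<open>The signs of sin a and sinh X cancel in the quotient. The argument \<open>a'\<close>
  stays the same because -\<alpha>(-s) has at s the derivative of \<alpha> at -s.\<close>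

lemma curvature_expr_uminus: "curvature_expr (- X) (- a) a' = curvature_expr X a a'"
  by (simp add: curvature_expr_def normal_denom_uminus K2_def Let_def)

lemma energy_uminus: "energy \<kappa> \<tau> H (\<lambda>s. - x (- s)) (\<lambda>s. - \<alpha> (- s)) s = energy \<kappa> \<tau> H x \<alpha> (- s)"
  by (simp add: energy_def normal_C_tan_def normal_denom_uminus)

end

context profile
begin

lemma profile_uminus: "profile \<kappa> \<tau> H E (uminus ` I) (\<lambda>s. - x (- s)) (\<lambda>s. y (- s)) (\<lambda>s. - \<alpha> (- s))"
proof
  show "0 \<le> H" by (rule H_nonneg)
  show "generating_curve (uminus ` I) (\<lambda>s. - x (- s)) (\<lambda>s. y (- s)) (\<lambda>s. - \<alpha> (- s))"
    by (rule generating_curve_uminus[OF gen])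
  show "closed (uminus ` I)" using closed_negations[OF closed_I] by simp
  show "energy \<kappa> \<tau> H (\<lambda>s. - x (- s)) (\<lambda>s. - \<alpha> (- s)) s = E" if "s \<in> uminus ` I" for s
    unfolding energy_uminus using that en by auto
  fix s a'
  assume s: "s \<in> interior (uminus ` I)" and d: "((\<lambda>s. - \<alpha> (- s)) has_real_derivative a') (at s)"
  have s': "- s \<in> interior I" using s unfolding interior_negations by auto
  have "((\<lambda>r. - (- \<alpha> (- (- r)))) has_real_derivative a') (at (- s))"
  proof -
    have "(uminus has_real_derivative - 1) (at (- s))"
      by (auto intro!: derivative_eq_intros)
    moreover have "((\<lambda>s. - \<alpha> (- s)) has_real_derivative a') (at (- (- s)))" using d by simp
    ultimately have "((\<lambda>r. - \<alpha> (- (- r))) has_real_derivative a' * - 1) (at (- s))"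
      by (rule DERIV_chain2[rotated])
    from DERIV_minus[OF this] show ?thesis by simp
  qed
  then have "(\<alpha> has_real_derivative a') (at (- s))" by simp
  then show "curvature_expr (- x (- s)) (- \<alpha> (- s)) a' = H"
    unfolding curvature_expr_uminus by (rule curv[OF s'])
qed

lemma is_interval_I: "is_interval I" and interior_ne: "interior I \<noteq> {}"
  using gen by (simp_all add: generating_curve_def)

lemma x_deriv: "s \<in> interior I \<Longrightarrow> (x has_real_derivative cos (\<alpha> s)) (at s)"
  and y_deriv: "s \<in> interior I \<Longrightarrow> (y has_real_derivative sin (\<alpha> s) / cosh (x s)) (at s)"
  and \<alpha>_deriv: "s \<in> interior I \<Longrightarrow> \<exists>d. (\<alpha> has_real_derivative d) (at s)"
  and x_nz: "s \<in> interior I \<Longrightarrow> x s \<noteq> 0"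
  using generating_curve_interior_derivs[OF gen] by blast+

text \<open>By the completed square behind \<open>first_form_ge\<close>,
  \<open>sqrt A * lam s * \<bar>s'\<bar>\<close> is the smallest speed that a choice of
  \<open>t'\<close> allows: the length of the curve in the quotient by the rotations.\<close>

definition lam :: "real \<Rightarrow> real" where "lam s = normal_denom \<kappa> \<tau> (x s) (\<alpha> s) / sqrt (K2 (x s))"

definition S :: "real \<Rightarrow> real" where "S s = (sinh (x s))\<^sup>2"

text \<open>The derivative of S with respect to this arclength, see \<open>S_deriv\<close>.\<close>

definition P :: "real \<Rightarrow> real" where "P s = 2 * sinh (x s) * cosh (x s) * cos (\<alpha> s) / lam s"

text \<open>A quarter of P^2 as a polynomial in S, see \<open>P_sq\<close>; \<open>Qd\<close> is the
  derivative of this polynomial.\<close>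

definition Qf :: "real \<Rightarrow> real" where "Qf z = z * (1 + z) + 4 / \<kappa> * (E + H * z)\<^sup>2"

definition Qd :: "real \<Rightarrow> real" where "Qd z = 1 + 2 * z + 8 / \<kappa> * H * (E + H * z)"

text \<open>The derivative of y with respect to arclength, as a function of S; \<open>Lf\<close> is
  that of the parameter s. With these two, \<alpha> disappears from the equations.\<close>

definition Rf :: "real \<Rightarrow> real" where
  "Rf z = (E + H * z) * sqrt (1 + (1 + \<rho>) * z) / (\<tau> * sqrt z * (1 + z))"

definition Lf :: "real \<Rightarrow> real" where
  "Lf z = sqrt ((Qf z + (E + H * z)\<^sup>2 * (1 + (1 + \<rho>) * z) / \<tau>\<^sup>2) / (z * (1 + z)))"

lemma lam_pos: "lam s > 0"
  using normal_denom_pos[of "x s" "\<alpha> s"] K2_pos[of "x s"] by (simp add: lam_def)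

lemma lam_sq: "(lam s)\<^sup>2 = (cos (\<alpha> s))\<^sup>2 + \<rho> * (sin (\<alpha> s))\<^sup>2 / K2 (x s)"
  using K2_pos[of "x s"] by (simp add: lam_def power_divide normal_denom_sq add_divide_distrib)

lemma abs_cos_le_lam: "\<bar>cos (\<alpha> s)\<bar> \<le> lam s"
proof (rule power2_le_imp_le)
  show "\<bar>cos (\<alpha> s)\<bar>\<^sup>2 \<le> (lam s)\<^sup>2" using lam_sq[of s] \<rho>_pos K2_pos[of "x s"] by simp
qed (simp add: less_imp_le[OF lam_pos])

text \<open>The bound has to depend on M: where sin^2 \<alpha> = 1, the square of \<open>lam\<close>
  is \<rho> / \<open>K2\<close>, which decays as x grows.\<close>

lemma lam_lower_bound:
  obtains c where "c > 0" "\<And>s. \<bar>x s\<bar> \<le> M \<Longrightarrow> c \<le> lam s"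
proof
  let ?c = "sqrt (min 1 (\<rho> / K2 M))"
  have m: "0 < min 1 (\<rho> / K2 M)" using \<rho>_pos K2_pos[of M] by simp
  then show "?c > 0" by simp
  fix s assume s: "\<bar>x s\<bar> \<le> M"
  have "(cosh (x s))\<^sup>2 \<le> (cosh M)\<^sup>2"
    using s by (intro power_mono) (subst cosh_real_abs[symmetric], subst cosh_real_nonneg_le_iff, auto)
  then have K: "K2 (x s) \<le> K2 M"
    unfolding K2_def using \<rho>_pos by (simp add: cosh_square_eq add_mono mult_left_mono)
  have "min 1 (\<rho> / K2 M) = min 1 (\<rho> / K2 M) * ((cos (\<alpha> s))\<^sup>2 + (sin (\<alpha> s))\<^sup>2)" by simp
  also have "\<dots> \<le> 1 * (cos (\<alpha> s))\<^sup>2 + (\<rho> / K2 M) * (sin (\<alpha> s))\<^sup>2"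
    unfolding distrib_left by (intro add_mono mult_right_mono) auto
  also have "\<dots> \<le> 1 * (cos (\<alpha> s))\<^sup>2 + (\<rho> / K2 (x s)) * (sin (\<alpha> s))\<^sup>2"
    using K K2_pos[of "x s"] \<rho>_pos by (intro add_mono mult_right_mono divide_left_mono mult_pos_pos) (auto simp: K2_pos)
  also have "\<dots> = (lam s)\<^sup>2" by (simp add: lam_sq)
  finally show "?c \<le> lam s"
    using real_sqrt_le_mono lam_pos[of s] by fastforce
qed

lemma lam_continuous: "continuous_on I lam"
proof -
  note c = generating_curve_continuous[OF gen]
  show ?thesis unfolding lam_def normal_denom_eq K2_def
    using K2_pos unfolding K2_def
    by (intro continuous_intros c) (auto simp: less_imp_neq[symmetric])
qed

text \<open>Conservation of energy without tan \<alpha> and without division, hence valid on the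
  axis and at cos \<alpha> = 0 alike.\<close>

lemma energy_eq: "s \<in> I \<Longrightarrow> \<tau> * sin (\<alpha> s) * cosh (x s) * sinh (x s) = normal_denom \<kappa> \<tau> (x s) (\<alpha> s) * (E + H * S s)"
  using en[of s] normal_denom_pos[of "x s" "\<alpha> s"]
  by (auto simp: energy_def normal_C_tan_def S_def field_simps)

lemma S_deriv:
  assumes "s \<in> interior I"
  shows "(S has_real_derivative lam s * P s) (at s)"
  using lam_pos[of s] unfolding S_def[abs_def] P_def
  by (auto intro!: derivative_eq_intros x_deriv[OF assms])

lemma inv_mu2: "4 / \<kappa> = - \<rho> / \<tau>\<^sup>2"
  using \<kappa>_neg \<tau>_nz by (simp add: \<rho>_def field_simps)

text \<open>The energy eliminates sin \<alpha>, and the formula for the squared denominator of the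
  normal then eliminates cos \<alpha>; the coefficient 4 / \<kappa> arises as -\<rho> /
  \<tau>^2.\<close>

lemma P_sq:
  assumes "s \<in> I"
  shows "(P s)\<^sup>2 = 4 * Qf (S s)"
proof -
  define D c sh u w where "D = normal_denom \<kappa> \<tau> (x s) (\<alpha> s)" and "c = cosh (x s)" and "sh = sinh (x s)"
    and "u = sin (\<alpha> s)" and "w = cos (\<alpha> s)"
  note defs = D_def c_def sh_def u_def w_def
  have D0: "D > 0" by (simp add: D_def normal_denom_pos)
  have K: "K2 (x s) > 0" by (rule K2_pos)
  have G: "E + H * S s = \<tau> * u * c * sh / D" using energy_eq[OF assms] D0 by (simp add: defs field_simps)
  have e: "D\<^sup>2 = w\<^sup>2 * K2 (x s) + \<rho> * u\<^sup>2" by (simp add: defs normal_denom_sq)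
  have S: "S s * (1 + S s) = sh\<^sup>2 * c\<^sup>2" by (simp add: S_def defs cosh_square_eq)
  have "(P s)\<^sup>2 = 4 * (sh\<^sup>2 * c\<^sup>2 * w\<^sup>2 * K2 (x s)) / D\<^sup>2"
    using K by (simp add: P_def lam_def defs power_divide power_mult_distrib)
  also have "\<dots> = 4 * (sh\<^sup>2 * c\<^sup>2 * (D\<^sup>2 - \<rho> * u\<^sup>2) / D\<^sup>2)"
    by (simp add: e mult.assoc)
  also have "\<dots> = 4 * (sh\<^sup>2 * c\<^sup>2 - \<rho> / \<tau>\<^sup>2 * (\<tau> * u * c * sh / D)\<^sup>2)"
    using D0 \<tau>_nz by (simp add: power_divide power_mult_distrib field_simps)
  finally show ?thesis unfolding Qf_def S inv_mu2 G by simp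
qed

text \<open>Differentiating \<open>P_sq\<close> would give this only where P is nonzero. The mean
  curvature is affine in the derivative of \<alpha> and gives it at the turning points of x as
  well.\<close>

lemma P_deriv:
  assumes s: "s \<in> interior I"
  shows "(P has_real_derivative lam s * (2 * Qd (S s))) (at s)"
proof -
  obtain a' where a: "(\<alpha> has_real_derivative a') (at s)" using \<alpha>_deriv[OF s] by blast
  have sI: "s \<in> I" using s interior_subset by blast
  define D c sh u w k where "D = normal_denom \<kappa> \<tau> (x s) (\<alpha> s)" and "c = cosh (x s)" and "sh = sinh (x s)"
    and "u = sin (\<alpha> s)" and "w = cos (\<alpha> s)" and "k = sqrt (K2 (x s))"
  note defs = D_def c_def sh_def u_def w_def k_def
  have D0: "D > 0" by (simp add: D_def normal_denom_pos)
  have k0: "k > 0" by (simp add: k_def K2_pos)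
  have c0: "c > 0" by (simp add: c_def)
  have sh0: "sh \<noteq> 0" using x_nz[OF s] by (simp add: sh_def)
  have e1: "u\<^sup>2 + w\<^sup>2 = 1" by (simp add: defs)
  have e2: "c\<^sup>2 = 1 + sh\<^sup>2" by (simp add: defs cosh_square_eq)
  have e3: "k\<^sup>2 = c\<^sup>2 + \<rho> * sh\<^sup>2" using K2_pos[of "x s"] by (simp add: defs K2_def)
  have e4: "D\<^sup>2 = w\<^sup>2 * k\<^sup>2 + \<rho> * u\<^sup>2" using K2_pos[of "x s"] by (simp add: defs normal_denom_sq)
  have dk2: "((\<lambda>s. K2 (x s)) has_real_derivative 2 * (1 + \<rho>) * sh * c * w) (at s)"
    unfolding K2_def defs
    by (rule derivative_eq_intros x_deriv[OF s] refl | (simp add: algebra_simps; fail))+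
  have dk: "((\<lambda>s. sqrt (K2 (x s))) has_real_derivative (1 + \<rho>) * sh * c * w / k) (at s)"
    by (rule DERIV_cong[OF has_real_derivative_sqrt[OF dk2 K2_pos]]) (use k0 in \<open>simp add: k_def field_simps\<close>)
  have dD2: "((\<lambda>s. (cos (\<alpha> s))\<^sup>2 * K2 (x s) + \<rho> * (sin (\<alpha> s))\<^sup>2) has_real_derivative
      2 * (- w * u * a' * k\<^sup>2 + w ^ 3 * (1 + \<rho>) * sh * c + \<rho> * u * w * a')) (at s)"
    apply (rule derivative_eq_intros a dk2 refl)+
    using K2_pos[of "x s"] by (simp add: defs algebra_simps power2_eq_square power3_eq_cube)
  have dD: "((\<lambda>s. normal_denom \<kappa> \<tau> (x s) (\<alpha> s)) has_real_derivative
      (- w * u * a' * k\<^sup>2 + w ^ 3 * (1 + \<rho>) * sh * c + \<rho> * u * w * a') / D) (at s)"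
    unfolding normal_denom_eq
    by (rule DERIV_cong[OF has_real_derivative_sqrt[OF dD2 normal_denom_arg_pos]])
       (use D0 in \<open>simp add: D_def normal_denom_eq field_simps\<close>)
  have P: "P = (\<lambda>s. 2 * sinh (x s) * cosh (x s) * cos (\<alpha> s) * sqrt (K2 (x s)) / normal_denom \<kappa> \<tau> (x s) (\<alpha> s))"
    by (simp add: P_def lam_def fun_eq_iff)
  define D' where "D' = (- w * u * a' * k\<^sup>2 + w ^ 3 * (1 + \<rho>) * sh * c + \<rho> * u * w * a') / D"
  define k' where "k' = (1 + \<rho>) * sh * c * w / k"
  have kk: "k * k' = (1 + \<rho>) * sh * c * w" using k0 by (simp add: k'_def)
  have DD: "D * D' = - w * u * a' * k\<^sup>2 + w ^ 3 * (1 + \<rho>) * sh * c + \<rho> * u * w * a'" using D0 by (simp add: D'_def)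
  have dP: "(P has_real_derivative 2 * ((c\<^sup>2 + sh\<^sup>2) * w * w * k / D - sh * c * u * a' * k / D + sh * c * w * k' / D
      - sh * c * w * k * D' / D\<^sup>2)) (at s)"
  proof -
    have n: "((\<lambda>s. 2 * sinh (x s) * cosh (x s) * cos (\<alpha> s)) has_real_derivative
        2 * ((c\<^sup>2 + sh\<^sup>2) * w * w - sh * c * u * a')) (at s)"
      unfolding defs
      by (rule derivative_eq_intros x_deriv[OF s] a refl | (simp add: algebra_simps power2_eq_square; fail))+
    have D: "normal_denom \<kappa> \<tau> (x s) (\<alpha> s) \<noteq> 0" using D0 by (simp add: D_def)
    show ?thesis
      unfolding P
      by (rule DERIV_cong[OF DERIV_divide[OF DERIV_mult[OF n dk] dD D]],
          unfold k'_def[symmetric] D'_def[symmetric] defs[symmetric])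
         (use D0 in \<open>simp add: field_simps power2_eq_square\<close>)
  qed
  define Z where "Z = (c\<^sup>2 + sh\<^sup>2) * D\<^sup>2 - c\<^sup>2 * sh\<^sup>2 * (1 + \<rho>) * w\<^sup>2"
  have Hc: "H * (2 * D ^ 3) * (sh * c) = \<tau> * (k\<^sup>2 * a' * sh * c + u * Z)"
  proof -
    have "H = \<tau> * (k\<^sup>2 * a' + u * Z / (sh * c)) / (2 * D ^ 3)"
      using curv[OF s a] K2_pos[of "x s"] by (simp add: curvature_expr_def Let_def Z_def defs)
    then show ?thesis using D0 c0 sh0 by (simp add: field_simps)
  qed
  have G: "(E + H * S s) * D = \<tau> * u * c * sh" using energy_eq[OF sI] by (simp add: defs)
  \<comment> \<open>The curvature equation times the energy relation produces the product H (E + H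
    S) that occurs in \<open>Qd\<close>.\<close>
  have HG: "H * (E + H * S s) * (2 * D ^ 4) = \<tau>\<^sup>2 * u * (k\<^sup>2 * a' * sh * c + u * Z)"
  proof -
    have "H * (E + H * S s) * (2 * D ^ 4) * (sh * c) = (H * (2 * D ^ 3) * (sh * c)) * ((E + H * S s) * D)"
      by (simp add: power3_eq_cube power4_eq_xxxx)
    also have "\<dots> = \<tau>\<^sup>2 * u * (k\<^sup>2 * a' * sh * c + u * Z) * (sh * c)"
      unfolding Hc G by (simp add: power2_eq_square)
    finally show ?thesis using c0 sh0 by simp
  qed
  have q: "Qd (S s) * D ^ 4 = (c\<^sup>2 + sh\<^sup>2) * D ^ 4 - \<rho> * u * (k\<^sup>2 * a' * sh * c + u * Z)"
  proof -
    have "8 / \<kappa> = - 2 * \<rho> / \<tau>\<^sup>2" using inv_mu2 by simp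
    then have "Qd (S s) * D ^ 4 = (1 + 2 * S s) * D ^ 4 - \<rho> / \<tau>\<^sup>2 * (H * (E + H * S s) * (2 * D ^ 4))"
      unfolding Qd_def by (simp add: algebra_simps add_divide_distrib)
    also have "\<dots> = (1 + 2 * S s) * D ^ 4 - \<rho> * u * (k\<^sup>2 * a' * sh * c + u * Z)"
      unfolding HG using \<tau>_nz by simp
    finally show ?thesis by (simp add: S_def e2 sh_def[symmetric])
  qed
  \<comment> \<open>Multiplied by \<open>k * D ^ 3\<close>, the derivatives of k and D occur only in
    the products \<open>k * k'\<close> and \<open>D * D'\<close>, which are polynomials.\<close>
  have "2 * ((c\<^sup>2 + sh\<^sup>2) * w * w * k / D - sh * c * u * a' * k / D + sh * c * w * k' / D
      - sh * c * w * k * D' / D\<^sup>2) * (k * D ^ 3)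
    = 2 * ((c\<^sup>2 + sh\<^sup>2) * w\<^sup>2 * k\<^sup>2 * D\<^sup>2 - sh * c * u * a' * k\<^sup>2 * D\<^sup>2 + sh * c * w * (k * k') * D\<^sup>2
      - sh * c * w * k\<^sup>2 * (D * D'))"
    using D0 by (simp add: field_simps power2_eq_square power3_eq_cube)
  also have "\<dots> = 2 * (Qd (S s) * D ^ 4)"
    unfolding q kk DD Z_def using e1 e2 e3 e4 by algebra
  also have "\<dots> = lam s * (2 * Qd (S s)) * (k * D ^ 3)"
    using k0 by (simp add: lam_def defs[symmetric] power3_eq_cube power4_eq_xxxx)
  finally have "2 * ((c\<^sup>2 + sh\<^sup>2) * w * w * k / D - sh * c * u * a' * k / D + sh * c * w * k' / D
      - sh * c * w * k * D' / D\<^sup>2) = lam s * (2 * Qd (S s))"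
    using D0 k0 by simp
  with dP show ?thesis by simp
qed

text \<open>\<open>Qf (S s)\<close> carries cos^2 \<alpha> and the squared energy term carries sin^2
  \<alpha>, both with the same factor, so their sum no longer contains \<alpha>.\<close>

lemma lam_inverse:
  assumes "s \<in> I" "x s \<noteq> 0"
  shows "1 / lam s = Lf (S s)"
proof -
  define D c sh u w where "D = normal_denom \<kappa> \<tau> (x s) (\<alpha> s)" and "c = cosh (x s)" and "sh = sinh (x s)"
    and "u = sin (\<alpha> s)" and "w = cos (\<alpha> s)"
  note defs = D_def c_def sh_def u_def w_def
  have D0: "D > 0" by (simp add: D_def normal_denom_pos)
  have K: "K2 (x s) > 0" by (rule K2_pos)
  have c0: "c > 0" by (simp add: c_def)
  have sh0: "sh \<noteq> 0" using assms(2) by (simp add: sh_def)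
  have e: "D\<^sup>2 = w\<^sup>2 * K2 (x s) + \<rho> * u\<^sup>2" by (simp add: defs normal_denom_sq)
  have e1: "u\<^sup>2 + w\<^sup>2 = 1" by (simp add: defs)
  have G: "E + H * S s = \<tau> * u * c * sh / D" using energy_eq[OF assms(1)] D0 by (simp add: defs field_simps)
  have S: "S s * (1 + S s) = sh\<^sup>2 * c\<^sup>2" by (simp add: S_def defs cosh_square_eq)
  have K2: "1 + (1 + \<rho>) * S s = K2 (x s)" by (simp add: K2_def S_def cosh_square_eq algebra_simps)
  have "Qf (S s) = (P s)\<^sup>2 / 4" using P_sq[OF assms(1)] by simp
  also have "\<dots> = sh\<^sup>2 * c\<^sup>2 * w\<^sup>2 * K2 (x s) / D\<^sup>2"
    using K by (simp add: P_def lam_def defs power_divide power_mult_distrib)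
  finally have "Qf (S s) + (E + H * S s)\<^sup>2 * (1 + (1 + \<rho>) * S s) / \<tau>\<^sup>2
      = sh\<^sup>2 * c\<^sup>2 * K2 (x s) / D\<^sup>2 * (u\<^sup>2 + w\<^sup>2)"
    unfolding G K2 using \<tau>_nz D0 by (simp add: power_divide power_mult_distrib field_simps)
  then have "(Qf (S s) + (E + H * S s)\<^sup>2 * (1 + (1 + \<rho>) * S s) / \<tau>\<^sup>2) / (S s * (1 + S s)) = K2 (x s) / D\<^sup>2"
    unfolding S e1 using c0 sh0 by simp
  then show ?thesis
    unfolding Lf_def using D0 by (simp add: lam_def D_def real_sqrt_divide)
qed

lemma y_deriv_Rf:
  assumes "s \<in> interior I" "x s > 0"
  shows "(y has_real_derivative lam s * Rf (S s)) (at s)"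
proof -
  have sI: "s \<in> I" using assms interior_subset by blast
  define D where "D = normal_denom \<kappa> \<tau> (x s) (\<alpha> s)"
  have D0: "D > 0" by (simp add: D_def normal_denom_pos)
  have K: "K2 (x s) > 0" by (rule K2_pos)
  have sh: "sinh (x s) > 0" using assms by simp
  have K2: "1 + (1 + \<rho>) * S s = K2 (x s)" by (simp add: K2_def S_def cosh_square_eq algebra_simps)
  have c: "1 + S s = (cosh (x s))\<^sup>2" by (simp add: S_def cosh_square_eq)
  have G: "E + H * S s = \<tau> * sin (\<alpha> s) * cosh (x s) * sinh (x s) / D" using energy_eq[OF sI] D0 by (simp add: D_def field_simps)
  have q: "sqrt (S s) = sinh (x s)" using sh by (simp add: S_def)
  have "lam s * Rf (S s) = sin (\<alpha> s) / cosh (x s)"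
    unfolding Rf_def G K2 c q lam_def D_def[symmetric] using D0 K sh \<tau>_nz
    by (simp add: field_simps power2_eq_square)
  then show ?thesis using y_deriv[OF assms(1)] by simp
qed

lemma P_zero_iff: "s \<in> interior I \<Longrightarrow> P s = 0 \<longleftrightarrow> cos (\<alpha> s) = 0"
  using lam_pos[of s] x_nz by (simp add: P_def)

end

section \<open>Auxiliary facts on linear equations and real functions\<close>

text \<open>Gronwall's argument: f^2 + h^2, damped by exp(-(1 + |c|) v), does not increase and
  starts at 0.\<close>

lemma linear_ode_unique_nonneg:
  fixes f h :: "real \<Rightarrow> real"
  assumes f: "\<And>v. (f has_real_derivative h v) (at v)" and h: "\<And>v. (h has_real_derivative c * f v) (at v)"
    and 0: "f 0 = 0" "h 0 = 0" and "v \<ge> 0"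
  shows "f v = 0"
proof -
  define M where "M v = exp (- (1 + \<bar>c\<bar>) * v) * ((f v)\<^sup>2 + (h v)\<^sup>2)" for v
  have d: "(M has_real_derivative exp (- (1 + \<bar>c\<bar>) * v) * (2 * (1 + c) * (f v * h v) - (1 + \<bar>c\<bar>) * ((f v)\<^sup>2 + (h v)\<^sup>2))) (at v)" for v
    unfolding M_def
    by (rule derivative_eq_intros f h refl | (simp add: algebra_simps power2_eq_square; fail))+
  have le: "exp (- (1 + \<bar>c\<bar>) * v) * (2 * (1 + c) * (f v * h v) - (1 + \<bar>c\<bar>) * ((f v)\<^sup>2 + (h v)\<^sup>2)) \<le> 0" for v
  proof -
    have "2 * \<bar>f v * h v\<bar> \<le> (f v)\<^sup>2 + (h v)\<^sup>2"
      using sum_squares_bound[of "\<bar>f v\<bar>" "\<bar>h v\<bar>"] by (simp add: abs_mult)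
    have "2 * (1 + c) * (f v * h v) \<le> \<bar>1 + c\<bar> * (2 * \<bar>f v * h v\<bar>)"
      using abs_ge_self[of "(1 + c) * (f v * h v)"] unfolding abs_mult[of "1 + c"] by linarith
    also have "\<dots> \<le> (1 + \<bar>c\<bar>) * ((f v)\<^sup>2 + (h v)\<^sup>2)"
      by (intro mult_mono \<open>2 * \<bar>f v * h v\<bar> \<le> _\<close>) auto
    finally show ?thesis by (intro mult_nonneg_nonpos) auto
  qed
  have "M v \<le> M 0"
    by (rule DERIV_nonpos_imp_nonincreasing[OF \<open>v \<ge> 0\<close>]) (use d le in blast)
  then have "exp (- (1 + \<bar>c\<bar>) * v) * ((f v)\<^sup>2 + (h v)\<^sup>2) \<le> 0" by (simp add: M_def 0)
  then have "(f v)\<^sup>2 + (h v)\<^sup>2 \<le> 0" by (simp add: mult_le_0_iff)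
  then show ?thesis by (smt (verit) zero_le_power2 zero_eq_power2)
qed

lemma linear_ode_unique:
  fixes f h :: "real \<Rightarrow> real"
  assumes f: "\<And>v. (f has_real_derivative h v) (at v)" and h: "\<And>v. (h has_real_derivative c * f v) (at v)"
    and 0: "f 0 = 0" "h 0 = 0"
  shows "f v = 0"
proof (cases "v \<ge> 0")
  case True
  then show ?thesis using linear_ode_unique_nonneg[OF assms] by blast
next
  case False
  have m: "(uminus has_real_derivative -1) (at r)" for r :: real
    by (auto intro!: derivative_eq_intros)
  have "f (- (- v)) = 0"
  proof (rule linear_ode_unique_nonneg[where f = "\<lambda>v. f (- v)" and h = "\<lambda>v. - h (- v)" and c = c and v = "- v"])
    show "((\<lambda>v. f (- v)) has_real_derivative - h (- v)) (at v)" for v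
      using DERIV_chain2[OF f m, of v] by simp
    show "((\<lambda>v. - h (- v)) has_real_derivative c * f (- v)) (at v)" for v
      using DERIV_minus[OF DERIV_chain2[OF h m, of v]] by simp
  qed (use False 0 in auto)
  then show ?thesis by simp
qed

text \<open>Carries the symmetry of S over to y and to the parameter s, whose derivatives are
  functions of S.\<close>

lemma odd_antiderivative:
  fixes f :: "real \<Rightarrow> real"
  assumes f: "\<And>v. (f has_real_derivative f' v) (at v)" and e: "\<And>u. f' (c - u) = f' (c + u)"
  shows "f (c - u) = 2 * f c - f (c + u)"
proof -
  have "((\<lambda>u. f (c + u) + f (c - u)) has_real_derivative 0) (at u)" for u
  proof -
    have 1: "((\<lambda>u. c + u) has_real_derivative 1) (at u)" "((\<lambda>u. c - u) has_real_derivative -1) (at u)"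
      by (auto intro!: derivative_eq_intros)
    show ?thesis using DERIV_add[OF DERIV_chain2[OF f 1(1)] DERIV_chain2[OF f 1(2)]] e by simp
  qed
  then have "f (c + u) + f (c - u) = f (c + 0) + f (c - 0)"
    by (intro DERIV_isconst_all[rule_format]) auto
  then show ?thesis by simp
qed

lemma has_real_derivative_inverse:
  fixes f g :: "real \<Rightarrow> real"
  assumes "(f has_real_derivative f') (at (g v))" "f' \<noteq> 0" "continuous_on UNIV f"
    and "\<And>s. g (f s) = s" "f (g v) = v"
  shows "(g has_real_derivative inverse f') (at v)"
  unfolding has_field_derivative_def
  by (rule has_derivative_inverse_strong_x[of UNIV g v f "(*) f'"])
     (use assms in \<open>auto simp: has_field_derivative_def\<close>)

section \<open>Orbit-space arclength and reflection symmetries\<close>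

context profile
begin

text \<open>An end of I that belongs to I lies on the axis, where the energy is 0. So I is open as
  well as closed.\<close>

lemma E_nz_imp_UNIV:
  assumes "E \<noteq> 0"
  shows "I = UNIV"
proof -
  have "I - interior I = {}"
  proof (rule ccontr)
    assume "I - interior I \<noteq> {}"
    then obtain s where s: "s \<in> I" "s \<in> I - interior I" by blast
    then have "x s = 0" using gen unfolding generating_curve_def by blast
    then show False using en[OF s(1)] assms by (simp add: energy_def)
  qed
  then have "interior I = I" using interior_subset by blast
  then have "open I" by (metis open_interior)
  then show ?thesis using closed_I interior_ne clopen[of I] \<open>interior I = I\<close> by blast
qed

lemma x_constant_sign: "(\<forall>s\<in>I. 0 \<le> x s) \<and> (\<forall>s\<in>interior I. 0 < x s) \<or> (\<forall>s\<in>I. x s \<le> 0) \<and> (\<forall>s\<in>interior I. x s < 0)"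
proof -
  have conv: "convex (interior I)" using is_interval_I by (simp add: convex_interior is_interval_convex_1)
  then have "connected (interior I)" by (rule convex_connected)
  moreover have "continuous_on (interior I) x"
    by (rule continuous_on_subset[OF generating_curve_continuous(1)[OF gen] interior_subset])
  ultimately have "is_interval (x ` interior I)"
    using connected_continuous_image is_interval_connected_1 by blast
  moreover have "0 \<notin> x ` interior I" using x_nz by auto
  ultimately have 1: "(\<forall>s\<in>interior I. 0 < x s) \<or> (\<forall>s\<in>interior I. x s < 0)"
  proof (rule_tac ccontr)
    assume iv: "is_interval (x ` interior I)" and z: "0 \<notin> x ` interior I"
    assume "\<not> ?thesis"
    then obtain r q where r: "r \<in> interior I" "\<not> 0 < x r" and q: "q \<in> interior I" "\<not> x q < 0" by blast
    have "0 \<in> x ` interior I"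
      by (rule mem_is_interval_1_I[OF iv imageI[OF r(1)] imageI[OF q(1)]]) (use r q in simp_all)
    then show False using z by blast
  qed
  have 2: "s \<in> interior I \<or> x s = 0" if "s \<in> I" for s
    using gen that unfolding generating_curve_def by blast
  show ?thesis
    using 1
  proof
    assume p: "\<forall>s\<in>interior I. 0 < x s"
    then have "0 \<le> x s" if "s \<in> I" for s using 2[OF that] by (auto simp: less_imp_le)
    with p show ?thesis by blast
  next
    assume p: "\<forall>s\<in>interior I. x s < 0"
    then have "x s \<le> 0" if "s \<in> I" for s using 2[OF that] by (auto simp: less_imp_le)
    with p show ?thesis by blast
  qed
qed

end

text \<open>A nonzero E makes I the whole line; the sign of x is a normalization, which the reversal
  of the curve removes at the end.\<close>

locale profile_line = profile +
  assumes E_nz: "E \<noteq> 0" and x_pos: "\<And>s. x s > 0"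
begin

lemma I_UNIV: "I = UNIV" by (rule E_nz_imp_UNIV[OF E_nz])

lemma int_UNIV: "s \<in> interior I" by (simp add: I_UNIV)

lemma in_I: "s \<in> I" by (simp add: I_UNIV)

lemma ex_arclength: "\<exists>f. \<forall>s. (f has_real_derivative lam s) (at s)"
proof -
  have "isCont lam s" for s
    using lam_continuous by (simp add: I_UNIV continuous_on_eq_continuous_at)
  then obtain F where "\<And>s. (F has_vector_derivative lam s) (at s)"
    using einterval_antiderivative[of "-\<infinity>" \<infinity> lam] by auto
  then show ?thesis by (auto simp: has_real_derivative_iff_has_vector_derivative)
qed

text \<open>Up to a factor, arclength of the generating curve in the orbit space.\<close>

definition \<sigma> :: "real \<Rightarrow> real" where "\<sigma> = (SOME f. \<forall>s. (f has_real_derivative lam s) (at s))"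

lemma \<sigma>_deriv: "(\<sigma> has_real_derivative lam s) (at s)"
  using someI_ex[OF ex_arclength] unfolding \<sigma>_def by blast

lemma \<sigma>_strict_mono: "strict_mono \<sigma>"
  unfolding strict_mono_def using DERIV_pos_imp_increasing[of _ _ \<sigma>] \<sigma>_deriv lam_pos by blast

lemma \<sigma>_continuous: "continuous_on T \<sigma>"
  by (rule DERIV_continuous_on[OF has_field_derivative_at_within[OF \<sigma>_deriv]])

lemma abs_x_le_\<sigma>: "\<bar>x s - x r\<bar> \<le> \<bar>\<sigma> s - \<sigma> r\<bar>"
proof -
  have *: "\<bar>x s - x r\<bar> \<le> \<sigma> s - \<sigma> r" if "r \<le> s" for r s
  proof -
    have d: "((\<lambda>s. \<sigma> s - x s) has_real_derivative lam s - cos (\<alpha> s)) (at s)"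
      "((\<lambda>s. \<sigma> s + x s) has_real_derivative lam s + cos (\<alpha> s)) (at s)" for s
      by (rule derivative_eq_intros \<sigma>_deriv x_deriv[OF int_UNIV] refl)+
    have "\<sigma> r - x r \<le> \<sigma> s - x s"
      by (rule DERIV_nonneg_imp_nondecreasing[OF that]) (use d(1) abs_cos_le_lam in \<open>metis abs_le_D1 diff_ge_0_iff_ge\<close>)
    moreover have "\<sigma> r + x r \<le> \<sigma> s + x s"
      by (rule DERIV_nonneg_imp_nondecreasing[OF that]) (use d(2) abs_cos_le_lam in \<open>metis abs_le_D2 add.commute diff_ge_0_iff_ge diff_minus_eq_add\<close>)
    ultimately show ?thesis by linarith
  qed
  show ?thesis using *[of r s] *[of s r] by linarith
qed

text \<open>If \<sigma> were bounded in one direction, \<open>abs_x_le_\<sigma>\<close> would bound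
  x there and so keep \<open>lam\<close> above some c > 0, which forces linear growth of
  \<sigma>.\<close>

lemma \<sigma>_unbounded: "\<exists>s. \<sigma> s > b" "\<exists>s. \<sigma> s < b"
proof -
  obtain c where c: "c > 0" "\<And>s. \<bar>x s\<bar> \<le> \<bar>x 0\<bar> + \<bar>b - \<sigma> 0\<bar> \<Longrightarrow> c \<le> lam s"
    using lam_lower_bound by blast
  show "\<exists>s. \<sigma> s > b"
  proof (rule ccontr)
    assume "\<nexists>s. \<sigma> s > b"
    then have b: "\<And>s. \<sigma> s \<le> b" by (meson not_le)
    have bb: "\<bar>x s\<bar> \<le> \<bar>x 0\<bar> + \<bar>b - \<sigma> 0\<bar>" if "s \<ge> 0" for s
      using abs_x_le_\<sigma>[of s 0] b[of s] strict_mono_mono[OF \<sigma>_strict_mono, THEN monoD, OF that] by linarith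
    define r where "r = (b - \<sigma> 0) / c + 1"
    have "r \<ge> 0" using b[of 0] c(1) by (simp add: r_def)
    have d: "((\<lambda>s. \<sigma> s - c * s) has_real_derivative lam s - c) (at s)" for s
      by (rule derivative_eq_intros \<sigma>_deriv refl | simp)+
    have "\<sigma> 0 - c * 0 \<le> \<sigma> r - c * r"
      by (rule DERIV_nonneg_imp_nondecreasing[OF \<open>r \<ge> 0\<close>]) (use d c(2)[OF bb] in \<open>metis diff_ge_0_iff_ge\<close>)
    moreover have "c * r = b - \<sigma> 0 + c" using c(1) by (simp add: r_def distrib_left)
    ultimately show False using b[of r] c(1) by linarith
  qed
  show "\<exists>s. \<sigma> s < b"
  proof (rule ccontr)
    assume "\<nexists>s. \<sigma> s < b"
    then have b: "\<And>s. \<sigma> s \<ge> b" by (meson not_le)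
    have bb: "\<bar>x s\<bar> \<le> \<bar>x 0\<bar> + \<bar>b - \<sigma> 0\<bar>" if "s \<le> 0" for s
      using abs_x_le_\<sigma>[of s 0] b[of s] strict_mono_mono[OF \<sigma>_strict_mono, THEN monoD, OF that] by linarith
    define r where "r = - ((\<sigma> 0 - b) / c + 1)"
    have "(\<sigma> 0 - b) / c \<ge> 0" using b[of 0] c(1) by simp
    then have "r \<le> 0" by (simp add: r_def)
    have d: "((\<lambda>s. \<sigma> s - c * s) has_real_derivative lam s - c) (at s)" for s
      by (rule derivative_eq_intros \<sigma>_deriv refl | simp)+
    have "\<sigma> r - c * r \<le> \<sigma> 0 - c * 0"
      by (rule DERIV_nonneg_imp_nondecreasing[OF \<open>r \<le> 0\<close>]) (use d c(2)[OF bb] in \<open>metis diff_ge_0_iff_ge\<close>)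
    moreover have "c * r = b - \<sigma> 0 - c"
    proof -
      have "c * ((\<sigma> 0 - b) / c) = \<sigma> 0 - b" using c(1) by simp
      then show ?thesis unfolding r_def mult_minus_right distrib_left by linarith
    qed
    ultimately show False using b[of r] c(1) by linarith
  qed
qed

definition g :: "real \<Rightarrow> real" where "g = inv \<sigma>"

lemma \<sigma>_surj: "surj \<sigma>"
  unfolding surj_def
proof
  fix b
  obtain s r where sr: "\<sigma> s < b" "\<sigma> r > b" using \<sigma>_unbounded by blast
  have "s \<le> r" using strict_mono_less_eq[OF \<sigma>_strict_mono, of s r] sr by linarith
  then obtain q where "\<sigma> q = b"
    using IVT'[OF less_imp_le[OF sr(1)] less_imp_le[OF sr(2)] _ \<sigma>_continuous] by blast
  then show "\<exists>s. b = \<sigma> s" by blast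
qed

lemma \<sigma>_g [simp]: "\<sigma> (g v) = v" and g_\<sigma> [simp]: "g (\<sigma> s) = s"
  using \<sigma>_surj strict_mono_imp_inj_on[OF \<sigma>_strict_mono]
  by (simp_all add: g_def surj_f_inv_f)

lemma g_strict_mono: "strict_mono g"
  by (metis \<sigma>_g \<sigma>_strict_mono strict_mono_def strict_mono_less)

lemma bij_g: "bij g"
  by (metis \<sigma>_g g_\<sigma> bijI')

text \<open>In arclength the system is autonomous: the derivatives of \<open>Pv\<close>,
  \<open>Yv\<close> and \<open>g\<close> depend on \<open>Sv\<close> alone.\<close>

definition Sv :: "real \<Rightarrow> real" where "Sv v = S (g v)"
definition Pv :: "real \<Rightarrow> real" where "Pv v = P (g v)"
definition Yv :: "real \<Rightarrow> real" where "Yv v = y (g v)"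

lemma Sv_pos: "Sv v > 0"
  using x_pos[of "g v"] by (simp add: Sv_def S_def)

lemma g_deriv': "(g has_real_derivative 1 / lam (g v)) (at v)"
proof -
  have "(g has_real_derivative inverse (lam (g v))) (at v)"
    by (rule has_real_derivative_inverse[OF \<sigma>_deriv])
       (use lam_pos[of "g v"] in \<open>simp_all add: \<sigma>_continuous\<close>)
  then show ?thesis by (simp add: divide_inverse)
qed

lemma g_deriv: "(g has_real_derivative Lf (Sv v)) (at v)"
  using g_deriv'[of v] lam_inverse[OF in_I, of "g v"] x_pos[of "g v"] by (simp add: Sv_def)

lemma along_g:
  assumes "(f has_real_derivative lam (g v) * f') (at (g v))"
  shows "((\<lambda>v. f (g v)) has_real_derivative f') (at v)"
  using DERIV_chain2[OF assms g_deriv'] lam_pos[of "g v"] by simp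

lemma Sv_deriv: "(Sv has_real_derivative Pv v) (at v)"
  unfolding Sv_def[abs_def] Pv_def by (rule along_g[OF S_deriv[OF int_UNIV]])

lemma Pv_deriv: "(Pv has_real_derivative 2 * Qd (Sv v)) (at v)"
  unfolding Sv_def Pv_def[abs_def] by (rule along_g[OF P_deriv[OF int_UNIV]])

lemma Yv_deriv: "(Yv has_real_derivative Rf (Sv v)) (at v)"
  unfolding Sv_def Yv_def[abs_def] by (rule along_g[OF y_deriv_Rf[OF int_UNIV x_pos]])

lemma Pv_sq: "(Pv v)\<^sup>2 = 4 * Qf (Sv v)"
  unfolding Pv_def Sv_def by (rule P_sq[OF in_I])

lemma x_g: "x (g v) = arsinh (sqrt (Sv v))"
  using x_pos[of "g v"] by (simp add: Sv_def S_def arsinh_sinh_real)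

lemma Pv_zero_iff: "Pv v = 0 \<longleftrightarrow> cos (\<alpha> (g v)) = 0"
  unfolding Pv_def by (rule P_zero_iff[OF int_UNIV])

lemma sgn_sin: "sgn (sin (\<alpha> (g v))) = sgn \<tau> * sgn (E + H * Sv v)"
proof -
  have "sgn (\<tau> * sin (\<alpha> (g v)) * cosh (x (g v)) * sinh (x (g v))) = sgn (E + H * Sv v)"
    unfolding energy_eq[OF in_I] Sv_def using normal_denom_pos by (simp add: sgn_mult)
  then have "sgn \<tau> * sgn (sin (\<alpha> (g v))) = sgn (E + H * Sv v)"
    using x_pos[of "g v"] by (simp add: sgn_mult)
  then have "sgn \<tau> * sgn \<tau> * sgn (sin (\<alpha> (g v))) = sgn \<tau> * sgn (E + H * Sv v)" by (simp only: mult.assoc)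
  moreover have "sgn \<tau> * sgn \<tau> = 1" using \<tau>_nz by (simp add: sgn_real_def)
  ultimately show ?thesis by (simp only: mult_1)
qed

definition q1 :: real where "q1 = 1 + 8 * E * H / \<kappa>"
definition q2 :: real where "q2 = 1 + 4 * H\<^sup>2 / \<kappa>"

lemma Qd_eq: "Qd z = q1 + 2 * q2 * z"
  using \<kappa>_neg by (simp add: Qd_def q1_def q2_def field_simps power2_eq_square)

lemma Qf_eq: "Qf z = q2 * z\<^sup>2 + q1 * z + 4 * E\<^sup>2 / \<kappa>"
  using \<kappa>_neg by (simp add: Qf_def q1_def q2_def field_simps power2_eq_square)

text \<open>\<open>Qd\<close> is affine, so the difference between \<open>Sv\<close> and its mirror
  image solves a homogeneous linear equation, with zero initial data at a critical point.\<close>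

lemma Sv_symmetric:
  assumes "Pv c = 0"
  shows "Sv (c - u) = Sv (c + u)"
proof -
  have 1: "((\<lambda>u. c + u) has_real_derivative 1) (at u)" "((\<lambda>u. c - u) has_real_derivative -1) (at u)" for u
    by (auto intro!: derivative_eq_intros)
  have "Sv (c + u) - Sv (c - u) = 0"
  proof (rule linear_ode_unique[where f = "\<lambda>u. Sv (c + u) - Sv (c - u)" and h = "\<lambda>u. Pv (c + u) + Pv (c - u)" and c = "4 * q2"])
    show "((\<lambda>u. Sv (c + u) - Sv (c - u)) has_real_derivative Pv (c + v) + Pv (c - v)) (at v)" for v
      using DERIV_diff[OF DERIV_chain2[OF Sv_deriv 1(1)] DERIV_chain2[OF Sv_deriv 1(2)]] by simp
    show "((\<lambda>v. Pv (c + v) + Pv (c - v)) has_real_derivative 4 * q2 * (Sv (c + v) - Sv (c - v))) (at v)" for v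
      using DERIV_add[OF DERIV_chain2[OF Pv_deriv 1(1)] DERIV_chain2[OF Pv_deriv 1(2)]] by (simp add: Qd_eq right_diff_distrib distrib_left mult.assoc)
  qed (use assms in auto)
  then show ?thesis by simp
qed

lemma Yv_symmetric: "Pv c = 0 \<Longrightarrow> Yv (c - u) = 2 * Yv c - Yv (c + u)"
  by (rule odd_antiderivative[OF Yv_deriv]) (simp add: Sv_symmetric)

lemma g_symmetric: "Pv c = 0 \<Longrightarrow> g (c - u) = 2 * g c - g (c + u)"
  by (rule odd_antiderivative[OF g_deriv]) (simp add: Sv_symmetric)

text \<open>The inverse \<open>g\<close> of the arclength is itself symmetric, so a reflection in
  arclength is one in the parameter s.\<close>

lemma symmetric_at_critical:
  assumes "cos (\<alpha> s) = 0"
  shows "symmetric_at s I x y"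
proof -
  define c where "c = \<sigma> s"
  have P: "Pv c = 0" using assms by (simp add: Pv_zero_iff c_def)
  have s: "s = g c" by (simp add: c_def)
  have "x (s - u) = x (s + u) \<and> y (s - u) = 2 * y s - y (s + u)" for u
  proof -
    define w where "w = \<sigma> (s + u) - c"
    have su: "s + u = g (c + w)" by (simp add: w_def)
    moreover have "s - u = g (c - w)" using g_symmetric[OF P, of w] su s by simp
    ultimately show ?thesis using Sv_symmetric[OF P, of w] Yv_symmetric[OF P, of w]
      by (simp add: x_g Yv_def s)
  qed
  then show ?thesis by (simp add: symmetric_at_def I_UNIV)
qed

end

lemma same_sgn: "sgn a = sgn b \<Longrightarrow> (0 < a \<longleftrightarrow> 0 < b) \<and> (a < 0 \<longleftrightarrow> b < 0)" for a b :: real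
  by (auto simp: sgn_real_def split: if_splits)

context profile_line
begin

lemma Rf_sgn: "sgn (Rf (Sv v)) = sgn \<tau> * sgn (E + H * Sv v)"
proof -
  have "sqrt (1 + (1 + \<rho>) * Sv v) > 0" using Sv_pos[of v] \<rho>_pos by (simp add: add_pos_pos)
  then show ?thesis using Sv_pos[of v] by (simp add: Rf_def sgn_mult sgn_divide)
qed

lemma Rf_zero_iff: "Rf (Sv v) = 0 \<longleftrightarrow> E + H * Sv v = 0"
  using Rf_sgn[of v] \<tau>_nz by (metis mult_eq_0_iff sgn_0_0)

lemma x_g_less_iff: "x (g v) < x (g w) \<longleftrightarrow> Sv v < Sv w"
  unfolding x_g arsinh_less_iff_real by simp

lemma x_g_le_iff: "x (g v) \<le> x (g w) \<longleftrightarrow> Sv v \<le> Sv w"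
  by (simp add: not_less[symmetric] x_g_less_iff)

lemma Sv_continuous: "continuous_on T Sv" and Yv_continuous: "continuous_on T Yv"
  and Pv_continuous: "continuous_on T Pv"
  by (rule DERIV_continuous_on[OF has_field_derivative_at_within[OF Sv_deriv]]
      DERIV_continuous_on[OF has_field_derivative_at_within[OF Yv_deriv]]
      DERIV_continuous_on[OF has_field_derivative_at_within[OF Pv_deriv]])+

text \<open>Rolle's theorem. Only points strictly between two points of \<open>T\<close> matter, so
  E + H S may vanish at an end of \<open>T\<close>.\<close>

lemma inj_on_Yv:
  assumes "\<And>p q z. \<lbrakk>p \<in> T; q \<in> T; p < z; z < q\<rbrakk> \<Longrightarrow> E + H * Sv z \<noteq> 0"
  shows "inj_on Yv T"
proof (rule inj_onI)
  have *: False if pq: "p \<in> T" "q \<in> T" "p < q" "Yv p = Yv q" for p q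
  proof -
    have "Yv differentiable (at z)" for z
      using Yv_deriv[of z] by (rule real_differentiable_def[THEN iffD2, OF exI])
    then obtain z where z: "p < z" "z < q" "(Yv has_real_derivative 0) (at z)"
      using Rolle[OF pq(3,4) Yv_continuous] by blast
    then have "Rf (Sv z) = 0" using DERIV_unique[OF Yv_deriv] by blast
    then show False using assms[OF pq(1,2) z(1,2)] by (simp add: Rf_zero_iff)
  qed
  show "p = q" if "p \<in> T" "q \<in> T" "Yv p = Yv q" for p q
    using *[of p q] *[of q p] that by (metis linorder_neqE_linordered_idom)
qed

lemma y_inj_on:
  assumes "inj_on Yv T"
  shows "inj_on y (g ` T)"
  using assms by (auto simp: inj_on_def Yv_def)

lemma x_g_deriv: "((\<lambda>v. x (g v)) has_real_derivative cos (\<alpha> (g v)) / lam (g v)) (at v)"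
  by (rule along_g) (use x_deriv[OF int_UNIV] lam_pos[of "g v"] in simp)

end

section \<open>Generating curves that are graphs x = F(y)\<close>

text \<open>The condition holds if E > 0 and also if H = 0; it makes y strictly monotone along the
  curve.\<close>

locale profile_graph = profile_line +
  assumes sgn_E: "\<And>v. sgn (E + H * Sv v) = sgn E"
begin

definition \<epsilon> :: real where "\<epsilon> = sgn \<tau> * sgn E"

lemma \<epsilon>_sq: "\<epsilon> * \<epsilon> = 1" using \<tau>_nz E_nz by (auto simp: \<epsilon>_def sgn_real_def)

lemma \<epsilon>_Rf: "\<epsilon> * Rf (Sv v) > 0"
proof -
  have "sgn (\<epsilon> * Rf (Sv v)) = \<epsilon> * \<epsilon>"
    using Rf_sgn[of v] by (simp add: sgn_mult sgn_E \<epsilon>_def)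
  then show ?thesis by (simp add: \<epsilon>_sq sgn_1_pos)
qed

lemma Rf_nz: "Rf (Sv v) \<noteq> 0"
  using \<epsilon>_Rf[of v] by auto

lemma \<epsilon>_Yv_mono: "v < w \<Longrightarrow> \<epsilon> * Yv v < \<epsilon> * Yv w"
  by (rule DERIV_pos_imp_increasing[where f = "\<lambda>v. \<epsilon> * Yv v"])
     (use DERIV_cmult[OF Yv_deriv, of \<epsilon>] \<epsilon>_Rf in blast)+

lemma inj_Yv: "inj Yv"
  by (rule inj_on_Yv) (use Rf_nz in \<open>simp add: Rf_zero_iff\<close>)

lemma open_range_Yv: "open (range Yv)"
  by (rule injective_into_1d_imp_open_map_UNIV[OF open_UNIV Yv_continuous inj_Yv]) simp

lemma is_interval_range_Yv: "is_interval (range Yv)"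
  using connected_continuous_image[OF Yv_continuous[of UNIV] connected_UNIV] by (simp add: is_interval_connected_1)

definition Yi :: "real \<Rightarrow> real" where "Yi = inv Yv"

lemma Yi_Yv [simp]: "Yi (Yv v) = v" by (simp add: Yi_def inj_Yv)

text \<open>Outside the range of \<open>Yv\<close> its values are arbitrary, since \<open>Yi\<close>
  is a chosen inverse.\<close>

definition F :: "real \<Rightarrow> real" where "F z = x (g (Yi z))"

definition F' :: "real \<Rightarrow> real" where
  "F' z = cos (\<alpha> (g (Yi z))) / lam (g (Yi z)) / Rf (Sv (Yi z))"

lemma F_Yv [simp]: "F (Yv v) = x (g v)" by (simp add: F_def)

lemma F_y: "F (y s) = x s"
  using F_Yv[of "\<sigma> s"] by (simp add: Yv_def)

lemma bij_y: "bij_betw y I (range Yv)"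
proof -
  have y: "y = Yv \<circ> \<sigma>" by (simp add: fun_eq_iff Yv_def)
  have "bij_betw \<sigma> UNIV UNIV"
    using \<sigma>_surj strict_mono_imp_inj_on[OF \<sigma>_strict_mono] by (simp add: bij_betw_def)
  moreover have "bij_betw Yv UNIV (range Yv)" using inj_Yv by (simp add: bij_betw_def)
  ultimately have "bij_betw (Yv \<circ> \<sigma>) UNIV (range Yv)" by (rule bij_betw_trans)
  then show ?thesis unfolding y[symmetric] I_UNIV .
qed

lemma F_deriv: "z \<in> range Yv \<Longrightarrow> (F has_real_derivative F' z) (at z)"
proof -
  assume "z \<in> range Yv"
  then obtain v where z: "z = Yv v" by blast
  have "(Yi has_real_derivative inverse (Rf (Sv v))) (at z)"
    by (rule has_real_derivative_inverse[OF _ Rf_nz Yv_continuous]) (use Yv_deriv[of v] in \<open>simp_all add: z\<close>)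
  moreover have "((\<lambda>v. x (g v)) has_real_derivative cos (\<alpha> (g (Yi z))) / lam (g (Yi z))) (at (Yi z))"
    by (rule x_g_deriv)
  ultimately have "((\<lambda>z. x (g (Yi z))) has_real_derivative cos (\<alpha> (g (Yi z))) / lam (g (Yi z)) * inverse (Rf (Sv v))) (at z)"
    by (rule DERIV_chain2[rotated])
  then show ?thesis by (simp add: F_def[abs_def] F'_def z divide_inverse)
qed

lemma F'_zero_iff: "F' (Yv v) = 0 \<longleftrightarrow> Pv v = 0"
  using lam_pos[of "g v"] Rf_nz[of v] by (simp add: F'_def Pv_zero_iff)

lemma F_symmetric:
  assumes "Pv c = 0" "Yv c + u \<in> range Yv"
  shows "Yv c - u \<in> range Yv \<and> F (Yv c - u) = F (Yv c + u)"
proof -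
  obtain w where w: "Yv c + u = Yv (c + w)" using assms(2) by (metis add.commute diff_add_cancel rangeE)
  have "Yv c - u = Yv (c - w)" using Yv_symmetric[OF assms(1), of w] w by simp
  then show ?thesis using w Sv_symmetric[OF assms(1), of w] by (simp add: x_g)
qed

text \<open>About a critical point \<open>Yv\<close> is odd up to a constant and monotone up to the
  sign \<epsilon>, so it preserves the order of the distances to the axis of reflection.\<close>

lemma abs_Yv_less:
  assumes "Pv c = 0"
  shows "\<bar>Yv v - Yv c\<bar> < \<bar>Yv w - Yv c\<bar> \<longleftrightarrow> \<bar>v - c\<bar> < \<bar>w - c\<bar>"
proof -
  define h where "h u = \<epsilon> * (Yv (c + u) - Yv c)" for u
  have m: "strict_mono h" unfolding strict_mono_def h_def using \<epsilon>_Yv_mono by (simp add: right_diff_distrib)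
  have e1: "\<bar>\<epsilon>\<bar> = 1" using \<epsilon>_sq by (metis abs_mult_self_eq abs_1 abs_mult power2_eq_1_iff power2_eq_square abs_minus_cancel)
  have a: "\<bar>Yv v - Yv c\<bar> = h \<bar>v - c\<bar>" for v
  proof -
    have "\<bar>Yv v - Yv c\<bar> = \<bar>h (v - c)\<bar>" by (simp add: h_def abs_mult e1)
    moreover have "h (- u) = - h u" for u
      using Yv_symmetric[OF assms, of u] by (simp add: h_def right_diff_distrib)
    moreover have "h 0 = 0" by (simp add: h_def)
    then have "h u \<ge> 0" if "u \<ge> 0" for u using strict_mono_mono[OF m, THEN monoD, OF that] by simp
    moreover have "\<bar>h u\<bar> = h \<bar>u\<bar>" for u
    proof (cases "u \<ge> 0")
      case True
      with calculation(3)[OF True] show ?thesis by simp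
    next
      case False
      then have "h (- u) \<ge> 0" by (intro calculation(3)) simp
      then show ?thesis using False calculation(2)[of u] by simp
    qed
    ultimately show ?thesis by simp
  qed
  show ?thesis unfolding a using strict_mono_less[OF m] .
qed

end

section \<open>Nonzero energy with 4 H^2 + \<kappa> at most 0: the open types\<close>

locale profile_open = profile_line +
  assumes q2_nonneg: "q2 \<ge> 0"
begin

lemma q0_neg: "4 * E\<^sup>2 / \<kappa> < 0" using E_nz \<kappa>_neg by (simp add: divide_pos_neg)

lemma Qf_nonneg: "Qf (Sv v) \<ge> 0" using Pv_sq[of v] zero_le_power2[of "Pv v"] by simp

text \<open>The square of \<open>Qd\<close> is \<open>4 * q2 * Qf\<close> plus the discriminant of
  \<open>Qf\<close>. Along the curve \<open>Qf\<close> is nonnegative, so the root of the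
  discriminant is a lower bound.\<close>

lemma Qd_lower: "\<exists>\<delta>>0. \<forall>v. \<delta> \<le> Qd (Sv v)"
proof -
  define \<delta>2 where "\<delta>2 = q1\<^sup>2 - 4 * q2 * (4 * E\<^sup>2 / \<kappa>)"
  have "\<delta>2 > 0"
  proof (cases "q2 = 0")
    case True
    \<comment> \<open>Otherwise \<open>Qf\<close> would be a negative constant.\<close>
    have "q1 \<noteq> 0" using Qf_nonneg[of 0] q0_neg True by (auto simp: Qf_eq)
    then show ?thesis using True by (simp add: \<delta>2_def)
  next
    case False
    then have "q2 * (4 * E\<^sup>2 / \<kappa>) < 0" using q2_nonneg q0_neg by (intro mult_pos_neg) auto
    then show ?thesis using zero_le_power2[of q1] unfolding \<delta>2_def by linarith
  qed
  moreover have "sqrt \<delta>2 \<le> Qd (Sv v)" for v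
  proof (rule real_le_lsqrt)
    \<comment> \<open>This fixes the sign of \<open>Qd\<close>: the difference z Qf'(z) - Qf(z)
      contains the constant term of \<open>Qf\<close> with the opposite sign, and that term is
      negative.\<close>
    have eq: "Qd (Sv v) * Sv v = Qf (Sv v) + q2 * (Sv v)\<^sup>2 - 4 * E\<^sup>2 / \<kappa>"
      by (simp add: Qd_eq Qf_eq algebra_simps power2_eq_square)
    have "Qd (Sv v) * Sv v > 0"
      using eq Qf_nonneg[of v] q0_neg mult_nonneg_nonneg[OF q2_nonneg zero_le_power2, of "Sv v"] by linarith
    then show "0 \<le> Qd (Sv v)" using Sv_pos[of v] by (simp add: zero_less_mult_iff)
    have "(Qd (Sv v))\<^sup>2 = 4 * q2 * Qf (Sv v) + \<delta>2"
      by (simp add: Qd_eq Qf_eq \<delta>2_def algebra_simps power2_eq_square)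
    moreover have "4 * q2 * Qf (Sv v) \<ge> 0" using q2_nonneg Qf_nonneg by simp
    ultimately show "\<delta>2 \<le> (Qd (Sv v))\<^sup>2" by linarith
  qed
  ultimately show ?thesis by (intro exI[of _ "sqrt \<delta>2"]) auto
qed

text \<open>The derivative of \<open>Pv\<close> has a positive lower bound, so \<open>Pv\<close>
  must vanish somewhere and increases at least linearly from there.\<close>

lemma ex_vertex:
  obtains v0 \<delta> where "Pv v0 = 0" "\<delta> > 0" "\<And>v. v0 \<le> v \<Longrightarrow> \<delta> * (v - v0) \<le> Pv v"
proof -
  obtain \<delta> where \<delta>: "\<delta> > 0" "\<And>v. \<delta> \<le> Qd (Sv v)" using Qd_lower by blast
  have m: "Pv a - \<delta> * a \<le> Pv b - \<delta> * b" if "a \<le> b" for a b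
  proof (rule DERIV_nonneg_imp_nondecreasing[OF that, where f = "\<lambda>v. Pv v - \<delta> * v"])
    fix v
    have "((\<lambda>v. Pv v - \<delta> * v) has_real_derivative 2 * Qd (Sv v) - \<delta>) (at v)"
      by (rule derivative_eq_intros Pv_deriv refl | simp)+
    then show "\<exists>y. ((\<lambda>v. Pv v - \<delta> * v) has_real_derivative y) (at v) \<and> 0 \<le> y"
      using \<delta>(1) \<delta>(2)[of v] by (intro exI[of _ "2 * Qd (Sv v) - \<delta>"]) auto
  qed
  define r where "r = \<bar>Pv 0\<bar> / \<delta>"
  have r0: "r \<ge> 0" "\<delta> * r = \<bar>Pv 0\<bar>" using \<delta>(1) by (simp_all add: r_def)
  have "0 \<le> Pv r" "Pv (- r) \<le> 0" using m[of 0 r] m[of "- r" 0] r0 by auto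
  then obtain v0 where v0: "Pv v0 = 0"
    using IVT'[of Pv "- r" 0 r, OF _ _ _ Pv_continuous] r0(1) by auto
  show ?thesis
  proof (rule that[OF v0 \<delta>(1)])
    show "\<delta> * (v - v0) \<le> Pv v" if "v0 \<le> v" for v
      using m[OF that] v0 by (simp add: right_diff_distrib)
  qed
qed

end

locale profile_open_vertex = profile_open +
  fixes v0 \<delta> :: real
  assumes v0: "Pv v0 = 0" and \<delta>: "\<delta> > 0" "\<And>v. v0 \<le> v \<Longrightarrow> \<delta> * (v - v0) \<le> Pv v"
begin

lemma Sv_mono_right: "v0 \<le> v \<Longrightarrow> v < w \<Longrightarrow> Sv v < Sv w"
proof (rule DERIV_pos_imp_increasing_open[OF _ _ Sv_continuous])
  fix z assume "v0 \<le> v" "v < z"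
  then have "0 < \<delta> * (z - v0)" "v0 \<le> z" using \<delta>(1) by auto
  then have "0 < Pv z" using \<delta>(2)[of z] by linarith
  then show "\<exists>y. (Sv has_real_derivative y) (at z) \<and> 0 < y" using Sv_deriv by blast
qed

lemma Sv_abs: "Sv v = Sv (v0 + \<bar>v - v0\<bar>)"
  using Sv_symmetric[OF v0, of "v0 - v"] by (simp add: abs_if)

lemma Sv_less_iff: "Sv v < Sv w \<longleftrightarrow> \<bar>v - v0\<bar> < \<bar>w - v0\<bar>"
proof -
  have "strict_mono_on {0..} (\<lambda>u. Sv (v0 + u))"
    by (rule strict_mono_onI) (use Sv_mono_right in auto)
  then have "Sv (v0 + a) < Sv (v0 + b) \<longleftrightarrow> a < b" if "a \<ge> 0" "b \<ge> 0" for a b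
    using that strict_mono_on_less[of "{0..}" "\<lambda>u. Sv (v0 + u)" a b] by simp
  then show ?thesis unfolding Sv_abs[of v] Sv_abs[of w] by simp
qed

text \<open>A second critical point would be another axis of reflection, and the mirror image of v0
  in it would share the minimal value, which is attained at v0 only.\<close>

lemma Pv_zero: "Pv v = 0 \<longleftrightarrow> v = v0"
proof
  assume P: "Pv v = 0"
  show "v = v0"
  proof (rule ccontr)
    assume "v \<noteq> v0"
    then have "Sv v0 < Sv v" by (simp add: Sv_less_iff)
    moreover have "Sv (v - (v - v0)) = Sv (v + (v - v0))" by (rule Sv_symmetric[OF P])
    moreover have "Sv v0 < Sv (2 * v - v0)" using \<open>v \<noteq> v0\<close> by (simp add: Sv_less_iff)
    ultimately show False by (simp add: algebra_simps)
  qed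
qed (simp add: v0)

text \<open>Integrating the linear lower bound for \<open>Pv\<close> gives quadratic growth.\<close>

lemma Sv_unbounded: "\<exists>v>v0. b < Sv v"
proof -
  have m: "Sv v0 - \<delta> / 2 * (v0 - v0)\<^sup>2 \<le> Sv v - \<delta> / 2 * (v - v0)\<^sup>2" if "v0 \<le> v" for v
  proof (rule deriv_nonneg_imp_mono[where g = "\<lambda>v. Sv v - \<delta> / 2 * (v - v0)\<^sup>2" and g' = "\<lambda>v. Pv v - \<delta> * (v - v0)", OF _ _ that])
    show "((\<lambda>v. Sv v - \<delta> / 2 * (v - v0)\<^sup>2) has_real_derivative Pv z - \<delta> * (z - v0)) (at z)" for z
      by (rule derivative_eq_intros Sv_deriv refl | simp)+
    show "0 \<le> Pv z - \<delta> * (z - v0)" if "z \<in> {v0..v}" for z using \<delta>(2)[of z] that by simp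
  qed
  define v where "v = v0 + 1 + 2 * \<bar>b\<bar> / \<delta>"
  have p: "2 * \<bar>b\<bar> / \<delta> \<ge> 0" using \<delta>(1) by simp
  then have v: "v0 < v" "1 \<le> v - v0" by (simp_all add: v_def)
  have "\<bar>b\<bar> \<le> \<delta> / 2 * (v - v0)"
  proof -
    have "\<delta> * (2 * \<bar>b\<bar> / \<delta>) = 2 * \<bar>b\<bar>" using \<delta>(1) by simp
    moreover have "\<delta> * (v - v0) = \<delta> + \<delta> * (2 * \<bar>b\<bar> / \<delta>)" by (simp add: v_def distrib_left)
    ultimately show ?thesis using \<delta>(1) by linarith
  qed
  also have "\<dots> \<le> \<delta> / 2 * (v - v0)\<^sup>2"
    using v \<delta>(1) by (intro mult_left_mono) (simp_all add: power2_eq_square mult_le_cancel_right1)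
  also have "\<dots> < Sv v" using m[of v] v Sv_pos[of v0] by simp
  finally show ?thesis using v by (intro exI[of _ v]) auto
qed

lemma x_unbounded: "\<not> bdd_above (x ` I)"
proof
  assume "bdd_above (x ` I)"
  then obtain b where b: "\<And>s. x s \<le> b" unfolding bdd_above_def I_UNIV by auto
  obtain v where v: "(sinh b)\<^sup>2 < Sv v" using Sv_unbounded by blast
  have "0 \<le> x (g v)" "x (g v) \<le> b" using x_pos[of "g v"] b by (auto simp: less_imp_le)
  then have "(sinh (x (g v)))\<^sup>2 \<le> (sinh b)\<^sup>2" by (intro power_mono) auto
  then show False using v by (simp add: Sv_def S_def)
qed

lemma open_nodoid:
  assumes "E < 0" "H > 0"
  shows "open_nodoid_type I x y \<alpha>"
proof -
  \<comment> \<open>The value of S at which y turns back.\<close>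
  define t0 where "t0 = - E / H"
  have t0: "t0 > 0" "E + H * t0 = 0" using assms by (simp_all add: t0_def divide_pos_pos field_simps)
  have sg: "sgn (E + H * z) = sgn (z - t0)" for z
  proof -
    have "E + H * z = H * (z - t0)" using t0(2) by (simp add: right_diff_distrib)
    then show ?thesis using assms by (simp add: sgn_mult)
  qed
  \<comment> \<open>\<open>Qf\<close> vanishes at \<open>Sv v0\<close> and is positive at t0, where
    its energy term is 0. Since \<open>Qf\<close>(z) / z increases for z > 0, t0 must be the larger
    of the two.\<close>
  have "Sv v0 < t0"
  proof (rule ccontr)
    assume "\<not> ?thesis"
    then have le: "t0 \<le> Sv v0" by simp
    have "Qf t0 = t0 * (1 + t0)" by (simp add: Qf_def t0(2))
    then have "Qf t0 > 0" using t0(1) by simp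
    moreover have "Qf (Sv v0) = 0" using Pv_sq[of v0] v0 by simp
    then have "Qf t0 * Sv v0 = (Sv v0 - t0) * (4 * E\<^sup>2 / \<kappa>) - q2 * t0 * Sv v0 * (Sv v0 - t0)"
      unfolding Qf_eq by (simp add: algebra_simps power2_eq_square) algebra
    moreover have "(Sv v0 - t0) * (4 * E\<^sup>2 / \<kappa>) \<le> 0"
      by (rule mult_nonneg_nonpos) (use le q0_neg in auto)
    moreover have "q2 * t0 * Sv v0 * (Sv v0 - t0) \<ge> 0"
      using le t0(1) q2_nonneg Sv_pos[of v0] by simp
    moreover have "Qf t0 * Sv v0 > 0" using \<open>Qf t0 > 0\<close> Sv_pos by simp
    ultimately show False by linarith
  qed
  moreover obtain w where "w > v0" "t0 < Sv w" using Sv_unbounded by blast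
  ultimately obtain v1 where v1: "v0 \<le> v1" "Sv v1 = t0"
    using IVT'[of Sv v0 t0 w, OF _ _ _ Sv_continuous] by auto
  then have v1': "v0 < v1" using \<open>Sv v0 < t0\<close> by (cases "v1 = v0") auto
  \<comment> \<open>The mirror image of v1 in v0; y turns at v1 and v2 and nowhere else.\<close>
  define v2 where "v2 = 2 * v0 - v1"
  have sgS: "sgn (sin (\<alpha> (g v))) = sgn \<tau> * sgn (\<bar>v - v0\<bar> - (v1 - v0))" for v
  proof -
    have "sgn (Sv v - Sv v1) = sgn (\<bar>v - v0\<bar> - \<bar>v1 - v0\<bar>)"
      using Sv_less_iff[of v v1] Sv_less_iff[of v1 v] by (simp add: sgn_real_def) linarith
    then show ?thesis using v1 by (simp add: sgn_sin sg)
  qed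
  have nz: "E + H * Sv v \<noteq> 0" if "v \<noteq> v1" "v \<noteq> v2" for v
  proof
    assume "E + H * Sv v = 0"
    then have "sgn (sin (\<alpha> (g v))) = 0" by (simp add: sgn_sin)
    then have "\<bar>v - v0\<bar> = v1 - v0" using \<tau>_nz by (simp add: sgS sgn_eq_0_iff)
    then show False using that by (auto simp: v2_def abs_if split: if_splits)
  qed
  have cs: "sgn (sin (\<alpha> s)) = sgn \<tau> * sgn (\<bar>\<sigma> s - v0\<bar> - (v1 - v0))" for s
    using sgS[of "\<sigma> s"] by simp
  have le_g: "s \<le> g v \<longleftrightarrow> \<sigma> s \<le> v" and ge_g: "g v \<le> s \<longleftrightarrow> v \<le> \<sigma> s"
    and less_g: "s < g v \<longleftrightarrow> \<sigma> s < v" and gr_g: "g v < s \<longleftrightarrow> v < \<sigma> s" for s v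
    using strict_mono_less_eq[OF \<sigma>_strict_mono, of s "g v"] strict_mono_less_eq[OF \<sigma>_strict_mono, of "g v" s]
      strict_mono_less[OF \<sigma>_strict_mono, of s "g v"] strict_mono_less[OF \<sigma>_strict_mono, of "g v" s] by simp_all
  have im: "g ` T = {s. \<sigma> s \<in> T}" for T
  proof safe
    fix s assume "\<sigma> s \<in> T"
    then show "s \<in> g ` T" using imageI[of "\<sigma> s" T g] by simp
  qed simp
  have inj: "inj_on y {s. \<sigma> s \<in> T}" if "\<And>p q z. \<lbrakk>p \<in> T; q \<in> T; p < z; z < q\<rbrakk> \<Longrightarrow> z \<noteq> v1 \<and> z \<noteq> v2" for T
    unfolding im[symmetric] by (rule y_inj_on, rule inj_on_Yv, rule nz) (use that in blast)+
  have zero: "sin (\<alpha> s) = 0 \<longleftrightarrow> sgn (sin (\<alpha> s)) = 0" for s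
    by (simp add: sgn_0_0)
  have ts: "sgn \<tau> = 1 \<or> sgn \<tau> = -1" using \<tau>_nz by (simp add: sgn_real_def)
  have right: "two_graphs (I \<inter> {g v0..}) y \<alpha>"
    unfolding two_graphs_def
  proof (intro exI[of _ "g v1"] conjI)
    show "changes_sign_once (\<lambda>s. sin (\<alpha> s)) (I \<inter> {g v0..}) (g v1)"
      unfolding changes_sign_once_def
    proof (intro conjI)
      show "g v1 \<in> I \<inter> {g v0..}" using v1 by (simp add: I_UNIV ge_g)
      show "\<exists>s\<in>I \<inter> {g v0..}. s < g v1" using v1' by (intro bexI[of _ "g v0"]) (simp_all add: I_UNIV less_g)
      show "\<exists>s\<in>I \<inter> {g v0..}. g v1 < s" using v1' by (intro bexI[of _ "g (v1 + 1)"]) (simp_all add: I_UNIV ge_g gr_g)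
      show "sin (\<alpha> (g v1)) = 0" unfolding zero cs using v1 by simp
      have *: "sgn (sin (\<alpha> s)) = sgn \<tau> * sgn (\<sigma> s - v1)" if "s \<in> I \<inter> {g v0..}" for s
        using that unfolding cs by (simp add: ge_g)
      show "(\<forall>s\<in>I \<inter> {g v0..}. (s < g v1 \<longrightarrow> sin (\<alpha> s) < 0) \<and> (g v1 < s \<longrightarrow> 0 < sin (\<alpha> s))) \<or>
        (\<forall>s\<in>I \<inter> {g v0..}. (s < g v1 \<longrightarrow> 0 < sin (\<alpha> s)) \<and> (g v1 < s \<longrightarrow> sin (\<alpha> s) < 0))"
      proof -
        have "(0 < sin (\<alpha> s) \<longleftrightarrow> 0 < sgn \<tau> * (\<sigma> s - v1)) \<and> (sin (\<alpha> s) < 0 \<longleftrightarrow> sgn \<tau> * (\<sigma> s - v1) < 0)"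
          if "s \<in> I \<inter> {g v0..}" for s
          by (rule same_sgn) (simp only: *[OF that] sgn_mult sgn_sgn)
        with ts show ?thesis by (elim disjE) (simp_all add: less_g gr_g del: Int_iff)
      qed
    qed
    show "inj_on y (I \<inter> {g v0..} \<inter> {..g v1})"
      by (rule inj_on_subset[OF inj[of "{v0..v1}"]]) (use v1' in \<open>auto simp: le_g ge_g v2_def\<close>)
    show "inj_on y (I \<inter> {g v0..} \<inter> {g v1..})"
      by (rule inj_on_subset[OF inj[of "{v1..}"]]) (use v1' in \<open>auto simp: le_g ge_g v2_def\<close>)
  qed
  have left: "two_graphs (I \<inter> {..g v0}) y \<alpha>"
    unfolding two_graphs_def
  proof (intro exI[of _ "g v2"] conjI)
    show "changes_sign_once (\<lambda>s. sin (\<alpha> s)) (I \<inter> {..g v0}) (g v2)"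
      unfolding changes_sign_once_def
    proof (intro conjI)
      show "g v2 \<in> I \<inter> {..g v0}" using v1' by (simp add: I_UNIV le_g v2_def)
      show "\<exists>s\<in>I \<inter> {..g v0}. g v2 < s" using v1' by (intro bexI[of _ "g v0"]) (simp_all add: I_UNIV gr_g v2_def)
      show "\<exists>s\<in>I \<inter> {..g v0}. s < g v2" using v1' by (intro bexI[of _ "g (v2 - 1)"]) (simp_all add: I_UNIV le_g less_g v2_def)
      show "sin (\<alpha> (g v2)) = 0" unfolding zero cs using v1' by (simp add: v2_def)
      have *: "sgn (sin (\<alpha> s)) = sgn \<tau> * sgn (v2 - \<sigma> s)" if "s \<in> I \<inter> {..g v0}" for s
      proof -
        have "\<bar>\<sigma> s - v0\<bar> - (v1 - v0) = v2 - \<sigma> s"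
          using that by (simp add: le_g v2_def)
        then show ?thesis by (simp only: cs)
      qed
      show "(\<forall>s\<in>I \<inter> {..g v0}. (s < g v2 \<longrightarrow> sin (\<alpha> s) < 0) \<and> (g v2 < s \<longrightarrow> 0 < sin (\<alpha> s))) \<or>
        (\<forall>s\<in>I \<inter> {..g v0}. (s < g v2 \<longrightarrow> 0 < sin (\<alpha> s)) \<and> (g v2 < s \<longrightarrow> sin (\<alpha> s) < 0))"
      proof -
        have "(0 < sin (\<alpha> s) \<longleftrightarrow> 0 < sgn \<tau> * (v2 - \<sigma> s)) \<and> (sin (\<alpha> s) < 0 \<longleftrightarrow> sgn \<tau> * (v2 - \<sigma> s) < 0)"
          if "s \<in> I \<inter> {..g v0}" for s
          by (rule same_sgn) (simp only: *[OF that] sgn_mult sgn_sgn)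
        with ts show ?thesis by (elim disjE) (simp_all add: less_g gr_g del: Int_iff)
      qed
    qed
    show "inj_on y (I \<inter> {..g v0} \<inter> {..g v2})"
      by (rule inj_on_subset[OF inj[of "{..v2}"]]) (use v1' in \<open>auto simp: le_g ge_g v2_def\<close>)
    show "inj_on y (I \<inter> {..g v0} \<inter> {g v2..})"
      by (rule inj_on_subset[OF inj[of "{v2..v0}"]]) (use v1' in \<open>auto simp: le_g ge_g v2_def\<close>)
  qed
  have c: "cos (\<alpha> s) = 0 \<longleftrightarrow> s = g v0" for s
    using Pv_zero_iff[of "\<sigma> s"] Pv_zero[of "\<sigma> s"] by (metis \<sigma>_g g_\<sigma>)
  have "x (g v0) \<le> x s" for s
    using x_g_le_iff[of v0 "\<sigma> s"] Sv_less_iff[of "\<sigma> s" v0] by simp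
  then show ?thesis
    unfolding open_nodoid_type_def
  proof (intro bexI[of _ "g v0"] conjI ballI)
    show "cos (\<alpha> s) = 0 \<longleftrightarrow> s = g v0" for s by (rule c)
    show "0 < x (g v0)" by (rule x_pos)
    show "symmetric_at (g v0) I x y" by (rule symmetric_at_critical) (simp add: c)
  qed (rule x_unbounded left right in_I | assumption)+
qed

end

locale profile_open_graph = profile_open_vertex + profile_graph
begin

lemma open_unduloid: "open_unduloid_type I x y \<alpha>"
  unfolding open_unduloid_type_def
proof (rule exI[of _ F], rule exI[of _ F'], rule exI[of _ "range Yv"], rule exI[of _ "Yv v0"], intro conjI)
  show "open (range Yv)" "is_interval (range Yv)" "bij_betw y I (range Yv)"
    by (rule open_range_Yv is_interval_range_Yv bij_y)+
  show "\<forall>s\<in>I. x s = F (y s)" by (simp add: F_y)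
  show "\<forall>v\<in>range Yv. (F has_real_derivative F' v) (at v)" using F_deriv by blast
  show "Yv v0 \<in> range Yv" by blast
  show "\<forall>v\<in>range Yv. (F' v = 0) = (v = Yv v0)"
    by (auto simp: F'_zero_iff Pv_zero inj_eq[OF inj_Yv])
  show "0 < F (Yv v0)" by (simp add: x_pos)
  show "\<forall>v\<in>range Yv. F (Yv v0) \<le> F v"
  proof -
    have "Sv v0 \<le> Sv w" for w using Sv_less_iff[of w v0] by simp
    then show ?thesis by (auto simp: x_g_le_iff)
  qed
  show "\<forall>u. Yv v0 + u \<in> range Yv \<longrightarrow> Yv v0 - u \<in> range Yv \<and> F (Yv v0 - u) = F (Yv v0 + u)"
    using F_symmetric[OF v0] by blast
  have less: "F p < F q" if "p \<in> range Yv" "q \<in> range Yv" "\<bar>p - Yv v0\<bar> < \<bar>q - Yv v0\<bar>" for p q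
    using that by (auto simp: x_g_less_iff Sv_less_iff abs_Yv_less[OF v0])
  show "strict_antimono_on (range Yv \<inter> {..Yv v0}) F"
    by (rule monotone_onI, rule less) auto
  show "strict_mono_on (range Yv \<inter> {Yv v0..}) F"
    by (rule monotone_onI, rule less) auto
  have "range g = UNIV" using bij_g by (rule bij_is_surj)
  moreover have "F ` range Yv = x ` range g" by (simp only: image_image F_Yv)
  ultimately show "\<not> bdd_above (F ` range Yv)" using x_unbounded by (simp add: I_UNIV)
qed

end

section \<open>Oscillation of S for 4 H^2 + \<kappa> > 0, and the period\<close>

lemma strict_mono_or_antimono_of_nonzero_deriv:
  fixes f f' :: "real \<Rightarrow> real"
  assumes d: "\<And>v. (f has_real_derivative f' v) (at v)" and c: "continuous_on UNIV f'"
    and nz: "\<And>v. a < v \<Longrightarrow> v < b \<Longrightarrow> f' v \<noteq> 0"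
  shows "strict_mono_on {a..b} f \<or> strict_antimono_on {a..b} f"
proof -
  have fc: "continuous_on T f" for T
    by (rule DERIV_continuous_on[OF has_field_derivative_at_within[OF d]])
  have iv: "is_interval (f' ` {a<..<b})"
    using connected_continuous_image[OF continuous_on_subset[OF c subset_UNIV] connected_Ioo[of a b]]
    by (simp add: is_interval_connected_1)
  have "(\<forall>v\<in>{a<..<b}. 0 < f' v) \<or> (\<forall>v\<in>{a<..<b}. f' v < 0)"
  proof (rule ccontr)
    assume "\<not> ?thesis"
    then obtain r q where r: "r \<in> {a<..<b}" "\<not> 0 < f' r" and q: "q \<in> {a<..<b}" "\<not> f' q < 0" by blast
    have "0 \<in> f' ` {a<..<b}"
      by (rule mem_is_interval_1_I[OF iv imageI[OF r(1)] imageI[OF q(1)]]) (use r q in simp_all)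
    then show False using nz by auto
  qed
  then show ?thesis
  proof
    assume p: "\<forall>v\<in>{a<..<b}. 0 < f' v"
    have "f r < f q" if "r \<in> {a..b}" "q \<in> {a..b}" "r < q" for r q
      by (rule DERIV_pos_imp_increasing_open[OF \<open>r < q\<close> _ fc]) (use p d that in \<open>force\<close>)
    then show ?thesis by (blast intro: monotone_onI)
  next
    assume p: "\<forall>v\<in>{a<..<b}. f' v < 0"
    have "f q < f r" if "r \<in> {a..b}" "q \<in> {a..b}" "r < q" for r q
      by (rule DERIV_neg_imp_decreasing_open[OF \<open>r < q\<close> _ fc]) (use p d that in \<open>force\<close>)
    then show ?thesis by (blast intro: monotone_onI)
  qed
qed

lemma arsinh_mono: "(a::real) \<le> b \<Longrightarrow> arsinh a \<le> arsinh b"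
  using arsinh_less_iff_real[of b a] by linarith

locale profile_closed = profile_line +
  assumes closed_case: "4 * H\<^sup>2 + \<kappa> > 0"
begin

text \<open>\<open>k\<close> is -\<open>q2\<close>, \<open>om\<close> the angular frequency,
  \<open>mid\<close> and \<open>amp\<close> the centre and the amplitude of the oscillation.
  \<open>amp\<close> is 0 if S is constant.\<close>

definition k :: real where "k = (4 * H\<^sup>2 + \<kappa>) / (- \<kappa>)"
definition om :: real where "om = 2 * sqrt k"
definition mid :: real where "mid = q1 / (2 * k)"
definition amp :: real where "amp = sqrt ((Sv 0 - mid)\<^sup>2 + (Pv 0 / om)\<^sup>2)"

lemma k_pos: "k > 0" using closed_case \<kappa>_neg by (simp add: k_def divide_pos_neg)

lemma om_pos: "om > 0" using k_pos by (simp add: om_def)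

lemma om_sq: "om\<^sup>2 = 4 * k" using k_pos by (simp add: om_def power_mult_distrib)

lemma q2_k: "q2 = - k" using \<kappa>_neg by (simp add: q2_def k_def field_simps)

lemma amp_nonneg: "amp \<ge> 0" by (simp add: amp_def)

lemma H_pos: "H > 0"
proof -
  have "H \<noteq> 0" using closed_case \<kappa>_neg by auto
  then show ?thesis using H_nonneg by simp
qed

text \<open>Polar coordinates of the initial data in the phase plane, in which the motion is a
  rotation.\<close>

lemma ex_phase: "\<exists>v0. Sv 0 - mid = amp * cos (om * v0) \<and> Pv 0 / om = amp * sin (om * v0)"
proof -
  have "complex_of_real (Sv 0 - mid) + \<i> * complex_of_real (Pv 0 / om) = rcis amp (Arg (Complex (Sv 0 - mid) (Pv 0 / om)))"
    using rcis_cmod_Arg[of "Complex (Sv 0 - mid) (Pv 0 / om)"]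
    by (simp add: amp_def cmod_def complex_eq_iff)
  then have "Sv 0 - mid = amp * cos (Arg (Complex (Sv 0 - mid) (Pv 0 / om)))"
    "Pv 0 / om = amp * sin (Arg (Complex (Sv 0 - mid) (Pv 0 / om)))"
    by (simp_all add: complex_eq_iff rcis_def)
  then show ?thesis
    using om_pos by (intro exI[of _ "Arg (Complex (Sv 0 - mid) (Pv 0 / om)) / om"]) simp
qed

text \<open>As \<open>amp\<close> is nonnegative, S is maximal at this phase.\<close>

definition v0 :: real where
  "v0 = (SOME v0. Sv 0 - mid = amp * cos (om * v0) \<and> Pv 0 / om = amp * sin (om * v0))"

lemma Sv_Pv_explicit: "Sv v = mid + amp * cos (om * (v - v0)) \<and> Pv v = - amp * om * sin (om * (v - v0))"
proof -
  have v0: "Sv 0 - mid = amp * cos (om * v0)" "Pv 0 / om = amp * sin (om * v0)"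
    using someI_ex[OF ex_phase] unfolding v0_def by blast+
  have S: "Sv v - mid - amp * cos (om * (v - v0)) = 0" for v
  proof (rule linear_ode_unique[where f = "\<lambda>v. Sv v - mid - amp * cos (om * (v - v0))"
        and h = "\<lambda>v. Pv v + amp * om * sin (om * (v - v0))" and c = "- om\<^sup>2"])
    show "((\<lambda>v. Sv v - mid - amp * cos (om * (v - v0))) has_real_derivative Pv v + amp * om * sin (om * (v - v0))) (at v)" for v
      by (rule derivative_eq_intros Sv_deriv refl | simp)+
    show "((\<lambda>v. Pv v + amp * om * sin (om * (v - v0))) has_real_derivative - om\<^sup>2 * (Sv v - mid - amp * cos (om * (v - v0)))) (at v)" for v
    proof -
      have "2 * Qd (Sv v) = - om\<^sup>2 * (Sv v - mid)"
        using k_pos by (simp add: Qd_eq q2_k om_sq mid_def field_simps)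
      then show ?thesis
        by (auto intro!: derivative_eq_intros Pv_deriv simp: algebra_simps power2_eq_square)
    qed
    show "Sv 0 - mid - amp * cos (om * (0 - v0)) = 0" using v0(1) by simp
    show "Pv 0 + amp * om * sin (om * (0 - v0)) = 0" using v0(2) om_pos by (simp add: field_simps)
  qed
  have "((\<lambda>v. mid + amp * cos (om * (v - v0))) has_real_derivative - amp * om * sin (om * (v - v0))) (at v)"
    by (rule derivative_eq_intros refl | simp)+
  moreover have "(\<lambda>v. mid + amp * cos (om * (v - v0))) = Sv"
  proof
    show "mid + amp * cos (om * (v - v0)) = Sv v" for v using S[of v] by linarith
  qed
  ultimately have "(Sv has_real_derivative - amp * om * sin (om * (v - v0))) (at v)" by (simp only:)
  from DERIV_unique[OF Sv_deriv this] S[of v] show ?thesis by linarith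
qed

lemma Sv_explicit: "Sv v = mid + amp * cos (om * (v - v0))"
  and Pv_explicit: "Pv v = - amp * om * sin (om * (v - v0))"
  using Sv_Pv_explicit by blast+

text \<open>\<open>Pv_sq\<close> at the maximum of S, where P vanishes: \<open>mid + amp\<close> is
  a zero of \<open>Qf\<close>.\<close>

lemma amp_sq: "4 * k\<^sup>2 * amp\<^sup>2 = q1\<^sup>2 + 4 * k * (4 * E\<^sup>2 / \<kappa>)"
proof -
  have "Qf (mid + amp) = 0"
    using Pv_sq[of v0] by (simp add: Pv_explicit Sv_explicit)
  then have "- k * (mid + amp)\<^sup>2 + q1 * (mid + amp) + 4 * E\<^sup>2 / \<kappa> = 0" by (simp add: Qf_eq q2_k)
  moreover have "q1 = 2 * k * mid" using k_pos by (simp add: mid_def)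
  ultimately show ?thesis by algebra
qed

lemma Qf_closed: "Qf z = k * (amp\<^sup>2 - (z - mid)\<^sup>2)"
proof -
  have "q1 = 2 * k * mid" using k_pos by (simp add: mid_def)
  then have "k * (4 * (Qf z - k * (amp\<^sup>2 - (z - mid)\<^sup>2))) = 0" unfolding Qf_eq q2_k
    using amp_sq by algebra
  then show ?thesis using k_pos by simp
qed

lemma root_disc_eq: "sqrt (root_disc \<kappa> H E) = 2 * (4 * H\<^sup>2 + \<kappa>) * amp"
proof -
  have "root_disc \<kappa> H E = \<kappa>\<^sup>2 * (q1\<^sup>2 + 4 * k * (4 * E\<^sup>2 / \<kappa>))"
    using \<kappa>_neg by (simp add: root_disc_def q1_def k_def field_simps power2_eq_square)
  also have "\<dots> = \<kappa>\<^sup>2 * (4 * k\<^sup>2 * amp\<^sup>2)" by (simp only: amp_sq)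
  also have "\<dots> = (2 * (4 * H\<^sup>2 + \<kappa>) * amp)\<^sup>2"
    using \<kappa>_neg by (simp add: k_def power_mult_distrib power_divide) algebra
  finally show ?thesis using closed_case amp_nonneg by (simp only: real_sqrt_abs) simp
qed

lemma t_min_eq: "t_min \<kappa> H E = mid - amp" and t_max_eq: "t_max \<kappa> H E = mid + amp"
proof -
  have "mid = (- 8 * H * E - \<kappa>) / (2 * (4 * H\<^sup>2 + \<kappa>))"
  proof -
    define a where "a = 4 * H\<^sup>2 + \<kappa>"
    have "a > 0" "k = a / (- \<kappa>)" using closed_case by (simp_all add: a_def k_def)
    then show ?thesis unfolding a_def[symmetric] mid_def q1_def \<open>k = a / (- \<kappa>)\<close> using \<kappa>_neg by (simp add: field_simps)
  qed
  then show "t_min \<kappa> H E = mid - amp" "t_max \<kappa> H E = mid + amp"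
    unfolding t_min_def t_max_def root_disc_eq using closed_case
    by (simp_all add: diff_divide_distrib add_divide_distrib)
qed

lemma t_min_pos: "mid - amp > 0"
proof -
  have "cos (om * (v0 + pi / om - v0)) = -1" using om_pos by simp
  then have "Sv (v0 + pi / om) = mid - amp" unfolding Sv_explicit by simp
  then show ?thesis using Sv_pos by metis
qed

definition h :: real where "h = pi / om"

lemma h_pos: "h > 0" using om_pos by (simp add: h_def)

lemma om_h: "om * h = pi" using om_pos by (simp add: h_def)

lemma Sv_periodic: "Sv (v + 2 * h) = Sv v"
proof -
  have "om * (v + 2 * h - v0) = om * (v - v0) + 2 * pi" using om_h by (simp add: algebra_simps)
  then show ?thesis by (simp only: Sv_explicit cos_periodic)
qed

lemma Pv_v0: "Pv v0 = 0" by (simp add: Pv_explicit)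

text \<open>The advance of y over one full oscillation of S; \<open>period_eq\<close> identifies it
  with the integral.\<close>

definition T :: real where "T = Yv (v0 + h) - Yv (v0 - h)"

lemma Yv_quasiperiodic: "Yv (v + 2 * h) = Yv v + T"
proof -
  have "((\<lambda>v. Yv (v + 2 * h) - Yv v) has_real_derivative Rf (Sv (v + 2 * h)) * 1 - Rf (Sv v)) (at v)" for v
    by (intro DERIV_diff DERIV_chain2[OF Yv_deriv] Yv_deriv) (auto intro!: derivative_eq_intros)
  then have "((\<lambda>v. Yv (v + 2 * h) - Yv v) has_real_derivative 0) (at v)" for v
    by (simp add: Sv_periodic)
  from DERIV_isconst_all[OF allI[OF this], of v "v0 - h"]
  have "Yv (v + 2 * h) - Yv v = Yv (v0 - h + 2 * h) - Yv (v0 - h)" .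
  moreover have "v0 - h + 2 * h = v0 + h" by simp
  ultimately show ?thesis by (simp only: T_def)
qed

lemma Yv_quasiperiodic_int: "Yv (v + 2 * h * of_int n) = Yv v + T * of_int n"
proof (induction n rule: int_induct[where k = 0])
  case (step1 i)
  have "v + 2 * h * of_int (i + 1) = (v + 2 * h * of_int i) + 2 * h" by (simp add: algebra_simps)
  then show ?case using Yv_quasiperiodic[of "v + 2 * h * of_int i"] step1 by (simp add: algebra_simps)
next
  case (step2 i)
  have "v + 2 * h * of_int i = (v + 2 * h * of_int (i - 1)) + 2 * h" by (simp add: algebra_simps)
  then show ?case using Yv_quasiperiodic[of "v + 2 * h * of_int (i - 1)"] step2 by (simp add: algebra_simps)
qed simp

lemma Sv_periodic_int: "Sv (v + 2 * h * of_int n) = Sv v"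
proof -
  have "om * (v + 2 * h * of_int n - v0) = om * (v - v0) + (2 * pi) * of_int n" using om_h by (simp add: algebra_simps)
  then show ?thesis by (simp only: Sv_explicit cos_add cos_int_2pin sin_int_2pin) simp
qed

lemma T_half: "T = 2 * (Yv v0 - Yv (v0 - h))"
  using Yv_symmetric[OF Pv_v0, of h] by (simp add: T_def)

lemma range_Sv: "range Sv = {mid - amp..mid + amp}"
proof (rule set_eqI, rule iffI)
  fix z assume "z \<in> range Sv"
  then obtain v where "z = mid + amp * cos (om * (v - v0))" by (auto simp: Sv_explicit)
  moreover have "\<bar>amp * cos (om * (v - v0))\<bar> \<le> amp * 1"
    unfolding abs_mult using amp_nonneg by (intro mult_mono) auto
  ultimately show "z \<in> {mid - amp..mid + amp}" by auto
next
  fix z assume z: "z \<in> {mid - amp..mid + amp}"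
  have "Sv (v0 - h) = mid - amp" "Sv v0 = mid + amp" using om_h by (simp_all add: Sv_explicit)
  then obtain v where "Sv v = z"
    using IVT'[of Sv "v0 - h" z v0, OF _ _ _ Sv_continuous] z h_pos by auto
  then show "z \<in> range Sv" by blast
qed

lemma x_range: "x ` I = {x_min \<kappa> H E..x_max \<kappa> H E}"
proof -
  have "range g = UNIV" using bij_g by (rule bij_is_surj)
  then have "x ` I = x ` range g" by (simp add: I_UNIV)
  also have "\<dots> = (\<lambda>z. arsinh (sqrt z)) ` {mid - amp..mid + amp}"
    by (simp only: image_image x_g range_Sv[symmetric])
  also have "\<dots> = {arsinh (sqrt (mid - amp))..arsinh (sqrt (mid + amp))}"
  proof (rule set_eqI, rule iffI)
    fix z :: real assume z: "z \<in> {arsinh (sqrt (mid - amp))..arsinh (sqrt (mid + amp))}"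
    have "continuous_on {mid - amp..mid + amp} (\<lambda>z. arsinh (sqrt z))"
      by (intro continuous_intros)
    then obtain w where "mid - amp \<le> w" "w \<le> mid + amp" "arsinh (sqrt w) = z"
      using IVT'[of "\<lambda>z. arsinh (sqrt z)" "mid - amp" z "mid + amp"] z amp_nonneg by auto
    then show "z \<in> (\<lambda>z. arsinh (sqrt z)) ` {mid - amp..mid + amp}" by auto
  qed (auto simp: arsinh_mono)
  finally show ?thesis by (simp add: x_min_def x_max_def t_min_eq t_max_eq)
qed

text \<open>In the half period before v0, S increases from its minimum to its maximum, and its
  inverse is the substitution that turns the advance of y into an integral over x. The integrand is
  singular at both ends, so the fundamental theorem is applied with derivatives in the open interval
  only.\<close>

lemma period_eq:
  assumes "amp > 0"
  shows "period \<kappa> \<tau> H E = T"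
proof -
  define a b where "a = x_min \<kappa> H E" and "b = x_max \<kappa> H E"
  have a: "a = arsinh (sqrt (mid - amp))" and b: "b = arsinh (sqrt (mid + amp))"
    by (simp_all add: a_def b_def x_min_def x_max_def t_min_eq t_max_eq)
  have sa: "sinh a = sqrt (mid - amp)" and sb: "sinh b = sqrt (mid + amp)" by (simp_all add: a b)
  have "a < b" unfolding a b arsinh_less_iff_real using assms by simp
  have "sinh a > 0" unfolding sa using t_min_pos by simp
  then have a0: "a > 0" by simp
  have sq: "(sinh a)\<^sup>2 = mid - amp" "(sinh b)\<^sup>2 = mid + amp" using sa sb t_min_pos amp_nonneg by simp_all
  have bd: "mid - amp \<le> (sinh z)\<^sup>2" "(sinh z)\<^sup>2 \<le> mid + amp" if "z \<in> {a..b}" for z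
  proof -
    have "(sinh a)\<^sup>2 \<le> (sinh z)\<^sup>2" "(sinh z)\<^sup>2 \<le> (sinh b)\<^sup>2"
      using that a0 by (auto intro!: power_mono)
    then show "mid - amp \<le> (sinh z)\<^sup>2" "(sinh z)\<^sup>2 \<le> mid + amp" by (simp_all add: sq)
  qed
  have bds: "mid - amp < (sinh z)\<^sup>2" "(sinh z)\<^sup>2 < mid + amp" if "z \<in> {a<..<b}" for z
  proof -
    have "(sinh a)\<^sup>2 < (sinh z)\<^sup>2" "(sinh z)\<^sup>2 < (sinh b)\<^sup>2"
      using that a0 by (auto intro!: power_strict_mono)
    then show "mid - amp < (sinh z)\<^sup>2" "(sinh z)\<^sup>2 < mid + amp" by (simp_all add: sq)
  qed
  define r where "r z = ((sinh z)\<^sup>2 - mid) / amp" for z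
  have rb: "-1 \<le> r z" "r z \<le> 1" if "z \<in> {a..b}" for z
    using bd[OF that] assms by (simp_all add: r_def divide_simps)
  have rbs: "-1 < r z" "r z < 1" if "z \<in> {a<..<b}" for z
    using bds[OF that] assms by (simp_all add: r_def divide_simps)
  \<comment> \<open>The inverse of S on the half period before v0; there the phase is the negative
    of the arccosine.\<close>
  define V where "V z = v0 - arccos (r z) / om" for z
  have SV: "Sv (V z) = (sinh z)\<^sup>2" if "z \<in> {a..b}" for z
  proof -
    have "om * (V z - v0) = - arccos (r z)" using om_pos by (simp add: V_def)
    then show ?thesis using rb[OF that] assms unfolding Sv_explicit by (simp add: r_def)
  qed
  define f where "f z = (E + H * (sinh z)\<^sup>2) * sqrt (1 - 4 * \<tau>\<^sup>2 / \<kappa> * (tanh z)\<^sup>2) /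
       (\<tau> * sqrt ((sinh z)\<^sup>2 * (cosh z)\<^sup>2 + 4 / \<kappa> * (E + H * (sinh z)\<^sup>2)\<^sup>2))" for z
  have "(f has_integral Yv (V b) - Yv (V a)) {a..b}"
  proof (rule fundamental_theorem_of_calculus_interior[OF less_imp_le[OF \<open>a < b\<close>]])
    have "continuous_on {a..b} V"
      unfolding V_def by (intro continuous_intros continuous_on_arccos) (use rb om_pos assms in \<open>auto simp: r_def intro!: continuous_intros\<close>)
    then show "continuous_on {a..b} (\<lambda>z. Yv (V z))"
      by (rule continuous_on_compose2[OF Yv_continuous[of UNIV]]) auto
    fix z assume z: "z \<in> {a<..<b}"
    then have z': "z \<in> {a..b}" and z0: "z > 0" using a0 by auto
    define s c where "s = sinh z" and "c = cosh z"
    have s0: "s > 0" and c0: "c > 0" and cs: "c\<^sup>2 = 1 + s\<^sup>2" using z0 by (simp_all add: s_def c_def cosh_square_eq)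
    have dr: "(r has_real_derivative 2 * s * c / amp) (at z)"
      unfolding r_def[abs_def] s_def c_def by (rule derivative_eq_intros refl | use assms in simp)+
    have dV: "(V has_real_derivative (2 * s * c / amp) / sqrt (1 - (r z)\<^sup>2) / om) (at z)"
      unfolding V_def[abs_def]
      by (rule derivative_eq_intros DERIV_chain2[OF DERIV_arccos] dr rbs[OF z] refl | use om_pos in \<open>simp add: divide_inverse\<close>)+
    have "((\<lambda>z. Yv (V z)) has_real_derivative Rf (Sv (V z)) * ((2 * s * c / amp) / sqrt (1 - (r z)\<^sup>2) / om)) (at z)"
      by (rule DERIV_chain2[OF Yv_deriv dV])
    moreover have "Rf (Sv (V z)) * ((2 * s * c / amp) / sqrt (1 - (r z)\<^sup>2) / om) = f z"
    proof -
      define Q where "Q = amp\<^sup>2 - (s\<^sup>2 - mid)\<^sup>2"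
      have rz: "1 - (r z)\<^sup>2 = Q / amp\<^sup>2" using assms by (simp add: r_def s_def Q_def field_simps)
      have "(r z)\<^sup>2 < 1" using rbs[OF z] by (simp add: power2_less_1_iff abs_less_iff)
      then have Q0: "Q > 0" using rz assms by (metis diff_gt_0_iff_gt zero_less_divide_iff zero_less_power less_asym)
      have "s\<^sup>2 * c\<^sup>2 + 4 / \<kappa> * (E + H * s\<^sup>2)\<^sup>2 = k * Q"
        using Qf_closed[of "s\<^sup>2"] unfolding Qf_def Q_def cs .
      moreover have "1 - 4 * \<tau>\<^sup>2 / \<kappa> * (tanh z)\<^sup>2 = (1 + (1 + \<rho>) * s\<^sup>2) / c\<^sup>2"
      proof -
        have "1 + (1 + \<rho>) * s\<^sup>2 = c\<^sup>2 + \<rho> * s\<^sup>2" by (simp add: cs distrib_right)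
        then show ?thesis using c0
          by (simp add: tanh_def s_def[symmetric] c_def[symmetric] \<rho>_def power_divide add_divide_distrib diff_divide_distrib)
      qed
      ultimately have fz: "f z = (E + H * s\<^sup>2) * (sqrt (1 + (1 + \<rho>) * s\<^sup>2) / c) / (\<tau> * (sqrt k * sqrt Q))"
        using c0 unfolding f_def s_def[symmetric] c_def[symmetric] by (simp add: real_sqrt_divide real_sqrt_mult)
      show ?thesis
        unfolding fz SV[OF z'] rz Rf_def s_def[symmetric] cs[symmetric] om_def
        using s0 c0 Q0 k_pos assms \<tau>_nz by (simp add: real_sqrt_divide field_simps power2_eq_square)
    qed
    ultimately show "((\<lambda>z. Yv (V z)) has_vector_derivative f z) (at z)"
      by (simp add: has_real_derivative_iff_has_vector_derivative)
  qed
  moreover have "V b = v0" "V a = v0 - h" using assms by (simp_all add: V_def r_def sq h_def)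
  ultimately have "integral {a..b} f = Yv v0 - Yv (v0 - h)" by (simp add: integral_unique)
  then show ?thesis by (simp add: period_def a_def b_def f_def[abs_def] T_half)
qed

end

section \<open>Tangent planes and self-crossings\<close>

text \<open>The inverse chart \<open>G\<close> is only continuous, so \<open>G\<close> composed with
  c cannot be differentiated directly. Instead \<open>K\<close>, built from a left inverse of L,
  vanishes exactly on the range of L, and K(c(r) - p) is shown to be o(|c(r) - p|).\<close>

lemma tangent_in_range_of_immersion:
  fixes F :: "real \<times> real \<Rightarrow> point" and c :: "real \<Rightarrow> point"
  assumes hom: "homeomorphism U (S \<inter> V) F G" and V: "open V" and F: "(F has_derivative L) (at (G p))" and inj: "inj L"
    and p: "p \<in> S" "p \<in> V" "c 0 = p"
    and c: "(c has_vector_derivative w) (at 0)" and cS: "\<forall>\<^sub>F r in at 0. c r \<in> S"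
  shows "w \<in> range L"
proof -
  have lin: "linear L" using F by (rule has_derivative_linear)
  obtain M where M: "linear M" "M \<circ> L = id" using linear_injective_left_inverse[OF lin inj] by blast
  define K where "K z = z - L (M z)" for z
  have linK: "linear K"
    by (rule linearI)
       (simp_all add: K_def linear_add[OF lin] linear_add[OF M(1)] linear_cmul[OF lin] linear_cmul[OF M(1)]
         scaleR_right_diff_distrib)
  have inv: "M (L z) = z" for z using fun_cong[OF M(2), of z] by simp
  then have KL: "K (L z) = 0" for z by (simp add: K_def)
  obtain B1 where B1: "B1 > 0" "\<And>z. norm (M z) \<le> B1 * norm z" using linear_bounded_pos[OF M(1)] by blast
  obtain B2 where B2: "B2 > 0" "\<And>z. norm (K z) \<le> B2 * norm z" using linear_bounded_pos[OF linK] by blast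
  define u0 where "u0 = G p"
  have Fu0: "F u0 = p" using hom p by (simp add: u0_def homeomorphism_def)
  have cont: "(c \<longlongrightarrow> p) (at 0)"
    using has_vector_derivative_continuous[OF c] p(3) by (simp add: continuous_at isCont_def)
  have cV: "\<forall>\<^sub>F r in at 0. c r \<in> S \<inter> V"
    using topological_tendstoD[OF cont V p(2)] cS by eventually_elim auto
  have Gc: "((\<lambda>r. G (c r)) \<longlongrightarrow> u0) (at 0)"
  proof -
    have "continuous_on (S \<inter> V) G" using hom by (simp add: homeomorphism_def)
    then show ?thesis unfolding u0_def
      by (rule continuous_on_tendsto_compose[OF _ cont _ cV]) (use p in auto)
  qed
  have small: "\<forall>\<^sub>F r in at 0. norm (K (c r - p)) \<le> e * norm (c r - p)" if "e > 0" for e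
  proof -
    \<comment> \<open>The first bound allows the absorption of the error below, the second leaves
      the factor e at the end.\<close>
    define d where "d = min (1 / (2 * B1)) (e / (2 * B1 * B2))"
    have d: "d > 0" "B1 * d \<le> 1 / 2" "2 * B1 * B2 * d \<le> e"
    proof -
      show "d > 0" using B1 B2 that by (simp add: d_def)
      have "B1 * d \<le> B1 * (1 / (2 * B1))" using B1 by (intro mult_left_mono) (auto simp: d_def)
      then show "B1 * d \<le> 1 / 2" using B1 by simp
      have "2 * B1 * B2 * d \<le> 2 * B1 * B2 * (e / (2 * B1 * B2))" using B1 B2 by (intro mult_left_mono) (auto simp: d_def)
      then show "2 * B1 * B2 * d \<le> e" using B1 B2 by simp
    qed
    obtain \<delta> where \<delta>: "\<delta> > 0" "\<And>u. norm (u - u0) < \<delta> \<Longrightarrow> norm (F u - F u0 - L (u - u0)) \<le> d * norm (u - u0)"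
      using F d(1) unfolding has_derivative_at_alt u0_def[symmetric] by blast
    have "\<forall>\<^sub>F r in at 0. dist (G (c r)) u0 < \<delta>" by (rule tendstoD[OF Gc \<delta>(1)])
    then show ?thesis using cV
    proof eventually_elim
      case (elim r)
      define u where "u = G (c r)"
      have Fu: "F u = c r" using hom elim(2) by (auto simp: u_def homeomorphism_def)
      have E: "norm (c r - p - L (u - u0)) \<le> d * norm (u - u0)"
        using \<delta>(2)[of u] elim(1) by (simp add: Fu Fu0 dist_norm u_def[symmetric])
      \<comment> \<open>A Lipschitz estimate for \<open>G\<close> at p, from the injectivity of L:
        the error contributes at most half of the left side and is absorbed.\<close>
      have "u - u0 = M (c r - p) - M (c r - p - L (u - u0))"
        by (simp add: linear_diff[OF M(1)] inv)
      then have "norm (u - u0) \<le> norm (M (c r - p)) + norm (M (c r - p - L (u - u0)))"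
        using norm_triangle_ineq4[of "M (c r - p)" "M (c r - p - L (u - u0))"] by (simp only:)
      also have "\<dots> \<le> B1 * norm (c r - p) + B1 * (d * norm (u - u0))"
        by (intro add_mono order_trans[OF B1(2)] mult_left_mono E) (use B1 in auto)
      also have "\<dots> = B1 * norm (c r - p) + (B1 * d) * norm (u - u0)" by simp
      also have "\<dots> \<le> B1 * norm (c r - p) + (1 / 2) * norm (u - u0)"
        by (intro add_left_mono mult_right_mono d(2)) simp
      finally have nu: "norm (u - u0) \<le> 2 * B1 * norm (c r - p)" by simp
      have "K (c r - p) = K (c r - p - L (u - u0))" by (simp add: linear_diff[OF linK] KL)
      then have "norm (K (c r - p)) \<le> B2 * norm (c r - p - L (u - u0))" using B2(2) by metis
      also have "\<dots> \<le> B2 * (d * (2 * B1 * norm (c r - p)))"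
        by (intro mult_left_mono order_trans[OF E]) (use B2 nu d in auto)
      also have "\<dots> = (2 * B1 * B2 * d) * norm (c r - p)" by simp
      also have "\<dots> \<le> e * norm (c r - p)" by (rule mult_right_mono[OF d(3)]) simp
      finally show ?case .
    qed
  qed
  have lim: "((\<lambda>r. (c r - p) /\<^sub>R r) \<longlongrightarrow> w) (at 0)"
  proof (rule LIM_zero_cancel, rule tendsto_norm_zero_cancel)
    have "((\<lambda>r. norm (c (0 + r) - c 0 - r *\<^sub>R w) / norm r) \<longlongrightarrow> 0) (at 0)"
      using c unfolding has_vector_derivative_def has_derivative_at by blast
    moreover have "\<forall>\<^sub>F r in at 0. norm (c (0 + r) - c 0 - r *\<^sub>R w) / norm r = norm ((c r - p) /\<^sub>R r - w)"
    proof (rule eventually_at_filter[THEN iffD2, OF always_eventually], intro allI impI)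
      fix r :: real assume r: "r \<noteq> 0"
      have "(c r - p) /\<^sub>R r - w = (c r - p - r *\<^sub>R w) /\<^sub>R r"
        using r by (simp add: scaleR_diff_right)
      then show "norm (c (0 + r) - c 0 - r *\<^sub>R w) / norm r = norm ((c r - p) /\<^sub>R r - w)"
        by (simp add: p(3) divide_inverse mult.commute)
    qed
    ultimately show "((\<lambda>r. norm ((c r - p) /\<^sub>R r - w)) \<longlongrightarrow> 0) (at 0)"
      by (rule Lim_transform_eventually)
  qed
  have "norm (K w) \<le> e * norm w" if "e > 0" for e
  proof (rule tendsto_le)
    show "((\<lambda>r. norm (K ((c r - p) /\<^sub>R r))) \<longlongrightarrow> norm (K w)) (at 0)"
      by (intro tendsto_norm bounded_linear.tendsto[OF linK[unfolded linear_conv_bounded_linear]] lim)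
    show "((\<lambda>r. e * norm ((c r - p) /\<^sub>R r)) \<longlongrightarrow> e * norm w) (at 0)"
      by (intro tendsto_intros lim)
    show "\<forall>\<^sub>F r in at 0. norm (K ((c r - p) /\<^sub>R r)) \<le> e * norm ((c r - p) /\<^sub>R r)"
      using small[OF that]
    proof eventually_elim
      case (elim r)
      from mult_left_mono[OF elim, of "inverse \<bar>r\<bar>"] show ?case
        by (simp add: linear_cmul[OF linK] mult_ac)
    qed
  qed simp
  then have "norm (K w) = 0"
  proof -
    assume a: "\<And>e. e > 0 \<Longrightarrow> norm (K w) \<le> e * norm w"
    have "norm (K w) \<le> 0 + e" if "e > 0" for e
    proof -
      have "norm (K w) \<le> e / (norm w + 1) * norm w" using that by (intro a divide_pos_pos) (auto simp: add_nonneg_pos)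
      also have "\<dots> \<le> e" using that by (simp add: divide_le_eq add_nonneg_pos)
      finally show ?thesis by simp
    qed
    then have "norm (K w) \<le> 0" by (rule field_le_epsilon)
    then show ?thesis by simp
  qed
  then have "w = L (M w)" by (simp add: K_def)
  then show ?thesis by blast
qed

text \<open>Cramer's rule gives the coefficients if the first two preimages are independent;
  otherwise these two are dependent already.\<close>

lemma three_vectors_in_plane:
  fixes L :: "real \<times> real \<Rightarrow> point"
  assumes "linear L" "w1 \<in> range L" "w2 \<in> range L" "w3 \<in> range L" "w1 \<noteq> 0"
  obtains p1 p2 p3 where "p1 *\<^sub>R w1 + p2 *\<^sub>R w2 + p3 *\<^sub>R w3 = 0" "p1 \<noteq> 0 \<or> p2 \<noteq> 0 \<or> p3 \<noteq> 0"
proof -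
  obtain a1 b1 a2 b2 a3 b3 where w: "w1 = L (a1, b1)" "w2 = L (a2, b2)" "w3 = L (a3, b3)"
    using assms(2-4) by (metis imageE surj_pair)
  have comb: "p1 *\<^sub>R w1 + p2 *\<^sub>R w2 + p3 *\<^sub>R w3 = L (p1 * a1 + p2 * a2 + p3 * a3, p1 * b1 + p2 * b2 + p3 * b3)" for p1 p2 p3
    unfolding w by (simp add: linear_cmul[OF assms(1), symmetric] linear_add[OF assms(1), symmetric])
  have L0: "L (0, 0) = 0" using linear_0[OF assms(1)] by (simp add: zero_prod_def)
  show ?thesis
  proof (cases "a1 * b2 - a2 * b1 = 0")
    case False
    show ?thesis
    proof (rule that)
      show "(a2 * b3 - a3 * b2) *\<^sub>R w1 + (a3 * b1 - a1 * b3) *\<^sub>R w2 + (a1 * b2 - a2 * b1) *\<^sub>R w3 = 0"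
        unfolding comb by (simp add: algebra_simps L0)
    qed (use False in simp)
  next
    case True
    have "a1 \<noteq> 0 \<or> b1 \<noteq> 0" using assms(5) L0 w(1) by auto
    then show ?thesis
    proof
      assume "a1 \<noteq> 0"
      then show ?thesis
      proof (intro that)
        show "a2 *\<^sub>R w1 + (- a1) *\<^sub>R w2 + 0 *\<^sub>R w3 = 0"
          unfolding comb using True by (simp add: algebra_simps L0)
      qed simp
    next
      assume "b1 \<noteq> 0"
      then show ?thesis
      proof (intro that)
        show "b2 *\<^sub>R w1 + (- b1) *\<^sub>R w2 + 0 *\<^sub>R w3 = 0"
          unfolding comb using True by (simp add: algebra_simps L0)
      qed simp
    qed
  qed
qed

text \<open>Two branches of the curve that meet with mirrored directions yield, together with the
  direction of the rotation, three independent tangent vectors at one point, while a chart allows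
  only a plane.\<close>

lemma (in sl2_params) not_embedded_of_crossing:
  assumes g: "generating_curve I x y \<alpha>" and s: "s1 \<in> interior I" "s2 \<in> interior I"
    and x: "x s2 = x s1" and y: "cis (y s2) = cis (y s1)"
    and a: "cos (\<alpha> s2) = - cos (\<alpha> s1)" "sin (\<alpha> s2) = sin (\<alpha> s1)" "cos (\<alpha> s1) \<noteq> 0" "sin (\<alpha> s1) \<noteq> 0"
  shows "\<not> embedded_surface (rot_surface I x y)"
proof
  let ?S = "rot_surface I x y"
  define p where "p = rot_immersion x y s1 0"
  assume "embedded_surface ?S"
  moreover have p1: "p \<in> ?S"
    unfolding p_def rot_surface_def using s(1) interior_subset by (intro image_eqI[of _ _ "(s1, 0)"]) auto
  ultimately obtain V U F G where V: "open V" "p \<in> V" and U: "open U" and hom: "homeomorphism U (?S \<inter> V) F G" and C: "C1_immersion_on U F"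
    unfolding embedded_surface_def by blast
  have "G p \<in> U" using hom p1 V(2) by (auto simp: homeomorphism_def)
  then obtain L where L: "(F has_derivative L) (at (G p))" "inj L"
    using C unfolding C1_immersion_on_def by blast
  have p2: "p = rot_immersion x y s2 0" using x y by (simp add: p_def rot_immersion_def)
  have x1: "x s1 \<noteq> 0" using g s(1) by (simp add: generating_curve_def)
  note tan = tangent_in_range_of_immersion[OF hom V(1) L p1 V(2)]
  have tS: "((\<lambda>r. rot_immersion x y (si + r) 0) has_vector_derivative
     ((complex_of_real (cos (\<alpha> si) * sinh (x si)) + \<i> * complex_of_real (sin (\<alpha> si))) * cis (y si),
      complex_of_real (cos (\<alpha> si) * cosh (x si)))) (at 0)" (is ?d)
    and eS: "\<forall>\<^sub>F r in at 0. rot_immersion x y (si + r) 0 \<in> ?S" (is ?e) if si: "si \<in> interior I" for si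
  proof -
    have at: "at si within I = at si" using si by (rule at_within_interior)
    have siI: "si \<in> I" using si interior_subset by blast
    have sh: "((\<lambda>r. si + r) has_real_derivative 1) (at 0)" by (auto intro!: derivative_eq_intros)
    have "((\<lambda>r. x (si + r)) has_real_derivative cos (\<alpha> si)) (at 0)"
      using DERIV_chain2[of x "cos (\<alpha> si)" "\<lambda>r. si + r" 0, OF _ sh] generating_curve_derivs(1)[OF g siI] at by simp
    moreover have "((\<lambda>r. y (si + r)) has_real_derivative sin (\<alpha> si) / cosh (x si)) (at 0)"
      using DERIV_chain2[of y "sin (\<alpha> si) / cosh (x si)" "\<lambda>r. si + r" 0, OF _ sh] generating_curve_derivs(2)[OF g siI] at by simp
    moreover have "((\<lambda>r. 0) has_real_derivative 0) (at (0::real))" by simp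
    ultimately have "((\<lambda>r. rot_immersion (\<lambda>r. x (si + r)) (\<lambda>r. y (si + r)) r 0) has_vector_derivative
     ((complex_of_real (cos (\<alpha> si) * sinh (x (si + 0))) + \<i> * complex_of_real (sin (\<alpha> si) / cosh (x si) * cosh (x (si + 0)))) * cis (y (si + 0)),
      (complex_of_real (cos (\<alpha> si) * cosh (x (si + 0))) + \<i> * complex_of_real (0 * sinh (x (si + 0)))) * cis 0)) (at 0)"
      by (rule has_vector_derivative_rot_immersion)
    then show ?d by (simp add: rot_immersion_def)
    have "((\<lambda>r. si + r) \<longlongrightarrow> si + 0) (at 0)" by (intro tendsto_intros)
    then have "\<forall>\<^sub>F r in at 0. si + r \<in> interior I"
      using topological_tendstoD[OF _ open_interior, of "\<lambda>r. si + r" si] si by simp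
    then show ?e
    proof eventually_elim
      case (elim r)
      then have "si + r \<in> I" using interior_subset by blast
      then show ?case unfolding rot_surface_def by (intro image_eqI[of _ _ "(si + r, 0)"]) auto
    qed
  qed
  define w1 w2 w3 where "w1 = (0 :: complex, \<i> * complex_of_real (sinh (x s1)))"
    and "w2 = ((complex_of_real (cos (\<alpha> s1) * sinh (x s1)) + \<i> * complex_of_real (sin (\<alpha> s1))) * cis (y s1),
      complex_of_real (cos (\<alpha> s1) * cosh (x s1)))"
    and "w3 = ((complex_of_real (cos (\<alpha> s2) * sinh (x s2)) + \<i> * complex_of_real (sin (\<alpha> s2))) * cis (y s2),
      complex_of_real (cos (\<alpha> s2) * cosh (x s2)))"
  have w2: "w2 \<in> range L" unfolding w2_def by (rule tan[OF _ tS[OF s(1)] eS[OF s(1)]]) (simp add: p_def)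
  have w3: "w3 \<in> range L" unfolding w3_def by (rule tan[OF _ tS[OF s(2)] eS[OF s(2)]]) (simp add: p2)
  have w1: "w1 \<in> range L"
  proof (rule tan)
    have 1: "((\<lambda>r. x s1) has_real_derivative 0) (at (0::real))" "((\<lambda>r. y s1) has_real_derivative 0) (at (0::real))"
      "((\<lambda>r. r) has_real_derivative 1) (at (0::real))"
      by (auto intro!: derivative_eq_intros)
    show "((\<lambda>r. rot_immersion x y s1 r) has_vector_derivative w1) (at 0)"
      using has_vector_derivative_rot_immersion[OF 1] by (simp add: rot_immersion_def w1_def)
    show "\<forall>\<^sub>F r in at 0. rot_immersion x y s1 r \<in> ?S"
      using s(1) interior_subset by (intro always_eventually allI) (force simp: rot_surface_def)
  qed (simp add: p_def)
  have "w1 \<noteq> 0" using x1 by (simp add: w1_def zero_prod_def)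
  then obtain p1 p2 p3 where P: "p1 *\<^sub>R w1 + p2 *\<^sub>R w2 + p3 *\<^sub>R w3 = 0" and nz: "p1 \<noteq> 0 \<or> p2 \<noteq> 0 \<or> p3 \<noteq> 0"
    using three_vectors_in_plane[OF has_derivative_linear[OF L(1)] w1 w2 w3] by blast
  have snd: "snd (p1 *\<^sub>R w1 + p2 *\<^sub>R w2 + p3 *\<^sub>R w3) = 0" and fst: "fst (p1 *\<^sub>R w1 + p2 *\<^sub>R w2 + p3 *\<^sub>R w3) = 0"
    using P by simp_all
  have "Re (snd (p1 *\<^sub>R w1 + p2 *\<^sub>R w2 + p3 *\<^sub>R w3)) = (p2 - p3) * (cos (\<alpha> s1) * cosh (x s1))"
    by (simp add: w1_def w2_def w3_def a x algebra_simps)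
  then have "(p2 - p3) * (cos (\<alpha> s1) * cosh (x s1)) = 0" unfolding snd by simp
  then have p23: "p2 = p3" using a(3) by simp
  have "Im (snd (p1 *\<^sub>R w1 + p2 *\<^sub>R w2 + p3 *\<^sub>R w3)) = p1 * sinh (x s1)"
    by (simp add: w1_def w2_def w3_def)
  then have "p1 * sinh (x s1) = 0" unfolding snd by simp
  then have p1: "p1 = 0" using x1 by simp
  have "fst (p1 *\<^sub>R w1 + p2 *\<^sub>R w2 + p3 *\<^sub>R w3) = complex_of_real (2 * p2 * sin (\<alpha> s1)) * (\<i> * cis (y s1))"
    unfolding p23 by (simp add: w1_def w2_def w3_def a x y scaleR_conv_of_real algebra_simps)
  then have "p2 = 0" using fst a(4) by simp
  with p1 p23 nz show False by simp
qed

context profile_line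
begin

lemma Pv_symmetric:
  assumes "Pv c = 0"
  shows "Pv (c - u) = - Pv (c + u)"
proof -
  have 1: "((\<lambda>u. c + u) has_real_derivative 1) (at u)" "((\<lambda>u. c - u) has_real_derivative -1) (at u)"
    by (auto intro!: derivative_eq_intros)
  have e: "(\<lambda>u. Sv (c - u)) = (\<lambda>u. Sv (c + u))" using Sv_symmetric[OF assms] by auto
  have "((\<lambda>u. Sv (c + u)) has_real_derivative Pv (c + u) * 1) (at u)"
    by (rule DERIV_chain2[OF Sv_deriv 1(1)])
  moreover have "((\<lambda>u. Sv (c + u)) has_real_derivative Pv (c - u) * -1) (at u)"
    unfolding e[symmetric] by (rule DERIV_chain2[OF Sv_deriv 1(2)])
  ultimately have "Pv (c + u) * 1 = Pv (c - u) * -1" by (rule DERIV_unique)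
  then show ?thesis by simp
qed

text \<open>Mirror images share x and \<open>lam\<close>, hence also sin \<alpha> by the energy,
  while cos \<alpha> changes sign with P. If y agrees modulo 2 pi as well, two branches
  cross.\<close>

lemma not_embedded_of_mirror_crossing:
  assumes c: "Pv c = 0" and u: "Pv (c + u) \<noteq> 0" "E + H * Sv (c + u) \<noteq> 0"
    and Y: "cis (Yv (c - u)) = cis (Yv (c + u))"
  shows "\<not> embedded_surface (rot_surface I x y)"
proof -
  have S: "Sv (c - u) = Sv (c + u)" by (rule Sv_symmetric[OF c])
  then have x: "x (g (c - u)) = x (g (c + u))" by (simp add: x_g)
  have l: "lam (g (c - u)) = lam (g (c + u))"
  proof -
    have "1 / lam (g (c - u)) = 1 / lam (g (c + u))"
      using lam_inverse[OF in_I, of "g (c - u)"] lam_inverse[OF in_I, of "g (c + u)"] S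
        x_pos[of "g (c - u)"] x_pos[of "g (c + u)"] by (simp add: Sv_def)
    from arg_cong[OF this, of inverse] show ?thesis by simp
  qed
  have D: "normal_denom \<kappa> \<tau> (x (g (c - u))) (\<alpha> (g (c - u))) = normal_denom \<kappa> \<tau> (x (g (c + u))) (\<alpha> (g (c + u)))"
    using l K2_pos[of "x (g (c + u))"] by (simp add: lam_def x)
  have sh: "sinh (x (g (c + u))) \<noteq> 0" using x_pos[of "g (c + u)"] by simp
  define K where "K = 2 * sinh (x (g (c + u))) * cosh (x (g (c + u))) / lam (g (c + u))"
  have K: "K \<noteq> 0" using sh lam_pos[of "g (c + u)"] by (simp add: K_def)
  have "K * cos (\<alpha> (g (c - u))) = K * - cos (\<alpha> (g (c + u)))"
    using Pv_symmetric[OF c, of u] by (simp add: Pv_def P_def l x K_def)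
  then have cs: "cos (\<alpha> (g (c - u))) = - cos (\<alpha> (g (c + u)))"
    by (rule mult_left_cancel[OF K, THEN iffD1])
  have "\<tau> * sin (\<alpha> (g (c - u))) * cosh (x (g (c + u))) * sinh (x (g (c + u))) = \<tau> * sin (\<alpha> (g (c + u))) * cosh (x (g (c + u))) * sinh (x (g (c + u)))"
    using energy_eq[OF in_I, of "g (c - u)"] energy_eq[OF in_I, of "g (c + u)"] S by (simp add: D[unfolded x] x Sv_def)
  then have sn: "sin (\<alpha> (g (c - u))) = sin (\<alpha> (g (c + u)))" using sh \<tau>_nz by simp
  show ?thesis
  proof (rule not_embedded_of_crossing[OF gen int_UNIV int_UNIV, of "g (c - u)" "g (c + u)"])
    show "cos (\<alpha> (g (c + u))) \<noteq> 0" using u(1) by (simp add: Pv_zero_iff)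
    have "sgn (sin (\<alpha> (g (c + u)))) \<noteq> 0" using u(2) \<tau>_nz by (simp add: sgn_sin sgn_eq_0_iff)
    then show "sin (\<alpha> (g (c + u))) \<noteq> 0" by (metis sgn_0)
  qed (use x cs sn Y in \<open>simp_all add: Yv_def\<close>)
qed

end

section \<open>Compactness and rationality of the period\<close>

lemma cis_plus_2pi_int: "cis (a + 2 * pi * of_int n) = cis a"
proof -
  have "cis (2 * pi * of_int n) = 1" by (rule cis_multiple_2pi) simp
  then show ?thesis by (simp only: cis_mult[symmetric] mult_1_right)
qed

lemma shift_into_period: "L > 0 \<Longrightarrow> v + L * of_int (- \<lfloor>v / L\<rfloor>) \<in> {0..L}" for v L :: real
proof -
  assume L: "L > 0"
  have "of_int \<lfloor>v / L\<rfloor> \<le> v / L" "v / L \<le> of_int \<lfloor>v / L\<rfloor> + 1" by linarith+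
  then have "L * of_int \<lfloor>v / L\<rfloor> \<le> L * (v / L)" "L * (v / L) \<le> L * (of_int \<lfloor>v / L\<rfloor> + 1)"
    using L by (intro mult_left_mono; simp)+
  then show ?thesis using L by (simp add: distrib_left)
qed

lemma cis_eq_imp: "cis a = cis b \<Longrightarrow> \<exists>n::int. a = b + 2 * pi * of_int n"
proof -
  assume "cis a = cis b"
  then have "exp (\<i> * complex_of_real a) = exp (\<i> * complex_of_real b)" by (simp only: cis_conv_exp)
  then obtain i :: int where "\<i> * complex_of_real a = \<i> * complex_of_real b + complex_of_real (real_of_int (2 * i) * pi) * \<i>"
    unfolding exp_eq by blast
  then have "Im (\<i> * complex_of_real a) = Im (\<i> * complex_of_real b + complex_of_real (real_of_int (2 * i) * pi) * \<i>)"
    by (rule arg_cong)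
  then show ?thesis by (intro exI[of _ i]) simp
qed

context profile_closed
begin

lemma Pv_zero_closed: "amp > 0 \<Longrightarrow> Pv v = 0 \<longleftrightarrow> (\<exists>n::int. v = v0 + of_int n * h)"
proof -
  assume amp: "amp > 0"
  have "Pv v = 0 \<longleftrightarrow> sin (om * (v - v0)) = 0" using amp om_pos by (simp add: Pv_explicit)
  also have "\<dots> \<longleftrightarrow> (\<exists>n::int. om * (v - v0) = of_int n * pi)" by (rule sin_zero_iff_int2)
  also have "\<dots> \<longleftrightarrow> (\<exists>n::int. v = v0 + of_int n * h)"
    using om_pos by (simp add: h_def field_simps)
  finally show ?thesis .
qed

lemma Sv_shift: "Sv (v0 + of_int n * h + u) = mid + amp * ((-1) powi n * cos (om * u))"
proof -
  have "om * (v0 + of_int n * h + u - v0) = of_int n * (om * h) + om * u" by (simp add: algebra_simps)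
  then have "om * (v0 + of_int n * h + u - v0) = pi * of_int n + om * u" unfolding om_h by (simp only: mult.commute[of pi])
  then show ?thesis
    by (simp only: Sv_explicit cos_add cos_npi_int sin_npi_int) (simp add: power_int_minus_left)
qed

text \<open>By the reflection at v0 the rising and the falling half of an oscillation contribute
  equally to T.\<close>

lemma Yv_half: "Yv (v0 + of_int n * h) = Yv v0 + T / 2 * of_int n"
proof (cases "even n")
  case True
  then obtain j where "n = 2 * j" by (elim evenE)
  then show ?thesis using Yv_quasiperiodic_int[of v0 j] by (simp add: mult_ac)
next
  case False
  then obtain j where n: "n = 2 * j + 1" by (elim oddE)
  have "Yv (v0 + h) = Yv v0 + T / 2"
  proof -
    have "T / 2 = Yv v0 - Yv (v0 - h)" using T_half by simp
    then show ?thesis using Yv_symmetric[OF Pv_v0, of h] by (simp add: field_simps)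
  qed
  moreover have "v0 + of_int n * h = v0 + h + 2 * h * of_int j" by (simp add: n algebra_simps)
  ultimately show ?thesis using Yv_quasiperiodic_int[of "v0 + h" j] by (simp add: n algebra_simps add_divide_distrib)
qed

lemma rot_surface_v: "rot_surface I x y = (\<lambda>(v, t). rot_immersion x y (g v) t) ` UNIV"
proof (intro equalityI subsetI)
  fix p assume "p \<in> rot_surface I x y"
  then obtain s t where "p = rot_immersion x y s t" by (auto simp: rot_surface_def)
  then have "p = (\<lambda>(v, t). rot_immersion x y (g v) t) (\<sigma> s, t)" by simp
  then show "p \<in> (\<lambda>(v, t). rot_immersion x y (g v) t) ` UNIV" by blast
next
  fix p assume "p \<in> (\<lambda>(v, t). rot_immersion x y (g v) t) ` UNIV"
  then obtain v t where "p = rot_immersion x y (g v) t" by auto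
  then show "p \<in> rot_surface I x y"
    unfolding rot_surface_def I_UNIV by (intro image_eqI[of _ _ "(g v, t)"]) simp_all
qed

lemma rot_immersion_v: "rot_immersion x y (g v) t = (complex_of_real (sqrt (1 + Sv v)) * cis (Yv v), complex_of_real (sqrt (Sv v)) * cis t)"
proof -
  have "sinh (x (g v)) = sqrt (Sv v)" by (simp add: x_g)
  moreover have "cosh (x (g v)) = sqrt (1 + Sv v)" using Sv_pos[of v] by (simp add: x_g cosh_arsinh_real add.commute)
  ultimately show ?thesis by (simp add: rot_immersion_def Yv_def)
qed

text \<open>Reduction of v modulo L and of t modulo 2 pi exhibits the surface as the image of a
  compact rectangle.\<close>

lemma compact_of_period:
  assumes L: "L > 0" and S: "\<And>v. Sv (v + L) = Sv v" and Y: "\<And>v. cis (Yv (v + L)) = cis (Yv v)"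
  shows "compact (rot_surface I x y)"
proof -
  let ?f = "\<lambda>(v, t). rot_immersion x y (g v) t"
  have Z: "Sv (v + L * of_int n) = Sv v \<and> cis (Yv (v + L * of_int n)) = cis (Yv v)" for v and n :: int
  proof (induction n rule: int_induct[where k = 0])
    case (step1 i)
    have e: "v + L * of_int (i + 1) = (v + L * of_int i) + L" by (simp add: algebra_simps)
    show ?case unfolding e S Y by (rule step1(2))
  next
    case (step2 i)
    have e: "v + L * of_int i = (v + L * of_int (i - 1)) + L" by (simp add: algebra_simps)
    show ?case using step2(2) unfolding e S Y .
  qed simp
  have "?f ` UNIV = ?f ` ({0..L} \<times> {0..2 * pi})"
  proof
    show "?f ` UNIV \<subseteq> ?f ` ({0..L} \<times> {0..2 * pi})"
    proof clarsimp
      fix v t :: real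
      define v' where "v' = v + L * of_int (- \<lfloor>v / L\<rfloor>)"
      define t' where "t' = t + 2 * pi * of_int (- \<lfloor>t / (2 * pi)\<rfloor>)"
      have "v' \<in> {0..L}" unfolding v'_def by (rule shift_into_period[OF L])
      moreover have "t' \<in> {0..2 * pi}" unfolding t'_def by (rule shift_into_period) simp
      moreover have "cis t' = cis t" unfolding t'_def by (rule cis_plus_2pi_int)
      then have "rot_immersion x y (g v') t' = rot_immersion x y (g v) t"
        unfolding rot_immersion_v v'_def using Z[of v "- \<lfloor>v / L\<rfloor>"] by simp
      ultimately show "rot_immersion x y (g v) t \<in> ?f ` ({0..L} \<times> {0..2 * pi})"
        by (intro image_eqI[of _ _ "(v', t')"]) auto
    qed
  qed blast
  moreover have "compact (?f ` ({0..L} \<times> {0..2 * pi}))"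
  proof (rule compact_continuous_image)
    show "continuous_on ({0..L} \<times> {0..2 * pi}) ?f"
      unfolding rot_immersion_v case_prod_unfold
      by (intro continuous_intros continuous_on_compose2[OF Sv_continuous[of UNIV]] continuous_on_compose2[OF Yv_continuous[of UNIV]]) auto
  qed (intro compact_Times compact_Icc)
  ultimately show ?thesis unfolding rot_surface_v by simp
qed

text \<open>If T is (a / b) pi, then after 2 b oscillations y has advanced by a full turns.\<close>

lemma compact_of_rational:
  assumes "r \<in> \<rat>" "T = r * pi"
  shows "compact (rot_surface I x y)"
proof -
  obtain a b :: int where ab: "b > 0" "r = of_int a / of_int b"
    using assms(1) by (metis Rats_cases')
  have T: "of_int b * T = of_int a * pi" using ab assms(2) by simp
  have "2 * h * of_int (2 * b) > 0" using h_pos ab(1) by simp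
  moreover have "cis (Yv (v + 2 * h * of_int (2 * b))) = cis (Yv v)" for v
  proof -
    have "T * of_int (2 * b) = 2 * pi * of_int a" using T by (simp add: mult_ac)
    then show ?thesis by (simp only: Yv_quasiperiodic_int cis_plus_2pi_int)
  qed
  ultimately show ?thesis by (rule compact_of_period[OF _ Sv_periodic_int])
qed

text \<open>On the circle of points with maximal \<open>x\<close>, the surface consists of countably many points,
  which are dense if the period is an irrational multiple of \<open>\<pi>\<close>.\<close>

lemma rational_of_compact:
  assumes amp: "amp > 0" and c: "compact (rot_surface I x y)"
  shows "\<exists>r\<in>\<rat>. T = r * pi"
proof (rule ccontr)
  assume n: "\<not> ?thesis"
  \<comment> \<open>The advance of y per oscillation, counted in full turns.\<close>
  define th where "th = T / (2 * pi)"
  have th: "th \<notin> \<rat>"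
  proof
    assume "th \<in> \<rat>"
    then have "2 * th \<in> \<rat>" by simp
    moreover have "T = 2 * th * pi" by (simp add: th_def)
    ultimately show False using n by blast
  qed
  define R where "R = sqrt (1 + (mid + amp))"
  have cl: "closed (rot_surface I x y)" using c by (rule compact_imp_closed)
  have S0: "Sv (v0 + 2 * h * of_int j) = mid + amp" for j
    using Sv_periodic_int[of v0 j] by (simp add: Sv_explicit)
  have mem: "(complex_of_real R * cis z, complex_of_real (sqrt (mid + amp))) \<in> rot_surface I x y" for z
  proof -
    have ex: "\<exists>q\<in>rot_surface I x y. dist q (complex_of_real R * cis z, complex_of_real (sqrt (mid + amp))) < e" if e: "e > 0" for e
    proof -
      have "continuous_on UNIV (\<lambda>r. (complex_of_real R * cis r, complex_of_real (sqrt (mid + amp))))"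
        by (intro continuous_intros)
      then have "isCont (\<lambda>r. (complex_of_real R * cis r, complex_of_real (sqrt (mid + amp)))) z"
        by (simp add: continuous_on_eq_continuous_at)
      then obtain d where d: "d > 0" "\<And>r. dist r z < d \<Longrightarrow>
          dist (complex_of_real R * cis r, complex_of_real (sqrt (mid + amp))) (complex_of_real R * cis z, complex_of_real (sqrt (mid + amp))) < e"
        unfolding continuous_at_eps_delta using e by (auto simp: dist_commute)
      have "d / (2 * pi) > 0" using d(1) by simp
      then obtain i j where ij: "\<bar>of_int j * th - of_int i - (z - Yv v0) / (2 * pi)\<bar> < d / (2 * pi)"
        using sequence_of_fractional_parts_is_dense[OF th] by metis
      define r where "r = Yv v0 + T * of_int j - 2 * pi * of_int i"
      have "2 * pi * th = T" by (simp add: th_def)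
      moreover have "2 * pi * ((z - Yv v0) / (2 * pi)) = z - Yv v0" by simp
      ultimately have "r - z = 2 * pi * (of_int j * th - of_int i - (z - Yv v0) / (2 * pi))"
        unfolding r_def right_diff_distrib by (simp only: mult.left_commute[of "2 * pi"] mult.commute[of T])
      then have "\<bar>r - z\<bar> = 2 * pi * \<bar>of_int j * th - of_int i - (z - Yv v0) / (2 * pi)\<bar>" by (simp add: abs_mult)
      also have "\<dots> < 2 * pi * (d / (2 * pi))" using ij by (intro mult_strict_left_mono) auto
      finally have "\<bar>r - z\<bar> < d" by simp
      then have "dist r z < d" by (simp add: dist_real_def)
      note close = d(2)[OF this]
      have "cis r = cis (Yv (v0 + 2 * h * of_int j))"
        using cis_plus_2pi_int[of r i] by (simp add: r_def Yv_quasiperiodic_int)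
      then have "rot_immersion x y (g (v0 + 2 * h * of_int j)) 0 = (complex_of_real R * cis r, complex_of_real (sqrt (mid + amp)))"
        unfolding rot_immersion_v S0 by (simp add: R_def)
      then have "(complex_of_real R * cis r, complex_of_real (sqrt (mid + amp))) \<in> rot_surface I x y"
        unfolding rot_surface_v by (metis case_prod_conv rangeI)
      with close show ?thesis by blast
    qed
    then show ?thesis
      using closure_approachable[of _ "rot_surface I x y"] closure_closed[OF cl] by blast
  qed
  \<comment> \<open>Conversely, a point of the surface on this circle forces S to be maximal, so its
    y comes from one of countably many parameters; the circle has uncountably many points.\<close>
  have "UNIV \<subseteq> (\<Union>j::int. \<Union>i::int. {Yv v0 + T * of_int j + 2 * pi * of_int i})"
  proof
    fix z :: real
    obtain v t where vt: "rot_immersion x y (g v) t = (complex_of_real R * cis z, complex_of_real (sqrt (mid + amp)))"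
      using mem[of z] unfolding rot_surface_v by auto
    then have 1: "complex_of_real (sqrt (1 + Sv v)) * cis (Yv v) = complex_of_real R * cis z"
      and 2: "complex_of_real (sqrt (Sv v)) * cis t = complex_of_real (sqrt (mid + amp))" unfolding rot_immersion_v by auto
    have "norm (complex_of_real (sqrt (Sv v)) * cis t) = norm (complex_of_real (sqrt (mid + amp)))" by (simp only: 2)
    then have Sv: "Sv v = mid + amp" using Sv_pos[of v] t_min_pos amp by (simp add: norm_mult)
    then have "cos (om * (v - v0)) = 1" using amp by (simp add: Sv_explicit)
    then obtain j :: int where "om * (v - v0) = of_int j * 2 * pi" by (auto simp: cos_one_2pi_int)
    then have v: "v = v0 + 2 * h * of_int j" using om_pos by (simp add: h_def field_simps)
    have "R > 0" using t_min_pos amp by (simp add: R_def)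
    then have "cis (Yv v) = cis z" using 1 by (simp add: Sv R_def)
    then obtain i :: int where "z = Yv v + 2 * pi * of_int i" using cis_eq_imp[of z "Yv v"] by auto
    then have "z = Yv v0 + T * of_int j + 2 * pi * of_int i" by (simp add: v Yv_quasiperiodic_int)
    then show "z \<in> (\<Union>j::int. \<Union>i::int. {Yv v0 + T * of_int j + 2 * pi * of_int i})" by blast
  qed
  moreover have "countable (\<Union>j::int. \<Union>i::int. {Yv v0 + T * of_int j + 2 * pi * of_int i})" by (intro countable_UN) auto
  ultimately show False using uncountable_UNIV_real countable_subset by blast
qed

end

section \<open>Positive energy: unduloid type\<close>

locale profile_closed_graph = profile_closed + assumes E_pos: "E > 0"
begin

sublocale profile_graph
proof
  fix v
  have "E + H * Sv v > 0" using E_pos H_pos Sv_pos[of v] by (simp add: add_pos_pos)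
  then show "sgn (E + H * Sv v) = sgn E" using E_pos by simp
qed

lemma \<epsilon>_T: "\<epsilon> * T > 0"
  using \<epsilon>_Yv_mono[of "v0 - h" "v0 + h"] h_pos by (simp add: T_def right_diff_distrib)

lemma T_nz: "T \<noteq> 0" using \<epsilon>_T by auto

text \<open>Each oscillation shifts y by T, which is nonzero, so the range is an interval with
  points on both sides of any z.\<close>

lemma range_Yv: "range Yv = UNIV"
proof (rule UNIV_eq_I[symmetric])
  fix z
  define n where "n = \<lfloor>(z - Yv v0) / T\<rfloor>"
  have n: "of_int n \<le> (z - Yv v0) / T" "(z - Yv v0) / T \<le> of_int (n + 1)" unfolding n_def by linarith+
  define a b where "a = Yv v0 + T * of_int n" and "b = Yv v0 + T * of_int (n + 1)"
  have ab: "a \<in> range Yv" "b \<in> range Yv" unfolding a_def b_def Yv_quasiperiodic_int[symmetric] by blast+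
  show "z \<in> range Yv"
  proof (cases "T > 0")
    case True
    then have "a \<le> z" "z \<le> b" using n by (simp_all add: a_def b_def field_simps)
    then show ?thesis using mem_is_interval_1_I[OF is_interval_range_Yv ab] by blast
  next
    case False
    then have "T < 0" using T_nz by simp
    then have "z \<le> a" "b \<le> z" using n by (simp_all add: a_def b_def field_simps)
    then show ?thesis using mem_is_interval_1_I[OF is_interval_range_Yv ab(2,1)] by blast
  qed
qed

lemma Yv_Yi: "Yv (Yi z) = z"
  using range_Yv by (simp add: Yi_def surj_f_inv_f)

lemma F_deriv': "(F has_real_derivative F' z) (at z)"
  using F_deriv range_Yv by blast

lemma F'_continuous: "continuous_on UNIV F'"
proof -
  have "isCont Yi z" for z
  proof -
    have "(Yi has_real_derivative inverse (Rf (Sv (Yi z)))) (at z)"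
      by (rule has_real_derivative_inverse[OF Yv_deriv Rf_nz Yv_continuous]) (simp_all add: Yv_Yi)
    then show ?thesis by (rule DERIV_isCont)
  qed
  then have Yi: "continuous_on UNIV Yi" by (simp add: continuous_on_eq_continuous_at)
  have gc: "continuous_on UNIV g" using g_deriv by (simp add: continuous_on_eq_continuous_at DERIV_isCont[OF g_deriv])
  have ac: "continuous_on UNIV \<alpha>" using generating_curve_continuous(3)[OF gen] by (simp add: I_UNIV)
  have lc: "continuous_on UNIV lam" using lam_continuous by (simp add: I_UNIV)
  have Rc: "continuous_on UNIV (\<lambda>v. Rf (Sv v))"
    unfolding Rf_def using Sv_pos \<tau>_nz
    by (intro continuous_intros Sv_continuous) (auto simp: less_imp_neq[symmetric] add_pos_pos add_nonneg_eq_0_iff less_imp_le)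
  have gYi: "continuous_on UNIV (\<lambda>z. g (Yi z))" by (rule continuous_on_compose2[OF gc Yi]) simp
  show ?thesis unfolding F'_def[abs_def]
    using lam_pos Rf_nz
    by (intro continuous_intros continuous_on_compose2[OF ac gYi] continuous_on_compose2[OF lc gYi] continuous_on_compose2[OF Rc Yi])
       (auto simp: less_imp_neq[symmetric])
qed

lemma F_periodic: "F (z + T) = F z"
proof -
  have "z + T = Yv (Yi z + 2 * h)" by (simp add: Yv_quasiperiodic Yv_Yi)
  then have "F (z + T) = x (g (Yi z + 2 * h))" by simp
  also have "\<dots> = x (g (Yi z))" by (simp add: x_g Sv_periodic)
  finally show ?thesis by (simp add: F_def)
qed

lemma F_periodic_int: "F (z + T * of_int n) = F z"
proof -
  have "z + T * of_int n = Yv (Yi z + 2 * h * of_int n)" by (simp only: Yv_quasiperiodic_int Yv_Yi)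
  then have "F (z + T * of_int n) = x (g (Yi z + 2 * h * of_int n))" by simp
  also have "\<dots> = x (g (Yi z))" by (simp only: x_g Sv_periodic_int)
  finally show ?thesis by (simp add: F_def)
qed

lemma unduloid: "unduloid_type (x_min \<kappa> H E) (x_max \<kappa> H E) I x y \<alpha>"
  unfolding unduloid_type_def
proof (rule exI[of _ F], rule exI[of _ F'], intro conjI)
  show "bij_betw y I UNIV" using bij_y by (simp add: range_Yv)
  show "\<forall>s\<in>I. x s = F (y s)" by (simp add: F_y)
  show "\<forall>v. (F has_real_derivative F' v) (at v)" using F_deriv' by blast
  show "\<exists>P>0. \<forall>v. F (v + P) = F v"
  proof (intro exI[of _ "\<bar>T\<bar>"] conjI allI)
    show "\<bar>T\<bar> > 0" using T_nz by simp
    show "F (v + \<bar>T\<bar>) = F v" for v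
      using F_periodic[of v] F_periodic[of "v - T"] by (cases "T \<ge> 0") simp_all
  qed
  have "range F = F ` range Yv" by (simp add: range_Yv)
  also have "\<dots> = x ` range g" by (simp only: image_image F_Yv)
  also have "range g = UNIV" using bij_g by (rule bij_is_surj)
  finally show "range F = {x_min \<kappa> H E..x_max \<kappa> H E}" using x_range by (simp add: I_UNIV)
  show "\<forall>a b. a < b \<and> F' a = 0 \<and> F' b = 0 \<and> (\<forall>v. a < v \<and> v < b \<longrightarrow> F' v \<noteq> 0)
           \<longrightarrow> strict_mono_on {a..b} F \<or> strict_antimono_on {a..b} F"
    using strict_mono_or_antimono_of_nonzero_deriv[OF F_deriv' F'_continuous] by blast
  show "\<forall>c. F' c = 0 \<longrightarrow> (\<forall>u. F (c + u) = F (c - u))"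
  proof (intro allI impI)
    fix c u assume "F' c = 0"
    then have "Pv (Yi c) = 0" using F'_zero_iff[of "Yi c"] by (simp add: Yv_Yi)
    from F_symmetric[OF this, of u] show "F (c + u) = F (c - u)" by (simp add: Yv_Yi range_Yv)
  qed
qed

text \<open>If \<open>amp\<close> is 0, then S is constant and y is linear in arclength, so the
  surface is a compact torus; the period integral over a single point is 0, a rational multiple of
  pi too.\<close>

lemma compact_iff_closed_graph: "compact (rot_surface I x y) \<longleftrightarrow> (\<exists>r\<in>\<rat>. period \<kappa> \<tau> H E = r * pi)"
proof (cases "amp = 0")
  case True
  have S: "Sv v = mid" for v by (simp add: Sv_explicit True)
  \<comment> \<open>The arclength in which y makes one full turn.\<close>
  define L where "L = 2 * pi / \<bar>Rf mid\<bar>"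
  have R: "Rf mid \<noteq> 0" using Rf_nz[of 0] by (simp add: S)
  have Y: "Yv (v + L) = Yv v + Rf mid * L" for v
  proof -
    have "((\<lambda>v. Yv v - Rf mid * v) has_real_derivative 0) (at v)" for v
      using Yv_deriv[of v] by (auto intro!: derivative_eq_intros simp: S)
    from DERIV_isconst_all[OF allI[OF this], of "v + L" v] show ?thesis by (simp add: algebra_simps)
  qed
  have "Rf mid * L = 2 * pi * of_int (if Rf mid > 0 then 1 else - 1)" using R by (simp add: L_def)
  then have "cis (Yv (v + L)) = cis (Yv v)" for v
    by (simp only: Y cis_plus_2pi_int)
  then have "compact (rot_surface I x y)"
    using R by (intro compact_of_period[of L]) (auto simp: L_def S)
  moreover have "period \<kappa> \<tau> H E = 0 * pi"
    by (simp add: period_def x_min_def x_max_def t_min_eq t_max_eq True)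
  ultimately show ?thesis using Rats_0 by blast
next
  case False
  then have "amp > 0" using amp_nonneg by simp
  then show ?thesis using rational_of_compact compact_of_rational by (auto simp: period_eq)
qed

text \<open>Where y is pi ahead of its value at v0, the mirror image is pi behind, which is the same
  place modulo 2 pi. An embedded surface has no crossing there, so the point is critical, and
  critical points lie at multiples of T / 2.\<close>

lemma embedded_imp_period:
  assumes amp: "amp > 0" and e: "embedded_surface (rot_surface I x y)"
  shows "\<exists>n::int. n \<noteq> 0 \<and> T = 2 * pi / of_int n"
proof -
  obtain v where v: "Yv v = Yv v0 + pi" using range_Yv by (metis UNIV_I rangeE)
  define u where "u = v - v0"
  have Yu: "Yv (v0 + u) = Yv v0 + pi" using v by (simp add: u_def)
  have Yu': "Yv (v0 - u) = Yv v0 - pi" using Yv_symmetric[OF Pv_v0, of u] Yu by simp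
  have "cis (Yv (v0 - u)) = cis (Yv (v0 + u))"
    using cis_plus_2pi_int[of "Yv v0 - pi" 1] unfolding Yu Yu' by (simp add: add.commute)
  then have "Pv (v0 + u) = 0"
    using not_embedded_of_mirror_crossing[OF Pv_v0, of u] e Rf_nz[of "v0 + u"] by (auto simp: Rf_zero_iff)
  then obtain n :: int where "v0 + u = v0 + of_int n * h" using Pv_zero_closed[OF amp] by blast
  then have n: "pi = T / 2 * of_int n" using Yv_half[of n] Yu by simp
  then have "n \<noteq> 0" by auto
  moreover have "T = 2 * pi / of_int n" using n \<open>n \<noteq> 0\<close> by (simp add: field_simps)
  ultimately show ?thesis by blast
qed

end

context profile_closed_graph
begin

text \<open>If \<open>2 \<pi>\<close> is a multiple of the period, the surface is a graph over a torus.\<close>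

lemma embedded_of_period:
  assumes n: "n \<noteq> 0" "T = 2 * pi / of_int n"
  shows "embedded_surface (rot_surface I x y)"
  unfolding embedded_surface_def
proof
  fix p assume "p \<in> rot_surface I x y"
  define \<Psi> where "\<Psi> = (\<lambda>(z, t). (complex_of_real (cosh (F z)) * cis z, complex_of_real (sinh (F z)) * cis t))"
  have surf: "rot_surface I x y = \<Psi> ` UNIV"
  proof (intro equalityI subsetI)
    fix p assume "p \<in> rot_surface I x y"
    then obtain s t where "p = rot_immersion x y s t" by (auto simp: rot_surface_def)
    then have "p = \<Psi> (y s, t)" by (simp add: \<Psi>_def rot_immersion_def F_y)
    then show "p \<in> \<Psi> ` UNIV" by blast
  next
    fix p assume "p \<in> \<Psi> ` UNIV"
    then obtain z t where "p = \<Psi> (z, t)" by auto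
    moreover have "y (g (Yi z)) = z" using Yv_Yi[of z] by (simp add: Yv_def)
    ultimately have "p = rot_immersion x y (g (Yi z)) t" by (simp add: \<Psi>_def rot_immersion_def F_def)
    then show "p \<in> rot_surface I x y"
      unfolding rot_surface_def I_UNIV by (intro image_eqI[of _ _ "(g (Yi z), t)"]) simp_all
  qed
  have Fp: "F z > 0" for z using x_pos by (simp add: F_def)
  \<comment> \<open>2 pi is n times T, so \<Psi> is unchanged by full turns in either
    argument.\<close>
  have F2: "F (z + 2 * pi * of_int j) = F z" for z and j :: int
  proof -
    have "2 * pi * of_int j = T * of_int (n * j)" using n by simp
    then show ?thesis by (simp only: F_periodic_int)
  qed
  obtain z0 t0 where p: "p = \<Psi> (z0, t0)" using \<open>p \<in> _\<close> unfolding surf by auto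
  define U where "U = {z0 - pi<..<z0 + pi} \<times> {t0 - pi<..<t0 + pi}"
  \<comment> \<open>Turned back by z0 and t0, both coordinates avoid the cut of \<open>Arg\<close>;
    there \<open>G\<close> is a continuous inverse of \<Psi>.\<close>
  define V where "V = {q :: point. fst q * cis (- z0) \<notin> \<real>\<^sub>\<le>\<^sub>0 \<and> snd q * cis (- t0) \<notin> \<real>\<^sub>\<le>\<^sub>0}"
  define G where "G q = (z0 + Arg (fst q * cis (- z0)), t0 + Arg (snd q * cis (- t0)))" for q :: point
  have openV: "open V"
  proof -
    have "open ((\<lambda>q::point. fst q * cis (- z0)) -` (- \<real>\<^sub>\<le>\<^sub>0))"
      by (intro open_vimage open_Compl closed_nonpos_Reals_complex continuous_intros)
    moreover have "open ((\<lambda>q::point. snd q * cis (- t0)) -` (- \<real>\<^sub>\<le>\<^sub>0))"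
      by (intro open_vimage open_Compl closed_nonpos_Reals_complex continuous_intros)
    moreover have "V = (\<lambda>q::point. fst q * cis (- z0)) -` (- \<real>\<^sub>\<le>\<^sub>0) \<inter> (\<lambda>q::point. snd q * cis (- t0)) -` (- \<real>\<^sub>\<le>\<^sub>0)"
      by (auto simp: V_def)
    ultimately show ?thesis by (simp add: open_Int)
  qed
  have polar: "complex_of_real r * cis a * cis (- b) = rcis r (a - b)" for r a b
    by (simp add: rcis_def cis_mult mult.assoc)
  have Arg: "Arg (rcis r a) = a" "rcis r a \<notin> \<real>\<^sub>\<le>\<^sub>0" if "r > 0" "- pi < a" "a < pi" for r a
  proof -
    show A: "Arg (rcis r a) = a"
      by (rule Arg_unique[of r]) (use that in \<open>simp_all add: rcis_def cis_conv_exp\<close>)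
    have "rcis r a \<noteq> 0" using that by simp
    then show "rcis r a \<notin> \<real>\<^sub>\<le>\<^sub>0"
    proof (rule_tac notI)
      assume nz: "rcis r a \<noteq> 0" and "rcis r a \<in> \<real>\<^sub>\<le>\<^sub>0"
      then have "Re (rcis r a) < 0 \<and> Im (rcis r a) = 0"
        by (auto simp: complex_nonpos_Reals_iff complex_eq_iff less_le)
      then have "Arg (rcis r a) = pi" by (simp only: Arg_eq_pi)
      then show False using A that by simp
    qed
  qed
  have U1: "G (\<Psi> u) = u \<and> \<Psi> u \<in> V" if "u \<in> U" for u
  proof -
    obtain z t where u: "u = (z, t)" by (cases u)
    have "- pi < z - z0" "z - z0 < pi" "- pi < t - t0" "t - t0 < pi" using that by (auto simp: U_def u)
    then show ?thesis
      unfolding G_def V_def \<Psi>_def u prod.case fst_conv snd_conv mem_Collect_eq polar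
      using Arg[of "cosh (F z)" "z - z0"] Arg[of "sinh (F z)" "t - t0"] Fp[of z] by simp
  qed
  have U2: "G q \<in> U \<and> \<Psi> (G q) = q" if q: "q \<in> rot_surface I x y \<inter> V" for q
  proof -
    obtain z t where qe: "q = \<Psi> (z, t)" using q unfolding surf by auto
    define a b where "a = Arg (fst q * cis (- z0))" and "b = Arg (snd q * cis (- t0))"
    have f: "fst q * cis (- z0) = rcis (cosh (F z)) (z - z0)" "snd q * cis (- t0) = rcis (sinh (F z)) (t - t0)"
      by (simp_all add: qe \<Psi>_def polar)
    have nz: "fst q * cis (- z0) \<notin> \<real>\<^sub>\<le>\<^sub>0" "snd q * cis (- t0) \<notin> \<real>\<^sub>\<le>\<^sub>0" using q by (auto simp: V_def)
    have bd: "- pi < Arg w \<and> Arg w < pi \<and> cis (Arg w) = sgn w" if "w \<notin> \<real>\<^sub>\<le>\<^sub>0" for w :: complex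
    proof -
      have "w \<noteq> 0" using that by auto
      then have "cis (Arg w) = sgn w" by (rule cis_Arg)
      moreover have "Arg w \<noteq> pi" using that by (auto simp: Arg_eq_pi complex_nonpos_Reals_iff)
      ultimately show ?thesis using Arg_bounded[of w] by simp
    qed
    have ca: "cis a = cis (z - z0)" unfolding a_def using bd[OF nz(1)] f(1) by (simp add: rcis_def sgn_mult sgn_of_real sgn_eq norm_mult)
    have cb: "cis b = cis (t - t0)" unfolding b_def using bd[OF nz(2)] f(2) Fp[of z] by (simp add: rcis_def sgn_eq norm_mult)
    obtain i j :: int where ij: "a = z - z0 + 2 * pi * of_int i" "b = t - t0 + 2 * pi * of_int j"
      using cis_eq_imp[OF ca] cis_eq_imp[OF cb] by blast
    have Gq: "G q = (z + 2 * pi * of_int i, t + 2 * pi * of_int j)"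
      unfolding G_def a_def[symmetric] b_def[symmetric] ij by simp
    have "\<Psi> (z + 2 * pi * of_int i, t + 2 * pi * of_int j) = \<Psi> (z, t)"
      by (simp only: \<Psi>_def prod.case F2 cis_plus_2pi_int)
    then have "\<Psi> (G q) = q" by (rule trans[OF arg_cong[OF Gq, of \<Psi>] trans[OF _ qe[symmetric]]])
    moreover have "G q \<in> U" using bd[OF nz(1)] bd[OF nz(2)] by (simp add: G_def U_def)
    ultimately show ?thesis by blast
  qed
  have Fc: "continuous_on S F" for S by (rule DERIV_continuous_on[OF has_field_derivative_at_within[OF F_deriv']])
  have \<Psi>c: "continuous_on U \<Psi>"
    unfolding \<Psi>_def case_prod_unfold
    by (intro continuous_intros continuous_on_compose2[OF Fc[of UNIV]]) auto
  have Gc: "continuous_on (rot_surface I x y \<inter> V) G"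
    unfolding G_def by (intro continuous_intros continuous_on_compose2[OF continuous_on_Arg]) (auto simp: V_def)
  have "homeomorphism U (rot_surface I x y \<inter> V) \<Psi> G"
  proof (rule homeomorphismI[OF \<Psi>c Gc])
    show "\<Psi> ` U \<subseteq> rot_surface I x y \<inter> V" using U1 unfolding surf by blast
  qed (use U1 U2 in blast)+
  moreover have "C1_immersion_on U \<Psi>"
  proof -
    define \<Psi>' where "\<Psi>' = (\<lambda>(z, t) (h1, h2).
       (h1 *\<^sub>R ((complex_of_real (F' z * sinh (F z)) + \<i> * complex_of_real (cosh (F z))) * cis z),
        (complex_of_real (h1 * (F' z * cosh (F z))) + \<i> * complex_of_real (h2 * sinh (F z))) * cis t))"
    have D: "(\<Psi> has_derivative \<Psi>' u) (at u)" for u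
    proof -
      obtain z t where u: "u = (z, t)" by (cases u)
      have "((\<lambda>r. complex_of_real (cosh (F r)) * cis r) has_vector_derivative
          (complex_of_real (F' z * sinh (F z)) + \<i> * complex_of_real (cosh (F z) * 1)) * cis z) (at z)"
        by (rule has_vector_derivative_complex_of_real_mult_cis) (auto intro!: derivative_eq_intros F_deriv')
      then have 1: "((\<lambda>r. complex_of_real (cosh (F r)) * cis r) has_derivative
          (\<lambda>h. h *\<^sub>R ((complex_of_real (F' z * sinh (F z)) + \<i> * complex_of_real (cosh (F z))) * cis z))) (at z)"
        by (simp add: has_vector_derivative_def)
      have 2: "((\<lambda>r. complex_of_real (sinh (F r))) has_derivative (\<lambda>h. h *\<^sub>R complex_of_real (F' z * cosh (F z)))) (at z)"
      proof -
        have "((\<lambda>r. sinh (F r)) has_real_derivative F' z * cosh (F z)) (at z)" by (auto intro!: derivative_eq_intros F_deriv')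
        then have "((\<lambda>r. complex_of_real (sinh (F r))) has_vector_derivative complex_of_real (F' z * cosh (F z))) (at z)"
          by (rule has_vector_derivative_of_real)
        then show ?thesis by (simp add: has_vector_derivative_def)
      qed
      have 3: "((\<lambda>r. cis r) has_derivative (\<lambda>h. h *\<^sub>R (\<i> * cis t))) (at t)"
        using has_vector_derivative_complex_of_real_mult_cis[of "\<lambda>r. 1" 0 t UNIV "\<lambda>r. r" 1]
        by (simp add: has_vector_derivative_def)
      have f: "((\<lambda>u::real \<times> real. fst u) has_derivative fst) (at u)" "((\<lambda>u::real \<times> real. snd u) has_derivative snd) (at u)"
        by (rule has_derivative_fst[OF has_derivative_ident, unfolded id_def] has_derivative_snd[OF has_derivative_ident, unfolded id_def])+
      have "((\<lambda>u. (complex_of_real (cosh (F (fst u))) * cis (fst u), complex_of_real (sinh (F (fst u))) * cis (snd u))) has_derivative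
        (\<lambda>h. (fst h *\<^sub>R ((complex_of_real (F' z * sinh (F z)) + \<i> * complex_of_real (cosh (F z))) * cis z),
              complex_of_real (sinh (F (fst u))) * (snd h *\<^sub>R (\<i> * cis t)) + fst h *\<^sub>R complex_of_real (F' z * cosh (F z)) * cis (snd u)))) (at u)"
        by (intro has_derivative_Pair has_derivative_mult
            has_derivative_compose[OF f(1)] has_derivative_compose[OF f(2)]) (use 1 2 3 in \<open>simp_all add: u\<close>)
      then show ?thesis
        unfolding \<Psi>_def \<Psi>'_def case_prod_unfold u
        by (rule has_derivative_eq_rhs) (simp add: fun_eq_iff scaleR_conv_of_real algebra_simps)
    qed
    have inj: "inj (\<Psi>' u)" for u
    proof -
      obtain z t where u: "u = (z, t)" by (cases u)
      have lin: "linear (\<Psi>' u)" by (rule has_derivative_linear[OF D])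
      have "h = 0" if h0: "\<Psi>' u h = 0" for h
      proof -
        obtain h1 h2 where h: "h = (h1, h2)" by (cases h)
        have "h1 *\<^sub>R ((complex_of_real (F' z * sinh (F z)) + \<i> * complex_of_real (cosh (F z))) * cis z) = 0"
          using h0 by (simp add: \<Psi>'_def u h zero_prod_def)
        moreover have "complex_of_real (F' z * sinh (F z)) + \<i> * complex_of_real (cosh (F z)) \<noteq> 0"
          by (simp add: complex_eq_iff)
        ultimately have "h1 = 0" by auto
        moreover have "(complex_of_real (h1 * (F' z * cosh (F z))) + \<i> * complex_of_real (h2 * sinh (F z))) * cis t = 0"
          using h0 by (simp add: \<Psi>'_def u h zero_prod_def)
        ultimately have "h2 = 0" using Fp[of z] by simp
        then show ?thesis using \<open>h1 = 0\<close> by (simp add: h zero_prod_def)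
      qed
      then show ?thesis using linear_injective_0[OF lin] by blast
    qed
    have "continuous_on U (\<lambda>u. \<Psi>' u h)" for h
      unfolding \<Psi>'_def case_prod_unfold
      by (intro continuous_intros continuous_on_compose2[OF Fc[of UNIV]] continuous_on_compose2[OF F'_continuous]) auto
    then show ?thesis unfolding C1_immersion_on_def using D inj by blast
  qed
  moreover have "p \<in> V" using U1[of "(z0, t0)"] by (simp add: U_def p)
  moreover have "open U" by (simp add: U_def open_Times)
  ultimately show "\<exists>V U F G. open V \<and> p \<in> V \<and> open U \<and> homeomorphism U (rot_surface I x y \<inter> V) F G \<and> C1_immersion_on U F"
    using openV by blast
qed

end

section \<open>Negative energy: nodoid type\<close>

locale profile_closed_nodoid = profile_closed + assumes E_neg: "E < 0"
begin

text \<open>For E < 0 < H the discriminant is \<kappa>^2 plus a positive term, so S cannot be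
  constant.\<close>

lemma amp_pos: "amp > 0"
proof (rule ccontr)
  assume "\<not> amp > 0"
  then have "sqrt (root_disc \<kappa> H E) = 0" using root_disc_eq amp_nonneg by simp
  then have "16 * \<kappa> * E * (H - E) + \<kappa>\<^sup>2 = 0" by (simp add: root_disc_def)
  moreover have "\<kappa> * E * (H - E) > 0" using \<kappa>_neg E_neg H_pos by (simp add: mult_neg_neg)
  moreover have "\<kappa>\<^sup>2 > 0" using \<kappa>_neg by simp
  ultimately show False by linarith
qed

definition t0 :: real where "t0 = - E / H"

lemma t0: "t0 > 0" "E + H * t0 = 0" using E_neg H_pos by (simp_all add: t0_def divide_neg_pos)

lemma sgn_t0: "sgn (E + H * z) = sgn (z - t0)"
proof -
  have "E + H * z = H * (z - t0)" using t0(2) by (simp add: right_diff_distrib)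
  then show ?thesis using H_pos by (simp add: sgn_mult)
qed

text \<open>At t0 the energy term of \<open>Qf\<close> vanishes and \<open>Qf\<close> is positive,
  so t0 lies strictly between the two zeros of \<open>Qf\<close>, the extreme values of S.\<close>

lemma t0_between: "\<bar>t0 - mid\<bar> < amp"
proof -
  have "Qf t0 = t0 * (1 + t0)" by (simp add: Qf_def t0(2))
  then have "k * (amp\<^sup>2 - (t0 - mid)\<^sup>2) > 0" using t0(1) by (simp add: Qf_closed)
  then have "(t0 - mid)\<^sup>2 < amp\<^sup>2" using k_pos by (simp add: zero_less_mult_iff)
  then have "\<bar>t0 - mid\<bar>\<^sup>2 < amp\<^sup>2" by simp
  then show ?thesis by (rule power2_less_imp_less) (use amp_pos in simp)
qed

text \<open>The distance in arclength from a maximum of S to the next point where y turns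
  back.\<close>

definition u0 :: real where "u0 = arccos ((t0 - mid) / amp) / om"

lemma u0: "0 < u0" "u0 < h" "amp * cos (om * u0) = t0 - mid"
proof -
  have b: "-1 < (t0 - mid) / amp" "(t0 - mid) / amp < 1" using t0_between amp_pos by (simp_all add: abs_less_iff field_simps)
  have "0 < arccos ((t0 - mid) / amp)" "arccos ((t0 - mid) / amp) < pi" using arccos_lt_bounded[OF b] by blast+
  then show "0 < u0" "u0 < h" using om_pos by (simp_all add: u0_def h_def divide_strict_right_mono)
  have "om * u0 = arccos ((t0 - mid) / amp)" using om_pos by (simp add: u0_def)
  then show "amp * cos (om * u0) = t0 - mid" using b amp_pos by simp
qed

lemma sgn_cos_diff: "0 \<le> u \<Longrightarrow> u \<le> h \<Longrightarrow> 0 \<le> w \<Longrightarrow> w \<le> h \<Longrightarrow> sgn (cos (om * u) - cos (om * w)) = sgn (w - u)"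
proof -
  assume a: "0 \<le> u" "u \<le> h" "0 \<le> w" "w \<le> h"
  have b: "0 \<le> om * u" "om * u \<le> pi" "0 \<le> om * w" "om * w \<le> pi"
    using a om_pos mult_left_mono[of u h om] mult_left_mono[of w h om] om_h by simp_all
  have "cos (om * u) < cos (om * w) \<longleftrightarrow> om * w < om * u" "cos (om * w) < cos (om * u) \<longleftrightarrow> om * u < om * w"
    using cos_mono_less_eq[OF b] cos_mono_less_eq[OF b(3,4,1,2)] by simp_all
  then show ?thesis using om_pos by (simp add: sgn_real_def) linarith
qed

text \<open>The half period starts at a maximum of S for even n and at a minimum for odd n; in the
  latter case the turning point is reached after h - u0 and the signs are interchanged.\<close>

lemma sgn_piece:
  obtains c q where "0 < c" "c < h" "q = 1 \<or> q = -1"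
    "\<And>u. 0 \<le> u \<Longrightarrow> u \<le> h \<Longrightarrow> sgn (E + H * Sv (v0 + of_int n * h + u)) = q * sgn (c - u)"
proof (cases "even n")
  case True
  show ?thesis
  proof (rule that[of u0 1])
    fix u assume u: "0 \<le> u" "u \<le> h"
    have "Sv (v0 + of_int n * h + u) - t0 = amp * (cos (om * u) - cos (om * u0))"
      using True u0(3) by (simp add: Sv_shift power_int_minus_left right_diff_distrib)
    then show "sgn (E + H * Sv (v0 + of_int n * h + u)) = 1 * sgn (u0 - u)"
      using sgn_cos_diff[OF u, of u0] u0 amp_pos by (simp add: sgn_t0 sgn_mult)
  qed (use u0 in auto)
next
  case False
  show ?thesis
  proof (rule that[of "h - u0" "-1"])
    fix u assume u: "0 \<le> u" "u \<le> h"
    have "cos (om * (h - u)) = - cos (om * u)" by (simp only: right_diff_distrib om_h) simp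
    then have "Sv (v0 + of_int n * h + u) - t0 = amp * (cos (om * (h - u)) - cos (om * u0))"
      using False u0(3) by (simp add: Sv_shift power_int_minus_left right_diff_distrib)
    then have "sgn (E + H * Sv (v0 + of_int n * h + u)) = sgn (u0 - (h - u))"
      using sgn_cos_diff[of "h - u" u0] u u0 amp_pos by (simp add: sgn_t0 sgn_mult)
    moreover have "u0 - (h - u) = - (h - u0 - u)" by simp
    ultimately show "sgn (E + H * Sv (v0 + of_int n * h + u)) = - 1 * sgn (h - u0 - u)"
      by (simp only: sgn_minus)
  qed (use u0 in auto)
qed

lemma two_graphs_piece: "two_graphs {g (v0 + of_int n * h)..g (v0 + of_int n * h + h)} y \<alpha>"
proof -
  define a where "a = v0 + of_int n * h"
  obtain c q where c: "0 < c" "c < h" and q: "q = 1 \<or> q = -1"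
    and sg: "\<And>u. 0 \<le> u \<Longrightarrow> u \<le> h \<Longrightarrow> sgn (E + H * Sv (a + u)) = q * sgn (c - u)"
    using sgn_piece[of n] unfolding a_def by metis
  let ?S = "{g a..g (a + h)}"
  have le_g: "s \<le> g v \<longleftrightarrow> \<sigma> s \<le> v" and ge_g: "g v \<le> s \<longleftrightarrow> v \<le> \<sigma> s"
    and less_g: "s < g v \<longleftrightarrow> \<sigma> s < v" and gr_g: "g v < s \<longleftrightarrow> v < \<sigma> s" for s v
    using strict_mono_less_eq[OF \<sigma>_strict_mono, of s "g v"] strict_mono_less_eq[OF \<sigma>_strict_mono, of "g v" s]
      strict_mono_less[OF \<sigma>_strict_mono, of s "g v"] strict_mono_less[OF \<sigma>_strict_mono, of "g v" s] by simp_all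
  have im: "g ` T = {s. \<sigma> s \<in> T}" for T
  proof safe
    fix s assume "\<sigma> s \<in> T"
    then show "s \<in> g ` T" using imageI[of "\<sigma> s" T g] by simp
  qed simp
  have nz: "E + H * Sv z \<noteq> 0" if "a \<le> z" "z \<le> a + h" "z \<noteq> a + c" for z
  proof
    assume "E + H * Sv z = 0"
    then have "q * sgn (c - (z - a)) = 0" using sg[of "z - a"] that by simp
    then show False using q that(3) by (auto simp: sgn_0_0)
  qed
  have inj: "inj_on y {s. \<sigma> s \<in> T}" if "\<And>p q z. \<lbrakk>p \<in> T; q \<in> T; p < z; z < q\<rbrakk> \<Longrightarrow> a \<le> z \<and> z \<le> a + h \<and> z \<noteq> a + c" for T
    unfolding im[symmetric] by (rule y_inj_on, rule inj_on_Yv, rule nz) (use that in blast)+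
  have ts: "sgn \<tau> = 1 \<or> sgn \<tau> = -1" using \<tau>_nz by (simp add: sgn_real_def)
  have *: "(0 < sin (\<alpha> s) \<longleftrightarrow> 0 < sgn \<tau> * q * (c - (\<sigma> s - a))) \<and> (sin (\<alpha> s) < 0 \<longleftrightarrow> sgn \<tau> * q * (c - (\<sigma> s - a)) < 0)"
    if "s \<in> ?S" for s
  proof (rule same_sgn)
    have "sgn (E + H * Sv (a + (\<sigma> s - a))) = q * sgn (c - (\<sigma> s - a))"
      by (rule sg) (use that in \<open>simp_all add: le_g ge_g\<close>)
    then have "sgn (sin (\<alpha> s)) = sgn \<tau> * (q * sgn (c - (\<sigma> s - a)))" using sgn_sin[of "\<sigma> s"] by simp
    moreover have "sgn q = q" using q by auto
    ultimately show "sgn (sin (\<alpha> s)) = sgn (sgn \<tau> * q * (c - (\<sigma> s - a)))" by (simp add: sgn_mult)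
  qed
  have "two_graphs ?S y \<alpha>"
    unfolding two_graphs_def
  proof (intro exI[of _ "g (a + c)"] conjI)
    show "changes_sign_once (\<lambda>s. sin (\<alpha> s)) ?S (g (a + c))"
      unfolding changes_sign_once_def
    proof (intro conjI)
      show m: "g (a + c) \<in> ?S" using c by (simp add: le_g ge_g)
      show "\<exists>s\<in>?S. s < g (a + c)" using c by (intro bexI[of _ "g a"]) (simp_all add: le_g less_g)
      show "\<exists>s\<in>?S. g (a + c) < s" using c by (intro bexI[of _ "g (a + h)"]) (simp_all add: ge_g gr_g)
      show "sin (\<alpha> (g (a + c))) = 0" using *[OF m] by simp
      show "(\<forall>s\<in>?S. (s < g (a + c) \<longrightarrow> sin (\<alpha> s) < 0) \<and> (g (a + c) < s \<longrightarrow> 0 < sin (\<alpha> s))) \<or>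
        (\<forall>s\<in>?S. (s < g (a + c) \<longrightarrow> 0 < sin (\<alpha> s)) \<and> (g (a + c) < s \<longrightarrow> sin (\<alpha> s) < 0))"
        using ts q * by (elim disjE) (simp_all add: less_g gr_g del: atLeastAtMost_iff)
    qed
    show "inj_on y (?S \<inter> {..g (a + c)})"
      by (rule inj_on_subset[OF inj[of "{a..a + c}"]]) (use c in \<open>auto simp: le_g ge_g\<close>)
    show "inj_on y (?S \<inter> {g (a + c)..})"
      by (rule inj_on_subset[OF inj[of "{a + c..a + h}"]]) (use c in \<open>auto simp: le_g ge_g\<close>)
  qed
  then show ?thesis by (simp add: a_def)
qed

lemma cos_zero_closed: "cos (\<alpha> s) = 0 \<longleftrightarrow> (\<exists>n::int. s = g (v0 + of_int n * h))"
proof -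
  have "cos (\<alpha> s) = 0 \<longleftrightarrow> Pv (\<sigma> s) = 0" by (simp add: Pv_zero_iff)
  also have "\<dots> \<longleftrightarrow> (\<exists>n::int. \<sigma> s = v0 + of_int n * h)" by (rule Pv_zero_closed[OF amp_pos])
  also have "\<dots> \<longleftrightarrow> (\<exists>n::int. s = g (v0 + of_int n * h))" by (metis \<sigma>_g g_\<sigma>)
  finally show ?thesis .
qed

lemma g_less: "g v < g w \<longleftrightarrow> v < w" by (rule strict_mono_less[OF g_strict_mono])

lemma consecutive: "consecutive_critical I \<alpha> a b \<longleftrightarrow> (\<exists>n::int. a = g (v0 + of_int n * h) \<and> b = g (v0 + of_int n * h + h))"
proof
  assume c: "consecutive_critical I \<alpha> a b"
  then obtain n m :: int where nm: "a = g (v0 + of_int n * h)" "b = g (v0 + of_int m * h)"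
    unfolding consecutive_critical_def by (meson cos_zero_closed)
  have "a < b" using c by (simp add: consecutive_critical_def)
  then have "of_int n * h < of_int m * h" by (simp add: nm g_less)
  then have "n < m" using h_pos by simp
  have "\<not> n + 1 < m"
  proof
    assume "n + 1 < m"
    then have "of_int (n + 1) * h < of_int m * h" using h_pos by (intro mult_strict_right_mono) auto
    moreover have "of_int n * h < of_int (n + 1) * h" using h_pos by (intro mult_strict_right_mono) auto
    ultimately have "a < g (v0 + of_int (n + 1) * h)" "g (v0 + of_int (n + 1) * h) < b" by (simp_all add: nm g_less)
    then have "cos (\<alpha> (g (v0 + of_int (n + 1) * h))) \<noteq> 0" using c by (simp add: consecutive_critical_def)
    then show False using cos_zero_closed by blast
  qed
  then have "m = n + 1" using \<open>n < m\<close> by linarith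
  then show "\<exists>n::int. a = g (v0 + of_int n * h) \<and> b = g (v0 + of_int n * h + h)"
    using nm by (intro exI[of _ n]) (simp add: distrib_right add.assoc)
next
  assume "\<exists>n::int. a = g (v0 + of_int n * h) \<and> b = g (v0 + of_int n * h + h)"
  then obtain n :: int where n: "a = g (v0 + of_int n * h)" "b = g (v0 + of_int n * h + h)" by blast
  have b: "b = g (v0 + of_int (n + 1) * h)" by (simp add: n distrib_right add.assoc)
  have "cos (\<alpha> s) \<noteq> 0" if "a < s" "s < b" for s
  proof
    assume "cos (\<alpha> s) = 0"
    then obtain m :: int where m: "s = g (v0 + of_int m * h)" using cos_zero_closed by blast
    then have "of_int n * h < of_int m * h" "of_int m * h < of_int (n + 1) * h"
      using that unfolding b unfolding n(1) m g_less by simp_all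
    then have "real_of_int n < real_of_int m" "real_of_int m < real_of_int (n + 1)" using h_pos by simp_all
    then have "n < m" "m < n + 1" by (simp_all only: of_int_less_iff)
    then show False by linarith
  qed
  moreover have "a < b" using h_pos by (simp add: n g_less)
  moreover have "cos (\<alpha> a) = 0" "cos (\<alpha> b) = 0" using cos_zero_closed n(1) b by blast+
  ultimately show "consecutive_critical I \<alpha> a b" by (simp add: consecutive_critical_def I_UNIV)
qed

lemma nodoid: "nodoid_type (x_min \<kappa> H E) (x_max \<kappa> H E) I x y \<alpha>"
  unfolding nodoid_type_def
proof (intro conjI)
  have xm: "x_min \<kappa> H E = arsinh (sqrt (mid - amp))" "x_max \<kappa> H E = arsinh (sqrt (mid + amp))"
    by (simp_all add: x_min_def x_max_def t_min_eq t_max_eq)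
  show "x_min \<kappa> H E < x_max \<kappa> H E" unfolding xm arsinh_less_iff_real using amp_pos by simp
  show "x ` I = {x_min \<kappa> H E..x_max \<kappa> H E}" by (rule x_range)
  show "\<forall>c\<in>I. cos (\<alpha> c) = 0 \<longrightarrow> symmetric_at c I x y" using symmetric_at_critical by blast
  show "\<forall>s\<in>I. \<exists>a b. a \<le> s \<and> s < b \<and> consecutive_critical I \<alpha> a b"
  proof
    fix s
    define n where "n = \<lfloor>(\<sigma> s - v0) / h\<rfloor>"
    have "of_int n \<le> (\<sigma> s - v0) / h" "(\<sigma> s - v0) / h < of_int n + 1" unfolding n_def by linarith+
    then have b: "v0 + of_int n * h \<le> \<sigma> s" "\<sigma> s < v0 + of_int n * h + h"
      using h_pos by (simp_all add: pos_le_divide_eq pos_divide_less_eq distrib_right)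
    have "g (v0 + of_int n * h) \<le> g (\<sigma> s)" using b(1) by (simp only: strict_mono_less_eq[OF g_strict_mono])
    moreover have "g (\<sigma> s) < g (v0 + of_int n * h + h)" using b(2) by (simp only: g_less)
    ultimately show "\<exists>a b. a \<le> s \<and> s < b \<and> consecutive_critical I \<alpha> a b"
      unfolding consecutive g_\<sigma> by blast
  qed
  show "\<forall>a b. consecutive_critical I \<alpha> a b \<longrightarrow>
        (x a = x_min \<kappa> H E \<and> x b = x_max \<kappa> H E \<or> x a = x_max \<kappa> H E \<and> x b = x_min \<kappa> H E) \<and> two_graphs {a..b} y \<alpha>"
  proof (intro allI impI conjI)
    fix a b assume "consecutive_critical I \<alpha> a b"
    then obtain n :: int where n: "a = g (v0 + of_int n * h)" "b = g (v0 + of_int n * h + h)" unfolding consecutive by blast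
    show "two_graphs {a..b} y \<alpha>" unfolding n by (rule two_graphs_piece)
    have "Sv (v0 + of_int n * h) = mid + amp * (-1) powi n" using Sv_shift[of n 0] by simp
    moreover have "Sv (v0 + of_int n * h + h) = mid - amp * (-1) powi n" using Sv_shift[of n h] by (simp add: om_h)
    ultimately show "x a = x_min \<kappa> H E \<and> x b = x_max \<kappa> H E \<or> x a = x_max \<kappa> H E \<and> x b = x_min \<kappa> H E"
      unfolding n xm x_g by (cases "even n") (simp_all add: power_int_minus_left)
  qed
qed

lemma sgn_near_max: "0 \<le> u \<Longrightarrow> u \<le> h \<Longrightarrow> sgn (E + H * Sv (v0 + u)) = sgn (u0 - u)"
proof -
  assume u: "0 \<le> u" "u \<le> h"
  have "Sv (v0 + u) - t0 = amp * (cos (om * u) - cos (om * u0))"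
    using u0(3) by (simp add: Sv_explicit right_diff_distrib)
  then show ?thesis
    using sgn_cos_diff[OF u, of u0] u0 amp_pos by (simp add: sgn_t0 sgn_mult)
qed

text \<open>The monotone factor in \<open>Rf_pr\<close>, written in terms of z / (1 + z) so that its
  monotonicity is visible.\<close>

definition pr :: "real \<Rightarrow> real" where "pr z = sqrt (z / (1 + z) * (1 + \<rho> * (z / (1 + z))))"

lemma pr_mono: "0 < z \<Longrightarrow> z \<le> w \<Longrightarrow> pr z \<le> pr w"
proof -
  assume z: "0 < z" "z \<le> w"
  have p: "z / (1 + z) \<le> w / (1 + w)" using z by (simp add: divide_simps algebra_simps)
  have "0 \<le> z / (1 + z)" using z by simp
  then show ?thesis unfolding pr_def using p z \<rho>_pos
    by (intro real_sqrt_le_mono mult_mono add_left_mono mult_left_mono) auto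
qed

lemma pr_pos: "0 < z \<Longrightarrow> pr z > 0"
  unfolding pr_def using \<rho>_pos by (simp add: add_pos_pos)

lemma Rf_pr: "0 < z \<Longrightarrow> \<tau> * Rf z = (E + H * z) / z * pr z"
proof -
  assume z: "0 < z"
  have "z / (1 + z) * (1 + \<rho> * (z / (1 + z))) = z * (1 + (1 + \<rho>) * z) / (1 + z)\<^sup>2"
    using z by (simp add: divide_simps power2_eq_square) (simp add: algebra_simps)
  then have "pr z = sqrt z * sqrt (1 + (1 + \<rho>) * z) / (1 + z)"
    unfolding pr_def using z by (simp add: real_sqrt_divide real_sqrt_mult)
  moreover define q w where "q = sqrt z" and "w = sqrt (1 + (1 + \<rho>) * z)"
  moreover have "q / z = 1 / q" using z by (simp add: q_def field_simps)
  ultimately have "(E + H * z) / z * pr z = (E + H * z) * (1 / q) * w / (1 + z)"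
    by (simp add: mult.assoc[symmetric] times_divide_eq_right[symmetric] del: times_divide_eq_right)
  also have "\<dots> = \<tau> * Rf z" using \<tau>_nz by (simp add: Rf_def q_def w_def)
  finally show ?thesis ..
qed

text \<open>The ratio of \<open>\<tau> Y'\<close> and \<open>(E + H S) / S\<close> is increasing in \<open>S\<close>, and the integral of
  the latter over a period is elementary and positive.\<close>

lemma \<tau>_T_pos: "\<tau> * T > 0"
proof -
  \<comment> \<open>The geometric mean of the minimum and the maximum of S.\<close>
  define D where "D = sqrt (mid\<^sup>2 - amp\<^sup>2)"
  have md: "mid > amp" using t_min_pos by simp
  have md2: "mid\<^sup>2 - amp\<^sup>2 > 0"
  proof -
    have "(mid - amp) * (mid + amp) > 0" using md amp_pos by (intro mult_pos_pos) auto
    then show ?thesis by (simp add: algebra_simps power2_eq_square)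
  qed
  have D: "D > 0" "D\<^sup>2 = mid\<^sup>2 - amp\<^sup>2" using md2 by (simp_all add: D_def)
  \<comment> \<open>The product of the zeros of \<open>Qf\<close> gives (4 H^2 + \<kappa>) D^2 = 4
    E^2, and \<kappa> < 0 makes -E smaller than H D.\<close>
  have E_D: "H + E / D > 0"
  proof -
    have "k * D\<^sup>2 = - (4 * E\<^sup>2 / \<kappa>)" using Qf_closed[of 0] by (simp add: Qf_def D(2) algebra_simps)
    then have e: "(4 * H\<^sup>2 + \<kappa>) * D\<^sup>2 = 4 * E\<^sup>2" using \<kappa>_neg by (simp add: k_def field_simps)
    have "\<kappa> * D\<^sup>2 < 0" using \<kappa>_neg D(1) by (simp add: mult_neg_pos)
    then have "4 * E\<^sup>2 < 4 * (H * D)\<^sup>2" using e by (simp add: power_mult_distrib distrib_right)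
    then have "(- E)\<^sup>2 < (H * D)\<^sup>2" by simp
    then have "- E < H * D" by (rule power2_less_imp_less) (use H_pos D in simp)
    then show ?thesis using D(1) by (simp add: field_simps)
  qed
  define c where "c v = cos (om * (v - v0))" for v
  \<comment> \<open>An antiderivative of \<open>om * D / Sv\<close> in the half period after v0, by
    the same substitution that relates the two anomalies of a Kepler ellipse.\<close>
  define \<Theta> where "\<Theta> v = arccos ((amp + mid * c v) / Sv v)" for v
  have Sc: "Sv v = mid + amp * c v" for v by (simp add: Sv_explicit c_def)
  have wb: "-1 \<le> (amp + mid * c v) / Sv v" "(amp + mid * c v) / Sv v \<le> 1" for v
  proof -
    have "\<bar>c v\<bar> \<le> 1" by (simp add: c_def)
    then have "0 \<le> (mid - amp) * (1 - c v)" "0 \<le> (mid + amp) * (1 + c v)"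
      using md amp_pos by (auto intro!: mult_nonneg_nonneg simp: abs_le_iff)
    then have "- Sv v \<le> amp + mid * c v" "amp + mid * c v \<le> Sv v" unfolding Sc by (simp_all add: algebra_simps)
    then show "-1 \<le> (amp + mid * c v) / Sv v" "(amp + mid * c v) / Sv v \<le> 1" using Sv_pos[of v] by (simp_all add: divide_simps)
  qed
  \<comment> \<open>The value of the monotone factor where E + H S changes sign: the derivative of
    \<open>Z\<close> becomes a product of two factors that change sign together.\<close>
  define r0 where "r0 = pr t0"
  have r0: "r0 > 0" unfolding r0_def by (rule pr_pos[OF t0(1)])
  define Z where "Z v = \<tau> * Yv v - r0 * (H * v + E / (om * D) * \<Theta> v)" for v
  have cc: "continuous_on X c" for X unfolding c_def by (intro continuous_intros)
  have "Z v0 \<le> Z (v0 + h)"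
  proof (rule DERIV_nonneg_imp_increasing_open[where f = Z and a = v0 and b = "v0 + h"])
    show "v0 \<le> v0 + h" using h_pos by simp
    show "continuous_on {v0..v0 + h} Z"
      unfolding Z_def \<Theta>_def using Sv_pos wb
      by (intro continuous_intros Yv_continuous continuous_on_arccos cc Sv_continuous) (auto simp: less_imp_neq[symmetric])
    fix v assume v: "v0 < v" "v < v0 + h"
    define s where "s = sin (om * (v - v0))"
    have "0 < om * (v - v0)" "om * (v - v0) < om * h" using v om_pos by simp_all
    then have s0: "s > 0" unfolding s_def om_h by (rule sin_gt_zero)
    have cs: "(c v)\<^sup>2 = 1 - s\<^sup>2" by (simp add: c_def s_def cos_squared_eq)
    have dc: "(c has_real_derivative - om * s) (at v)"
      unfolding c_def[abs_def] s_def by (rule derivative_eq_intros refl | simp)+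
    have Sp: "Sv v > 0" by (rule Sv_pos)
    have Pve: "Pv v = - amp * om * s" by (simp add: Pv_explicit s_def)
    have dw: "((\<lambda>v. (amp + mid * c v) / Sv v) has_real_derivative - om * s * D\<^sup>2 / (Sv v)\<^sup>2) (at v)"
    proof -
      have "((\<lambda>v. (amp + mid * c v) / Sv v) has_real_derivative
          (mid * (- om * s) * Sv v - (amp + mid * c v) * Pv v) / (Sv v * Sv v)) (at v)"
        using Sp by (auto intro!: derivative_eq_intros dc Sv_deriv)
      moreover have "mid * (- om * s) * Sv v - (amp + mid * c v) * Pv v = - om * s * D\<^sup>2"
        unfolding Pve D(2) Sc by (simp add: algebra_simps power2_eq_square)
      ultimately show ?thesis by (simp add: power2_eq_square)
    qed
    have w2: "1 - ((amp + mid * c v) / Sv v)\<^sup>2 = (D * s / Sv v)\<^sup>2"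
    proof -
      have "(Sv v)\<^sup>2 - (amp + mid * c v)\<^sup>2 = (D * s)\<^sup>2"
        unfolding power_mult_distrib D(2) Sc using cs by algebra
      then show ?thesis using Sp by (simp add: power_divide diff_divide_distrib[symmetric] divide_simps)
    qed
    have pos: "D * s / Sv v > 0" using D s0 Sp by simp
    have "((amp + mid * c v) / Sv v)\<^sup>2 < 1" using w2 zero_less_power[OF pos, of 2] by linarith
    then have "\<bar>(amp + mid * c v) / Sv v\<bar> < 1" by (simp only: abs_square_less_1)
    then have wbs: "-1 < (amp + mid * c v) / Sv v" "(amp + mid * c v) / Sv v < 1"
      by (simp_all only: abs_less_iff) linarith
    have "(\<Theta> has_real_derivative inverse (- sqrt (1 - ((amp + mid * c v) / Sv v)\<^sup>2)) * (- om * s * D\<^sup>2 / (Sv v)\<^sup>2)) (at v)"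
      unfolding \<Theta>_def[abs_def] by (rule DERIV_chain2[OF DERIV_arccos[OF wbs] dw])
    moreover have "inverse (- sqrt (1 - ((amp + mid * c v) / Sv v)\<^sup>2)) * (- om * s * D\<^sup>2 / (Sv v)\<^sup>2) = om * D / Sv v"
    proof -
      have "sqrt ((D * s / Sv v)\<^sup>2) = D * s / Sv v"
        by (rule real_sqrt_unique[OF refl less_imp_le[OF pos]])
      then show ?thesis unfolding w2 using D(1) s0 Sp by (simp add: field_simps power2_eq_square)
    qed
    ultimately have d\<Theta>: "(\<Theta> has_real_derivative om * D / Sv v) (at v)" by simp
    have "(Z has_real_derivative \<tau> * Rf (Sv v) - r0 * (H * 1 + E / (om * D) * (om * D / Sv v))) (at v)"
      unfolding Z_def[abs_def]
      by (intro DERIV_diff DERIV_cmult DERIV_add Yv_deriv d\<Theta> DERIV_ident)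
    moreover have "\<tau> * Rf (Sv v) - r0 * (H * 1 + E / (om * D) * (om * D / Sv v)) \<ge> 0"
    proof -
      have "H * 1 + E / (om * D) * (om * D / Sv v) = (E + H * Sv v) / Sv v"
        using om_pos D(1) Sp by (simp add: field_simps)
      then have "\<tau> * Rf (Sv v) - r0 * (H * 1 + E / (om * D) * (om * D / Sv v)) = (E + H * Sv v) / Sv v * (pr (Sv v) - r0)"
        by (simp only: Rf_pr[OF Sp] right_diff_distrib mult.commute[of r0])
      also have "\<dots> \<ge> 0"
      proof (cases "Sv v \<ge> t0")
        case True
        then have "sgn (E + H * Sv v) \<ge> 0" by (simp add: sgn_t0)
        then have "0 \<le> E + H * Sv v" by simp
        moreover have "0 \<le> pr (Sv v) - r0" using pr_mono[OF t0(1) True] by (simp add: r0_def)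
        ultimately show ?thesis using Sp by simp
      next
        case False
        then have "sgn (E + H * Sv v) \<le> 0" by (simp add: sgn_t0)
        then have "E + H * Sv v \<le> 0" by simp
        moreover have "pr (Sv v) - r0 \<le> 0" using pr_mono[OF Sp, of t0] False by (simp add: r0_def)
        ultimately show ?thesis using Sp by (simp add: mult_nonpos_nonpos divide_nonpos_pos)
      qed
      finally show ?thesis .
    qed
    ultimately show "\<exists>y. (Z has_real_derivative y) (at v) \<and> 0 \<le> y" by blast
  qed
  note Zle = this
  have \<Theta>0: "\<Theta> v0 = 0" using md amp_pos by (simp add: \<Theta>_def Sc c_def add.commute)
  have \<Theta>h: "\<Theta> (v0 + h) = pi"
  proof -
    have "c (v0 + h) = -1" by (simp add: c_def om_h)
    then have "(amp + mid * c (v0 + h)) / Sv (v0 + h) = -1" using md by (simp add: Sc divide_simps)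
    then show ?thesis by (simp add: \<Theta>_def)
  qed
  define e where "e = E / (om * D) * pi"
  have "\<tau> * (Yv (v0 + h) - Yv v0) \<ge> r0 * (H * h + E / (om * D) * pi)"
    using Zle unfolding Z_def \<Theta>0 \<Theta>h e_def[symmetric] by (simp add: algebra_simps)
  moreover have "H * h + E / (om * D) * pi = h * (H + E / D)" using om_pos D(1) by (simp add: h_def field_simps)
  moreover have "r0 * (h * (H + E / D)) > 0" using r0 h_pos E_D by simp
  ultimately have "\<tau> * (Yv (v0 + h) - Yv v0) > 0" by (simp only:)
  moreover have "T = 2 * (Yv (v0 + h) - Yv v0)" using Yv_half[of 1] by simp
  then have "\<tau> * T = 2 * (\<tau> * (Yv (v0 + h) - Yv v0))" by (simp only: mult.left_commute)
  ultimately show ?thesis by linarith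
qed

text \<open>After the maximum at v0, y moves in the direction of \<tau> up to u0 and then back. By
  \<open>\<tau>_T_pos\<close> the net motion up to the minimum at v0 + h still has that direction,
  so y has already passed the value it takes there. Reflection in the axis through the minimum sends
  this earlier point to one with the same x and y, where the curve crosses itself.\<close>

lemma not_embedded_nodoid: "\<not> embedded_surface (rot_surface I x y)"
proof -
  define e where "e = sgn \<tau>"
  have e: "e * e = 1" "e * T > 0" "e * \<tau> > 0"
    using \<tau>_T_pos \<tau>_nz by (auto simp: e_def sgn_real_def zero_less_mult_iff)
  have d: "((\<lambda>v. e * Yv v) has_real_derivative e * Rf (Sv v)) (at v)" for v
    by (rule DERIV_cmult[OF Yv_deriv])
  have sd: "sgn (e * Rf (Sv (v0 + u))) = sgn (u0 - u)" if "0 \<le> u" "u \<le> h" for u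
    using sgn_near_max[OF that] e(1) by (simp add: sgn_mult Rf_sgn mult.assoc[symmetric] e_def)
  have "e * Yv (v0 + h) < e * Yv (v0 + u0)"
  proof (rule DERIV_neg_imp_decreasing_open[where f = "\<lambda>v. e * Yv v"])
    show "v0 + u0 < v0 + h" using u0 by simp
    show "\<exists>y. ((\<lambda>v. e * Yv v) has_real_derivative y) (at v) \<and> y < 0" if v: "v0 + u0 < v" "v < v0 + h" for v
    proof -
      have "sgn (e * Rf (Sv v)) = -1" using sd[of "v - v0"] v u0 by simp
      then have "e * Rf (Sv v) < 0" by (simp add: sgn_1_neg)
      then show ?thesis using d by blast
    qed
  qed (intro continuous_intros Yv_continuous)
  moreover have "e * Yv v0 < e * Yv (v0 + h)"
    using e(2) Yv_half[of 1] by (simp add: distrib_left)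
  moreover have "continuous_on {v0..v0 + u0} (\<lambda>v. e * Yv v)" by (intro continuous_intros Yv_continuous)
  moreover have "v0 \<le> v0 + u0" using u0 by simp
  ultimately obtain v where v: "v0 \<le> v" "v \<le> v0 + u0" "e * Yv v = e * Yv (v0 + h)"
    using IVT'[of "\<lambda>v. e * Yv v" v0 "e * Yv (v0 + h)" "v0 + u0", OF less_imp_le less_imp_le] by blast
  have Yv: "Yv v = Yv (v0 + h)" using v(3) e(1) by (metis mult.assoc mult_1)
  have ne: "v \<noteq> v0" "v \<noteq> v0 + u0" using v(3) \<open>e * Yv v0 < _\<close> \<open>e * Yv (v0 + h) < _\<close> by auto
  define c u where "c = v0 + h" and "u = v - c"
  have P: "Pv c = 0" using Pv_zero_closed[OF amp_pos, of c] by (auto simp: c_def intro!: exI[of _ 1])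
  have cu: "c + u = v" by (simp add: u_def)
  have Y: "Yv (c - u) = Yv (c + u)" using Yv_symmetric[OF P, of u] Yv unfolding cu by (simp add: c_def)
  show ?thesis
  proof (rule not_embedded_of_mirror_crossing[OF P, of u])
    show "E + H * Sv (c + u) \<noteq> 0"
    proof
      assume "E + H * Sv (c + u) = 0"
      then have "sgn (u0 - (v - v0)) = 0" using sgn_near_max[of "v - v0"] v u0 unfolding cu by simp
      then show False using ne by (simp add: sgn_0_0)
    qed
    show "Pv (c + u) \<noteq> 0"
    proof
      assume "Pv (c + u) = 0"
      then obtain n :: int where n: "v = v0 + of_int n * h" unfolding cu using Pv_zero_closed[OF amp_pos] by blast
      have "0 < v - v0" "v - v0 < h" using v(1,2) ne u0 by linarith+
      then have "0 < of_int n * h" "of_int n * h < 1 * h" by (simp_all add: n)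
      then have "0 < real_of_int n" "real_of_int n < 1" using h_pos by (simp_all add: zero_less_mult_iff)
      then show False by simp
    qed
  qed (simp add: Y)
qed

lemma compact_iff_nodoid: "compact (rot_surface I x y) \<longleftrightarrow> (\<exists>r\<in>\<rat>. period \<kappa> \<tau> H E = r * pi)"
  using rational_of_compact[OF amp_pos] compact_of_rational by (auto simp: period_eq[OF amp_pos])

end

section \<open>Quotient maps and the topological sphere\<close>

lemma closedin_top_of_set_sequentially:
  fixes V :: "'a::metric_space set"
  shows "closedin (top_of_set U) V \<longleftrightarrow> V \<subseteq> U \<and> (\<forall>\<xi> u. (\<forall>n. \<xi> n \<in> V) \<and> \<xi> \<longlonglongrightarrow> u \<and> u \<in> U \<longrightarrow> u \<in> V)"
proof
  assume "closedin (top_of_set U) V"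
  then obtain T where T: "closed T" "V = U \<inter> T" by (auto simp: closedin_closed)
  have "u \<in> T" if "\<forall>n. \<xi> n \<in> V" "\<xi> \<longlonglongrightarrow> u" for \<xi> u
    by (rule closed_sequentially[OF T(1) _ that(2)]) (use that(1) T(2) in auto)
  then show "V \<subseteq> U \<and> (\<forall>\<xi> u. (\<forall>n. \<xi> n \<in> V) \<and> \<xi> \<longlonglongrightarrow> u \<and> u \<in> U \<longrightarrow> u \<in> V)"
    using T(2) by blast
next
  assume V: "V \<subseteq> U \<and> (\<forall>\<xi> u. (\<forall>n. \<xi> n \<in> V) \<and> \<xi> \<longlonglongrightarrow> u \<and> u \<in> U \<longrightarrow> u \<in> V)"
  then have "V = U \<inter> closure V"
    using closure_subset[of V] by (auto simp: closure_sequential)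
  then show "closedin (top_of_set U) V" unfolding closedin_closed using closed_closure by blast
qed

text \<open>The angle is unbounded, so preimages of convergent sequences need not cluster in all of
  \<open>A\<close>; it is enough that they do in a subset \<open>K\<close> that already covers
  \<open>U\<close>.\<close>

lemma quotient_map_of_subsequences:
  fixes q :: "'a::metric_space \<Rightarrow> 'b::metric_space"
  assumes c: "continuous_on A q" and A: "q ` A = U" and K: "K \<subseteq> A" "q ` K = U"
    and sub: "\<And>k u. \<lbrakk>\<And>n. k n \<in> K; (\<lambda>n. q (k n)) \<longlonglongrightarrow> u; u \<in> U\<rbrakk>
      \<Longrightarrow> \<exists>l\<in>K. \<exists>r. strict_mono (r :: nat \<Rightarrow> nat) \<and> (k \<circ> r) \<longlonglongrightarrow> l"
  shows "quotient_map (top_of_set A) (top_of_set U) q"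
  unfolding quotient_map_closedin
proof (intro conjI allI impI)
  show "q ` topspace (top_of_set A) = topspace (top_of_set U)" using A by simp
  fix V assume "V \<subseteq> topspace (top_of_set U)"
  then have V: "V \<subseteq> U" by simp
  have cl: "closedin (top_of_set U) V" if P: "closedin (top_of_set A) {x \<in> A. q x \<in> V}"
    unfolding closedin_top_of_set_sequentially
  proof (intro conjI V allI impI, elim conjE)
    fix \<xi> u assume \<xi>: "\<forall>n. \<xi> n \<in> V" "\<xi> \<longlonglongrightarrow> u" and u: "u \<in> U"
    have "\<exists>l. l \<in> K \<and> q l = \<xi> n" for n
    proof -
      have "\<xi> n \<in> q ` K" unfolding K(2) by (rule subsetD[OF V spec[OF \<xi>(1)]])
      then obtain l where "\<xi> n = q l" "l \<in> K" by (rule imageE)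
      then show ?thesis by (intro exI[of _ l]) simp
    qed
    from choice[OF allI[OF this]] obtain k where k': "\<forall>n. k n \<in> K \<and> q (k n) = \<xi> n" by (rule exE)
    then have k: "\<And>n. k n \<in> K" "\<And>n. q (k n) = \<xi> n" by simp_all
    have "(\<lambda>n. q (k n)) \<longlonglongrightarrow> u" using \<xi>(2) by (simp add: k(2))
    from sub[OF k(1) this u] obtain l and r :: "nat \<Rightarrow> nat" where l: "l \<in> K" "strict_mono r" "(k \<circ> r) \<longlonglongrightarrow> l"
      by (elim bexE exE conjE) (rule that)
    have kA: "(k \<circ> r) n \<in> A" for n using subsetD[OF K(1) k(1)[of "r n"]] by simp
    have lA: "l \<in> A" by (rule subsetD[OF K(1) l(1)])
    have "(\<lambda>n. q ((k \<circ> r) n)) \<longlonglongrightarrow> q l"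
      by (rule continuous_on_tendsto_compose[OF c l(3) lA]) (simp add: kA[unfolded o_apply])
    moreover have "(\<xi> \<circ> r) \<longlonglongrightarrow> u" by (rule LIMSEQ_subseq_LIMSEQ[OF \<xi>(2) l(2)])
    moreover have "(\<lambda>n. q ((k \<circ> r) n)) = \<xi> \<circ> r" by (simp add: fun_eq_iff k(2))
    ultimately have ql: "q l = u" by (metis LIMSEQ_unique)
    have "\<forall>n. (k \<circ> r) n \<in> {x \<in> A. q x \<in> V}" using kA k(2) \<xi>(1) by simp
    then have "l \<in> {x \<in> A. q x \<in> V}" 
      using P[unfolded closedin_top_of_set_sequentially, THEN conjunct2, THEN spec, THEN spec, of "k \<circ> r" l] l(3) lA by simp
    then show "u \<in> V" using ql by simp
  qed
  have "closedin (top_of_set A) {x \<in> A. q x \<in> V}" if "closedin (top_of_set U) V"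
  proof -
    have "A \<inter> q -` V = {x \<in> A. q x \<in> V}" by auto
    moreover have "closedin (top_of_set A) (A \<inter> q -` V)"
      by (rule continuous_closedin_preimage_gen[OF c _ that]) (use A in auto)
    ultimately show ?thesis by simp
  qed
  then show "closedin (top_of_set A) {x \<in> topspace (top_of_set A). q x \<in> V} = closedin (top_of_set U) V"
    using cl by auto
qed

lemma polar_coordinates: "\<exists>t\<in>{0..2 * pi}. (a, b) = (r * cos t, r * sin t)" if "r = norm (a, b :: real)"
proof -
  have r: "cmod (Complex a b) = r" using that by (simp add: cmod_def norm_Pair)
  define t where "t = Arg2pi (Complex a b)"
  have "Complex a b = of_real r * exp (\<i> * of_real t)"
    using Arg2pi_eq[of "Complex a b"] r by (simp add: t_def)
  then have "Complex a b = of_real r * cis t" by (simp add: cis_conv_exp)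
  then have "a = r * cos t" "b = r * sin t" by (simp_all add: complex_eq_iff)
  moreover have "t \<in> {0..2 * pi}" using Arg2pi[of "Complex a b"] by (auto simp: t_def less_imp_le)
  ultimately show ?thesis by blast
qed

lemma cos_sin_eq_imp: "cos a = cos b \<Longrightarrow> sin a = sin b \<Longrightarrow> \<exists>n::int. b = a + 2 * pi * of_int n"
  using sin_cos_eq_iff[of b a] by auto

text \<open>Geographic coordinates: the interval becomes the colatitude and t the longitude; the two
  ends on the axis become the poles.\<close>

lemma two_sphere_of_interval:
  assumes "a < b" and x: "x a = 0" "x b = 0" "\<And>s. a < s \<Longrightarrow> s < b \<Longrightarrow> x s \<noteq> 0"
  shows "two_sphere_surface {a..b} x"
proof -
  define th where "th s = pi * (s - a) / (b - a)" for s
  define q :: "real \<times> real \<Rightarrow> real^3" where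
    "q p = vector [sin (th (fst p)) * cos (snd p), sin (th (fst p)) * sin (snd p), cos (th (fst p))]" for p
  have th: "0 \<le> th s \<and> th s \<le> pi" if "s \<in> {a..b}" for s
  proof -
    have h: "0 \<le> (s - a) / (b - a)" "(s - a) / (b - a) \<le> 1" using that assms(1) by (auto simp: divide_simps)
    have e: "th s = pi * ((s - a) / (b - a))" by (simp add: th_def)
    show ?thesis unfolding e
      using mult_left_mono[OF h(2) pi_ge_zero] mult_nonneg_nonneg[OF pi_ge_zero h(1)] by simp
  qed
  have th_inj: "th s = th r \<Longrightarrow> s = r" for s r using assms(1) by (simp add: th_def)
  have qn: "norm (q p) = 1" for p
  proof -
    have "(sin (th (fst p)) * cos (snd p))\<^sup>2 + (sin (th (fst p)) * sin (snd p))\<^sup>2 + (cos (th (fst p)))\<^sup>2 = 1"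
      by (simp add: power_mult_distrib distrib_left[symmetric])
    then show ?thesis by (simp add: q_def norm_vec_def L2_set_def sum_3)
  qed
  have c: "continuous_on X q" for X
  proof -
    have "continuous_on X (\<lambda>p. q p $ 1)" unfolding q_def th_def vector_3
      by (intro continuous_intros) (use assms(1) in simp_all)
    moreover have "continuous_on X (\<lambda>p. q p $ 2)" unfolding q_def th_def vector_3
      by (intro continuous_intros) (use assms(1) in simp_all)
    moreover have "continuous_on X (\<lambda>p. q p $ 3)" unfolding q_def th_def vector_3
      by (intro continuous_intros) (use assms(1) in simp_all)
    ultimately have "continuous_on X (\<lambda>p. q p $ i)" for i
      using exhaust_3[of i] by (elim disjE) simp_all
    then have "continuous_on X (\<lambda>p. \<chi> i. q p $ i)" by (rule continuous_on_vec_lambda)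
    then show ?thesis by simp
  qed
  have surj: "sphere 0 1 \<subseteq> q ` ({a..b} \<times> {0..2 * pi})"
  proof
    fix u :: "real^3" assume "u \<in> sphere 0 1"
    then have u: "(u $ 1)\<^sup>2 + (u $ 2)\<^sup>2 + (u $ 3)\<^sup>2 = 1"
      by (simp add: norm_vec_def L2_set_def sum_3)
    have "(u $ 3)\<^sup>2 \<le> 1" using u zero_le_power2[of "u $ 1"] zero_le_power2[of "u $ 2"] by linarith
    then have "\<bar>u $ 3\<bar> \<le> 1" by (simp only: abs_square_le_1)
    then have u3: "-1 \<le> u $ 3" "u $ 3 \<le> 1" by linarith+
    define s where "s = a + (b - a) * (arccos (u $ 3) / pi)"
    have ths: "th s = arccos (u $ 3)" using assms(1) by (simp add: s_def th_def)
    have sI: "s \<in> {a..b}"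
    proof -
      have "0 \<le> arccos (u $ 3) / pi" "arccos (u $ 3) / pi \<le> 1" using arccos_bounded[OF u3] by (simp_all add: divide_le_eq_1)
      then have h: "0 \<le> (b - a) * (arccos (u $ 3) / pi)" "(b - a) * (arccos (u $ 3) / pi) \<le> b - a"
        using mult_nonneg_nonneg[of "b - a" "arccos (u $ 3) / pi"] mult_left_mono[of "arccos (u $ 3) / pi" 1 "b - a"] assms(1) by simp_all
      have "a + v \<in> {a..b}" if "0 \<le> v" "v \<le> b - a" for v using that by simp
      from this[OF h] show ?thesis by (simp only: s_def)
    qed
    have "(sin (th s))\<^sup>2 = (u $ 1)\<^sup>2 + (u $ 2)\<^sup>2"
      unfolding ths using u u3 by (simp add: sin_squared_eq)
    moreover have "sin (th s) \<ge> 0" using th[OF sI] by (simp add: sin_ge_zero)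
    ultimately have "sin (th s) = norm (u $ 1, u $ 2)"
      unfolding norm_Pair by (simp add: real_sqrt_unique)
    from polar_coordinates[OF this] obtain t where t: "t \<in> {0..2 * pi}" "(u $ 1, u $ 2) = (sin (th s) * cos t, sin (th s) * sin t)" by blast
    have "u = q (s, t)" using t(2) u3 by (simp add: q_def vec_eq_iff forall_3 ths)
    then show "u \<in> q ` ({a..b} \<times> {0..2 * pi})" using sI t(1) by blast
  qed
  have im: "q ` X \<subseteq> sphere 0 1" for X using qn by auto
  have "quotient_map (top_of_set ({a..b} \<times> UNIV)) (top_of_set (sphere (0::real^3) 1)) q"
  proof (rule quotient_map_of_subsequences[OF c, where K = "{a..b} \<times> {0..2 * pi}"])
    show "q ` ({a..b} \<times> UNIV) = sphere 0 1"
      by (rule equalityI[OF im order_trans[OF surj image_mono]]) auto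
    show "q ` ({a..b} \<times> {0..2 * pi}) = sphere 0 1" by (rule equalityI[OF im surj])
    have "compact ({a..b} \<times> {0..2 * pi})" by (intro compact_Times compact_Icc)
    then show "\<exists>l\<in>{a..b} \<times> {0..2 * pi}. \<exists>r. strict_mono (r :: nat \<Rightarrow> nat) \<and> (k \<circ> r) \<longlonglongrightarrow> l"
      if "\<And>n. k n \<in> {a..b} \<times> {0..2 * pi}" for k
      using that unfolding compact_def by blast
  qed auto
  moreover have "q p = q p' \<longleftrightarrow> same_point x p p'" if p: "p \<in> {a..b} \<times> UNIV" "p' \<in> {a..b} \<times> UNIV" for p p'
  proof -
    obtain s t s' t' where pp: "p = (s, t)" "p' = (s', t')" by (cases p, cases p')
    have sI: "s \<in> {a..b}" "s' \<in> {a..b}" using p by (auto simp: pp)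
    have sin0: "sin (th s) = 0 \<longleftrightarrow> x s = 0"
    proof (cases "s = a \<or> s = b")
      case True
      then show ?thesis using x assms(1) by (auto simp: th_def)
    next
      case False
      then have s: "a < s" "s < b" using sI by auto
      have h: "0 < (s - a) / (b - a)" "(s - a) / (b - a) < 1" using s by (auto simp: divide_simps)
      have e: "th s = pi * ((s - a) / (b - a))" by (simp add: th_def)
      have "0 < th s" "th s < pi" unfolding e
        using mult_strict_left_mono[OF h(2) pi_gt_zero] mult_pos_pos[OF pi_gt_zero h(1)] by linarith+
      then show ?thesis using x(3)[OF s] sin_gt_zero[of "th s"] by simp
    qed
    show ?thesis
    proof
      assume "q p = q p'"
      then have e: "sin (th s) * cos t = sin (th s') * cos t'" "sin (th s) * sin t = sin (th s') * sin t'" "cos (th s) = cos (th s')"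
        by (simp_all add: q_def pp vec_eq_iff forall_3)
      have "th s = th s'" using cos_inj_pi e(3) th[OF sI(1)] th[OF sI(2)] by blast
      then have ss: "s' = s" using th_inj by metis
      show "same_point x p p'"
      proof (cases "x s = 0")
        case False
        then have "cos t = cos t'" "sin t = sin t'" using e(1,2) sin0 by (simp_all add: ss)
        then show ?thesis using cos_sin_eq_imp[of t t'] by (simp add: same_point_def pp ss)
      qed (simp add: same_point_def pp ss)
    next
      assume sp: "same_point x p p'"
      then have ss: "s' = s" by (simp add: same_point_def pp)
      show "q p = q p'"
      proof (cases "x s = 0")
        case True
        then show ?thesis using sin0 by (simp add: q_def pp ss)
      next
        case False
        then obtain n :: int where "t' = t + 2 * pi * of_int n" using sp by (auto simp: same_point_def pp)
        then have "sin t' = sin t \<and> cos t' = cos t" using sin_cos_eq_iff[of t' t] by auto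
        then show ?thesis by (simp add: q_def pp ss)
      qed
    qed
  qed
  ultimately show ?thesis unfolding two_sphere_surface_def by blast
qed

section \<open>Zero energy: spheres and half lines\<close>

context profile
begin

text \<open>The derivative of sinh x with respect to orbit-space arclength. P is 2 sinh x times it
  and so loses all information on the axis.\<close>

definition W :: "real \<Rightarrow> real" where "W s = cosh (x s) * cos (\<alpha> s) / lam s"

text \<open>The same number as \<open>q2\<close> in \<open>profile_line\<close>, for curves that may
  meet the axis.\<close>

definition qq :: real where "qq = 1 + 4 * H\<^sup>2 / \<kappa>"

lemma sinh_x_deriv: "s \<in> interior I \<Longrightarrow> ((\<lambda>s. sinh (x s)) has_real_derivative lam s * W s) (at s)"
  using lam_pos[of s] by (auto intro!: derivative_eq_intros x_deriv simp: W_def)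

lemma W_sq:
  assumes "E = 0" "s \<in> I" "x s \<noteq> 0"
  shows "(W s)\<^sup>2 = 1 + qq * S s"
proof -
  have "P s = 2 * sinh (x s) * W s" by (simp add: P_def W_def)
  then have "4 * (S s * (W s)\<^sup>2) = 4 * Qf (S s)" using P_sq[OF assms(2)] by (simp add: S_def power_mult_distrib)
  also have "Qf (S s) = S s * (1 + qq * S s)"
    unfolding Qf_def qq_def using assms(1) by (simp add: algebra_simps power2_eq_square)
  finally show ?thesis using assms(3) by (simp add: S_def)
qed

text \<open>In the interior W is P / (2 sinh x); the quotient rule and \<open>W_sq\<close> leave a
  multiple of sinh x, so that sinh x itself obeys a linear equation.\<close>

lemma W_deriv:
  assumes E: "E = 0" and s: "s \<in> interior I"
  shows "(W has_real_derivative lam s * (qq * sinh (x s))) (at s)"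
proof -
  have nz: "sinh (x s) \<noteq> 0" using x_nz[OF s] by simp
  have sI: "s \<in> I" using s interior_subset by blast
  have PW: "P r = 2 * sinh (x r) * W r" for r by (simp add: P_def W_def)
  have "((\<lambda>s. P s / (2 * sinh (x s))) has_real_derivative
      (lam s * (2 * Qd (S s)) * (2 * sinh (x s)) - P s * (2 * (lam s * W s))) / (2 * sinh (x s) * (2 * sinh (x s)))) (at s)"
    by (rule DERIV_divide[OF P_deriv[OF s] DERIV_cmult[OF sinh_x_deriv[OF s]]]) (use nz in simp)
  moreover have "(lam s * (2 * Qd (S s)) * (2 * sinh (x s)) - P s * (2 * (lam s * W s))) / (2 * sinh (x s) * (2 * sinh (x s)))
      = lam s * (qq * sinh (x s))"
  proof -
    have "Qd (S s) - (W s)\<^sup>2 = qq * S s"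
      unfolding W_sq[OF E sI x_nz[OF s]] Qd_def qq_def using E by (simp add: algebra_simps power2_eq_square)
    then have "lam s * (2 * Qd (S s)) * (2 * sinh (x s)) - P s * (2 * (lam s * W s)) = 4 * lam s * sinh (x s) * (qq * (sinh (x s))\<^sup>2)"
      unfolding PW S_def by (simp add: power2_eq_square) algebra
    then show ?thesis using nz by (simp add: power2_eq_square)
  qed
  moreover have "\<forall>\<^sub>F r in nhds s. r \<in> interior I"
    by (rule eventually_nhds_in_open[OF open_interior s])
  then have ev: "\<forall>\<^sub>F r in nhds s. P r / (2 * sinh (x r)) = W r"
    by eventually_elim (simp add: PW x_nz)
  ultimately show ?thesis using DERIV_cong_ev[OF refl ev refl] by simp
qed

lemma linear_growth:
  assumes "r < s" "{r..s} \<subseteq> interior I" "\<And>z. r \<le> z \<Longrightarrow> z \<le> s \<Longrightarrow> f' z \<ge> c"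
    and "\<And>z. z \<in> interior I \<Longrightarrow> (f has_real_derivative f' z) (at z)"
  shows "f s \<ge> f r + c * (s - r)"
proof -
  have "f r - c * r \<le> f s - c * s"
  proof (rule DERIV_nonneg_imp_nondecreasing[where f = "\<lambda>z. f z - c * z"])
    fix z assume z: "r \<le> z" "z \<le> s"
    then have "((\<lambda>z. f z - c * z) has_real_derivative f' z - c) (at z)"
      using assms(2) by (auto intro!: derivative_eq_intros assms(4))
    then show "\<exists>y. ((\<lambda>z. f z - c * z) has_real_derivative y) (at z) \<and> 0 \<le> y" using assms(3)[OF z] by (intro exI[of _ "f' z - c"]) simp
  qed (use assms(1) in simp)
  then show ?thesis by (simp add: algebra_simps)
qed

lemma Icc_subset_I:
  assumes "r \<in> I" "s \<in> I"
  shows "{r..s} \<subseteq> I"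
proof
  fix z assume "z \<in> {r..s}"
  then show "z \<in> I" using is_interval_I[unfolded is_interval_1, rule_format, OF assms, of z] by simp
qed

lemma up_set_interior:
  assumes "\<not> bdd_above I" "r \<in> interior I" "r \<le> s"
  shows "s \<in> interior I"
proof -
  obtain z where z: "z \<in> I" "z > s" using assms(1) by (meson bdd_above.I not_le)
  obtain e where e: "e > 0" "ball r e \<subseteq> I" using assms(2) mem_interior by blast
  have "r - e / 2 \<in> I" using e(1) by (intro subsetD[OF e(2)]) (simp add: dist_real_def)
  then have "{r - e / 2..z} \<subseteq> I" using Icc_subset_I z(1) by blast
  then have "{r - e / 2<..<z} \<subseteq> I" by (rule order_trans[rotated]) (simp add: subset_iff)
  then have sub: "{r - e / 2<..<z} \<subseteq> interior I" by (rule interior_maximal) (rule open_greaterThanLessThan)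
  show ?thesis by (rule subsetD[OF sub]) (use assms(3) z(2) e(1) in simp)
qed

lemma boundary_point: "s \<in> I \<Longrightarrow> s \<notin> interior I \<Longrightarrow> x s = 0 \<and> sin (\<alpha> s) = 0"
  using gen unfolding generating_curve_def by blast

text \<open>As \<open>qq\<close> is negative, |sinh x| is a positive, bounded, concave function of
  arclength. On an unbounded interval its slope would become negative and it would fall below 0. The
  bound on x keeps \<open>lam\<close> away from 0, so that these rates hold in the parameter s as
  well. The sign \<open>e\<close> replaces the absolute value.\<close>

lemma bounded_above_of_sphere:
  assumes E: "E = 0" and q: "qq < 0"
  shows "bdd_above I"
proof (rule ccontr)
  assume nb: "\<not> bdd_above I"
  obtain r where r: "r \<in> interior I" using interior_ne by blast
  note up = up_set_interior[OF nb r]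
  define e :: real where "e = (if \<forall>s\<in>interior I. 0 < x s then 1 else -1)"
  have ex: "e * sinh (x s) > 0" if "s \<in> interior I" for s
  proof (cases "\<forall>s\<in>interior I. 0 < x s")
    case True
    then show ?thesis using that by (simp add: e_def)
  next
    case False
    then have "\<forall>s\<in>interior I. x s < 0" using x_constant_sign by blast
    then show ?thesis using that False by (simp add: e_def)
  qed
  have e2: "e * e = 1" by (simp add: e_def)
  have Sb: "S s \<le> 1 / - qq" if s: "s \<in> interior I" for s
  proof -
    have sI: "s \<in> I" using s interior_subset by blast
    have "0 \<le> 1 + qq * S s" using W_sq[OF E sI x_nz[OF s]] zero_le_power2[of "W s"] by simp
    then show ?thesis using q by (simp add: field_simps)
  qed
  define M where "M = arsinh (sqrt (1 / - qq))"
  have xb: "\<bar>x s\<bar> \<le> M" if "s \<in> interior I" for s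
  proof -
    have "\<bar>sinh (x s)\<bar> \<le> sqrt (1 / - qq)" using Sb[OF that] by (intro real_le_rsqrt) (simp add: S_def)
    then have "sinh \<bar>x s\<bar> \<le> sinh M" by (simp add: M_def)
    then show ?thesis by (rule sinh_real_le_iff[THEN iffD1])
  qed
  obtain c where c: "c > 0" "\<And>s. \<bar>x s\<bar> \<le> M \<Longrightarrow> c \<le> lam s" using lam_lower_bound by blast
  have dX: "((\<lambda>s. e * sinh (x s)) has_real_derivative lam s * (e * W s)) (at s)" if "s \<in> interior I" for s
    using DERIV_cmult[OF sinh_x_deriv[OF that], of e] by (simp add: mult_ac)
  have dW: "((\<lambda>s. - (e * W s)) has_real_derivative lam s * (- qq * (e * sinh (x s)))) (at s)" if "s \<in> interior I" for s
    using DERIV_minus[OF DERIV_cmult[OF W_deriv[OF E that], of e]] by (simp add: mult_ac)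
  have sub: "{r'..s} \<subseteq> interior I" if "r \<le> r'" for r' s using up that by auto
  \<comment> \<open>While \<open>e * W\<close> is nonnegative, |sinh x| stays above its value at r,
    so \<open>e * W\<close> decreases at a fixed rate.\<close>
  have "\<exists>s1\<ge>r. e * W s1 < 0"
  proof (rule ccontr)
    assume "\<not> ?thesis"
    then have Wn: "\<And>s. s \<ge> r \<Longrightarrow> 0 \<le> e * W s" by (meson not_le)
    have X: "e * sinh (x r) \<le> e * sinh (x s)" if s: "r \<le> s" for s
    proof (cases "s = r")
      case False
      then have rs: "r < s" using s by simp
      have "e * sinh (x r) + 0 * (s - r) \<le> e * sinh (x s)"
      proof (rule linear_growth[OF rs sub[OF order_refl] _ dX])
        show "0 \<le> lam z * (e * W z)" if "r \<le> z" "z \<le> s" for z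
          by (rule mult_nonneg_nonneg[OF less_imp_le[OF lam_pos] Wn[OF that(1)]])
      qed
      then show ?thesis by simp
    qed simp
    define d where "d = c * (- qq * (e * sinh (x r)))"
    have d0: "d > 0" unfolding d_def by (rule mult_pos_pos[OF c(1) mult_pos_pos[OF _ ex[OF r]]]) (use q in simp)
    define s where "s = r + (\<bar>e * W r\<bar> + 1) / d"
    have s: "s > r" "d * (s - r) = \<bar>e * W r\<bar> + 1" using d0 by (simp_all add: s_def)
    have "- (e * W s) \<ge> - (e * W r) + d * (s - r)"
    proof (rule linear_growth[OF s(1) sub _ dW])
      show "d \<le> lam z * (- qq * (e * sinh (x z)))" if "r \<le> z" "z \<le> s" for z
      proof -
        have "c \<le> lam z" by (rule c(2)[OF xb[OF up[OF that(1)]]])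
        moreover have "- qq * (e * sinh (x r)) \<le> - qq * (e * sinh (x z))"
          by (rule mult_left_mono[OF X[OF that(1)]]) (use q in simp)
        moreover have "0 \<le> - qq * (e * sinh (x r))"
          by (rule mult_nonneg_nonneg) (use q ex[OF r] in simp_all)
        ultimately show ?thesis unfolding d_def by (rule mult_mono[OF _ _ less_imp_le[OF lam_pos]])
      qed
    qed (rule order_refl)
    then have "d * (s - r) \<le> e * W r - e * W s" by linarith
    moreover have "0 \<le> e * W s" by (rule Wn) (use s(1) in simp)
    ultimately show False using s(2) by linarith
  qed
  then obtain s1 where s1: "s1 \<ge> r" "e * W s1 < 0" by blast
  \<comment> \<open>From s1 on, the slope stays below its negative value at s1.\<close>
  have Wd: "e * W s \<le> e * W s1" if s: "s1 \<le> s" for s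
  proof (cases "s = s1")
    case False
    then have rs: "s1 < s" using s by simp
    have "- (e * W s1) + 0 * (s - s1) \<le> - (e * W s)"
    proof (rule linear_growth[OF rs sub[OF s1(1)] _ dW])
      fix z assume z: "s1 \<le> z" "z \<le> s"
      have "0 \<le> e * sinh (x z)" using ex[OF up[OF order_trans[OF s1(1) z(1)]]] by simp
      then have "0 \<le> - qq * (e * sinh (x z))" by (rule mult_nonneg_nonneg[rotated]) (use q in simp)
      then show "0 \<le> lam z * (- qq * (e * sinh (x z)))"
        by (rule mult_nonneg_nonneg[OF less_imp_le[OF lam_pos]])
    qed
    then show ?thesis by simp
  qed simp
  define d where "d = c * (- (e * W s1))"
  have d0: "d > 0" unfolding d_def by (rule mult_pos_pos[OF c(1)]) (use s1(2) in simp)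
  define s where "s = s1 + (e * sinh (x s1) + 1) / d"
  have s: "s > s1" "d * (s - s1) = e * sinh (x s1) + 1" using d0 ex[OF up[OF s1(1)]] by (simp_all add: s_def)
  have "- (e * sinh (x s)) \<ge> - (e * sinh (x s1)) + d * (s - s1)"
  proof (rule linear_growth[OF s(1) sub[OF s1(1)]])
    show "((\<lambda>s. - (e * sinh (x s))) has_real_derivative lam z * (- (e * W z))) (at z)" if "z \<in> interior I" for z
      using DERIV_minus[OF dX[OF that]] by simp
    show "d \<le> lam z * (- (e * W z))" if "s1 \<le> z" "z \<le> s" for z
    proof -
      have "c \<le> lam z" by (rule c(2)[OF xb[OF up[OF order_trans[OF s1(1) that(1)]]]])
      moreover have "- (e * W s1) \<le> - (e * W z)" using Wd[OF that(1)] by simp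
      ultimately show ?thesis unfolding d_def using lam_pos[of z] s1(2) by (intro mult_mono) simp_all
    qed
  qed
  moreover have "0 < e * sinh (x s)" by (rule ex[OF up]) (use s(1) s1(1) in simp)
  ultimately show False using s(2) by linarith
qed

end

text \<open>The reversed curve gives the lower bound. A compact I contains its ends, and these lie
  on the axis.\<close>

lemma (in profile) sphere:
  assumes E: "E = 0" and q: "4 * H\<^sup>2 + \<kappa> > 0"
  shows "\<exists>a b. a < b \<and> I = {a..b} \<and> x a = 0 \<and> x b = 0"
proof -
  have qq: "1 + 4 * H\<^sup>2 / \<kappa> < 0" using q \<kappa>_neg by (simp add: field_simps)
  have "bdd_above I" by (rule bounded_above_of_sphere[OF E]) (simp add: qq_def qq)
  have bl: "bdd_above (uminus ` I)"
  proof -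
    interpret r: profile \<kappa> \<tau> H E "uminus ` I" "\<lambda>s. - x (- s)" "\<lambda>s. y (- s)" "\<lambda>s. - \<alpha> (- s)"
      by (rule profile_uminus)
    show ?thesis by (rule r.bounded_above_of_sphere[OF E]) (simp add: r.qq_def qq)
  qed
  obtain u where u: "\<forall>s\<in>I. s \<le> u" using \<open>bdd_above I\<close> unfolding bdd_above_def by blast
  obtain l where l: "\<forall>s\<in>uminus ` I. s \<le> l" using bl unfolding bdd_above_def by blast
  have "I \<subseteq> {- l..u}"
  proof
    fix s assume s: "s \<in> I"
    then have "- s \<le> l" using l by (simp only: ball_simps)
    then show "s \<in> {- l..u}" using u s by simp
  qed
  then have "bounded I" using bounded_closed_interval bounded_subset by blast
  then have "compact I" using closed_I by (simp add: compact_eq_bounded_closed)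
  moreover have "connected I" using is_interval_I by (simp add: is_interval_connected_1)
  ultimately obtain a b where ab: "I = {a..b}" using connected_compact_interval_1 by blast
  have "a < b" using interior_ne by (auto simp: ab)
  moreover have "x a = 0" "x b = 0" using boundary_point[of a] boundary_point[of b] \<open>a < b\<close> by (auto simp: ab)
  ultimately show ?thesis using ab by blast
qed

lemma (in profile) two_sphere:
  assumes "E = 0" and "4 * H\<^sup>2 + \<kappa> > 0"
  shows "two_sphere_surface I x"
proof -
  obtain a b where ab: "a < b" "I = {a..b}" "x a = 0" "x b = 0" using sphere[OF assms] by blast
  have nz: "x s \<noteq> 0" if "a < s" "s < b" for s
  proof (rule x_nz)
    have "s \<in> {a<..<b}" using that by simp
    then show "s \<in> interior I" unfolding ab(2) interior_atLeastAtMost_real .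
  qed
  show ?thesis unfolding ab(2) by (rule two_sphere_of_interval[OF ab(1,3,4) nz])
qed

lemma constant_sign_of_connected:
  fixes f :: "'a::topological_space \<Rightarrow> real"
  assumes "connected T" "continuous_on T f" "\<And>s. s \<in> T \<Longrightarrow> f s \<noteq> 0"
  shows "(\<forall>s\<in>T. 0 < f s) \<or> (\<forall>s\<in>T. f s < 0)"
proof (rule ccontr)
  assume n: "\<not> ?thesis"
  then obtain s r where s: "s \<in> T" "\<not> 0 < f s" and r: "r \<in> T" "\<not> f r < 0" by blast
  have "connected (f ` T)" by (rule connected_continuous_image[OF assms(2,1)])
  then have "{f s..f r} \<subseteq> f ` T" by (rule connected_contains_Icc) (use s r in auto)
  moreover have "0 \<in> {f s..f r}" using s r by auto
  ultimately have "0 \<in> f ` T" by (rule subsetD)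
  then show False using assms(3) by (metis imageE)
qed

context profile
begin

text \<open>\<open>e\<close> is the sign of x and of its derivative, so |x| increases, at a rate
  bounded below wherever |x| is bounded. This decides in which direction I ends and which values are
  attained.\<close>

lemma half_line_increasing:
  assumes E: "E = 0" and q: "qq \<ge> 0" and e: "e = 1 \<or> e = - 1" "\<And>s. s \<in> interior I \<Longrightarrow> 0 < e * x s"
    and d: "\<And>s. s \<in> interior I \<Longrightarrow> 0 < e * cos (\<alpha> s)"
  shows "\<exists>a. I = {a..} \<and> x a = 0 \<and> strict_mono_on I (\<lambda>s. e * x s) \<and> (\<lambda>s. e * x s) ` I = {0..}"
proof -
  \<comment> \<open>With \<open>qq\<close> nonnegative, |W| is at least 1, which bounds |cos
    \<alpha>| below by \<open>lam\<close> / cosh x.\<close>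
  have low: "\<exists>c>0. \<forall>s\<in>interior I. e * x s \<le> M \<longrightarrow> c \<le> e * cos (\<alpha> s)" for M
  proof -
    obtain c where c: "c > 0" "\<And>s. \<bar>x s\<bar> \<le> M \<Longrightarrow> c \<le> lam s" using lam_lower_bound by blast
    have "c / cosh M \<le> e * cos (\<alpha> s)" if s: "s \<in> interior I" "e * x s \<le> M" for s
    proof -
      have ax: "\<bar>x s\<bar> = e * x s" using e(1) e(2)[OF s(1)] by auto
      have sI: "s \<in> I" using s(1) interior_subset by blast
      have W1: "1 \<le> (W s)\<^sup>2" using W_sq[OF E sI x_nz[OF s(1)]] q by (simp add: S_def)
      have eW: "e * W s = cosh (x s) * (e * cos (\<alpha> s)) / lam s" by (simp add: W_def)
      have pos: "0 < e * W s" unfolding eW using d[OF s(1)] lam_pos[of s] by simp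
      have "(e * W s)\<^sup>2 = (W s)\<^sup>2" using e(1) by auto
      then have "1 \<le> e * W s" by (intro power2_le_imp_le[of 1 "e * W s", OF _ less_imp_le[OF pos]]) (use W1 in simp)
      then have l: "lam s \<le> cosh (x s) * (e * cos (\<alpha> s))" unfolding eW using lam_pos[of s] by (simp add: field_simps)
      have M: "0 \<le> M" using s(2) e(2)[OF s(1)] by linarith
      have "cosh (x s) = cosh \<bar>x s\<bar>" by simp
      also have "\<dots> \<le> cosh M" using ax s(2) M by (subst cosh_real_nonneg_le_iff) auto
      finally have "cosh (x s) * (e * cos (\<alpha> s)) \<le> cosh M * (e * cos (\<alpha> s))"
        using d[OF s(1)] by (intro mult_right_mono) auto
      moreover have "c \<le> lam s" using c(2) ax s(2) by simp
      ultimately have "c \<le> cosh M * (e * cos (\<alpha> s))" using l by linarith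
      then show ?thesis by (simp add: field_simps)
    qed
    moreover have "c / cosh M > 0" using c(1) by simp
    ultimately show ?thesis by blast
  qed
  have dx: "((\<lambda>s. e * x s) has_real_derivative e * cos (\<alpha> s)) (at s)" if "s \<in> interior I" for s
    by (rule DERIV_cmult[OF x_deriv[OF that]])
  note seg = Icc_subset_I
  have btw: "z \<in> interior I" if "r \<in> I" "s \<in> I" "r < z" "z < s" for r s z
  proof -
    have "{r<..<s} \<subseteq> I" using seg[OF that(1,2)] greaterThanLessThan_subseteq_atLeastAtMost_iff by force
    then have "{r<..<s} \<subseteq> interior I" by (rule interior_maximal) simp
    then show ?thesis using that(3,4) by auto
  qed
  have contx: "continuous_on I (\<lambda>s. e * x s)"
    by (intro continuous_intros generating_curve_continuous(1)[OF gen])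
  have smono: "strict_mono_on I (\<lambda>s. e * x s)"
  proof (rule strict_mono_onI)
    fix r s assume rs: "r \<in> I" "s \<in> I" "r < s"
    show "e * x r < e * x s"
    proof (rule DERIV_pos_imp_increasing_open[OF rs(3)])
      show "\<exists>y. ((\<lambda>s. e * x s) has_real_derivative y) (at z) \<and> 0 < y" if "r < z" "z < s" for z
        using dx[OF btw[OF rs(1,2) that]] d[OF btw[OF rs(1,2) that]] by blast
      show "continuous_on {r..s} (\<lambda>s. e * x s)" by (rule continuous_on_subset[OF contx seg[OF rs(1,2)]])
    qed
  qed
  have inc: "e * x r < e * x s" if "r \<in> I" "s \<in> I" "r < s" for r s
    using strict_mono_onD[OF smono that] .
  have nbd: "\<exists>r'\<in>I. r' < s" "\<exists>r'\<in>I. s < r'" if s: "s \<in> interior I" for s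
  proof -
    obtain b where b: "b > 0" "ball s b \<subseteq> I" using s mem_interior by blast
    have "s - b / 2 \<in> I" "s + b / 2 \<in> I"
      using b(1) by (auto intro!: subsetD[OF b(2)] simp: dist_real_def)
    moreover have "s - b / 2 < s" "s < s + b / 2" using b(1) by simp_all
    ultimately show "\<exists>r'\<in>I. r' < s" "\<exists>r'\<in>I. s < r'" by blast+
  qed
  obtain r where r: "r \<in> interior I" using interior_ne by blast
  have rI: "r \<in> I" using r interior_subset by blast
  \<comment> \<open>A last point of I would lie on the axis, but |x| has increased up to it.\<close>
  have nb: "\<not> bdd_above I"
  proof
    assume b: "bdd_above I"
    have S: "Sup I \<in> I" using rI by (intro closed_contains_Sup[OF _ b closed_I]) auto
    have "Sup I \<notin> interior I" using nbd(2)[of "Sup I"] cSup_upper[OF _ b] by (metis not_le)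
    then have "x (Sup I) = 0" using boundary_point[OF S] by blast
    moreover have "r < Sup I" using cSup_upper[OF rI b] r \<open>Sup I \<notin> interior I\<close> by (metis order_le_less)
    ultimately show False using inc[OF rI S] e(2)[OF r] by simp
  qed
  \<comment> \<open>Followed backwards on an unbounded interval, |x| would become negative.\<close>
  have bb: "bdd_below I"
  proof (rule ccontr)
    assume nbb: "\<not> bdd_below I"
    have down: "s \<in> interior I" if "s \<le> r" for s
    proof (cases "s = r")
      case False
      obtain z where "z \<in> I" "z < s" using nbb by (meson bdd_below.I not_le)
      then show ?thesis using btw[OF _ rI] that False by force
    qed (simp add: r)
    obtain c where c: "c > 0" "\<forall>s\<in>interior I. e * x s \<le> e * x r \<longrightarrow> c \<le> e * cos (\<alpha> s)" using low by blast
    define s where "s = r - e * x r / c"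
    have s: "s < r" "c * (r - s) = e * x r" using c(1) e(2)[OF r] by (simp_all add: s_def)
    have "e * x r \<ge> e * x s + c * (r - s)"
    proof (rule linear_growth[OF s(1) _ _ dx])
      show "c \<le> e * cos (\<alpha> z)" if "s \<le> z" "z \<le> r" for z
      proof -
        have "z \<in> I" using down[OF that(2)] interior_subset by blast
        then have "e * x z \<le> e * x r" using inc[OF _ rI] that(2) by (metis order_le_less order_refl)
        then show ?thesis using c(2) down[OF that(2)] by blast
      qed
    qed (use down in auto)
    then show False using s e(2)[OF down[of s]] by simp
  qed
  define a where "a = Inf I"
  have aI: "a \<in> I" unfolding a_def using rI by (intro closed_contains_Inf[OF _ bb closed_I]) auto
  have lower: "a \<le> s" if "s \<in> I" for s unfolding a_def by (rule cInf_lower[OF that bb])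
  have "a \<notin> interior I" using nbd(1)[of a] lower by (metis not_le)
  then have xa: "x a = 0" using boundary_point[OF aI] by blast
  have up: "s \<in> I" if "a \<le> s" for s
  proof -
    obtain z where "z \<in> I" "s < z" using nb by (meson bdd_above.I not_le)
    then show ?thesis using seg[OF aI \<open>z \<in> I\<close>] that by auto
  qed
  have I: "I = {a..}" using lower up by auto
  have im: "(\<lambda>s. e * x s) ` I = {0..}"
  proof
    show "(\<lambda>s. e * x s) ` I \<subseteq> {0..}"
    proof (rule image_subsetI)
      fix s assume s: "s \<in> I"
      then show "e * x s \<in> {0..}" using inc[OF aI s] lower[OF s] xa by (cases "s = a") auto
    qed
    show "{0..} \<subseteq> (\<lambda>s. e * x s) ` I"
    proof
      fix M :: real assume "M \<in> {0..}"
      then have M: "0 \<le> M" by simp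
      have "\<exists>s\<in>I. M \<le> e * x s"
      proof (rule ccontr)
        assume n: "\<not> ?thesis"
        obtain c where c: "c > 0" "\<forall>s\<in>interior I. e * x s \<le> M \<longrightarrow> c \<le> e * cos (\<alpha> s)" using low by blast
        define s where "s = r + (M + 1) / c"
        have s: "r < s" "c * (s - r) = M + 1" using c(1) M by (simp_all add: s_def)
        have upr: "z \<in> interior I" if "r \<le> z" for z using up_set_interior[OF nb r that] .
        have "e * x s \<ge> e * x r + c * (s - r)"
        proof (rule linear_growth[OF s(1) _ _ dx])
          show "c \<le> e * cos (\<alpha> z)" if "r \<le> z" "z \<le> s" for z
          proof -
            have "z \<in> I" using upr[OF that(1)] interior_subset by blast
            then have "e * x z \<le> M" using n by (meson not_le less_imp_le)
            then show ?thesis using c(2) upr[OF that(1)] by blast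
          qed
        qed (use upr in auto)
        moreover have "s \<in> I" using upr[of s] s(1) interior_subset by auto
        then have "e * x s < M" using n by (meson not_le)
        ultimately show False using s(2) e(2)[OF r] by linarith
      qed
      then obtain s where s: "s \<in> I" "M \<le> e * x s" by blast
      have "connected ((\<lambda>s. e * x s) ` I)"
        by (rule connected_continuous_image[OF contx]) (use is_interval_I in \<open>simp add: is_interval_connected_1\<close>)
      then have "{e * x a..e * x s} \<subseteq> (\<lambda>s. e * x s) ` I"
        by (rule connected_contains_Icc) (use aI s(1) in auto)
      then show "M \<in> (\<lambda>s. e * x s) ` I" by (rule subsetD) (use xa M s(2) in simp)
    qed
  qed
  show ?thesis by (intro exI[of _ a] conjI I xa smono im)
qed

text \<open>A zero of cos \<alpha> would be one of W, whose square is at least 1.\<close>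

lemma cos_sign:
  assumes E: "E = 0" and q: "qq \<ge> 0"
  obtains d where "d = 1 \<or> d = (- 1 :: real)" "\<And>s. s \<in> interior I \<Longrightarrow> 0 < d * cos (\<alpha> s)"
proof -
  have nz: "cos (\<alpha> s) \<noteq> 0" if s: "s \<in> interior I" for s
  proof
    assume "cos (\<alpha> s) = 0"
    then have "W s = 0" by (simp add: W_def)
    moreover have "s \<in> I" using s interior_subset by blast
    ultimately have "1 + qq * S s = 0" using W_sq[OF E _ x_nz[OF s]] by simp
    moreover have "qq * S s \<ge> 0" using q by (simp add: S_def)
    ultimately show False by linarith
  qed
  have "connected (interior I)"
    using is_interval_I by (intro convex_connected convex_interior) (simp add: is_interval_convex_1)
  moreover have "continuous_on (interior I) (\<lambda>s. cos (\<alpha> s))"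
    by (intro continuous_intros continuous_on_subset[OF generating_curve_continuous(3)[OF gen] interior_subset])
  ultimately have "(\<forall>s\<in>interior I. 0 < cos (\<alpha> s)) \<or> (\<forall>s\<in>interior I. cos (\<alpha> s) < 0)"
    using nz by (rule constant_sign_of_connected)
  then show thesis
  proof
    assume "\<forall>s\<in>interior I. 0 < cos (\<alpha> s)"
    then show thesis by (intro that[of 1]) auto
  next
    assume "\<forall>s\<in>interior I. cos (\<alpha> s) < 0"
    then show thesis by (intro that[of "-1"]) auto
  qed
qed

end

lemma (in profile) half_line:
  assumes E: "E = 0" and q: "4 * H\<^sup>2 + \<kappa> \<le> 0" and pos: "\<And>s. s \<in> interior I \<Longrightarrow> 0 < x s"
  shows "\<exists>a. (I = {a..} \<or> I = {..a}) \<and> x a = 0 \<and> bij_betw x I {0..}"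
proof -
  have qq: "1 + 4 * H\<^sup>2 / \<kappa> \<ge> 0" using q \<kappa>_neg by (simp add: field_simps)
  then have qq0: "qq \<ge> 0" by (simp add: qq_def)
  obtain d where d: "d = 1 \<or> d = (- 1 :: real)" "\<And>s. s \<in> interior I \<Longrightarrow> 0 < d * cos (\<alpha> s)" using cos_sign[OF E qq0] by blast
  show ?thesis
  proof (cases "d = 1")
    case True
    have "\<exists>a. I = {a..} \<and> x a = 0 \<and> strict_mono_on I (\<lambda>s. 1 * x s) \<and> (\<lambda>s. 1 * x s) ` I = {0..}"
      by (rule half_line_increasing[OF E qq0]) (use pos d(2) True in simp_all)
    then obtain a where a: "I = {a..}" "x a = 0" "strict_mono_on I (\<lambda>s. 1 * x s)" "(\<lambda>s. 1 * x s) ` I = {0..}" by blast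
    have "inj_on x I" using strict_mono_on_imp_inj_on[OF a(3)] by simp
    then have "bij_betw x I {0..}" using a(4) by (simp add: bij_betw_def)
    then show ?thesis using a(1,2) by blast
  next
    case False
    then have dm: "d = -1" using d(1) by blast
    \<comment> \<open>If x decreases, the reversed curve has negative x and negative derivative of
      x, so the increasing case applies with the sign -1.\<close>
    interpret r: profile \<kappa> \<tau> H E "uminus ` I" "\<lambda>s. - x (- s)" "\<lambda>s. y (- s)" "\<lambda>s. - \<alpha> (- s)"
      by (rule profile_uminus)
    have int: "interior (uminus ` I) = uminus ` interior I" by (rule interior_negations)
    obtain a where a: "uminus ` I = {a..}" "- x (- a) = 0" "strict_mono_on (uminus ` I) (\<lambda>s. - 1 * - x (- s))"
        "(\<lambda>s. - 1 * - x (- s)) ` (uminus ` I) = {0..}"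
    proof -
      have mi: "- s \<in> interior I" if "s \<in> interior (uminus ` I)" for s using that unfolding int by auto
      have "\<exists>a. uminus ` I = {a..} \<and> - x (- a) = 0 \<and> strict_mono_on (uminus ` I) (\<lambda>s. - 1 * - x (- s))
          \<and> (\<lambda>s. - 1 * - x (- s)) ` (uminus ` I) = {0..}"
      proof (rule r.half_line_increasing[OF E])
        show "0 \<le> r.qq" unfolding r.qq_def by (rule qq)
        show "(- 1 :: real) = 1 \<or> (- 1 :: real) = - 1" by simp
        show "0 < - 1 * - x (- s)" if "s \<in> interior (uminus ` I)" for s using pos[OF mi[OF that]] by simp
        show "0 < - 1 * cos (- \<alpha> (- s))" if "s \<in> interior (uminus ` I)" for s using d(2)[OF mi[OF that]] by (simp add: dm)
      qed
      then show thesis using that by blast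
    qed
    have "I = uminus ` (uminus ` I)" by (simp add: image_image)
    also have "\<dots> = {..- a}" unfolding a(1) by simp
    finally have I: "I = {..- a}" .
    have "inj_on x I"
    proof (rule inj_onI)
      fix s r assume "s \<in> I" "r \<in> I" "x s = x r"
      then show "s = r" using inj_onD[OF strict_mono_on_imp_inj_on[OF a(3)], of "- s" "- r"] by simp
    qed
    then have "bij_betw x I {0..}" using a(4) by (simp add: bij_betw_def image_image)
    then show ?thesis using I a(2) by auto
  qed
qed

context profile
begin

text \<open>The absolute slope of y as a function of x when E = 0, found by dividing
  \<open>Rf\<close> by the rate of x, which \<open>W_sq\<close> determines. Under the root stands a
  product of two factors that both increase with (sinh \<xi>)^2.\<close>

definition fp :: "real \<Rightarrow> real" where
  "fp \<xi> = H / \<bar>\<tau>\<bar> * sqrt ((sinh \<xi>)\<^sup>2 / (1 + qq * (sinh \<xi>)\<^sup>2) * (1 + \<rho> * ((sinh \<xi>)\<^sup>2 / (1 + (sinh \<xi>)\<^sup>2))))"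

text \<open>In the interior both sides are the rate of y, expressed once by \<open>Rf\<close> and
  once by the rate of x; on the axis sin \<alpha> and \<open>fp\<close> both vanish.\<close>

lemma sin_eq_fp:
  assumes E: "E = 0" and q: "qq \<ge> 0" and pos: "\<And>s. s \<in> interior I \<Longrightarrow> 0 < x s"
    and d: "d = 1 \<or> d = - 1" "\<And>s. s \<in> interior I \<Longrightarrow> 0 < d * cos (\<alpha> s)" and s: "s \<in> I"
  shows "sin (\<alpha> s) / cosh (x s) = d * sgn \<tau> * (fp (x s) * cos (\<alpha> s))"
proof (cases "s \<in> interior I")
  case True
  have "sin (\<alpha> s) / cosh (x s) = lam s * Rf (S s)"
    by (rule DERIV_unique[OF generating_curve_interior_derivs(2)[OF gen True] y_deriv_Rf[OF True pos[OF True]]])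
  define h where "h = sinh (x s)"
  define c where "c = cosh (x s)"
  have h: "h > 0" using pos[OF True] by (simp add: h_def)
  have c: "c > 0" "c\<^sup>2 = 1 + h\<^sup>2" by (simp_all add: c_def h_def cosh_square_eq)
  have Ss: "S s = h\<^sup>2" by (simp add: S_def h_def)
  define w where "w = sqrt (1 + qq * h\<^sup>2)"
  have w: "w > 0" "w\<^sup>2 = 1 + qq * h\<^sup>2" using q by (simp_all add: w_def add_pos_nonneg)
  define K where "K = sqrt (1 + (1 + \<rho>) * h\<^sup>2)"
  have W: "W s = d * w"
  proof -
    have dW: "d * W s = c * (d * cos (\<alpha> s)) / lam s" by (simp add: W_def c_def)
    have "0 < d * W s" unfolding dW using d(2)[OF True] lam_pos[of s] c(1) by simp
    moreover have "(d * W s)\<^sup>2 = w\<^sup>2" using W_sq[OF E s x_nz[OF True]] d(1) w(2) Ss by (auto simp: power_mult_distrib)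
    ultimately have "d * W s = w" using w(1) by (metis power2_eq_imp_eq less_imp_le)
    then show ?thesis using d(1) by auto
  qed
  have cos: "cos (\<alpha> s) = lam s * (d * w) / c"
    using W lam_pos[of s] c(1) by (simp add: W_def c_def[symmetric] field_simps)
  have "1 + \<rho> * (h\<^sup>2 / (1 + h\<^sup>2)) = (1 + (1 + \<rho>) * h\<^sup>2) / c\<^sup>2"
  proof -
    have n: "1 + h\<^sup>2 \<noteq> 0" using c by (metis less_irrefl zero_less_power)
    have "1 + \<rho> * (h\<^sup>2 / (1 + h\<^sup>2)) = (1 + h\<^sup>2) / (1 + h\<^sup>2) + \<rho> * h\<^sup>2 / (1 + h\<^sup>2)" using n by simp
    also have "\<dots> = (1 + (1 + \<rho>) * h\<^sup>2) / (1 + h\<^sup>2)" unfolding add_divide_distrib[symmetric] by (simp add: algebra_simps)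
    finally show ?thesis by (simp only: c(2))
  qed
  then have "sqrt (1 + \<rho> * (h\<^sup>2 / (1 + h\<^sup>2))) = K / c" using c(1) by (simp add: real_sqrt_divide K_def)
  then have fp: "fp (x s) = H / \<bar>\<tau>\<bar> * ((h / w) * (K / c))"
    unfolding fp_def h_def[symmetric] real_sqrt_mult using h by (simp add: real_sqrt_divide w_def)
  have "Rf (S s) = H * h * K / (\<tau> * c\<^sup>2)"
    unfolding Rf_def Ss K_def c(2) using E h by (simp add: power2_eq_square)
  moreover have "d * sgn \<tau> * (fp (x s) * cos (\<alpha> s)) = lam s * (H * h * K / (\<tau> * c\<^sup>2))"
  proof -
    have "d * d = 1" using d(1) by auto
    have t: "sgn \<tau> / \<bar>\<tau>\<bar> = 1 / \<tau>" using \<tau>_nz by (auto simp: sgn_real_def)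
    have "d * sgn \<tau> * (fp (x s) * cos (\<alpha> s)) = (d * d) * (sgn \<tau> / \<bar>\<tau>\<bar>) * (H * ((h / w) * (K / c)) * (lam s * w / c))"
      unfolding fp cos by argo
    also have "\<dots> = lam s * (H * h * K / (\<tau> * c\<^sup>2))"
      unfolding \<open>d * d = 1\<close> t using w(1) c(1) \<tau>_nz by (simp add: power2_eq_square)
    finally show ?thesis .
  qed
  ultimately show ?thesis using \<open>sin (\<alpha> s) / cosh (x s) = lam s * Rf (S s)\<close> by simp
next
  case False
  then show ?thesis using boundary_point[OF s] by (simp add: fp_def)
qed

lemma fp_continuous:
  assumes q: "qq \<ge> 0"
  shows "isCont fp \<xi>"
proof -
  have "1 + qq * (sinh \<xi>)\<^sup>2 \<noteq> 0" "1 + (sinh \<xi>)\<^sup>2 \<noteq> 0"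
    using q by (metis add_pos_nonneg less_irrefl mult_nonneg_nonneg zero_le_power2 zero_less_one)
      (metis add_pos_nonneg less_irrefl zero_le_power2 zero_less_one)
  then show ?thesis unfolding fp_def by (intro continuous_intros) auto
qed

lemma fp_strict_mono:
  assumes q: "qq \<ge> 0" and H: "H > 0" and ab: "0 \<le> a" "a < b"
  shows "fp a < fp b"
proof -
  define u v where "u = (sinh a)\<^sup>2" and "v = (sinh b)\<^sup>2"
  have uv: "0 \<le> u" "u < v" using ab by (auto simp: u_def v_def intro!: power_strict_mono)
  have qu: "1 + qq * u > 0" "1 + qq * v > 0" using q uv by (auto intro!: add_pos_nonneg)
  have 1: "u / (1 + qq * u) < v / (1 + qq * v)" using qu uv by (simp add: divide_less_eq less_divide_eq field_simps)
  have 2: "u / (1 + u) < v / (1 + v)" using uv by (simp add: divide_less_eq less_divide_eq field_simps)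
  have "u / (1 + qq * u) * (1 + \<rho> * (u / (1 + u))) < v / (1 + qq * v) * (1 + \<rho> * (v / (1 + v)))"
  proof (rule mult_less_le_imp_less[OF 1])
    show "1 + \<rho> * (u / (1 + u)) \<le> 1 + \<rho> * (v / (1 + v))" using mult_left_mono[OF less_imp_le[OF 2] less_imp_le[OF \<rho>_pos]] by simp
    show "0 \<le> u / (1 + qq * u)" using uv qu by simp
    show "0 < 1 + \<rho> * (u / (1 + u))" using uv \<rho>_pos by (intro add_pos_nonneg) auto
  qed
  then show ?thesis unfolding fp_def u_def[symmetric] v_def[symmetric]
    using H \<tau>_nz by (intro mult_strict_left_mono) auto
qed

text \<open>By \<open>sin_eq_fp\<close>, y minus \<epsilon> times an antiderivative of
  \<open>fp\<close> at x has zero derivative on I, including the one-sided derivative at its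
  end.\<close>

lemma y_as_function_of_x:
  assumes E: "E = 0" and q: "4 * H\<^sup>2 + \<kappa> \<le> 0" and pos: "\<And>s. s \<in> interior I \<Longrightarrow> 0 < x s"
  obtains f \<epsilon> where "\<epsilon> = 1 \<or> \<epsilon> = (- 1 :: real)" "\<And>\<xi>. (f has_real_derivative fp \<xi>) (at \<xi>)" "\<And>s. s \<in> I \<Longrightarrow> y s = \<epsilon> * f (x s)"
proof -
  have qq0: "qq \<ge> 0" using q \<kappa>_neg by (simp add: qq_def field_simps)
  obtain d where d: "d = 1 \<or> d = (- 1 :: real)" "\<And>s. s \<in> interior I \<Longrightarrow> 0 < d * cos (\<alpha> s)" using cos_sign[OF E qq0] by blast
  define \<epsilon> where "\<epsilon> = d * sgn \<tau>"
  have \<epsilon>: "\<epsilon> = 1 \<or> \<epsilon> = - 1" using d(1) \<tau>_nz by (auto simp: \<epsilon>_def sgn_real_def)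
  obtain f where "\<And>\<xi>. (f has_vector_derivative fp \<xi>) (at \<xi>)"
    using einterval_antiderivative[of "-\<infinity>" \<infinity> fp] fp_continuous[OF qq0] by auto
  then have f: "\<And>\<xi>. (f has_real_derivative fp \<xi>) (at \<xi>)" by (simp add: has_real_derivative_iff_has_vector_derivative)
  have "\<exists>c. \<forall>s\<in>I. y s - \<epsilon> * f (x s) = c"
  proof (rule has_field_derivative_zero_constant)
    show "convex I" using is_interval_I by (simp add: is_interval_convex_1)
    fix s assume s: "s \<in> I"
    have "((\<lambda>s. y s - \<epsilon> * f (x s)) has_real_derivative (sin (\<alpha> s) / cosh (x s) - \<epsilon> * (fp (x s) * cos (\<alpha> s)))) (at s within I)"
      by (intro DERIV_diff DERIV_cmult generating_curve_derivs[OF gen s] DERIV_chain2[OF f])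
    then show "((\<lambda>s. y s - \<epsilon> * f (x s)) has_real_derivative 0) (at s within I)"
      using sin_eq_fp[OF E qq0 pos d s] by (simp add: \<epsilon>_def)
  qed
  then obtain c where c: "\<And>s. s \<in> I \<Longrightarrow> y s - \<epsilon> * f (x s) = c" by blast
  show thesis
  proof (rule that[OF \<epsilon>, of "\<lambda>\<xi>. f \<xi> + \<epsilon> * c"])
    show "((\<lambda>\<xi>. f \<xi> + \<epsilon> * c) has_real_derivative fp \<xi>) (at \<xi>)" for \<xi>
      using DERIV_add[OF f DERIV_const] by simp
    have "\<epsilon> * \<epsilon> = 1" using \<epsilon> by auto
    then show "y s = \<epsilon> * (f (x s) + \<epsilon> * c)" if "s \<in> I" for s
      using c[OF that] by (simp add: distrib_left mult.assoc[symmetric])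
  qed
qed

text \<open>Strict convexity comes from the strictly increasing slope \<open>fp\<close>, by the mean
  value theorem on both sides of the intermediate point.\<close>

lemma open_sphere:
  assumes E: "E = 0" and q: "4 * H\<^sup>2 + \<kappa> \<le> 0" and pos: "\<And>s. s \<in> interior I \<Longrightarrow> 0 < x s" and H: "H > 0"
  shows "open_sphere_type I x y \<alpha>"
proof -
  have qq0: "qq \<ge> 0" using q \<kappa>_neg by (simp add: qq_def field_simps)
  obtain f \<epsilon> where f: "\<epsilon> = 1 \<or> \<epsilon> = (- 1 :: real)" "\<And>\<xi>. (f has_real_derivative fp \<xi>) (at \<xi>)" "\<And>s. s \<in> I \<Longrightarrow> y s = \<epsilon> * f (x s)"
    using y_as_function_of_x[OF E q pos] by metis
  have fp0: "fp 0 = 0" by (simp add: fp_def)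
  have mono: "strict_mono_on {0..} f"
  proof (rule strict_mono_onI)
    fix a b :: real assume ab: "a \<in> {0..}" "b \<in> {0..}" "a < b"
    obtain z where z: "a < z" "z < b" "f b - f a = (b - a) * fp z" using MVT2[OF ab(3), of f fp] f(2) by blast
    have "0 < fp z" using fp_strict_mono[OF qq0 H, of 0 z] fp0 ab z by simp
    then have "0 < (b - a) * fp z" using ab(3) by simp
    then show "f a < f b" using z(3) by linarith
  qed
  have conv: "f ((1 - u) * a + u * b) < (1 - u) * f a + u * f b" if ab: "0 \<le> a" "a < b" and u: "0 < u" "u < 1" for a b u
  proof -
    define m where "m = (1 - u) * a + u * b"
    have ma: "m - a = u * (b - a)" "b - m = (1 - u) * (b - a)" by (simp_all add: m_def algebra_simps)
    then have lt: "a < m" "m < b" using ab u by (metis diff_gt_0_iff_gt mult_pos_pos)+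
    obtain z1 where z1: "a < z1" "z1 < m" "f m - f a = (m - a) * fp z1" using MVT2[OF lt(1), of f fp] f(2) by blast
    obtain z2 where z2: "m < z2" "z2 < b" "f b - f m = (b - m) * fp z2" using MVT2[OF lt(2), of f fp] f(2) by blast
    have "fp z1 < fp z2" using fp_strict_mono[OF qq0 H, of z1 z2] ab z1 z2 by simp
    then have "(1 - u) * (u * (b - a)) * fp z1 < (1 - u) * (u * (b - a)) * fp z2"
      using ab u by (intro mult_strict_left_mono) auto
    then have "(1 - u) * (f m - f a) < u * (f b - f m)"
      unfolding z1(3) z2(3) ma by (simp add: mult_ac)
    then show ?thesis unfolding m_def[symmetric] by (simp add: algebra_simps)
  qed
  have "f ((1 - u) * a + u * b) < (1 - u) * f a + u * f b" if "a \<ge> 0" "b \<ge> 0" "a \<noteq> b" "0 < u" "u < 1" for a b u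
  proof (cases "a < b")
    case True
    then show ?thesis using conv that by blast
  next
    case False
    then show ?thesis using conv[of b a "1 - u"] that by (simp add: add.commute)
  qed
  then show ?thesis unfolding open_sphere_type_def
    using f(1,3) mono half_line[OF E q pos] by blast
qed

lemma half_geodesic:
  assumes E: "E = 0" and q: "4 * H\<^sup>2 + \<kappa> \<le> 0" and pos: "\<And>s. s \<in> interior I \<Longrightarrow> 0 < x s" and H: "H = 0"
  shows "half_geodesic I x y \<alpha>"
proof -
  obtain f \<epsilon> where f: "\<epsilon> = 1 \<or> \<epsilon> = (- 1 :: real)" "\<And>\<xi>. (f has_real_derivative fp \<xi>) (at \<xi>)" "\<And>s. s \<in> I \<Longrightarrow> y s = \<epsilon> * f (x s)"
    using y_as_function_of_x[OF E q pos] by metis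
  have "fp \<xi> = 0" for \<xi> unfolding fp_def using H by simp
  then have d: "(f has_real_derivative 0) (at \<xi>)" for \<xi> using f(2)[of \<xi>] by simp
  have "f \<xi> = f 0" for \<xi> by (intro DERIV_isconst_all allI d)
  then have "\<forall>s\<in>I. y s = \<epsilon> * f 0" using f(3) by metis
  then show ?thesis unfolding half_geodesic_def using half_line[OF E q pos] by blast
qed

end

section \<open>Charts across the axis\<close>

definition cplx :: "real \<times> real \<Rightarrow> complex" where "cplx h = Complex (fst h) (snd h)"

lemma norm_cplx: "cmod (cplx h) = norm h"
  by (cases h) (simp add: cplx_def cmod_def norm_Pair)

lemma bounded_linear_cplx: "bounded_linear cplx"
  by (rule bounded_linear_intro[where K = 1]) (auto simp: norm_cplx, auto simp: cplx_def complex_eq_iff)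

text \<open>The direction of \<xi> has no limit at 0, but b is bounded on directions and a vanishes
  there.\<close>

lemma continuous_on_sgn_mult:
  fixes a :: "real \<Rightarrow> 'v::real_normed_vector" and b :: "real \<times> real \<Rightarrow> real"
  assumes a: "continuous_on D a" "0 \<in> D \<Longrightarrow> a 0 = 0" and b: "\<And>\<eta>. isCont b \<eta>" "\<And>\<xi>. \<bar>b (sgn \<xi>)\<bar> \<le> B"
  shows "continuous_on {\<xi>. norm \<xi> \<in> D} (\<lambda>\<xi>. b (sgn \<xi>) *\<^sub>R a (norm \<xi>))"
  unfolding continuous_on_def
proof
  let ?U = "{\<xi> :: real \<times> real. norm \<xi> \<in> D}"
  have "continuous_on ?U (\<lambda>\<xi>. a (norm \<xi>))"
    by (rule continuous_on_compose2[OF a(1)]) (auto intro!: continuous_intros)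
  then have ac: "((\<lambda>\<xi>. a (norm \<xi>)) \<longlongrightarrow> a (norm \<xi>)) (at \<xi> within ?U)" if "\<xi> \<in> ?U" for \<xi>
    using that unfolding continuous_on_def by blast
  fix \<xi> :: "real \<times> real" assume \<xi>: "\<xi> \<in> ?U"
  show "((\<lambda>\<xi>. b (sgn \<xi>) *\<^sub>R a (norm \<xi>)) \<longlongrightarrow> b (sgn \<xi>) *\<^sub>R a (norm \<xi>)) (at \<xi> within ?U)"
  proof (cases "\<xi> = 0")
    case True
    then have a0: "a (norm \<xi>) = 0" using a(2) \<xi> by simp
    have "((\<lambda>\<xi>. b (sgn \<xi>) *\<^sub>R a (norm \<xi>)) \<longlongrightarrow> 0) (at \<xi> within ?U)"
    proof (rule Lim_null_comparison)
      show "\<forall>\<^sub>F \<zeta> in at \<xi> within ?U. norm (b (sgn \<zeta>) *\<^sub>R a (norm \<zeta>)) \<le> B * norm (a (norm \<zeta>))"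
        by (intro always_eventually allI) (auto intro!: mult_right_mono b(2))
      show "((\<lambda>\<zeta>. B * norm (a (norm \<zeta>))) \<longlongrightarrow> 0) (at \<xi> within ?U)"
        using tendsto_mult_right_zero[OF tendsto_norm_zero[OF ac[OF \<xi>, unfolded a0]]] .
    qed
    then show ?thesis by (simp add: a0)
  next
    case False
    have "((\<lambda>\<zeta>. sgn \<zeta>) \<longlongrightarrow> sgn \<xi>) (at \<xi> within ?U)" by (rule tendsto_sgn[OF tendsto_ident_at False])
    then have "((\<lambda>\<zeta>. b (sgn \<zeta>)) \<longlongrightarrow> b (sgn \<xi>)) (at \<xi> within ?U)" by (rule isCont_tendsto_compose[OF b(1)])
    then show ?thesis by (rule tendsto_scaleR[OF _ ac[OF \<xi>]])
  qed
qed

text \<open>A surface of revolution in polar coordinates, over the punctured plane or the plane. At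
  the origin differentiability rests on M(0) = 0 and \<psi>'(0) = 0: the profile meets the axis
  orthogonally.\<close>

lemma C1_immersion_polar:
  fixes \<psi> \<psi>' :: "real \<Rightarrow> complex" and M M' :: "real \<Rightarrow> real"
  assumes D: "D = {0<..} \<or> D = {0..} \<and> M 0 = 0 \<and> \<psi>' 0 = 0"
    and \<psi>: "\<And>r. r \<in> D \<Longrightarrow> (\<psi> has_vector_derivative \<psi>' r) (at r within D)"
    and M: "\<And>r. r \<in> D \<Longrightarrow> (M has_real_derivative M' r) (at r within D)"
    and cont: "continuous_on D \<psi>'" "continuous_on D M'"
    and nz: "\<And>r. 0 < r \<Longrightarrow> M r \<noteq> 0"
    and reg: "\<And>r. r \<in> D \<Longrightarrow> \<psi>' r \<noteq> 0 \<or> M' r \<noteq> 0"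
  shows "C1_immersion_on {\<xi>. norm \<xi> \<in> D} (\<lambda>\<xi>. (\<psi> (norm \<xi>), (M (norm \<xi>) / norm \<xi>) *\<^sub>R cplx \<xi>))"
proof -
  interpret c: bounded_linear cplx by (rule bounded_linear_cplx)
  \<comment> \<open>M(r) / r with its limit at 0.\<close>
  define \<mu> where "\<mu> r = (if r = 0 then M' 0 else M r / r)" for r
  define F1 where "F1 \<xi> h = (h \<bullet> sgn \<xi>) *\<^sub>R \<psi>' (norm \<xi>)" for \<xi> h :: "real \<times> real"
  \<comment> \<open>The derivative of the planar part stretches by M' in the radial direction and by
    \<mu> in the orthogonal one.\<close>
  define F2 where "F2 \<xi> h = ((h \<bullet> sgn \<xi>) * (M' (norm \<xi>) - \<mu> (norm \<xi>))) *\<^sub>R sgn \<xi> + \<mu> (norm \<xi>) *\<^sub>R h" for \<xi> h :: "real \<times> real"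
  let ?U = "{\<xi> :: real \<times> real. norm \<xi> \<in> D}"
  have D0: "0 \<le> r" if "r \<in> D" for r using D that by auto
  have Dpos: "r \<in> D" if "0 < r" for r using D that by auto
  have at: "at r within D = at r" if "0 < r" for r
  proof (rule at_within_interior)
    have "{0<..} \<subseteq> interior D" by (rule interior_maximal) (auto intro: Dpos)
    then show "r \<in> interior D" using that by auto
  qed
  have D00: "D = {0..}" "M 0 = 0" "\<psi>' 0 = 0" if "0 \<in> D" using D that by auto
  have sgn_norm: "norm \<xi> *\<^sub>R sgn \<xi> = \<xi>" for \<xi> :: "real \<times> real" by (cases "\<xi> = 0") (simp_all add: sgn_div_norm)
  have d2: "((\<lambda>\<xi>. (M (norm \<xi>) / norm \<xi>) *\<^sub>R \<xi>) has_derivative F2 \<xi>) (at \<xi>)"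
    and d1: "((\<lambda>\<xi>. \<psi> (norm \<xi>)) has_derivative F1 \<xi>) (at \<xi>)" if \<xi>: "norm \<xi> \<in> D" for \<xi> :: "real \<times> real"
  proof -
    have "((\<lambda>\<xi>. (M (norm \<xi>) / norm \<xi>) *\<^sub>R \<xi>) has_derivative F2 \<xi>) (at \<xi>) \<and> ((\<lambda>\<xi>. \<psi> (norm \<xi>)) has_derivative F1 \<xi>) (at \<xi>)"
    proof (cases "\<xi> = 0")
      case True
      have z: "0 \<in> D" using \<xi> True by simp
      note D00 = D00[OF z]
      have fl: "filterlim (norm :: real \<times> real \<Rightarrow> real) (at 0 within D) (at 0)"
        unfolding filterlim_at D00(1) by (auto intro!: tendsto_norm_zero simp: eventually_at_filter)
      have F20: "F2 0 h = M' 0 *\<^sub>R h" for h by (simp add: F2_def \<mu>_def)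
      have F10: "F1 0 h = 0" for h by (simp add: F1_def)
      have "((\<lambda>r. norm (M r - M 0 - M' 0 * (r - 0)) / norm (r - 0)) \<longlongrightarrow> 0) (at 0 within D)"
        using M[OF z] unfolding has_field_derivative_def has_derivative_iff_norm by blast
      then have l: "((\<lambda>h :: real \<times> real. norm (M (norm h) - M 0 - M' 0 * (norm h - 0)) / norm (norm h - 0)) \<longlongrightarrow> 0) (at 0)"
        by (rule filterlim_compose[OF _ fl])
      have "((\<lambda>h. norm ((M (norm h) / norm h) *\<^sub>R h - (M (norm (0 :: real \<times> real)) / norm (0 :: real \<times> real)) *\<^sub>R 0 - F2 0 (h - 0)) / norm (h - 0)) \<longlongrightarrow> 0) (at 0)"
      proof (rule Lim_transform_eventually[OF l])
        show "\<forall>\<^sub>F h :: real \<times> real in at 0. norm (M (norm h) - M 0 - M' 0 * (norm h - 0)) / norm (norm h - 0)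
            = norm ((M (norm h) / norm h) *\<^sub>R h - (M (norm (0 :: real \<times> real)) / norm (0 :: real \<times> real)) *\<^sub>R 0 - F2 0 (h - 0)) / norm (h - 0)"
          unfolding eventually_at_filter
        proof (intro always_eventually allI impI)
          fix h :: "real \<times> real" assume h: "h \<noteq> 0"
          have "(M (norm h) / norm h) *\<^sub>R h - M' 0 *\<^sub>R h = ((M (norm h) - M' 0 * norm h) / norm h) *\<^sub>R h"
            using h by (simp add: scaleR_left_diff_distrib[symmetric] diff_divide_distrib)
          then have "norm ((M (norm h) / norm h) *\<^sub>R h - M' 0 *\<^sub>R h) = \<bar>M (norm h) - M' 0 * norm h\<bar>"
            using h by simp
          then show "norm (M (norm h) - M 0 - M' 0 * (norm h - 0)) / norm (norm h - 0)
            = norm ((M (norm h) / norm h) *\<^sub>R h - (M (norm (0 :: real \<times> real)) / norm (0 :: real \<times> real)) *\<^sub>R 0 - F2 0 (h - 0)) / norm (h - 0)"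
            by (simp add: F20 D00)
        qed
      qed
      moreover have "bounded_linear (F2 0)" unfolding F20[abs_def] by (rule bounded_linear_scaleR_right)
      ultimately have "((\<lambda>\<xi>. (M (norm \<xi>) / norm \<xi>) *\<^sub>R \<xi>) has_derivative F2 0) (at 0)"
        unfolding has_derivative_iff_norm by blast
      moreover have "((\<lambda>r. norm (\<psi> r - \<psi> 0 - (r - 0) *\<^sub>R \<psi>' 0) / norm (r - 0)) \<longlongrightarrow> 0) (at 0 within D)"
        using \<psi>[OF z] unfolding has_vector_derivative_def has_derivative_iff_norm by blast
      then have l: "((\<lambda>h :: real \<times> real. norm (\<psi> (norm h) - \<psi> 0 - (norm h - 0) *\<^sub>R \<psi>' 0) / norm (norm h - 0)) \<longlongrightarrow> 0) (at 0)"
        by (rule filterlim_compose[OF _ fl])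
      have "((\<lambda>\<xi>. \<psi> (norm \<xi>)) has_derivative F1 0) (at 0)"
        unfolding has_derivative_iff_norm F10[abs_def] using l by (simp add: D00)
      ultimately show ?thesis by (simp add: True)
    next
      case False
      define r where "r = norm \<xi>"
      have r: "0 < r" "r \<in> D" using False \<xi> by (simp_all add: r_def)
      have dn: "(norm has_derivative (\<lambda>h. h \<bullet> sgn \<xi>)) (at \<xi>)" by (rule has_derivative_norm[OF False])
      have "(\<psi> has_derivative (\<lambda>t. t *\<^sub>R \<psi>' r)) (at (norm \<xi>))"
        using \<psi>[OF r(2)] unfolding at[OF r(1)] has_vector_derivative_def by (simp add: r_def)
      from has_derivative_compose[OF dn this] have 1: "((\<lambda>\<xi>. \<psi> (norm \<xi>)) has_derivative F1 \<xi>) (at \<xi>)"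
        by (simp add: F1_def[abs_def] r_def)
      have "((\<lambda>r. M r / r) has_real_derivative (M' r * r - M r * 1) / (r * r)) (at r)"
        using M[OF r(2)] r(1) unfolding at[OF r(1)] by (intro DERIV_divide DERIV_ident) auto
      then have "((\<lambda>r. M r / r) has_derivative (*) ((M' r * r - M r * 1) / (r * r))) (at (norm \<xi>))"
        by (simp add: has_field_derivative_def r_def)
      from has_derivative_scaleR[OF has_derivative_compose[OF dn this] has_derivative_ident]
      have "((\<lambda>\<xi>. (M (norm \<xi>) / norm \<xi>) *\<^sub>R \<xi>) has_derivative
          (\<lambda>h. (M (norm \<xi>) / norm \<xi>) *\<^sub>R h + ((M' r * r - M r * 1) / (r * r) * (h \<bullet> sgn \<xi>)) *\<^sub>R \<xi>)) (at \<xi>)" .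
      moreover have "(M (norm \<xi>) / norm \<xi>) *\<^sub>R h + ((M' r * r - M r * 1) / (r * r) * (h \<bullet> sgn \<xi>)) *\<^sub>R \<xi> = F2 \<xi> h" for h
      proof -
        have "((M' r * r - M r * 1) / (r * r) * (h \<bullet> sgn \<xi>)) *\<^sub>R \<xi>
            = ((M' r * r - M r * 1) / (r * r) * (h \<bullet> sgn \<xi>) * r) *\<^sub>R sgn \<xi>"
          by (subst (2) sgn_norm[of \<xi>, symmetric]) (simp add: r_def)
        also have "(M' r * r - M r * 1) / (r * r) * (h \<bullet> sgn \<xi>) * r = (h \<bullet> sgn \<xi>) * (M' r - \<mu> r)"
          using r(1) by (simp add: \<mu>_def field_simps)
        finally show ?thesis using r(1) by (simp add: F2_def r_def[symmetric] \<mu>_def)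
      qed
      ultimately show ?thesis using 1 by simp
    qed
    then show "((\<lambda>\<xi>. (M (norm \<xi>) / norm \<xi>) *\<^sub>R \<xi>) has_derivative F2 \<xi>) (at \<xi>)" "((\<lambda>\<xi>. \<psi> (norm \<xi>)) has_derivative F1 \<xi>) (at \<xi>)"
      by blast+
  qed
  have d: "((\<lambda>\<xi>. (\<psi> (norm \<xi>), (M (norm \<xi>) / norm \<xi>) *\<^sub>R cplx \<xi>)) has_derivative (\<lambda>h. (F1 \<xi> h, cplx (F2 \<xi> h)))) (at \<xi>)"
    if "norm \<xi> \<in> D" for \<xi>
    using has_derivative_Pair[OF d1[OF that] c.has_derivative[OF d2[OF that]]] by (simp add: c.scaleR)
  have inj: "inj (\<lambda>h. (F1 \<xi> h, cplx (F2 \<xi> h)))" if \<xi>: "norm \<xi> \<in> D" for \<xi>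
  proof -
    have "h = 0" if h: "F1 \<xi> h = 0" "cplx (F2 \<xi> h) = 0" for h
    proof -
      have F2: "F2 \<xi> h = 0" using h(2) norm_cplx[of "F2 \<xi> h"] by simp
      show "h = 0"
      proof (cases "\<xi> = 0")
        case True
        then have "M' 0 \<noteq> 0" using reg[OF \<xi>] D00(3) \<xi> by auto
        then show ?thesis using F2 True by (simp add: F2_def \<mu>_def)
      next
        case False
        then have \<mu>: "\<mu> (norm \<xi>) \<noteq> 0" using nz[of "norm \<xi>"] by (simp add: \<mu>_def)
        have ss: "sgn \<xi> \<bullet> sgn \<xi> = 1" using False by (simp add: dot_square_norm norm_sgn)
        show ?thesis
        proof (cases "h \<bullet> sgn \<xi> = 0")
          case True
          then show ?thesis using F2 \<mu> by (simp add: F2_def)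
        next
          case nz': False
          then have "\<psi>' (norm \<xi>) = 0" using h(1) by (simp add: F1_def)
          then have M': "M' (norm \<xi>) \<noteq> 0" using reg[OF \<xi>] by blast
          have "F2 \<xi> h \<bullet> sgn \<xi> = (h \<bullet> sgn \<xi>) * M' (norm \<xi>)"
            by (simp add: F2_def inner_add_left ss algebra_simps)
          then show ?thesis using F2 nz' M' by simp
        qed
      qed
    qed
    then show ?thesis
      unfolding linear_injective_0[OF has_derivative_linear[OF d[OF \<xi>]]] by (auto simp: zero_prod_def)
  qed
  have \<mu>c: "continuous_on D \<mu>"
    unfolding continuous_on_def
  proof
    fix r assume r: "r \<in> D"
    show "(\<mu> \<longlongrightarrow> \<mu> r) (at r within D)"
    proof (cases "r = 0")
      case True
      have "((\<lambda>s. (M s - M 0) / (s - 0)) \<longlongrightarrow> M' 0) (at 0 within D)"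
        using M[of 0] r True by (simp add: has_field_derivative_iff)
      then have l: "((\<lambda>s. (M s - M 0) / (s - 0)) \<longlongrightarrow> \<mu> 0) (at 0 within D)" by (simp add: \<mu>_def)
      show ?thesis unfolding True
        by (rule Lim_transform_eventually[OF l]) (use D00(2) r True in \<open>auto simp: eventually_at_filter \<mu>_def\<close>)
    next
      case False
      have "(M \<longlongrightarrow> M r) (at r within D)" using DERIV_continuous[OF M[OF r]] by (simp add: continuous_within)
      then have "((\<lambda>s. M s / s) \<longlongrightarrow> M r / r) (at r within D)" using False by (intro tendsto_divide tendsto_ident_at)
      moreover have "\<forall>\<^sub>F s in at r within D. M s / s = \<mu> s"
        using eventually_neq_at_within[of 0 r D] by eventually_elim (simp add: \<mu>_def)
      ultimately show ?thesis using False by (simp add: \<mu>_def Lim_transform_eventually)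
    qed
  qed
  have "continuous_on ?U (\<lambda>\<xi>. (F1 \<xi> h, cplx (F2 \<xi> h)))" for h
  proof -
    have sg: "norm (sgn \<xi>) \<le> 1" for \<xi> :: "real \<times> real" by (simp add: norm_sgn)
    have b1: "\<bar>h \<bullet> sgn \<xi>\<bar> \<le> norm h" for \<xi>
      using Cauchy_Schwarz_ineq2[of h "sgn \<xi>"] mult_left_mono[OF sg norm_ge_zero[of h], of \<xi>] by simp
    have fs: "\<bar>fst (sgn \<xi>)\<bar> \<le> 1" "\<bar>snd (sgn \<xi>)\<bar> \<le> 1" for \<xi> :: "real \<times> real"
      using norm_fst_le[of "fst (sgn \<xi>)" "snd (sgn \<xi>)"] norm_snd_le[of "snd (sgn \<xi>)" "fst (sgn \<xi>)"] sg[of \<xi>] by simp_all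
    have b2: "\<bar>(h \<bullet> sgn \<xi>) * fst (sgn \<xi>)\<bar> \<le> norm h" "\<bar>(h \<bullet> sgn \<xi>) * snd (sgn \<xi>)\<bar> \<le> norm h" for \<xi>
      using mult_mono[OF b1[of \<xi>] fs(1)[of \<xi>]] mult_mono[OF b1[of \<xi>] fs(2)[of \<xi>]] by (simp_all add: abs_mult)
    have c1: "continuous_on ?U (\<lambda>\<xi>. F1 \<xi> h)" unfolding F1_def
      by (rule continuous_on_sgn_mult[of D \<psi>' "\<lambda>\<eta>. h \<bullet> \<eta>" "norm h"]) (use cont(1) D00(3) b1 in \<open>auto intro!: continuous_intros\<close>)
    have cM: "continuous_on D (\<lambda>r. M' r - \<mu> r)" by (intro continuous_intros cont(2) \<mu>c)
    have cM0: "M' 0 - \<mu> 0 = 0" by (simp add: \<mu>_def)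
    have e1: "continuous_on ?U (\<lambda>\<xi>. ((h \<bullet> sgn \<xi>) * fst (sgn \<xi>)) *\<^sub>R (M' (norm \<xi>) - \<mu> (norm \<xi>)))"
      by (rule continuous_on_sgn_mult[of D "\<lambda>r. M' r - \<mu> r" "\<lambda>\<eta>. (h \<bullet> \<eta>) * fst \<eta>" "norm h"]) (use cM cM0 b2 in \<open>auto intro!: continuous_intros\<close>)
    have e2: "continuous_on ?U (\<lambda>\<xi>. ((h \<bullet> sgn \<xi>) * snd (sgn \<xi>)) *\<^sub>R (M' (norm \<xi>) - \<mu> (norm \<xi>)))"
      by (rule continuous_on_sgn_mult[of D "\<lambda>r. M' r - \<mu> r" "\<lambda>\<eta>. (h \<bullet> \<eta>) * snd \<eta>" "norm h"]) (use cM cM0 b2 in \<open>auto intro!: continuous_intros\<close>)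
    have \<mu>n: "continuous_on ?U (\<lambda>\<xi>. \<mu> (norm \<xi>))"
      by (rule continuous_on_compose2[OF \<mu>c]) (auto intro!: continuous_intros)
    have F2: "F2 \<xi> h = (((h \<bullet> sgn \<xi>) * fst (sgn \<xi>)) *\<^sub>R (M' (norm \<xi>) - \<mu> (norm \<xi>)),
        ((h \<bullet> sgn \<xi>) * snd (sgn \<xi>)) *\<^sub>R (M' (norm \<xi>) - \<mu> (norm \<xi>))) + \<mu> (norm \<xi>) *\<^sub>R h" for \<xi>
      by (simp add: F2_def prod_eq_iff)
    have c2: "continuous_on ?U (\<lambda>\<xi>. F2 \<xi> h)" unfolding F2
      by (intro continuous_on_add continuous_on_Pair e1 e2 continuous_on_scaleR \<mu>n continuous_on_const)
    show ?thesis by (intro continuous_on_Pair c1 c.continuous_on c2)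
  qed
  then show ?thesis unfolding C1_immersion_on_def using d inj
    by (intro exI[of _ "\<lambda>\<xi> h. (F1 \<xi> h, cplx (F2 \<xi> h))"]) simp
qed

context sl2_params
begin

text \<open>The chart is given in polar coordinates; its radius \<open>rad\<close> is a parameter of \<open>\<gamma>\<close> that vanishes
  on the axis, and \<open>\<theta>\<close> is the inverse parameter change.\<close>

lemma immersed_surface_polar:
  assumes g: "generating_curve I x y \<alpha>"
    and D: "D = {0<..} \<or> D = {0..} \<and> x (\<theta> 0) = 0 \<and> sin (\<alpha> (\<theta> 0)) = 0"
    and \<theta>: "\<And>r. r \<in> D \<Longrightarrow> \<theta> r \<in> I" "\<And>s. s \<in> I \<Longrightarrow> rad s \<in> D \<and> \<theta> (rad s) = s"
    and \<theta>': "\<And>r. r \<in> D \<Longrightarrow> (\<theta> has_real_derivative \<theta>' r) (at r within D)" "continuous_on D \<theta>'" "\<And>r. r \<in> D \<Longrightarrow> \<theta>' r \<noteq> 0"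
    and rad: "continuous_on I rad" "\<And>r. r \<in> D \<Longrightarrow> rad (\<theta> r) = r"
    and x: "\<And>r. 0 < r \<Longrightarrow> x (\<theta> r) \<noteq> 0"
  shows "immersed_surface I x y"
proof -
  define X Y a where "X r = x (\<theta> r)" and "Y r = y (\<theta> r)" and "a r = \<alpha> (\<theta> r)" for r
  have im: "\<theta> ` D \<subseteq> I" using \<theta>(1) by blast
  have X: "(X has_real_derivative cos (a r) * \<theta>' r) (at r within D)"
    and Y: "(Y has_real_derivative sin (a r) / cosh (X r) * \<theta>' r) (at r within D)" if "r \<in> D" for r
    using DERIV_image_chain[OF has_field_derivative_subset[OF generating_curve_derivs(1)[OF g \<theta>(1)[OF that]] im] \<theta>'(1)[OF that]]
      DERIV_image_chain[OF has_field_derivative_subset[OF generating_curve_derivs(2)[OF g \<theta>(1)[OF that]] im] \<theta>'(1)[OF that]]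
    by (simp_all add: X_def[abs_def] Y_def[abs_def] a_def o_def)
  have \<theta>c: "continuous_on D \<theta>" by (rule DERIV_continuous_on[OF \<theta>'(1)])
  have Xc: "continuous_on D X" by (rule DERIV_continuous_on[OF X])
  have Yc: "continuous_on D Y" by (rule DERIV_continuous_on[OF Y])
  have ac: "continuous_on D a" unfolding a_def
    by (rule continuous_on_compose2[OF generating_curve_continuous(3)[OF g] \<theta>c im])
  define \<psi> where "\<psi> r = complex_of_real (cosh (X r)) * cis (Y r)" for r
  define \<psi>' where "\<psi>' r = complex_of_real (\<theta>' r) * (complex_of_real (sinh (X r) * cos (a r)) + \<i> * complex_of_real (sin (a r))) * cis (Y r)" for r
  define M where "M r = sinh (X r)" for r
  define M' where "M' r = cosh (X r) * cos (a r) * \<theta>' r" for r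
  define F where "F \<xi> = (\<psi> (norm \<xi>), (M (norm \<xi>) / norm \<xi>) *\<^sub>R cplx \<xi>)" for \<xi>
  let ?U = "{\<xi> :: real \<times> real. norm \<xi> \<in> D}"
  have imm: "C1_immersion_on ?U F" unfolding F_def
  proof (rule C1_immersion_polar)
    show "D = {0<..} \<or> D = {0..} \<and> M 0 = 0 \<and> \<psi>' 0 = 0" using D by (auto simp: M_def \<psi>'_def X_def a_def)
    show "(\<psi> has_vector_derivative \<psi>' r) (at r within D)" if r: "r \<in> D" for r
    proof -
      have c: "((\<lambda>r. cosh (X r)) has_real_derivative sinh (X r) * (cos (a r) * \<theta>' r)) (at r within D)"
        by (rule derivative_eq_intros X[OF r] refl | simp)+
      show ?thesis using has_vector_derivative_complex_of_real_mult_cis[OF c Y[OF r]]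
        by (simp add: \<psi>_def[abs_def] \<psi>'_def algebra_simps)
    qed
    show "(M has_real_derivative M' r) (at r within D)" if r: "r \<in> D" for r
      unfolding M_def[abs_def] M'_def by (rule derivative_eq_intros X[OF r] refl | simp)+
    show "continuous_on D \<psi>'" unfolding \<psi>'_def by (intro continuous_intros Xc Yc ac \<theta>'(2))
    show "continuous_on D M'" unfolding M'_def by (intro continuous_intros Xc ac \<theta>'(2))
    show "M r \<noteq> 0" if "0 < r" for r using x[OF that] by (simp add: M_def X_def)
    show "\<psi>' r \<noteq> 0 \<or> M' r \<noteq> 0" if r: "r \<in> D" for r
    proof (rule ccontr)
      assume n: "\<not> ?thesis"
      then have c0: "cos (a r) = 0" using \<theta>'(3)[OF r] by (simp add: M'_def)
      then have "sin (a r) = 0" using n \<theta>'(3)[OF r] by (simp add: \<psi>'_def)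
      then show False using c0 sin_cos_squared_add[of "a r"] by simp
    qed
  qed
  define q where "q p = rad (fst p) *\<^sub>R (cos (snd p), sin (snd p))" for p :: "real \<times> real"
  have rad0: "0 \<le> rad s" if "s \<in> I" for s using \<theta>(2)[OF that] D by auto
  have nq: "norm (q p) = rad (fst p)" if "fst p \<in> I" for p
    unfolding q_def norm_scaleR norm_Pair using rad0[OF that] by simp
  have xz: "x s = 0 \<longleftrightarrow> rad s = 0" if "s \<in> I" for s
  proof (cases "rad s = 0")
    case True
    then show ?thesis using \<theta>(2)[OF that] D by auto
  next
    case False
    then show ?thesis using x[of "rad s"] rad0[OF that] \<theta>(2)[OF that] by auto
  qed
  have qc: "continuous_on (I \<times> UNIV) q" unfolding q_def
    by (intro continuous_intros continuous_on_compose2[OF rad(1)]) auto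
  have sub: "q ` (I \<times> UNIV) \<subseteq> ?U" using nq \<theta>(2) by auto
  have surj: "?U \<subseteq> q ` (I \<times> {0..2 * pi})"
  proof
    fix \<xi> :: "real \<times> real" assume \<xi>: "\<xi> \<in> ?U"
    obtain t where t: "t \<in> {0..2 * pi}" "(fst \<xi>, snd \<xi>) = (norm \<xi> * cos t, norm \<xi> * sin t)"
      using polar_coordinates[of "norm \<xi>" "fst \<xi>" "snd \<xi>"] by auto
    have "\<xi> = q (\<theta> (norm \<xi>), t)" using t(2) rad(2) \<xi> by (simp add: q_def prod_eq_iff)
    moreover have "(\<theta> (norm \<xi>), t) \<in> I \<times> {0..2 * pi}" using \<theta>(1) \<xi> t(1) by simp
    ultimately show "\<xi> \<in> q ` (I \<times> {0..2 * pi})" by (rule image_eqI)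
  qed
  have quot: "quotient_map (top_of_set (I \<times> UNIV)) (top_of_set ?U) q"
  proof (rule quotient_map_of_subsequences[OF qc, where K = "I \<times> {0..2 * pi}"])
    show "q ` (I \<times> UNIV) = ?U" by (rule equalityI[OF sub order_trans[OF surj image_mono]]) auto
    show "q ` (I \<times> {0..2 * pi}) = ?U" by (rule equalityI[OF order_trans[OF image_mono sub] surj]) auto
    fix k :: "nat \<Rightarrow> real \<times> real" and u assume k: "\<And>n. k n \<in> I \<times> {0..2 * pi}" "(\<lambda>n. q (k n)) \<longlonglongrightarrow> u" and u: "u \<in> ?U"
    have kI: "fst (k n) \<in> I" "snd (k n) \<in> {0..2 * pi}" for n using k(1)[of n] by (simp_all add: mem_Times_iff)
    have "(\<lambda>n. rad (fst (k n))) \<longlonglongrightarrow> norm u" using tendsto_norm[OF k(2)] by (simp add: nq[OF kI(1)])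
    then have "(\<lambda>n. \<theta> (rad (fst (k n)))) \<longlonglongrightarrow> \<theta> (norm u)"
      by (rule continuous_on_tendsto_compose[OF \<theta>c]) (use u \<theta>(2)[OF kI(1)] in auto)
    then have s: "(\<lambda>n. fst (k n)) \<longlonglongrightarrow> \<theta> (norm u)" using \<theta>(2)[OF kI(1)] by simp
    have "seq_compact {0..2 * pi}" by (simp add: compact_imp_seq_compact)
    then obtain t and r :: "nat \<Rightarrow> nat" where t: "t \<in> {0..2 * pi}" "strict_mono r" "((\<lambda>n. snd (k n)) \<circ> r) \<longlonglongrightarrow> t"
      using seq_compactE[of "{0..2 * pi}" "\<lambda>n. snd (k n)"] kI(2) by blast
    have "(\<lambda>n. (fst (k (r n)), snd (k (r n)))) \<longlonglongrightarrow> (\<theta> (norm u), t)"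
      using LIMSEQ_subseq_LIMSEQ[OF s t(2)] t(3) by (intro tendsto_Pair) (simp_all add: o_def)
    then have "(k \<circ> r) \<longlonglongrightarrow> (\<theta> (norm u), t)" by (simp add: o_def)
    then show "\<exists>l\<in>I \<times> {0..2 * pi}. \<exists>r. strict_mono (r :: nat \<Rightarrow> nat) \<and> (k \<circ> r) \<longlonglongrightarrow> l"
      using t(1,2) \<theta>(1) u by (intro bexI[of _ "(\<theta> (norm u), t)"] exI[of _ r]) auto
  qed auto
  have same: "q p = q p' \<longleftrightarrow> same_point x p p'" if p: "p \<in> I \<times> UNIV" "p' \<in> I \<times> UNIV" for p p'
  proof -
    obtain s t s' t' where pp: "p = (s, t)" "p' = (s', t')" by (cases p, cases p')
    have sI: "s \<in> I" "s' \<in> I" using p by (auto simp: pp)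
    show ?thesis
    proof
      assume e: "q p = q p'"
      then have "rad s = rad s'" using nq[of p] nq[of p'] sI by (simp add: pp)
      then have ss: "s' = s" using \<theta>(2)[OF sI(1)] \<theta>(2)[OF sI(2)] by metis
      show "same_point x p p'"
      proof (cases "x s = 0")
        case False
        then have "cos t = cos t'" "sin t = sin t'" using e xz[OF sI(1)] by (simp_all add: q_def pp ss)
        then show ?thesis using cos_sin_eq_imp[of t t'] by (simp add: same_point_def pp ss)
      qed (simp add: same_point_def pp ss)
    next
      assume sp: "same_point x p p'"
      then have ss: "s' = s" by (simp add: same_point_def pp)
      show "q p = q p'"
      proof (cases "x s = 0")
        case True
        then show ?thesis using xz[OF sI(1)] by (simp add: q_def pp ss)
      next
        case False
        then obtain n :: int where "t' = t + 2 * pi * of_int n" using sp by (auto simp: same_point_def pp)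
        then have "sin t' = sin t \<and> cos t' = cos t" using sin_cos_eq_iff[of t' t] by auto
        then show ?thesis by (simp add: q_def pp ss)
      qed
    qed
  qed
  have rot: "rot_immersion x y (fst p) (snd p) = F (q p)" if p: "p \<in> I \<times> UNIV" for p
  proof -
    obtain s t where pp: "p = (s, t)" by (cases p)
    have sI: "s \<in> I" using p by (simp add: pp)
    have \<theta>s: "\<theta> (rad s) = s" using \<theta>(2)[OF sI] by blast
    have n: "norm (q p) = rad s" using nq[of p] sI by (simp add: pp)
    have cq: "cplx (q p) = complex_of_real (rad s) * cis t" by (simp add: q_def pp cplx_def complex_eq_iff)
    have "(sinh (x s) / rad s) *\<^sub>R (complex_of_real (rad s) * cis t) = complex_of_real (sinh (x s)) * cis t"
    proof (cases "rad s = 0")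
      case True
      then show ?thesis using xz[OF sI] by simp
    next
      case False
      then show ?thesis by (simp add: scaleR_conv_of_real)
    qed
    then show ?thesis unfolding F_def n cq by (simp add: \<psi>_def M_def X_def Y_def \<theta>s rot_immersion_def pp)
  qed
  have op: "open ?U"
  proof -
    have "?U = - {0} \<or> ?U = UNIV" using D by auto
    then show ?thesis by (metis open_Compl closed_singleton open_UNIV)
  qed
  show ?thesis unfolding immersed_surface_def
  proof
    fix s assume s: "s \<in> I"
    have "openin (top_of_set I) I" by simp
    then show "\<exists>J U q F. openin (top_of_set I) J \<and> s \<in> J \<and> open U \<and>
        quotient_map (top_of_set (J \<times> UNIV)) (top_of_set U) q \<and>
        (\<forall>p\<in>J \<times> UNIV. \<forall>p'\<in>J \<times> UNIV. q p = q p' \<longleftrightarrow> same_point x p p') \<and>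
        (\<forall>p\<in>J \<times> UNIV. rot_immersion x y (fst p) (snd p) = F (q p)) \<and> C1_immersion_on U F"
      using s op quot same rot imm by (intro exI[of _ I] exI[of _ ?U] exI[of _ q] exI[of _ F] conjI ballI)
  qed
qed

text \<open>No point lies on the axis, so exp can serve as the radius and the chart is a punctured
  plane.\<close>

lemma immersed_surface_UNIV:
  assumes g: "generating_curve UNIV x y \<alpha>"
  shows "immersed_surface UNIV x y"
proof (rule immersed_surface_polar[OF g, where D = "{0<..}" and \<theta> = ln and rad = exp and \<theta>' = inverse])
  show "(ln has_real_derivative inverse r) (at r within {0<..})" if "r \<in> {0<..}" for r :: real
    using that by (intro has_field_derivative_at_within[OF DERIV_ln]) simp
  show "continuous_on {0<..} (inverse :: real \<Rightarrow> real)" by (intro continuous_intros) auto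
  show "continuous_on UNIV (exp :: real \<Rightarrow> real)" by (intro continuous_intros)
  show "x (ln r) \<noteq> 0" for r using g by (simp add: generating_curve_def)
qed auto

lemma immersed_surface_half_line:
  assumes g: "generating_curve I x y \<alpha>" and I: "I = {a..} \<or> I = {..a}" and xa: "x a = 0"
  shows "immersed_surface I x y"
proof -
  have aI: "a \<in> I" using I by auto
  have "a \<notin> interior I" using g xa by (auto simp: generating_curve_def)
  then have sa: "sin (\<alpha> a) = 0" using g aI by (auto simp: generating_curve_def)
  have xn: "x s \<noteq> 0" if "s \<in> interior I" for s using g that by (auto simp: generating_curve_def)
  from I show ?thesis
  proof
    assume I: "I = {a..}"
    show ?thesis
    proof (rule immersed_surface_polar[OF g, where D = "{0..}" and \<theta> = "\<lambda>r. a + r" and rad = "\<lambda>s. s - a" and \<theta>' = "\<lambda>_. 1"])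
      show "((+) a has_real_derivative 1) (at r within {0..})" for r by (auto intro!: derivative_eq_intros)
      have sub: "{a<..} \<subseteq> interior I" by (rule interior_maximal) (auto simp: I)
      show "x (a + r) \<noteq> 0" if "0 < r" for r using xn[OF subsetD[OF sub, of "a + r"]] that by simp
    qed (auto simp: I xa sa intro!: continuous_intros)
  next
    assume I: "I = {..a}"
    show ?thesis
    proof (rule immersed_surface_polar[OF g, where D = "{0..}" and \<theta> = "\<lambda>r. a - r" and rad = "\<lambda>s. a - s" and \<theta>' = "\<lambda>_. -1"])
      show "((-) a has_real_derivative -1) (at r within {0..})" for r by (auto intro!: derivative_eq_intros)
      have sub: "{..<a} \<subseteq> interior I" by (rule interior_maximal) (auto simp: I)
      show "x (a - r) \<noteq> 0" if "0 < r" for r using xn[OF subsetD[OF sub, of "a - r"]] that by simp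
    qed (auto simp: I xa sa intro!: continuous_intros)
  qed
qed

end

lemma bounded_x_of_compact:
  assumes "compact (rot_surface I x y)"
  shows "bounded (x ` I)"
proof -
  obtain B where B: "\<And>p. p \<in> rot_surface I x y \<Longrightarrow> norm p \<le> B"
    using compact_imp_bounded[OF assms] unfolding bounded_iff by blast
  have "\<bar>x s\<bar> \<le> arsinh B" if s: "s \<in> I" for s
  proof -
    have "rot_immersion x y s 0 \<in> rot_surface I x y" using s by (force simp: rot_surface_def)
    then have "norm (rot_immersion x y s 0) \<le> B" by (rule B)
    moreover have "\<bar>sinh (x s)\<bar> \<le> norm (rot_immersion x y s 0)"
      unfolding rot_immersion_def by (rule order_trans[OF _ norm_snd_le]) (simp add: norm_mult)
    ultimately have "\<bar>sinh (x s)\<bar> \<le> B" by linarith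
    then have "sinh \<bar>x s\<bar> \<le> sinh (arsinh B)" by simp
    then show ?thesis by (rule sinh_real_le_iff[THEN iffD1])
  qed
  then show ?thesis unfolding bounded_iff by auto
qed

section \<open>A sphere of constant mean curvature that crosses itself\<close>

lemma ex_antiderivative:
  fixes f :: "real \<Rightarrow> real"
  assumes "\<And>t. isCont f t"
  obtains F where "F 0 = 0" "\<And>t. (F has_real_derivative f t) (at t)"
proof -
  obtain F where "\<And>t. (F has_vector_derivative f t) (at t)"
    using einterval_antiderivative[of "-\<infinity>" \<infinity> f] assms by auto
  then have F: "\<And>t. (F has_real_derivative f t) (at t)" by (simp add: has_real_derivative_iff_has_vector_derivative)
  have "((\<lambda>t. F t - F 0) has_real_derivative f t) (at t)" for t using DERIV_diff[OF F DERIV_const] by simp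
  then show thesis by (intro that[of "\<lambda>t. F t - F 0"]) auto
qed

text \<open>A continuous argument of the plane curve (p, q): the unit vector along (p, q), turned
  back by the angle a, has zero derivative.\<close>

lemma angle_function:
  fixes p q a p' q' :: "real \<Rightarrow> real"
  assumes p: "\<And>t. (p has_real_derivative p' t) (at t)" and q: "\<And>t. (q has_real_derivative q' t) (at t)"
    and pos: "\<And>t. (p t)\<^sup>2 + (q t)\<^sup>2 > 0"
    and a: "\<And>t. (a has_real_derivative (p t * q' t - q t * p' t) / ((p t)\<^sup>2 + (q t)\<^sup>2)) (at t)"
    and init: "a 0 = 0" "q 0 = 0" "p 0 > 0"
  shows "cos (a t) = p t / sqrt ((p t)\<^sup>2 + (q t)\<^sup>2)" and "sin (a t) = q t / sqrt ((p t)\<^sup>2 + (q t)\<^sup>2)"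
proof -
  define R where "R t = sqrt ((p t)\<^sup>2 + (q t)\<^sup>2)" for t
  define D where "D t = (p t * q' t - q t * p' t) / ((p t)\<^sup>2 + (q t)\<^sup>2)" for t
  have R: "R t > 0" "(R t)\<^sup>2 = (p t)\<^sup>2 + (q t)\<^sup>2" for t using pos[of t] by (simp_all add: R_def)
  have DR: "D t * (R t)\<^sup>2 = p t * q' t - q t * p' t" for t using R[of t] pos[of t] by (simp add: D_def)
  have R': "(R has_real_derivative (p t * p' t + q t * q' t) / R t) (at t)" for t
  proof -
    have "((\<lambda>t. (p t)\<^sup>2 + (q t)\<^sup>2) has_real_derivative 2 * (p t * p' t + q t * q' t)) (at t)"
      by (rule derivative_eq_intros p q refl | simp)+
    from has_real_derivative_sqrt[OF this pos] show ?thesis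
      unfolding R_def[abs_def] by (simp only: mult_divide_mult_cancel_left_if) simp
  qed
  have a': "(a has_real_derivative D t) (at t)" for t using a by (simp add: D_def)
  have u: "((\<lambda>t. (p t * cos (a t) + q t * sin (a t)) / R t) has_real_derivative 0) (at t)" for t
  proof -
    have "((\<lambda>t. (p t * cos (a t) + q t * sin (a t)) / R t) has_real_derivative
        ((p' t * cos (a t) - p t * sin (a t) * D t + q' t * sin (a t) + q t * cos (a t) * D t) * R t
          - (p t * cos (a t) + q t * sin (a t)) * ((p t * p' t + q t * q' t) / R t)) / (R t * R t)) (at t)"
      by (rule derivative_eq_intros p q a' R' refl | use R(1)[of t] in \<open>simp add: algebra_simps\<close>)+
    moreover have "(p' t * cos (a t) - p t * sin (a t) * D t + q' t * sin (a t) + q t * cos (a t) * D t) * R t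
          - (p t * cos (a t) + q t * sin (a t)) * ((p t * p' t + q t * q' t) / R t) = 0"
    proof -
      have "(p' t * cos (a t) - p t * sin (a t) * D t + q' t * sin (a t) + q t * cos (a t) * D t) * (R t)\<^sup>2
          = (p t * cos (a t) + q t * sin (a t)) * (p t * p' t + q t * q' t)"
        using R(2)[of t] DR[of t] by algebra
      then show ?thesis using R(1)[of t] by (simp add: field_simps power2_eq_square)
    qed
    ultimately show ?thesis by simp
  qed
  have v: "((\<lambda>t. (p t * sin (a t) - q t * cos (a t)) / R t) has_real_derivative 0) (at t)" for t
  proof -
    have "((\<lambda>t. (p t * sin (a t) - q t * cos (a t)) / R t) has_real_derivative
        ((p' t * sin (a t) + p t * cos (a t) * D t - q' t * cos (a t) + q t * sin (a t) * D t) * R t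
          - (p t * sin (a t) - q t * cos (a t)) * ((p t * p' t + q t * q' t) / R t)) / (R t * R t)) (at t)"
      by (rule derivative_eq_intros p q a' R' refl | use R(1)[of t] in \<open>simp add: algebra_simps\<close>)+
    moreover have "(p' t * sin (a t) + p t * cos (a t) * D t - q' t * cos (a t) + q t * sin (a t) * D t) * R t
          - (p t * sin (a t) - q t * cos (a t)) * ((p t * p' t + q t * q' t) / R t) = 0"
    proof -
      have "(p' t * sin (a t) + p t * cos (a t) * D t - q' t * cos (a t) + q t * sin (a t) * D t) * (R t)\<^sup>2
          = (p t * sin (a t) - q t * cos (a t)) * (p t * p' t + q t * q' t)"
        using R(2)[of t] DR[of t] by algebra
      then show ?thesis using R(1)[of t] by (simp add: field_simps power2_eq_square)
    qed
    ultimately show ?thesis by simp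
  qed
  have R0: "R 0 = p 0" using init by (simp add: R_def)
  have "(p t * cos (a t) + q t * sin (a t)) / R t = (p 0 * cos (a 0) + q 0 * sin (a 0)) / R 0"
    using u by (intro DERIV_isconst_all) simp
  then have 1: "p t * cos (a t) + q t * sin (a t) = R t" using init R0 R(1)[of t] by simp
  have "(p t * sin (a t) - q t * cos (a t)) / R t = (p 0 * sin (a 0) - q 0 * cos (a 0)) / R 0"
    using v by (intro DERIV_isconst_all) simp
  then have 2: "p t * sin (a t) = q t * cos (a t)" using init R(1)[of t] by simp
  have "R t * cos (a t) = p t * (cos (a t))\<^sup>2 + (q t * cos (a t)) * sin (a t)"
    unfolding 1[symmetric] by algebra
  also have "\<dots> = p t * ((sin (a t))\<^sup>2 + (cos (a t))\<^sup>2)" unfolding 2[symmetric] by algebra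
  finally have Rc: "R t * cos (a t) = p t" by simp
  have "R t * sin (a t) = (p t * sin (a t)) * cos (a t) + q t * (sin (a t))\<^sup>2"
    unfolding 1[symmetric] by algebra
  also have "\<dots> = q t * ((sin (a t))\<^sup>2 + (cos (a t))\<^sup>2)" unfolding 2 by algebra
  finally have Rs: "R t * sin (a t) = q t" by simp
  show "cos (a t) = p t / sqrt ((p t)\<^sup>2 + (q t)\<^sup>2)" "sin (a t) = q t / sqrt ((p t)\<^sup>2 + (q t)\<^sup>2)"
    using R(1)[of t] Rc Rs unfolding R_def[symmetric] by (simp_all add: eq_divide_eq mult.commute)
qed

context sl2_params
begin

text \<open>Data of the explicit sphere: w is sinh x, and C plays the part of W, so that C^2 = 1 - k
  w^2 is \<open>W_sq\<close>; the result means that \<open>lam\<close> is c / R.\<close>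

lemma sphere_normal_denom:
  assumes pos: "R > 0" "K > 0" "c > 0" and eqs: "c\<^sup>2 = 1 + w\<^sup>2" "K\<^sup>2 = 1 + (1 + \<rho>) * w\<^sup>2" "C\<^sup>2 = 1 - k * w\<^sup>2"
    "\<rho> * H\<^sup>2 = (1 + k) * \<tau>\<^sup>2"
    and X: "cosh X = c" "sinh X = w" and a: "cos a = C / R" "sin a = H * K * w / (\<tau> * R)"
  shows "normal_denom \<kappa> \<tau> X a = K * c / R"
proof -
  have K2: "K2 X = K\<^sup>2" by (simp add: K2_def X eqs algebra_simps)
  have "\<rho> * (H * K * w / (\<tau> * R))\<^sup>2 = (1 + k) * K\<^sup>2 * w\<^sup>2 / R\<^sup>2"
  proof -
    have "\<rho> * (H * K * w / (\<tau> * R))\<^sup>2 = (\<rho> * H\<^sup>2) * K\<^sup>2 * w\<^sup>2 / (\<tau>\<^sup>2 * R\<^sup>2)" by (simp add: power_mult_distrib power_divide)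
    also have "\<dots> = (1 + k) * K\<^sup>2 * w\<^sup>2 / R\<^sup>2" unfolding eqs(4) using \<tau>_nz pos(1) by simp
    finally show ?thesis .
  qed
  then have "(cos a)\<^sup>2 * K2 X + \<rho> * (sin a)\<^sup>2 = ((1 - k * w\<^sup>2) * K\<^sup>2 + (1 + k) * K\<^sup>2 * w\<^sup>2) / R\<^sup>2"
    unfolding a K2 power_divide eqs(3) by (simp add: add_divide_distrib)
  also have "\<dots> = (K * c / R)\<^sup>2" by (simp add: power_mult_distrib power_divide eqs(1) algebra_simps)
  finally show ?thesis unfolding normal_denom_eq using pos by simp
qed

text \<open>Both terms of the curvature are multiples of \<open>G\<close>; the parts with C cancel,
  and 1 + w^2 + c^2 = 2 c^2 leaves H.\<close>

lemma sphere_curvature: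
  assumes pos: "R > 0" "K > 0" "c > 0" "w \<noteq> 0" and eqs: "c\<^sup>2 = 1 + w\<^sup>2" "K\<^sup>2 = 1 + (1 + \<rho>) * w\<^sup>2" "C\<^sup>2 = 1 - k * w\<^sup>2"
    "\<rho> * H\<^sup>2 = (1 + k) * \<tau>\<^sup>2"
    and X: "cosh X = c" "sinh X = w" and a: "cos a = C / R" "sin a = H * K * w / (\<tau> * R)"
    and a': "a' = H * c * (K\<^sup>2 + (1 + \<rho>) * w\<^sup>2 * C\<^sup>2) / (\<tau> * K * R ^ 3)"
  shows "curvature_expr X a a' = H"
proof -
  have K2: "K2 X = K\<^sup>2" by (simp add: K2_def X eqs algebra_simps)
  define G where "G = H * K * c / (\<tau> * R ^ 3)"
  have t1: "K2 X * a' = G * (K\<^sup>2 + (1 + \<rho>) * w\<^sup>2 * C\<^sup>2)"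
    unfolding K2 a' G_def using pos by (simp add: power2_eq_square)
  have t2: "sin a * ((c\<^sup>2 + w\<^sup>2) * (K * c / R)\<^sup>2 - c\<^sup>2 * w\<^sup>2 * (1 + \<rho>) * (cos a)\<^sup>2) / (w * c)
      = G * ((c\<^sup>2 + w\<^sup>2) * K\<^sup>2 - w\<^sup>2 * (1 + \<rho>) * C\<^sup>2)"
  proof -
    have "(c\<^sup>2 + w\<^sup>2) * (K * c / R)\<^sup>2 - c\<^sup>2 * w\<^sup>2 * (1 + \<rho>) * (cos a)\<^sup>2
        = c\<^sup>2 / R\<^sup>2 * ((c\<^sup>2 + w\<^sup>2) * K\<^sup>2 - w\<^sup>2 * (1 + \<rho>) * C\<^sup>2)"
      unfolding a(1) power_divide power_mult_distrib by (simp add: right_diff_distrib mult_ac)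
    moreover have "sin a * (c\<^sup>2 / R\<^sup>2) / (w * c) = G"
      unfolding a(2) G_def using pos \<tau>_nz by (simp add: power2_eq_square power3_eq_cube)
    moreover have "sin a * (u * v) / (w * c) = (sin a * u / (w * c)) * v" for u v by simp
    ultimately show ?thesis by metis
  qed
  have "curvature_expr X a a' = \<tau> * (G * (K\<^sup>2 + (1 + \<rho>) * w\<^sup>2 * C\<^sup>2) + G * ((c\<^sup>2 + w\<^sup>2) * K\<^sup>2 - w\<^sup>2 * (1 + \<rho>) * C\<^sup>2)) / (2 * (K * c / R) ^ 3)"
    unfolding curvature_expr_def Let_def sphere_normal_denom[OF pos(1-3) eqs X a] X t1 t2 ..
  also have "G * (K\<^sup>2 + (1 + \<rho>) * w\<^sup>2 * C\<^sup>2) + G * ((c\<^sup>2 + w\<^sup>2) * K\<^sup>2 - w\<^sup>2 * (1 + \<rho>) * C\<^sup>2) = G * (K\<^sup>2 * (1 + w\<^sup>2 + c\<^sup>2))"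
    by (simp add: algebra_simps)
  also have "1 + w\<^sup>2 + c\<^sup>2 = 2 * c\<^sup>2" using eqs(1) by simp
  also have "\<tau> * (G * (K\<^sup>2 * (2 * c\<^sup>2))) / (2 * (K * c / R) ^ 3) = H"
    unfolding G_def using pos \<tau>_nz by (simp add: power_divide power_mult_distrib power2_eq_square power3_eq_cube)
  finally show ?thesis .
qed

text \<open>The profile is built from its solution sinh x = sin \<phi> / om, where \<phi> in [0, pi]
  is om times arclength. If the extent of y exceeds 2 pi, then by continuity some pair of mirror
  points \<phi> and pi - \<phi> differs in y by exactly 2 pi, and there the surface crosses
  itself.\<close>

lemma ex_non_embedded_sphere:
  "\<exists>H I x y \<alpha>. 0 \<le> H \<and> 4 * H\<^sup>2 + \<kappa> > 0 \<and> rot_cmc_surface \<kappa> \<tau> H 0 I x y \<alpha> \<and> \<not> embedded_surface (rot_surface I x y)"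
proof -
  define h0 where "h0 = sqrt (- \<kappa>) / (2 * \<bar>\<tau>\<bar>)"
  have h0: "h0 > 0" using \<kappa>_neg \<tau>_nz by (simp add: h0_def)
  \<comment> \<open>With m = 1 + exp (-B), ln (m - 1) is -B, and the extent of y will be at least h0
    B = 4 pi + h0, more than 2 pi.\<close>
  define B where "B = 4 * pi / h0 + 1"
  define m where "m = 1 + exp (- B)"
  have m: "1 < m" by (simp add: m_def)
  define k where "k = m\<^sup>2 - 1"
  have k: "k > 0" using m by (simp add: k_def)
  define om where "om = sqrt k"
  have om: "om > 0" "om\<^sup>2 = k" using k by (simp_all add: om_def)
  define H where "H = sqrt (- \<kappa>) * m / 2"
  have H: "H > 0" "4 * H\<^sup>2 = - \<kappa> * m\<^sup>2" using \<kappa>_neg m by (simp_all add: H_def power_mult_distrib power_divide)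
  have H1: "4 * H\<^sup>2 + \<kappa> > 0"
  proof -
    have "4 * H\<^sup>2 + \<kappa> = - \<kappa> * k" unfolding H(2) k_def by (simp add: algebra_simps)
    then show ?thesis using \<kappa>_neg k by (simp add: mult_neg_pos)
  qed
  have \<rho>H: "\<rho> * H\<^sup>2 = (1 + k) * \<tau>\<^sup>2"
  proof -
    have "\<rho> * (4 * H\<^sup>2) = 4 * ((1 + k) * \<tau>\<^sup>2)" unfolding H(2) \<rho>_def k_def using \<kappa>_neg by simp
    then show ?thesis by simp
  qed
  define w where "w \<phi> = sin \<phi> / om" for \<phi>
  define K where "K \<phi> = sqrt (1 + (1 + \<rho>) * (w \<phi>)\<^sup>2)" for \<phi>
  define c where "c \<phi> = sqrt (1 + (w \<phi>)\<^sup>2)" for \<phi>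
  \<comment> \<open>The ratio of tan \<alpha> to tan \<phi>, from zero energy.\<close>
  define n where "n \<phi> = H / (\<tau> * om) * K \<phi>" for \<phi>
  define R where "R \<phi> = sqrt ((cos \<phi>)\<^sup>2 + (n \<phi> * sin \<phi>)\<^sup>2)" for \<phi>
  have Karg: "1 + (1 + \<rho>) * (w \<phi>)\<^sup>2 > 0" for \<phi> using \<rho>_pos by (intro add_pos_nonneg) auto
  have K: "K \<phi> \<ge> 1" "(K \<phi>)\<^sup>2 = 1 + (1 + \<rho>) * (w \<phi>)\<^sup>2" for \<phi> using \<rho>_pos by (simp_all add: K_def)
  have Kp: "K \<phi> > 0" for \<phi> using K(1)[of \<phi>] by linarith
  have cc: "c \<phi> > 0" "(c \<phi>)\<^sup>2 = 1 + (w \<phi>)\<^sup>2" for \<phi> by (simp_all add: c_def add_pos_nonneg)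
  have n: "n \<phi> \<noteq> 0" for \<phi> using H om \<tau>_nz Kp[of \<phi>] by (simp add: n_def)
  have Rarg: "(cos \<phi>)\<^sup>2 + (n \<phi> * sin \<phi>)\<^sup>2 > 0" for \<phi>
  proof (cases "sin \<phi> = 0")
    case True
    then show ?thesis using sin_cos_squared_add[of \<phi>] by simp
  next
    case False
    then show ?thesis using n[of \<phi>] by (intro add_nonneg_pos) auto
  qed
  have R: "R \<phi> > 0" for \<phi> using Rarg by (simp add: R_def)
  have sw: "sin \<phi> = om * w \<phi>" for \<phi> using om by (simp add: w_def)
  have C2: "(cos \<phi>)\<^sup>2 = 1 - k * (w \<phi>)\<^sup>2" for \<phi>
    using sin_cos_squared_add[of \<phi>] by (simp add: sw power_mult_distrib om(2))
  define w' where "w' \<phi> = cos \<phi> / om" for \<phi>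
  have dw: "(w has_real_derivative w' \<phi>) (at \<phi>)" for \<phi>
    unfolding w_def[abs_def] w'_def using om by (auto intro!: derivative_eq_intros)
  define K' where "K' \<phi> = (1 + \<rho>) * w \<phi> * w' \<phi> / K \<phi>" for \<phi>
  have dK: "(K has_real_derivative K' \<phi>) (at \<phi>)" for \<phi>
  proof -
    have "((\<lambda>\<phi>. 1 + (1 + \<rho>) * (w \<phi>)\<^sup>2) has_real_derivative 2 * ((1 + \<rho>) * w \<phi> * w' \<phi>)) (at \<phi>)"
      by (rule derivative_eq_intros dw refl | simp)+
    from has_real_derivative_sqrt[OF this Karg] show ?thesis by (simp add: K_def[abs_def] K'_def)
  qed
  define n' where "n' \<phi> = H / (\<tau> * om) * K' \<phi>" for \<phi>
  have dn: "(n has_real_derivative n' \<phi>) (at \<phi>)" for \<phi>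
    unfolding n_def[abs_def] n'_def by (rule DERIV_cmult[OF dK])
  have dq: "((\<lambda>\<phi>. n \<phi> * sin \<phi>) has_real_derivative (n' \<phi> * sin \<phi> + n \<phi> * cos \<phi>)) (at \<phi>)" for \<phi>
    by (rule derivative_eq_intros dn refl | simp)+
  have wc: "isCont w \<phi>" and Kc: "isCont K \<phi>" and nc: "isCont n \<phi>" for \<phi>
    using DERIV_isCont[OF dw] DERIV_isCont[OF dK] DERIV_isCont[OF dn] by blast+
  have w'c: "isCont w' \<phi>" for \<phi> unfolding w'_def using om by (intro continuous_intros) auto
  have K'c: "isCont K' \<phi>" for \<phi> unfolding K'_def using Kp[of \<phi>] by (intro continuous_intros wc w'c Kc) auto
  have n'c: "isCont n' \<phi>" for \<phi> unfolding n'_def by (intro continuous_intros K'c)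
  have ccont: "isCont c \<phi>" for \<phi> unfolding c_def by (intro continuous_intros wc)
  have Rc: "isCont R \<phi>" for \<phi> unfolding R_def by (intro continuous_intros nc)
  \<comment> \<open>The rate at which the argument of (cos \<phi>, n sin \<phi>) turns; this
    argument becomes \<alpha>.\<close>
  define ra where "ra \<phi> = (cos \<phi> * (n' \<phi> * sin \<phi> + n \<phi> * cos \<phi>) - n \<phi> * sin \<phi> * (- sin \<phi>)) / ((cos \<phi>)\<^sup>2 + (n \<phi> * sin \<phi>)\<^sup>2)" for \<phi>
  have rac: "isCont ra \<phi>" for \<phi> unfolding ra_def using Rarg[of \<phi>] by (intro continuous_intros nc n'c) auto
  obtain a where a: "a 0 = 0" "\<And>\<phi>. (a has_real_derivative ra \<phi>) (at \<phi>)" using ex_antiderivative[OF rac] by blast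
  have ca: "cos (a \<phi>) = cos \<phi> / R \<phi>" and sa: "sin (a \<phi>) = n \<phi> * sin \<phi> / R \<phi>" for \<phi>
    unfolding R_def
    by (rule angle_function[where p' = "\<lambda>\<phi>. - sin \<phi>" and q' = "\<lambda>\<phi>. n' \<phi> * sin \<phi> + n \<phi> * cos \<phi>", OF DERIV_cos dq Rarg a(2)[unfolded ra_def] a(1)]; simp)+
  \<comment> \<open>The derivative of s with respect to \<phi>, that is 1 / (om lam), since
    \<open>lam\<close> is c / R on this curve.\<close>
  define l where "l \<phi> = R \<phi> / (om * c \<phi>)" for \<phi>
  have l: "l \<phi> > 0" for \<phi> using R[of \<phi>] cc(1)[of \<phi>] om by (simp add: l_def)
  have lc: "isCont l \<phi>" for \<phi> unfolding l_def using cc(1)[of \<phi>] om by (intro continuous_intros Rc ccont) auto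
  obtain sg where sg: "sg 0 = 0" "\<And>\<phi>. (sg has_real_derivative l \<phi>) (at \<phi>)" using ex_antiderivative[OF lc] by blast
  define yr where "yr \<phi> = n \<phi> * sin \<phi> / (om * (c \<phi>)\<^sup>2)" for \<phi>
  have yrc: "isCont yr \<phi>" for \<phi> unfolding yr_def using cc(1)[of \<phi>] om by (intro continuous_intros nc ccont) auto
  obtain yy where yy: "\<And>\<phi>. (yy has_real_derivative yr \<phi>) (at \<phi>)" using ex_antiderivative[OF yrc] by blast
  have sgm: "sg s < sg r" if "s < r" for s r
    by (rule DERIV_pos_imp_increasing[OF that]) (use sg(2) l in blast)
  have inj: "inj sg"
  proof (rule injI)
    fix u v assume "sg u = sg v"
    then show "u = v" using sgm[of u v] sgm[of v u] by (cases u v rule: linorder_cases) auto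
  qed
  define g where "g = inv sg"
  have gs: "g (sg \<phi>) = \<phi>" for \<phi> using inj by (simp add: g_def)
  define b where "b = sg pi"
  have b: "b > 0" using sgm[of 0 pi] sg(1) by (simp add: b_def)
  have sgc: "continuous_on V sg" for V
    by (rule DERIV_continuous_on[OF has_field_derivative_at_within[OF sg(2)]])
  have gI: "0 \<le> g s \<and> g s \<le> pi \<and> sg (g s) = s" if "s \<in> {0..b}" for s
  proof -
    have "\<exists>\<phi>\<ge>0. \<phi> \<le> pi \<and> sg \<phi> = s"
      by (rule IVT') (use that sgc sg(1) in \<open>auto simp: b_def\<close>)
    then obtain \<phi> where "0 \<le> \<phi>" "\<phi> \<le> pi" "sg \<phi> = s" by blast
    then show ?thesis using gs[of \<phi>] by simp
  qed
  have dg: "(g has_real_derivative inverse (l (g s))) (at s)" if "s \<in> {0..b}" for s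
    by (rule has_real_derivative_inverse[where f = sg]) (use sg(2) l[of "g s"] sgc gs gI[OF that] in auto)
  define x y \<alpha> where "x s = arsinh (w (g s))" and "y s = yy (g s)" and "\<alpha> s = a (g s)" for s
  have shx: "sinh (x s) = w (g s)" and chx: "cosh (x s) = c (g s)" for s
    by (simp_all add: x_def c_def cosh_arsinh_real add.commute)
  have dx: "(x has_real_derivative cos (\<alpha> s)) (at s)" if s: "s \<in> {0..b}" for s
  proof -
    have "(arsinh has_real_derivative 1 / c (g s)) (at (w (g s)))"
      using arsinh_real_has_field_derivative[of "w (g s)" UNIV] by (simp add: c_def add.commute)
    from DERIV_chain2[OF DERIV_chain2[OF this dw] dg[OF s]]
    have "(x has_real_derivative 1 / c (g s) * w' (g s) * inverse (l (g s))) (at s)" by (simp add: x_def[abs_def])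
    moreover have "1 / c (g s) * w' (g s) * inverse (l (g s)) = cos (\<alpha> s)"
      using cc(1)[of "g s"] om R[of "g s"] by (simp add: w'_def l_def \<alpha>_def ca)
    ultimately show ?thesis by simp
  qed
  have dy: "(y has_real_derivative sin (\<alpha> s) / cosh (x s)) (at s)" if s: "s \<in> {0..b}" for s
  proof -
    have "(y has_real_derivative yr (g s) * inverse (l (g s))) (at s)"
      using DERIV_chain2[OF yy dg[OF s]] by (simp add: y_def[abs_def])
    moreover have "yr (g s) * inverse (l (g s)) = sin (\<alpha> s) / cosh (x s)"
      using cc(1)[of "g s"] om R[of "g s"] by (simp add: yr_def l_def \<alpha>_def sa chx power2_eq_square)
    ultimately show ?thesis by simp
  qed
  have da: "(\<alpha> has_real_derivative ra (g s) * inverse (l (g s))) (at s)" if s: "s \<in> {0..b}" for s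
    using DERIV_chain2[OF a(2) dg[OF s]] by (simp add: \<alpha>_def[abs_def])
  have gc: "continuous_on {0..b} g"
    by (rule DERIV_continuous_on[OF has_field_derivative_at_within[OF dg]])
  have int: "interior {0..b} = {0<..<b}" by simp
  have gint: "0 < g s" "g s < pi" if "s \<in> {0<..<b}" for s
  proof -
    have G: "0 \<le> g s \<and> g s \<le> pi \<and> sg (g s) = s" using gI that by simp
    then have "g s \<noteq> 0" "g s \<noteq> pi" using sg(1) that by (auto simp: b_def)
    then show "0 < g s" "g s < pi" using G by auto
  qed
  have wpos: "w (g s) > 0" if "s \<in> {0<..<b}" for s
    using gint[OF that] om by (simp add: w_def sin_gt_zero)
  have gen: "generating_curve {0..b} x y \<alpha>"
    unfolding generating_curve_def
  proof (intro conjI ballI exI)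
    show "is_interval {0..b}" by (rule is_interval_cc)
    show "interior {0..b} \<noteq> {}" using b by simp
    show "continuous_on {0..b} (\<lambda>s. ra (g s) * inverse (l (g s)))"
    proof (intro continuous_on_mult continuous_on_inverse)
      show "continuous_on {0..b} (\<lambda>s. ra (g s))" "continuous_on {0..b} (\<lambda>s. l (g s))"
        by (rule continuous_on_compose2[OF continuous_at_imp_continuous_on[of UNIV] gc]; simp add: rac lc)+
      show "\<forall>s\<in>{0..b}. l (g s) \<noteq> 0" using l by (metis less_irrefl)
    qed
    show "x s \<noteq> 0" if "s \<in> interior {0..b}" for s
      using wpos[of s] that unfolding int by (metis shx sinh_0 less_irrefl)
    fix s assume s: "s \<in> {0..b} - interior {0..b}"
    then have "s = 0 \<or> s = b" unfolding int by auto
    then have "sin (g s) = 0" using gs[of 0] gs[of pi] sg(1) by (auto simp: b_def)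
    then show "x s = 0" "sin (\<alpha> s) = 0" by (simp_all add: x_def w_def \<alpha>_def sa)
  qed (auto intro!: has_field_derivative_at_within dx dy da)
  have nsw: "n \<phi> * sin \<phi> / R \<phi> = H * K \<phi> * w \<phi> / (\<tau> * R \<phi>)" for \<phi>
    using om by (simp add: n_def sw)
  have den: "normal_denom \<kappa> \<tau> (x s) (\<alpha> s) = K (g s) * c (g s) / R (g s)" for s
    by (rule sphere_normal_denom[OF R Kp cc(1) cc(2) K(2) C2 \<rho>H chx shx]) (simp_all add: \<alpha>_def ca sa nsw)
  have mc: "mean_curvature \<kappa> \<tau> (rot_immersion x y) (rot_normal \<kappa> \<tau> x y \<alpha>) s t = H" if s: "s \<in> interior {0..b}" for s t
  proof -
    have s': "s \<in> {0..b}" "s \<in> {0<..<b}" using s unfolding int by auto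
    have wz: "w (g s) \<noteq> 0" using wpos[OF s'(2)] by simp
    have xz: "x s \<noteq> 0" using wz by (metis shx sinh_0)
    have "mean_curvature \<kappa> \<tau> (rot_immersion x y) (rot_normal \<kappa> \<tau> x y \<alpha>) s t = curvature_expr (x s) (\<alpha> s) (ra (g s) * inverse (l (g s)))"
      by (rule mean_curvature_eq[where S = "interior {0..b}" and x = x and y = y and \<alpha> = \<alpha> and s = s, OF open_interior s _ _ da[OF s'(1)] xz]) (use int dx dy in auto)
    also have "\<dots> = H"
    proof (rule sphere_curvature[OF R Kp cc(1) wz cc(2) K(2) C2 \<rho>H chx shx])
      show "cos (\<alpha> s) = cos (g s) / R (g s)" "sin (\<alpha> s) = H * K (g s) * w (g s) / (\<tau> * R (g s))"
        by (simp_all add: \<alpha>_def ca sa nsw)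
      define \<phi> where "\<phi> = g s"
      have R2: "(R \<phi>)\<^sup>2 = (cos \<phi>)\<^sup>2 + (n \<phi> * sin \<phi>)\<^sup>2" using Rarg[of \<phi>] by (simp add: R_def)
      have "cos \<phi> * (n' \<phi> * sin \<phi> + n \<phi> * cos \<phi>) - n \<phi> * sin \<phi> * (- sin \<phi>) = n \<phi> * ((sin \<phi>)\<^sup>2 + (cos \<phi>)\<^sup>2) + n' \<phi> * sin \<phi> * cos \<phi>"
        by algebra
      also have "\<dots> = n \<phi> + n' \<phi> * sin \<phi> * cos \<phi>" by simp
      also have "\<dots> = H / (\<tau> * om) * (K \<phi> + (1 + \<rho>) * (w \<phi>)\<^sup>2 * (cos \<phi>)\<^sup>2 / K \<phi>)"
        using om(1) by (simp add: n_def n'_def K'_def w'_def sw[of \<phi>] power2_eq_square distrib_left mult_ac)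
      also have "K \<phi> + (1 + \<rho>) * (w \<phi>)\<^sup>2 * (cos \<phi>)\<^sup>2 / K \<phi> = ((K \<phi>)\<^sup>2 + (1 + \<rho>) * (w \<phi>)\<^sup>2 * (cos \<phi>)\<^sup>2) / K \<phi>"
        using Kp[of \<phi>] by (simp add: add_divide_distrib power2_eq_square)
      finally have rae: "ra \<phi> = H / (\<tau> * om) * (((K \<phi>)\<^sup>2 + (1 + \<rho>) * (w \<phi>)\<^sup>2 * (cos \<phi>)\<^sup>2) / K \<phi>) / (R \<phi>)\<^sup>2"
        unfolding ra_def R2 by simp
      have "ra \<phi> * inverse (l \<phi>) = H * c \<phi> * ((K \<phi>)\<^sup>2 + (1 + \<rho>) * (w \<phi>)\<^sup>2 * (cos \<phi>)\<^sup>2) / (\<tau> * K \<phi> * R \<phi> ^ 3)"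
      proof -
        have "H / (\<tau> * om) * (Z / K \<phi>) / (R \<phi>)\<^sup>2 * inverse (R \<phi> / (om * c \<phi>)) = H * c \<phi> * Z / (\<tau> * K \<phi> * R \<phi> ^ 3)" for Z
          using om(1) R[of \<phi>] cc(1)[of \<phi>] Kp[of \<phi>] \<tau>_nz by (simp add: power2_eq_square power3_eq_cube mult_ac)
        then show ?thesis unfolding l_def rae .
      qed
      then show "ra (g s) * inverse (l (g s)) = H * c (g s) * ((K (g s))\<^sup>2 + (1 + \<rho>) * (w (g s))\<^sup>2 * (cos (g s))\<^sup>2) / (\<tau> * K (g s) * R (g s) ^ 3)"
        by (simp add: \<phi>_def)
    qed
    finally show ?thesis .
  qed
  have en: "energy \<kappa> \<tau> H x \<alpha> s = 0" for s
    unfolding energy_def normal_C_tan_def den shx chx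
    using R[of "g s"] Kp[of "g s"] cc(1)[of "g s"] \<tau>_nz by (simp add: \<alpha>_def sa nsw power2_eq_square)
  have cmc: "rot_cmc_surface \<kappa> \<tau> H 0 {0..b} x y \<alpha>"
    unfolding rot_cmc_surface_def using gen complete_surface_compact[OF gen] mc en by blast
  \<comment> \<open>The gap in y between a point and its mirror image, with the sign that makes it
    positive at 0.\<close>
  define f where "f \<phi> = sgn \<tau> * (yy (pi - \<phi>) - yy \<phi>)" for \<phi>
  have big: "2 * pi < f 0"
  proof -
    \<comment> \<open>An antiderivative of the rate of y with \<open>K\<close> replaced by its lower
      bound 1, by partial fractions of m^2 - cos^2 \<phi>.\<close>
    define G where "G \<phi> = h0 * ((ln (m - cos \<phi>) - ln (m + cos \<phi>)) / 2)" for \<phi>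
    have mp: "m - cos \<phi> > 0" "m + cos \<phi> > 0" for \<phi> using m cos_le_one[of \<phi>] cos_ge_minus_one[of \<phi>] by linarith+
    have dG: "(G has_real_derivative h0 * m * sin \<phi> / (k + (sin \<phi>)\<^sup>2)) (at \<phi>)" for \<phi>
    proof -
      have "(G has_real_derivative h0 * ((sin \<phi> / (m - cos \<phi>) - (- sin \<phi>) / (m + cos \<phi>)) / 2)) (at \<phi>)"
        unfolding G_def[abs_def] using mp[of \<phi>] by (auto intro!: derivative_eq_intros)
      moreover have "(m - cos \<phi>) * (m + cos \<phi>) = k + (sin \<phi>)\<^sup>2"
        using sin_cos_squared_add[of \<phi>] by (simp add: k_def algebra_simps power2_eq_square)
      moreover have "sin \<phi> / (m - cos \<phi>) - (- sin \<phi>) / (m + cos \<phi>)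
          = (sin \<phi> * (m + cos \<phi>) - (- sin \<phi>) * (m - cos \<phi>)) / ((m - cos \<phi>) * (m + cos \<phi>))"
        by (rule diff_frac_eq) (use mp[of \<phi>] in linarith)+
      moreover have "sin \<phi> * (m + cos \<phi>) - (- sin \<phi>) * (m - cos \<phi>) = 2 * (m * sin \<phi>)" by (simp add: algebra_simps)
      moreover have "h0 * (2 * (m * sin \<phi>) / v / 2) = h0 * m * sin \<phi> / v" for v by simp
      ultimately show ?thesis by metis
    qed
    have "sgn \<tau> * yy 0 - G 0 \<le> sgn \<tau> * yy pi - G pi"
    proof (rule DERIV_nonneg_imp_nondecreasing[where f = "\<lambda>\<phi>. sgn \<tau> * yy \<phi> - G \<phi>"])
      fix \<phi> :: real assume \<phi>: "0 \<le> \<phi>" "\<phi> \<le> pi"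
      have d: "((\<lambda>\<phi>. sgn \<tau> * yy \<phi> - G \<phi>) has_real_derivative sgn \<tau> * yr \<phi> - h0 * m * sin \<phi> / (k + (sin \<phi>)\<^sup>2)) (at \<phi>)"
        by (intro DERIV_diff DERIV_cmult yy dG)
      have ks: "k + (sin \<phi>)\<^sup>2 > 0" using k by (intro add_pos_nonneg) auto
      have "om * (c \<phi>)\<^sup>2 = (k + (sin \<phi>)\<^sup>2) / om"
        unfolding cc(2) w_def power_divide om(2)[symmetric] using om(1) by (simp add: field_simps power2_eq_square)
      moreover have "sgn \<tau> / \<tau> = 1 / \<bar>\<tau>\<bar>" by (auto simp: sgn_real_def)
      moreover have "sgn \<tau> * (H / (\<tau> * om) * K \<phi> * sin \<phi> / (v / om)) = (sgn \<tau> / \<tau>) * H * K \<phi> * sin \<phi> / v" for v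
        using om(1) by simp
      ultimately have "sgn \<tau> * yr \<phi> = (1 / \<bar>\<tau>\<bar>) * H * K \<phi> * sin \<phi> / (k + (sin \<phi>)\<^sup>2)"
        unfolding yr_def n_def by metis
      also have "(1 / \<bar>\<tau>\<bar>) * H = h0 * m" by (simp add: h0_def H_def)
      finally have e: "sgn \<tau> * yr \<phi> = h0 * m * K \<phi> * sin \<phi> / (k + (sin \<phi>)\<^sup>2)" .
      have "h0 * m * 1 * sin \<phi> \<le> h0 * m * K \<phi> * sin \<phi>"
        using h0 m K(1)[of \<phi>] \<phi> by (intro mult_right_mono mult_left_mono) (auto simp: sin_ge_zero)
      then have "0 \<le> sgn \<tau> * yr \<phi> - h0 * m * sin \<phi> / (k + (sin \<phi>)\<^sup>2)"
        unfolding e using ks by (simp add: divide_right_mono)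
      then show "\<exists>d. ((\<lambda>\<phi>. sgn \<tau> * yy \<phi> - G \<phi>) has_real_derivative d) (at \<phi>) \<and> 0 \<le> d" using d by blast
    qed simp
    moreover have "G pi - G 0 = h0 * (ln (m + 1) - ln (m - 1))" by (simp add: G_def field_simps)
    moreover have lnm: "ln (m - 1) = - B" by (simp add: m_def)
    ultimately have "sgn \<tau> * yy 0 - G 0 \<le> sgn \<tau> * yy pi - G pi" "G pi - G 0 = h0 * (ln (m + 1) + B)" by simp_all
    moreover have ln1: "ln (m + 1) \<ge> 0" using m by simp
    moreover have "h0 * B = 4 * pi + h0" using h0 by (simp add: B_def field_simps)
    moreover have "h0 * (ln (m + 1) + B) \<ge> h0 * B" using h0 ln1 by simp
    moreover have "f 0 = sgn \<tau> * yy pi - sgn \<tau> * yy 0" by (simp add: f_def right_diff_distrib)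
    ultimately show ?thesis using h0 pi_gt_zero by linarith
  qed
  have yyc: "continuous_on V yy" for V
    by (rule DERIV_continuous_on[OF has_field_derivative_at_within[OF yy]])
  \<comment> \<open>The gap falls from more than 2 pi at 0 to 0 at pi / 2, where a point is its own
    mirror image.\<close>
  have "\<exists>\<phi>\<ge>0. \<phi> \<le> pi / 2 \<and> f \<phi> = 2 * pi"
  proof (rule IVT2')
    show "f (pi / 2) \<le> 2 * pi" by (simp add: f_def)
    show "continuous_on {0..pi / 2} f" unfolding f_def
      by (intro continuous_intros continuous_on_compose2[OF yyc[of UNIV]]) auto
  qed (use big in auto)
  then obtain \<phi> where \<phi>: "0 \<le> \<phi>" "\<phi> \<le> pi / 2" "f \<phi> = 2 * pi" by blast
  have "\<phi> \<noteq> 0" using big \<phi>(3) by auto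
  moreover have "\<phi> \<noteq> pi / 2"
  proof
    assume h: "\<phi> = pi / 2"
    have "f \<phi> = 0" unfolding f_def h by simp
    then show False using \<phi>(3) pi_gt_zero by linarith
  qed
  ultimately have \<phi>': "0 < \<phi>" "\<phi> < pi / 2" using \<phi> by auto
  have sI: "sg u \<in> interior {0..b}" if "0 < u" "u < pi" for u
    using sgm[OF that(1)] sgm[OF that(2)] sg(1) by (simp add: b_def)
  have ww: "w (pi - \<phi>) = w \<phi>" by (simp add: w_def)
  have KK: "K (pi - \<phi>) = K \<phi>" by (simp add: K_def ww)
  have nn: "n (pi - \<phi>) = n \<phi>" by (simp add: n_def KK)
  have RR: "R (pi - \<phi>) = R \<phi>" by (simp add: R_def nn)
  have cp: "cos \<phi> > 0" using \<phi>' by (intro cos_gt_zero_pi) auto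
  have sp: "sin \<phi> > 0" using \<phi>' by (intro sin_gt_zero) auto
  have "\<not> embedded_surface (rot_surface {0..b} x y)"
  proof (rule not_embedded_of_crossing[OF gen sI sI])
    show "0 < \<phi>" "\<phi> < pi" "0 < pi - \<phi>" "pi - \<phi> < pi" using \<phi>' by auto
    show "x (sg (pi - \<phi>)) = x (sg \<phi>)" by (simp add: x_def gs ww)
    have "yy (pi - \<phi>) = yy \<phi> + 2 * pi \<or> yy (pi - \<phi>) = yy \<phi> - 2 * pi"
      using \<phi>(3) \<tau>_nz by (auto simp: f_def sgn_real_def split: if_splits)
    then show "cis (y (sg (pi - \<phi>))) = cis (y (sg \<phi>))" by (auto simp: y_def gs complex_eq_iff cos_diff sin_diff)
    show "cos (\<alpha> (sg (pi - \<phi>))) = - cos (\<alpha> (sg \<phi>))" "sin (\<alpha> (sg (pi - \<phi>))) = sin (\<alpha> (sg \<phi>))"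
      by (simp_all add: \<alpha>_def gs ca sa RR nn)
    show "cos (\<alpha> (sg \<phi>)) \<noteq> 0" "sin (\<alpha> (sg \<phi>)) \<noteq> 0"
      using R[of \<phi>] cp sp n[of \<phi>] by (simp_all add: \<alpha>_def gs ca sa)
  qed
  then show ?thesis using H(1) H1 cmc by (intro exI[of _ H] exI[of _ "{0..b}"] exI[of _ x] exI[of _ y] exI[of _ \<alpha>]) auto
qed

end

text \<open>\<open>T\<close> tells which types the generating curve has, and \<open>M\<close> is the surface.\<close>

definition classification :: "real \<Rightarrow> real \<Rightarrow> real \<Rightarrow> real \<Rightarrow> (curve_type \<Rightarrow> bool) \<Rightarrow> point set \<Rightarrow> bool" where
  "classification \<kappa> \<tau> H E T M \<longleftrightarrow>
     (4 * H\<^sup>2 + \<kappa> > 0 \<longrightarrow>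
        (E > 0 \<longrightarrow> T (unduloid_type (x_min \<kappa> H E) (x_max \<kappa> H E))) \<and>
        (E < 0 \<longrightarrow> T (nodoid_type (x_min \<kappa> H E) (x_max \<kappa> H E)) \<and> \<not> embedded_surface M) \<and>
        (E \<noteq> 0 \<longrightarrow> (compact M \<longleftrightarrow> (\<exists>r\<in>\<rat>. period \<kappa> \<tau> H E = r * pi))) \<and>
        (E > 0 \<and> x_min \<kappa> H E < x_max \<kappa> H E \<longrightarrow>
           (compact M \<and> embedded_surface M \<longleftrightarrow> (\<exists>k::int. k \<noteq> 0 \<and> period \<kappa> \<tau> H E = 2 * pi / of_int k)))) \<and>
     (4 * H\<^sup>2 + \<kappa> \<le> 0 \<longrightarrow>
        \<not> compact M \<and>
        (E = 0 \<and> H > 0 \<longrightarrow> T open_sphere_type) \<and>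
        (E = 0 \<and> H = 0 \<longrightarrow> T half_geodesic) \<and>
        (E > 0 \<or> E \<noteq> 0 \<and> H = 0 \<longrightarrow> T open_unduloid_type) \<and>
        (E < 0 \<and> H > 0 \<longrightarrow> T open_nodoid_type))"

section \<open>Assembly of the classification\<close>

text \<open>The types occur only in conclusions, so knowledge about a normalized curve passes to
  \<open>of_type\<close> of the original one.\<close>

lemma classification_mono:
  assumes "classification \<kappa> \<tau> H E T M" "\<And>p. T p \<Longrightarrow> T' p"
  shows "classification \<kappa> \<tau> H E T' M"
  using assms(1) assms(2)[of "unduloid_type (x_min \<kappa> H E) (x_max \<kappa> H E)"] assms(2)[of "nodoid_type (x_min \<kappa> H E) (x_max \<kappa> H E)"]
    assms(2)[of open_sphere_type] assms(2)[of half_geodesic] assms(2)[of open_unduloid_type] assms(2)[of open_nodoid_type]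
  unfolding classification_def by argo

lemma (in profile_closed_graph) classification:
  "classification \<kappa> \<tau> H E (\<lambda>p. p I x y \<alpha>) (rot_surface I x y)"
proof -
  have "compact (rot_surface I x y) \<and> embedded_surface (rot_surface I x y) \<longleftrightarrow> (\<exists>n::int. n \<noteq> 0 \<and> period \<kappa> \<tau> H E = 2 * pi / of_int n)"
    if l: "x_min \<kappa> H E < x_max \<kappa> H E"
  proof -
    have "amp \<noteq> 0" using l unfolding x_min_def x_max_def t_min_eq t_max_eq by (cases "amp = 0") simp_all
    then have a: "amp > 0" using amp_nonneg by simp
    show ?thesis unfolding period_eq[OF a]
    proof
      show "\<exists>n::int. n \<noteq> 0 \<and> T = 2 * pi / of_int n" if "compact (rot_surface I x y) \<and> embedded_surface (rot_surface I x y)"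
        by (rule embedded_imp_period[OF a conjunct2[OF that]])
      assume "\<exists>n::int. n \<noteq> 0 \<and> T = 2 * pi / of_int n"
      then obtain n :: int where n: "n \<noteq> 0" "T = 2 * pi / of_int n" by blast
      have "T = 2 / of_int n * pi" using n(2) by simp
      then have "compact (rot_surface I x y)" by (rule compact_of_rational[rotated]) simp
      then show "compact (rot_surface I x y) \<and> embedded_surface (rot_surface I x y)"
        using embedded_of_period[OF n] by (rule conjI)
    qed
  qed
  then show ?thesis unfolding classification_def using unduloid compact_iff_closed_graph closed_case E_pos by simp
qed

lemma (in profile_closed_nodoid) classification:
  "classification \<kappa> \<tau> H E (\<lambda>p. p I x y \<alpha>) (rot_surface I x y)"
  unfolding classification_def using nodoid not_embedded_nodoid compact_iff_nodoid closed_case E_neg by simp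

lemma (in profile_open) classification:
  "classification \<kappa> \<tau> H E (\<lambda>p. p I x y \<alpha>) (rot_surface I x y)"
proof -
  obtain v0 \<delta> where v: "Pv v0 = 0" "\<delta> > 0" "\<And>v. v0 \<le> v \<Longrightarrow> \<delta> * (v - v0) \<le> Pv v" using ex_vertex by blast
  interpret o: profile_open_vertex \<kappa> \<tau> H E I x y \<alpha> v0 \<delta> by unfold_locales (use v in auto)
  have q: "4 * H\<^sup>2 + \<kappa> \<le> 0" using q2_nonneg \<kappa>_neg by (simp add: q2_def field_simps)
  have nc: "\<not> compact (rot_surface I x y)"
    using o.x_unbounded bounded_imp_bdd_above[OF bounded_x_of_compact[of I x y]] by (rule contrapos_nn)
  have un: "open_unduloid_type I x y \<alpha>" if c: "E > 0 \<or> E \<noteq> 0 \<and> H = 0"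
  proof -
    have "sgn (E + H * Sv v) = sgn E" for v
    proof (cases "E > 0")
      case True
      have "0 \<le> H * Sv v" by (rule mult_nonneg_nonneg[OF H_nonneg less_imp_le[OF Sv_pos]])
      then show ?thesis using True by simp
    next
      case False
      then show ?thesis using c by simp
    qed
    then interpret gr: profile_open_graph \<kappa> \<tau> H E I x y \<alpha> v0 \<delta> by unfold_locales
    show ?thesis by (rule gr.open_unduloid)
  qed
  show ?thesis unfolding classification_def using q nc un o.open_nodoid E_nz by simp
qed

text \<open>The condition on E leaves out exactly the case of spheres, where no type of curve is
  asserted.\<close>

lemma (in profile) classification_of_pos:
  assumes pos: "\<And>s. s \<in> interior I \<Longrightarrow> 0 < x s" and E: "E \<noteq> 0 \<or> 4 * H\<^sup>2 + \<kappa> \<le> 0"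
  shows "classification \<kappa> \<tau> H E (\<lambda>p. p I x y \<alpha>) (rot_surface I x y)"
proof (cases "E = 0")
  case True
  then have q: "4 * H\<^sup>2 + \<kappa> \<le> 0" using E by blast
  have bij: "bij_betw x I {0..}" using half_line[OF True q pos] by blast
  have "\<not> compact (rot_surface I x y)"
  proof
    assume "compact (rot_surface I x y)"
    then have "bdd_above (x ` I)" by (rule bounded_imp_bdd_above[OF bounded_x_of_compact])
    then have "bdd_above {0::real..}" using bij by (simp add: bij_betw_def)
    then obtain b where "\<forall>z\<in>{0::real..}. z \<le> b" unfolding bdd_above_def by blast
    from bspec[OF this, of "\<bar>b\<bar> + 1"] show False by simp
  qed
  then show ?thesis unfolding classification_def
    using q True open_sphere[OF True q pos] half_geodesic[OF True q pos] by simp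
next
  case False
  have U: "I = UNIV" by (rule E_nz_imp_UNIV[OF False])
  have xp: "x s > 0" for s by (rule pos) (simp add: U)
  interpret l: profile_line \<kappa> \<tau> H E I x y \<alpha> by unfold_locales (use False xp in auto)
  show ?thesis
  proof (cases "4 * H\<^sup>2 + \<kappa> > 0")
    case True
    show ?thesis
    proof (cases "E > 0")
      case E: True
      interpret c: profile_closed_graph \<kappa> \<tau> H E I x y \<alpha> by unfold_locales (use True E in auto)
      show ?thesis by (rule c.classification)
    next
      case E: False
      interpret c: profile_closed_nodoid \<kappa> \<tau> H E I x y \<alpha> by unfold_locales (use True E False in auto)
      show ?thesis by (rule c.classification)
    qed
  next
    case c: False
    have "l.q2 \<ge> 0" using c \<kappa>_neg by (simp add: l.q2_def field_simps)
    then interpret o: profile_open \<kappa> \<tau> H E I x y \<alpha> by unfold_locales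
    show ?thesis by (rule o.classification)
  qed
qed

text \<open>A change of sign of sinh x is undone by the rotation through pi, so the reversed curve
  generates the same set.\<close>

lemma rot_surface_uminus: "rot_surface (uminus ` I) (\<lambda>s. - x (- s)) (\<lambda>s. y (- s)) = rot_surface I x y"
proof -
  have e: "rot_immersion (\<lambda>s. - x (- s)) (\<lambda>s. y (- s)) (- s) t = rot_immersion x y s (t + pi)" for s t
    by (simp add: rot_immersion_def complex_eq_iff)
  have "p \<in> rot_surface (uminus ` I) (\<lambda>s. - x (- s)) (\<lambda>s. y (- s)) \<longleftrightarrow> (\<exists>s\<in>I. \<exists>t. p = rot_immersion x y s (t + pi))" for p
    unfolding rot_surface_def e[symmetric] by (auto simp: image_iff)
  moreover have "(\<exists>t. p = rot_immersion x y s (t + pi)) \<longleftrightarrow> (\<exists>t. p = rot_immersion x y s t)" for p s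
    by (metis diff_add_cancel)
  moreover have "p \<in> rot_surface I x y \<longleftrightarrow> (\<exists>s\<in>I. \<exists>t. p = rot_immersion x y s t)" for p
    unfolding rot_surface_def by (auto simp: image_iff)
  ultimately show ?thesis by fast
qed

lemma (in profile) classification_of_type:
  assumes E: "E \<noteq> 0 \<or> 4 * H\<^sup>2 + \<kappa> \<le> 0"
  shows "classification \<kappa> \<tau> H E (\<lambda>p. of_type p I x y \<alpha>) (rot_surface I x y)"
  using x_constant_sign
proof
  assume p: "(\<forall>s\<in>I. 0 \<le> x s) \<and> (\<forall>s\<in>interior I. 0 < x s)"
  have "classification \<kappa> \<tau> H E (\<lambda>p. p I x y \<alpha>) (rot_surface I x y)"
    by (rule classification_of_pos[OF _ E]) (use p in blast)
  then show ?thesis by (rule classification_mono) (simp add: of_type_def p)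
next
  assume n: "(\<forall>s\<in>I. x s \<le> 0) \<and> (\<forall>s\<in>interior I. x s < 0)"
  interpret r: profile \<kappa> \<tau> H E "uminus ` I" "\<lambda>s. - x (- s)" "\<lambda>s. y (- s)" "\<lambda>s. - \<alpha> (- s)"
    by (rule profile_uminus)
  have "classification \<kappa> \<tau> H E (\<lambda>p. p (uminus ` I) (\<lambda>s. - x (- s)) (\<lambda>s. y (- s)) (\<lambda>s. - \<alpha> (- s))) (rot_surface I x y)"
    unfolding rot_surface_uminus[symmetric, of I x y]
  proof (rule r.classification_of_pos[OF _ E])
    fix s assume "s \<in> interior (uminus ` I)"
    then have "- s \<in> interior I" by (auto simp: interior_negations)
    then show "0 < - x (- s)" using n by simp
  qed
  then show ?thesis by (rule classification_mono) (simp add: of_type_def n)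
qed

text \<open>For E = 0 a chart across the axis is needed at the single end of a half line; otherwise
  the curve stays off the axis.\<close>

lemma (in profile) immersed:
  assumes E: "E \<noteq> 0 \<or> 4 * H\<^sup>2 + \<kappa> \<le> 0"
  shows "immersed_surface I x y"
proof (cases "E = 0")
  case True
  then have q: "4 * H\<^sup>2 + \<kappa> \<le> 0" using E by blast
  from x_constant_sign have "\<exists>a. (I = {a..} \<or> I = {..a}) \<and> x a = 0"
  proof
    assume "(\<forall>s\<in>I. 0 \<le> x s) \<and> (\<forall>s\<in>interior I. 0 < x s)"
    then show ?thesis using half_line[OF True q] by blast
  next
    assume n: "(\<forall>s\<in>I. x s \<le> 0) \<and> (\<forall>s\<in>interior I. x s < 0)"
    interpret r: profile \<kappa> \<tau> H E "uminus ` I" "\<lambda>s. - x (- s)" "\<lambda>s. y (- s)" "\<lambda>s. - \<alpha> (- s)"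
      by (rule profile_uminus)
    have "0 < - x (- s)" if "s \<in> interior (uminus ` I)" for s
    proof -
      have "- s \<in> interior I" using that by (auto simp: interior_negations)
      then show ?thesis using n by simp
    qed
    from r.half_line[OF True q this] obtain a where a: "uminus ` I = {a..} \<or> uminus ` I = {..a}" "- x (- a) = 0" by blast
    have "I = uminus ` (uminus ` I)" by (simp add: image_image)
    then have "I = {..- a} \<or> I = {- a..}" using a(1) by (metis image_uminus_atLeast image_uminus_atMost)
    then show ?thesis using a(2) by (intro exI[of _ "- a"]) auto
  qed
  then obtain a where "I = {a..} \<or> I = {..a}" "x a = 0" by blast
  then show ?thesis by (rule immersed_surface_half_line[OF gen])
next
  case False
  have U: "I = UNIV" by (rule E_nz_imp_UNIV[OF False])
  show ?thesis unfolding U by (rule immersed_surface_UNIV[OF gen[unfolded U]])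
qed

theorem theorem2:
  fixes \<kappa> \<tau> :: real
  assumes "\<kappa> < 0" and "\<tau> \<noteq> 0"
  shows "(\<forall>H E I x y \<alpha>.
       0 \<le> H \<and> rot_cmc_surface \<kappa> \<tau> H E I x y \<alpha> \<longrightarrow>
         (4 * H\<^sup>2 + \<kappa> > 0 \<longrightarrow>
            (E = 0 \<longrightarrow> two_sphere_surface I x) \<and>
            (E > 0 \<longrightarrow> of_type (unduloid_type (x_min \<kappa> H E) (x_max \<kappa> H E)) I x y \<alpha>) \<and>
            (E < 0 \<longrightarrow> of_type (nodoid_type (x_min \<kappa> H E) (x_max \<kappa> H E)) I x y \<alpha> \<and>
               immersed_surface I x y \<and> \<not> embedded_surface (rot_surface I x y)) \<and>
            (E \<noteq> 0 \<longrightarrow>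
               (compact (rot_surface I x y) \<longleftrightarrow> (\<exists>r\<in>\<rat>. period \<kappa> \<tau> H E = r * pi))) \<and>
            (E > 0 \<and> x_min \<kappa> H E < x_max \<kappa> H E \<longrightarrow>
               (compact (rot_surface I x y) \<and> embedded_surface (rot_surface I x y) \<longleftrightarrow>
                  (\<exists>k::int. k \<noteq> 0 \<and> period \<kappa> \<tau> H E = 2 * pi / of_int k)))) \<and>
         (4 * H\<^sup>2 + \<kappa> \<le> 0 \<longrightarrow>
            immersed_surface I x y \<and> \<not> compact (rot_surface I x y) \<and>
            (E = 0 \<and> H > 0 \<longrightarrow> of_type open_sphere_type I x y \<alpha>) \<and>
            (E = 0 \<and> H = 0 \<longrightarrow> of_type half_geodesic I x y \<alpha>) \<and>
            (E > 0 \<or> E \<noteq> 0 \<and> H = 0 \<longrightarrow> of_type open_unduloid_type I x y \<alpha>) \<and>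
            (E < 0 \<and> H > 0 \<longrightarrow> of_type open_nodoid_type I x y \<alpha>))) \<and>
     (\<exists>H I x y \<alpha>.
       0 \<le> H \<and> 4 * H\<^sup>2 + \<kappa> > 0 \<and> rot_cmc_surface \<kappa> \<tau> H 0 I x y \<alpha> \<and>
       \<not> embedded_surface (rot_surface I x y))"
proof (rule conjI)
  interpret sl2_params \<kappa> \<tau> by unfold_locales (use assms in auto)
  show "\<exists>H I x y \<alpha>. 0 \<le> H \<and> 4 * H\<^sup>2 + \<kappa> > 0 \<and> rot_cmc_surface \<kappa> \<tau> H 0 I x y \<alpha> \<and> \<not> embedded_surface (rot_surface I x y)"
    by (rule ex_non_embedded_sphere)
  show "\<forall>H E I x y \<alpha>. 0 \<le> H \<and> rot_cmc_surface \<kappa> \<tau> H E I x y \<alpha> \<longrightarrow> ((4 * H\<^sup>2 + \<kappa> > 0 \<longrightarrow>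
            (E = 0 \<longrightarrow> two_sphere_surface I x) \<and>
            (E > 0 \<longrightarrow> of_type (unduloid_type (x_min \<kappa> H E) (x_max \<kappa> H E)) I x y \<alpha>) \<and>
            (E < 0 \<longrightarrow> of_type (nodoid_type (x_min \<kappa> H E) (x_max \<kappa> H E)) I x y \<alpha> \<and>
               immersed_surface I x y \<and> \<not> embedded_surface (rot_surface I x y)) \<and>
            (E \<noteq> 0 \<longrightarrow>
               (compact (rot_surface I x y) \<longleftrightarrow> (\<exists>r\<in>\<rat>. period \<kappa> \<tau> H E = r * pi))) \<and>
            (E > 0 \<and> x_min \<kappa> H E < x_max \<kappa> H E \<longrightarrow>
               (compact (rot_surface I x y) \<and> embedded_surface (rot_surface I x y) \<longleftrightarrow>
                  (\<exists>k::int. k \<noteq> 0 \<and> period \<kappa> \<tau> H E = 2 * pi / of_int k)))) \<and>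
         (4 * H\<^sup>2 + \<kappa> \<le> 0 \<longrightarrow>
            immersed_surface I x y \<and> \<not> compact (rot_surface I x y) \<and>
            (E = 0 \<and> H > 0 \<longrightarrow> of_type open_sphere_type I x y \<alpha>) \<and>
            (E = 0 \<and> H = 0 \<longrightarrow> of_type half_geodesic I x y \<alpha>) \<and>
            (E > 0 \<or> E \<noteq> 0 \<and> H = 0 \<longrightarrow> of_type open_unduloid_type I x y \<alpha>) \<and>
            (E < 0 \<and> H > 0 \<longrightarrow> of_type open_nodoid_type I x y \<alpha>)))"
  proof (intro allI impI)
    fix H E I x y \<alpha> assume "0 \<le> H \<and> rot_cmc_surface \<kappa> \<tau> H E I x y \<alpha>"
    then have h: "rot_cmc_surface \<kappa> \<tau> H E I x y \<alpha>" "0 \<le> H" by blast+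
    interpret profile \<kappa> \<tau> H E I x y \<alpha> by (rule rot_cmc_surface_imp_profile[OF h])
    show "((4 * H\<^sup>2 + \<kappa> > 0 \<longrightarrow>
            (E = 0 \<longrightarrow> two_sphere_surface I x) \<and>
            (E > 0 \<longrightarrow> of_type (unduloid_type (x_min \<kappa> H E) (x_max \<kappa> H E)) I x y \<alpha>) \<and>
            (E < 0 \<longrightarrow> of_type (nodoid_type (x_min \<kappa> H E) (x_max \<kappa> H E)) I x y \<alpha> \<and>
               immersed_surface I x y \<and> \<not> embedded_surface (rot_surface I x y)) \<and>
            (E \<noteq> 0 \<longrightarrow>
               (compact (rot_surface I x y) \<longleftrightarrow> (\<exists>r\<in>\<rat>. period \<kappa> \<tau> H E = r * pi))) \<and>
            (E > 0 \<and> x_min \<kappa> H E < x_max \<kappa> H E \<longrightarrow>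
               (compact (rot_surface I x y) \<and> embedded_surface (rot_surface I x y) \<longleftrightarrow>
                  (\<exists>k::int. k \<noteq> 0 \<and> period \<kappa> \<tau> H E = 2 * pi / of_int k)))) \<and>
         (4 * H\<^sup>2 + \<kappa> \<le> 0 \<longrightarrow>
            immersed_surface I x y \<and> \<not> compact (rot_surface I x y) \<and>
            (E = 0 \<and> H > 0 \<longrightarrow> of_type open_sphere_type I x y \<alpha>) \<and>
            (E = 0 \<and> H = 0 \<longrightarrow> of_type half_geodesic I x y \<alpha>) \<and>
            (E > 0 \<or> E \<noteq> 0 \<and> H = 0 \<longrightarrow> of_type open_unduloid_type I x y \<alpha>) \<and>
            (E < 0 \<and> H > 0 \<longrightarrow> of_type open_nodoid_type I x y \<alpha>)))"
    proof (cases "E \<noteq> 0 \<or> 4 * H\<^sup>2 + \<kappa> \<le> 0")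
      case True
      show ?thesis using classification_of_type[OF True] immersed[OF True] True
        unfolding classification_def by argo
    next
      case False
      then have q: "E = 0" "4 * H\<^sup>2 + \<kappa> > 0" by auto
      show ?thesis using two_sphere[OF q] q by simp
    qed
  qed
qed

end
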